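(* Fix an integer $m\ge3$ and $0<\alpha\le1$. Let $\omega^{1D}(t,x)\in L^\infty_{loc}([0,\infty);\mathring{C}^{0,\alpha}(\mathbb{R}^2))$ be an $m$-fold rotationally symmetric and $0$-homogeneous solution to the 2D Euler equation. Take any $m$-fold rotationally symmetric initial data $\omega_0\in\mathring{C}^{0,\alpha}(\mathbb{R}^2)$ such that $\omega_0-\omega^{1D}(0,\cdot)$ belongs to $C^\alpha(\mathbb{R}^2)$ and vanishes at the origin. Then, for all $t\in[0,\infty)$, $$\|\omega(t)\|_{\mathring{C}^{0,\alpha}}\ge\|\omega^{1D}(t)\|_{\mathring{C}^{0,\alpha}},$$ where $\omega(t)$ is the unique solution of the 2D Euler equation associated with $\omega_0$.
   Context: Norm: $\|f\|_{\mathring{C}^{0,\alpha}}:=\|f\|_{L^\infty(\mathbb{R}^2)}+\sup_{x\ne x'}\frac{||x|^\alpha f(x)-|x'|^\alpha f(x')|}{|x-x'|^\alpha}$. $C^\alpha(\mathbb{R}^2)$ is the usual Hölder space (Lipschitz functions if $\alpha=1$). A function $\omega(t,x)$ is $0$-homogeneous if $\omega(t,\lambda x)=\omega(t,x)$ for all $\lambda>0$, $x\ne0$. A scalar function $f$ is $m$-fold rotationally symmetric if $f(O_{2\pi/m}x)=f(x)$, a vector field $v$ if $v(O_{2\pi/m}x)=O_{2\pi/m}v(x)$, where $O_\theta$ is counterclockwise rotation by $\theta$. For bounded $m$-fold symmetric $\omega$, $m\ge3$, the velocity $u=u(\omega)$ is the unique $m$-fold symmetric vector field with $|u(x)|\le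 C|x|$ for some $C$, $\nabla\cdot u=0$ and $\nabla\times u=\partial_1u_2-\partial_2u_1=\omega$ in the sense of distributions. The solution of the 2D Euler equation $\partial_t\omega+u\cdot\nabla\omega=0$ with bounded $m$-fold symmetric initial data $\omega_0$ is the unique $m$-fold symmetric $\omega\in L^\infty([0,\infty);L^\infty(\mathbb{R}^2))$ with $\omega(t,x)=\omega_0(\Phi_t^{-1}(x))$, where $\frac{d}{dt}\Phi_t(x)=u(t,\Phi_t(x))$, $\Phi_0(x)=x$ and $u(t)=u(\omega(t))$. *)

theory Defs
  imports "HOL-Analysis.Analysis" "HOL-Probability.Essential_Supremum"
begin

section \<open>Function spaces on the plane\<close>

text \<open>The essential supremum does not see the value at the origin, and neither does the seminorm,
  since \<open>0 powr \<alpha> = 0\<close>. Hence this depends only on \<open>f\<close> away from the origin, and a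
  function given on the punctured plane may be extended to \<open>0\<close> by any value. The norm
  is \<open>top\<close> if \<open>f\<close> is not in the space.\<close>

definition ring_norm :: "real \<Rightarrow> (real^2 \<Rightarrow> real) \<Rightarrow> ennreal" where
  "ring_norm \<alpha> f =
     esssup lebesgue (\<lambda>x. ennreal \<bar>f x\<bar>) +
     (SUP x. SUP x'\<in>{x'. x \<noteq> x'}.
        ennreal (\<bar>norm x powr \<alpha> * f x - norm x' powr \<alpha> * f x'\<bar> / norm (x - x') powr \<alpha>))"

text \<open>The essential supremum only tests measurability of \<open>\<bar>f\<bar>\<close>. If the seminorm is finite, however,
  then \<open>f\<close> is continuous away from the origin and hence measurable.\<close>

definition ring_space :: "real \<Rightarrow> (real^2 \<Rightarrow> real) set" where
  "ring_space \<alpha> = {f. ring_norm \<alpha> f < top}"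

definition holder_space :: "real \<Rightarrow> (real^2 \<Rightarrow> real) set" where
  "holder_space \<alpha> = {f. bounded (range f) \<and> (\<exists>C. \<forall>x x'. \<bar>f x - f x'\<bar> \<le> C * norm (x - x') powr \<alpha>)}"

definition Linf_loc_ring :: "real \<Rightarrow> (real \<Rightarrow> real^2 \<Rightarrow> real) \<Rightarrow> bool" where
  "Linf_loc_ring \<alpha> w \<longleftrightarrow>
     (\<forall>T\<ge>0. \<exists>C::real. AE t in lebesgue_on {0..T}. ring_norm \<alpha> (w t) \<le> ennreal C)"

section \<open>Symmetry and homogeneity\<close>

definition rot :: "real \<Rightarrow> real^2 \<Rightarrow> real^2" where
  "rot \<theta> x = vector [cos \<theta> * x$1 - sin \<theta> * x$2, sin \<theta> * x$1 + cos \<theta> * x$2]"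

definition sym_scalar :: "nat \<Rightarrow> (real^2 \<Rightarrow> real) \<Rightarrow> bool" where
  "sym_scalar m f \<longleftrightarrow> (\<forall>x. f (rot (2 * pi / real m) x) = f x)"

definition sym_field :: "nat \<Rightarrow> (real^2 \<Rightarrow> real^2) \<Rightarrow> bool" where
  "sym_field m v \<longleftrightarrow> (\<forall>x. v (rot (2 * pi / real m) x) = rot (2 * pi / real m) (v x))"

definition zero_homogeneous :: "(real \<Rightarrow> real^2 \<Rightarrow> real) \<Rightarrow> bool" where
  "zero_homogeneous w \<longleftrightarrow> (\<forall>t\<ge>0. \<forall>l>0. \<forall>x. x \<noteq> 0 \<longrightarrow> w t (l *\<^sub>R x) = w t x)"

section \<open>Divergence and curl in the sense of distributions\<close>

definition partial :: "2 \<Rightarrow> (real^2 \<Rightarrow> real) \<Rightarrow> real^2 \<Rightarrow> real" where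
  "partial i f x = frechet_derivative f (at x) (axis i 1)"

primrec Ck :: "nat \<Rightarrow> (real^2 \<Rightarrow> real) \<Rightarrow> bool" where
  "Ck 0 f \<longleftrightarrow> continuous_on UNIV f"
| "Ck (Suc k) f \<longleftrightarrow> f differentiable_on UNIV \<and> (\<forall>i. Ck k (partial i f))"

definition test_fun :: "(real^2 \<Rightarrow> real) \<Rightarrow> bool" where
  "test_fun \<phi> \<longleftrightarrow> (\<forall>k. Ck k \<phi>) \<and> compact (closure {x. \<phi> x \<noteq> 0})"

definition weak_div_zero :: "(real^2 \<Rightarrow> real^2) \<Rightarrow> bool" where
  "weak_div_zero u \<longleftrightarrow>
     (\<forall>\<phi>. test_fun \<phi> \<longrightarrow>
        (LINT x|lebesgue. - (u x $ 1 * partial 1 \<phi> x + u x $ 2 * partial 2 \<phi> x)) = 0)"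

definition weak_curl :: "(real^2 \<Rightarrow> real^2) \<Rightarrow> (real^2 \<Rightarrow> real) \<Rightarrow> bool" where
  "weak_curl u w \<longleftrightarrow>
     (\<forall>\<phi>. test_fun \<phi> \<longrightarrow>
        (LINT x|lebesgue. - (u x $ 2 * partial 1 \<phi> x - u x $ 1 * partial 2 \<phi> x)) =
        (LINT x|lebesgue. w x * \<phi> x))"

section \<open>The Euler equation\<close>

text \<open>The distributional equations determine \<open>u\<close> only almost everywhere; continuity selects the
  representative for which the flow equation below makes sense pointwise. The integrals above are
  then all absolutely convergent for bounded measurable \<open>w\<close>.\<close>

definition velocity_of :: "nat \<Rightarrow> (real^2 \<Rightarrow> real) \<Rightarrow> (real^2 \<Rightarrow> real^2) \<Rightarrow> bool" where
  "velocity_of m w u \<longleftrightarrow>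
     continuous_on UNIV u \<and> sym_field m u \<and> (\<exists>C. \<forall>x. norm (u x) \<le> C * norm x) \<and>
     weak_div_zero u \<and> weak_curl u w"

text \<open>\<open>euler_solution m w0 w\<close>: \<open>w\<close> is the \<open>m\<close>-fold symmetric solution on \<open>[0,\<infinity>)\<close> with initial
  data \<open>w0\<close>. The first four conjuncts say that \<open>w\<close> is a symmetric element of
  \<open>L\<^sup>\<infinity>([0,\<infinity>); L\<^sup>\<infinity>)\<close>; nothing is said about \<open>t < 0\<close>. The flow fixes the origin, where vorticities
  need not be defined, so transport is only required away from it.\<close>

definition euler_solution ::
    "nat \<Rightarrow> (real^2 \<Rightarrow> real) \<Rightarrow> (real \<Rightarrow> real^2 \<Rightarrow> real) \<Rightarrow> bool" where
  "euler_solution m w0 w \<longleftrightarrow>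
     (\<lambda>(t, x). w t x) \<in> borel_measurable (lebesgue_on ({0..} \<times> UNIV)) \<and>
     (\<forall>t\<ge>0. w t \<in> borel_measurable lebesgue) \<and>
     (\<exists>C::real. \<forall>t\<ge>0. AE x in lebesgue. \<bar>w t x\<bar> \<le> C) \<and>
     (\<forall>t\<ge>0. sym_scalar m (w t)) \<and>
     (\<exists>u \<Phi>.
        (\<forall>t\<ge>0. velocity_of m (w t) (u t)) \<and>
        (\<forall>x. \<Phi> 0 x = x) \<and>
        (\<forall>t\<ge>0. \<forall>x. ((\<lambda>s. \<Phi> s x) has_vector_derivative u t (\<Phi> t x)) (at t within {0..})) \<and>
        (\<forall>t\<ge>0. bij (\<Phi> t)) \<and>
        (\<forall>t\<ge>0. \<forall>x. x \<noteq> 0 \<longrightarrow> w t x = w0 (inv (\<Phi> t) x)))"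

end

theory Submission
  imports Defs
begin

text \<open>Let \<open>\<Phi>\<close> and \<open>\<Psi>\<close> be the flows of \<open>w\<close> and of the homogeneous solution. The norm is invariant under
  dilations and lower semicontinuous under pointwise limits, so it suffices to show that
  \<open>w t (x / n)\<close> tends to \<open>w1D t x\<close>. Since the initial data differ by a function that vanishes at the origin,
  this follows once \<open>\<bar>\<Phi> t y - \<Psi> t y\<bar> = o(\<bar>y\<bar>)\<close> as \<open>y\<close> tends to \<open>0\<close>. By the symmetry the Biot-Savart kernel may be replaced
  far away by one that decays cubically. In Lagrangian variables, which requires that the flows preserve
  the Lebesgue measure, the difference of the velocities along the two flows at \<open>x\<close> is then at most
  \<open>C \<bar>x\<bar> (d (1 - ln d) + o(1))\<close> if \<open>\<bar>\<Phi> t y - \<Psi> t y\<bar> \<le> d \<bar>y\<bar>\<close> near the origin, and Osgood's argument gives the claim.\<close>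

section \<open>Smooth cutoff functions\<close>

text \<open>The obstacle is that the velocity is only log-Lipschitz, so that the flows are merely
  Hoelder continuous and Liouville's theorem cannot be applied to them. Measure preservation is
  therefore obtained from short time steps, in each of which the displacement is mollified with an
  error of higher order than the step. The vorticities at time \<open>t\<close> cannot be compared
  directly either, since each is the composition of its datum with a rough inverse flow. In
  Lagrangian variables both velocities are integrals over the same labels against the data
  themselves, and only data and kernels are left to compare. Closeness of the flows is known near
  the origin only; labels farther than \<open>n \<bar>x\<bar>\<close> contribute
  \<open>O(\<bar>x\<bar> / n)\<close> by the cubic decay, and \<open>n\<close> may be as large as
  desired if \<open>x\<close> is small. To avoid any question about the regularity in
  \<open>t\<close> of the best \<open>d\<close>, Osgood's argument runs over finitely many time
  steps, each of which shrinks the neighbourhood of the origin. As the velocity is given by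
  distributional equations, the Biot-Savart law is derived first. Most numerical constants are
  rounded up.\<close>

lemma Ck_SucI:
  fixes g :: "2 \<Rightarrow> real^2 \<Rightarrow> real"
  assumes "\<And>x. (f has_derivative (\<lambda>h. g 1 x * h$1 + g 2 x * h$2)) (at x)"
    and "\<And>i. Ck k (g i)"
  shows "Ck (Suc k) f"
proof -
  have "partial i f = g i" for i
  proof
    fix x
    have "frechet_derivative f (at x) = (\<lambda>h. g 1 x * h$1 + g 2 x * h$2)"
      using frechet_derivative_at[OF assms(1)] by simp
    then show "partial i f x = g i x"
      using exhaust_2[of i] by (auto simp: partial_def axis_def)
  qed
  then show ?thesis
    using assms by (auto simp: differentiable_on_def differentiable_def intro: has_derivative_at_withinI)
qed

lemma partial_eqI:
  assumes "(f has_derivative (\<lambda>h. a * h$1 + b * h$2)) (at x)"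
  shows "partial 1 f x = a" "partial 2 f x = b"
  by (auto simp: partial_def axis_def frechet_derivative_at[OF assms, symmetric])

lemma Ck_has_derivative:
  assumes "Ck (Suc k) f"
  shows "(f has_derivative (\<lambda>h. partial 1 f x * h$1 + partial 2 f x * h$2)) (at x)"
proof -
  have d: "(f has_derivative frechet_derivative f (at x)) (at x)"
    using assms by (simp add: differentiable_on_def frechet_derivative_works[symmetric])
  have "frechet_derivative f (at x) h = partial 1 f x * h$1 + partial 2 f x * h$2" for h
  proof -
    interpret linear "frechet_derivative f (at x)" using d by (rule has_derivative_linear)
    have "h = (h$1) *\<^sub>R axis 1 1 + (h$2) *\<^sub>R axis 2 1"
      by (simp add: vec_eq_iff forall_2 axis_def)
    then have "frechet_derivative f (at x) h =
        frechet_derivative f (at x) ((h$1) *\<^sub>R axis 1 1 + (h$2) *\<^sub>R axis 2 1)" by simp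
    also have "\<dots> = partial 1 f x * h$1 + partial 2 f x * h$2"
      by (simp add: add scale partial_def)
    finally show ?thesis .
  qed
  then have "frechet_derivative f (at x) = (\<lambda>h. partial 1 f x * h$1 + partial 2 f x * h$2)" by auto
  with d show ?thesis by simp
qed

lemma Ck_continuous: "Ck k f \<Longrightarrow> continuous_on UNIV f"
  by (cases k) (auto intro: differentiable_imp_continuous_on)

lemma Ck_Suc_imp: "Ck (Suc k) f \<Longrightarrow> Ck k f"
proof (induction k arbitrary: f)
  case 0 then show ?case using Ck_continuous by (metis Ck.simps(1))
next
  case (Suc k)
  then have "f differentiable_on UNIV" "\<And>i. Ck (Suc k) (partial i f)" by auto
  then show ?case using Suc.IH by auto
qed

lemma Ck_const: "Ck k (\<lambda>x. c)"
proof (induction k arbitrary: c)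
  case (Suc k)
  show ?case
    by (rule Ck_SucI[where g = "\<lambda>i x. 0"]) (use Suc in auto)
qed simp

lemma Ck_component: "Ck k (\<lambda>x. x $ i)"
proof (cases k)
  case (Suc n)
  show ?thesis unfolding Suc
  proof (rule Ck_SucI[where g = "\<lambda>j x. if j = i then 1 else 0"])
    show "((\<lambda>x. x $ i) has_derivative (\<lambda>h. (if 1 = i then 1 else 0) * h $ 1 + (if 2 = i then 1 else 0) * h $ 2)) (at x)"
      for x :: "real^2"
    proof -
      have "(\<lambda>h::real^2. (if 1 = i then 1 else 0) * h $ 1 + (if 2 = i then 1 else 0) * h $ 2) = (\<lambda>h. h $ i)"
        using exhaust_2[of i] by auto
      then show ?thesis by (simp add: bounded_linear_imp_has_derivative bounded_linear_vec_nth)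
    qed
  qed (auto simp: Ck_const)
qed (auto intro!: continuous_intros)

lemma Ck_add: "Ck k f \<Longrightarrow> Ck k g \<Longrightarrow> Ck k (\<lambda>x. f x + g x)"
proof (induction k arbitrary: f g)
  case (Suc k)
  show ?case
  proof (rule Ck_SucI[where g = "\<lambda>i x. partial i f x + partial i g x"])
    show "((\<lambda>x. f x + g x) has_derivative (\<lambda>h. (partial 1 f x + partial 1 g x) * h $ 1 + (partial 2 f x + partial 2 g x) * h $ 2)) (at x)" for x
      by (rule has_derivative_eq_rhs[OF has_derivative_add[OF Ck_has_derivative[OF Suc.prems(1)] Ck_has_derivative[OF Suc.prems(2)]]])
        (auto simp: algebra_simps)
    show "Ck k (\<lambda>x. partial i f x + partial i g x)" for i
      using Suc by auto
  qed
qed (auto intro!: continuous_intros)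

lemma Ck_mult: "Ck k f \<Longrightarrow> Ck k g \<Longrightarrow> Ck k (\<lambda>x. f x * g x)"
proof (induction k arbitrary: f g)
  case (Suc k)
  show ?case
  proof (rule Ck_SucI[where g = "\<lambda>i x. f x * partial i g x + partial i f x * g x"])
    show "((\<lambda>x. f x * g x) has_derivative (\<lambda>h. (f x * partial 1 g x + partial 1 f x * g x) * h $ 1 + (f x * partial 2 g x + partial 2 f x * g x) * h $ 2)) (at x)" for x
      by (rule has_derivative_eq_rhs[OF has_derivative_mult[OF Ck_has_derivative[OF Suc.prems(1)] Ck_has_derivative[OF Suc.prems(2)]]])
        (auto simp: algebra_simps)
    show "Ck k (\<lambda>x. f x * partial i g x + partial i f x * g x)" for i
      using Suc by (intro Ck_add Suc.IH) (auto intro: Ck_Suc_imp simp del: Ck.simps(2) simp: Ck.simps(2)[of k f] Ck.simps(2)[of k g])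
  qed
qed (auto intro!: continuous_intros)

text \<open>The whole sequence of derivatives enters, because differentiating
  \<open>F n (g x)\<close> produces \<open>F (Suc n) (g x)\<close>; stating the claim for every
  \<open>n\<close> makes the induction on the order \<open>k\<close> close.\<close>

lemma Ck_compose:
  assumes F: "\<And>n s. s \<in> D \<Longrightarrow> (F n has_real_derivative F (Suc n) s) (at s)"
    and g: "Ck k g" and D: "\<And>x. g x \<in> D"
  shows "Ck k (\<lambda>x. F n (g x))"
  using g
proof (induction k arbitrary: n)
  case 0
  have "continuous_on D (F n)"
    by (intro continuous_at_imp_continuous_on ballI DERIV_isCont[OF F])
  then show ?case using 0 D by (auto intro: continuous_on_compose2)
next
  case (Suc k)
  show ?case
  proof (rule Ck_SucI[where g = "\<lambda>i x. F (Suc n) (g x) * partial i g x"])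
    show "((\<lambda>x. F n (g x)) has_derivative (\<lambda>h. F (Suc n) (g x) * partial 1 g x * h $ 1 + F (Suc n) (g x) * partial 2 g x * h $ 2)) (at x)" for x
      by (rule has_derivative_eq_rhs[OF has_derivative_compose[OF Ck_has_derivative[OF Suc.prems] F[unfolded has_field_derivative_def, OF D]]])
        (auto simp: algebra_simps)
    show "Ck k (\<lambda>x. F (Suc n) (g x) * partial i g x)" for i
      using Suc Ck_Suc_imp[OF Suc.prems] by (intro Ck_mult) auto
  qed
qed

text \<open>The derivative of \<open>inverse (g x)\<close> is built from first partials of
  \<open>g\<close> and from \<open>inverse (g x)\<close> itself, so the induction hypothesis and the
  product rule suffice. It makes the regularised Cauchy kernel smooth.\<close>

lemma Ck_inverse:
  assumes "Ck k g" and pos: "\<And>x. 0 < g x"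
  shows "Ck k (\<lambda>x. inverse (g x))"
  using assms(1)
proof (induction k)
  case 0
  have "g x \<noteq> 0" for x using pos[of x] by simp
  then show ?case using 0 by (auto intro!: continuous_intros)
next
  case (Suc k)
  have nz: "g x \<noteq> 0" for x using pos[of x] by simp
  have IH: "Ck k (\<lambda>x. inverse (g x))" using Suc Ck_Suc_imp by blast
  show ?case
  proof (rule Ck_SucI[where g = "\<lambda>i x. (-1) * (partial i g x * (inverse (g x) * inverse (g x)))"])
    show "((\<lambda>x. inverse (g x)) has_derivative (\<lambda>h. (-1) * (partial 1 g x * (inverse (g x) * inverse (g x))) * h $ 1 +
        (-1) * (partial 2 g x * (inverse (g x) * inverse (g x))) * h $ 2)) (at x)" for x
      by (rule has_derivative_eq_rhs[OF Deriv.has_derivative_inverse[OF nz Ck_has_derivative[OF Suc.prems]]])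
        (auto simp: algebra_simps)
    show "Ck k (\<lambda>x. (-1) * (partial i g x * (inverse (g x) * inverse (g x))))" for i
      using Suc.prems by (intro Ck_mult Ck_const IH) auto
  qed
qed

text \<open>All derivatives of \<open>s \<mapsto> exp (- 1 / s)\<close> are of this form; \<open>bumpP n\<close> belongs to the \<open>n\<close>-th one.\<close>

definition bumpG :: "real poly \<Rightarrow> real \<Rightarrow> real" where
  "bumpG P s = (if s > 0 then poly P (inverse s) * exp (- inverse s) else 0)"

primrec bumpP :: "nat \<Rightarrow> real poly" where
  "bumpP 0 = 1"
| "bumpP (Suc n) = monom 1 2 * (bumpP n - pderiv (bumpP n))"

lemma poly_exp_tendsto_0: "((\<lambda>x. poly P x * exp (- x)) \<longlongrightarrow> (0::real)) at_top"
proof -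
  have "((\<lambda>x. \<Sum>i\<le>degree P. coeff P i * (x ^ i / exp x)) \<longlongrightarrow> (\<Sum>i\<le>degree P. coeff P i * 0)) at_top"
    by (intro tendsto_sum tendsto_mult tendsto_const tendsto_power_div_exp_0)
  then show ?thesis
    by (simp add: poly_altdef sum_distrib_right sum_divide_distrib exp_minus divide_inverse mult.assoc)
qed

text \<open>With \<open>y = 1 / s\<close> the derivative of \<open>p(y) exp (- y)\<close> in
  \<open>s\<close> is \<open>y\<^sup>2 (p(y) - p'(y)) exp (- y)\<close>, which explains the factor
  \<open>monom 1 2\<close>. At \<open>s = 0\<close> both one-sided difference quotients tend to
  \<open>0\<close>, as the exponential beats every polynomial in \<open>1 / s\<close>.\<close>

lemma bumpG_deriv:
  "(bumpG P has_real_derivative bumpG (monom 1 2 * (P - pderiv P)) s) (at s)"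
proof -
  consider "s > 0" | "s < 0" | "s = 0" by linarith
  then show ?thesis
  proof cases
    case 1
    have "((\<lambda>s. poly P (inverse s) * exp (- inverse s)) has_real_derivative
        bumpG (monom 1 2 * (P - pderiv P)) s) (at s)"
      using 1 by (auto intro!: derivative_eq_intros simp: bumpG_def poly_monom algebra_simps power2_eq_square)
    then show ?thesis
      by (rule has_field_derivative_transform_within_open[where S = "{0<..}"]) (use 1 in \<open>auto simp: bumpG_def\<close>)
  next
    case 2
    have "((\<lambda>s. 0) has_real_derivative bumpG (monom 1 2 * (P - pderiv P)) s) (at s)"
      using 2 by (auto simp: bumpG_def)
    then show ?thesis
      by (rule has_field_derivative_transform_within_open[where S = "{..<0}"]) (use 2 in \<open>auto simp: bumpG_def\<close>)
  next
    case 3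
    have "((\<lambda>h. bumpG P h / h) \<longlongrightarrow> 0) (at_right 0)"
    proof -
      \<comment> \<open>Dividing by \<open>h\<close> only multiplies the polynomial by its variable
        \<open>1 / h\<close>.\<close>
      have "((\<lambda>h. poly (monom 1 1 * P) (inverse h) * exp (- inverse h)) \<longlongrightarrow> 0) (at_right 0)"
        by (rule filterlim_compose[OF poly_exp_tendsto_0 filterlim_inverse_at_top_right])
      moreover have "eventually (\<lambda>h. poly (monom 1 1 * P) (inverse h) * exp (- inverse h) = bumpG P h / h) (at_right 0)"
        by (auto simp: eventually_at_filter bumpG_def poly_monom divide_simps)
      ultimately show ?thesis by (rule Lim_transform_eventually)
    qed
    moreover have "((\<lambda>h. bumpG P h / h) \<longlongrightarrow> 0) (at_left 0)"
      by (rule Lim_transform_eventually[OF tendsto_const]) (auto simp: eventually_at_filter bumpG_def)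
    ultimately have "((\<lambda>h. bumpG P h / h) \<longlongrightarrow> 0) (at 0)"
      by (simp add: filterlim_at_split)
    then show ?thesis using 3 by (simp add: DERIV_def bumpG_def)
  qed
qed

definition bump :: "real \<Rightarrow> real" where "bump = bumpG 1"
definition bump' :: "real \<Rightarrow> real" where "bump' = bumpG (monom 1 2)"

lemma bump_deriv: "(bump has_real_derivative bump' s) (at s)"
  using bumpG_deriv[of 1 s] by (simp add: bump_def bump'_def pderiv_1)

lemma Ck_bump: "Ck k g \<Longrightarrow> Ck k (\<lambda>x. bump (g x))"
  using Ck_compose[where D = UNIV and F = "\<lambda>n. bumpG (bumpP n)" and n = 0 and k = k and g = g]
  by (simp add: bump_def bumpG_deriv)

lemma bump_nonneg: "0 \<le> bump s" and bump_le_1: "bump s \<le> 1" and bump_zero: "s \<le> 0 \<Longrightarrow> bump s = 0"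
  and bump_eq: "s > 0 \<Longrightarrow> bump s = exp (- inverse s)"
  by (auto simp: bump_def bumpG_def)

lemma bump'_nonneg: "0 \<le> bump' s" and bump'_zero: "s \<le> 0 \<Longrightarrow> bump' s = 0"
  by (auto simp: bump'_def bumpG_def poly_monom)

lemma bump'_le: "bump' s \<le> 2"
proof (cases "s > 0")
  case True
  define t where "t = inverse s"
  have t: "t > 0" using True by (simp add: t_def)
  have "1 + t + t\<^sup>2 / 2 \<le> exp t" using exp_lower_Taylor_quadratic[of t] t by simp
  then have "t\<^sup>2 \<le> 2 * exp t" using t by linarith
  then have "t\<^sup>2 * inverse (exp t) \<le> 2" by (simp add: divide_simps)
  then show ?thesis using True
    by (simp add: bump'_def bumpG_def poly_monom t_def[symmetric] exp_minus)
qed (simp add: bump'_zero)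

lemma continuous_bump [continuous_intros]: "continuous_on S f \<Longrightarrow> continuous_on S (\<lambda>x. bump (f x))"
  by (rule continuous_on_compose2[of UNIV bump])
    (auto intro!: continuous_at_imp_continuous_on DERIV_isCont bump_deriv)

lemma continuous_bump' [continuous_intros]: "continuous_on S f \<Longrightarrow> continuous_on S (\<lambda>x. bump' (f x))"
  by (rule continuous_on_compose2[of UNIV bump'])
    (auto intro!: continuous_at_imp_continuous_on DERIV_isCont simp: bump'_def intro: bumpG_deriv)

lemma norm2_eq: "(norm (x::real^2))\<^sup>2 = (x$1)\<^sup>2 + (x$2)\<^sup>2"
  unfolding power2_norm_eq_inner inner_vec_def sum_2 by (simp add: power2_eq_square)

lemma Ck_diff: "Ck k f \<Longrightarrow> Ck k g \<Longrightarrow> Ck k (\<lambda>x. f x - g x)"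
  using Ck_add[of k f "\<lambda>x. (-1) * g x"] Ck_mult[OF Ck_const[of k "-1"], of g] by simp

lemma Ck_norm2: "Ck k (\<lambda>x. (norm (x - a))\<^sup>2)"
  unfolding norm2_eq
  by (auto intro!: Ck_add Ck_mult Ck_diff Ck_component Ck_const simp: power2_eq_square)

lemma Ck_radial_bump: "Ck k (\<lambda>x. bump (1 - (norm (x - a))\<^sup>2 / R\<^sup>2))"
  unfolding divide_inverse by (intro Ck_bump Ck_diff Ck_mult Ck_norm2 Ck_const)

text \<open>The functions to be tested with, such as the Cauchy kernel, are smooth but have no
  compact support; the bump factor vanishes outside the disc of radius \<open>R\<close> about
  \<open>a\<close>.\<close>

lemma test_fun_cutoff:
  assumes "\<And>k. Ck k f" "R > 0"
  shows "test_fun (\<lambda>x. bump (1 - (norm (x - a))\<^sup>2 / R\<^sup>2) * f x)"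
  unfolding test_fun_def
proof
  show "\<forall>k. Ck k (\<lambda>x. bump (1 - (norm (x - a))\<^sup>2 / R\<^sup>2) * f x)"
    using assms by (auto intro!: Ck_mult Ck_radial_bump)
  have "{x. bump (1 - (norm (x - a))\<^sup>2 / R\<^sup>2) * f x \<noteq> 0} \<subseteq> cball a R"
  proof
    fix x assume "x \<in> {x. bump (1 - (norm (x - a))\<^sup>2 / R\<^sup>2) * f x \<noteq> 0}"
    then have "1 - (norm (x - a))\<^sup>2 / R\<^sup>2 > 0" using bump_zero[of "1 - (norm (x - a))\<^sup>2 / R\<^sup>2"] by fastforce
    then have "(norm (x - a))\<^sup>2 < R\<^sup>2" using assms by (simp add: field_simps)
    then have "norm (x - a) < R" using power2_less_imp_less[of "norm (x - a)" R] assms by simp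
    then show "x \<in> cball a R" by (simp add: dist_norm norm_minus_commute)
  qed
  then show "compact (closure {x. bump (1 - (norm (x - a))\<^sup>2 / R\<^sup>2) * f x \<noteq> 0})"
    using bounded_subset[OF bounded_cball] compact_closure by blast
qed

lemma radial_bump_deriv:
  "((\<lambda>x. bump (1 - (norm (x - a))\<^sup>2 / R\<^sup>2)) has_derivative
    (\<lambda>h. - bump' (1 - (norm (x - a))\<^sup>2 / R\<^sup>2) * (2 * ((x - a) $ 1) / R\<^sup>2) * h$1 +
         - bump' (1 - (norm (x - a))\<^sup>2 / R\<^sup>2) * (2 * ((x - a) $ 2) / R\<^sup>2) * h$2)) (at (x::real^2))"
proof -
  have "((\<lambda>x. 1 - (norm (x - a))\<^sup>2 / R\<^sup>2) has_derivative (\<lambda>h. - (2 * ((x - a)$1) * h$1 + 2 * ((x-a)$2) * h$2) / R\<^sup>2)) (at x)"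
    unfolding norm2_eq
    unfolding divide_inverse
    by (auto intro!: derivative_eq_intros bounded_linear_imp_has_derivative bounded_linear_vec_nth simp: fun_eq_iff algebra_simps)
  from has_derivative_compose[OF this bump_deriv[unfolded has_field_derivative_def]]
  show ?thesis
    by (rule has_derivative_eq_rhs) (auto simp: divide_inverse algebra_simps)
qed

section \<open>Kernel estimates\<close>

text \<open>The plane is identified with the complex numbers so that the Biot-Savart kernel becomes
  the Cauchy kernel and rotations become multiplications by \<open>cis \<theta>\<close>.\<close>

definition cx :: "real^2 \<Rightarrow> complex" where "cx v = Complex (v$1) (v$2)"

lemma norm_cx [simp]: "norm (cx v) = norm v"
  by (simp add: cx_def cmod_def norm2_eq[symmetric])

lemma cx_linear: "bounded_linear cx"
  by (intro linear_conv_bounded_linear[THEN iffD1] linearI) (auto simp: cx_def complex_eq_iff)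

lemmas cx_add = linear_add[OF bounded_linear.linear[OF cx_linear]]
lemmas cx_diff = linear_diff[OF bounded_linear.linear[OF cx_linear]]
lemmas cx_scaleR = linear_scale[OF bounded_linear.linear[OF cx_linear]]

lemma cx_eq_0_iff [simp]: "cx v = 0 \<longleftrightarrow> v = 0"
  by (metis norm_cx norm_eq_zero)

lemma cx_eq_iff [simp]: "cx v = cx w \<longleftrightarrow> v = w"
  using cx_eq_0_iff[of "v - w"] by (simp add: cx_diff)

lemma continuous_cx [continuous_intros]: "continuous_on S f \<Longrightarrow> continuous_on S (\<lambda>x. cx (f x))"
  by (rule bounded_linear.continuous_on[OF cx_linear])

lemma measurable_cx [measurable]: "cx \<in> borel_measurable borel"
  by (intro borel_measurable_continuous_onI continuous_intros)

lemma cx_rot: "cx (rot \<theta> v) = cis \<theta> * cx v"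
  by (simp add: cx_def rot_def complex_eq_iff algebra_simps)

lemma norm_rot [simp]: "norm (rot \<theta> v) = norm v"
  by (metis cx_rot norm_cx norm_cis norm_mult mult_1)

text \<open>A disc of radius \<open>sqrt a\<close> has area \<open>pi * a\<close>, and the
  half-lines \<open>{..a}\<close> generate the Borel sets. This takes the place of polar
  coordinates: an integral of a function of \<open>(norm w)\<^sup>2\<close> becomes
  \<open>pi\<close> times an integral over the half-line.\<close>

lemma distr_norm2:
  "distr lborel borel (\<lambda>w::real^2. (norm w)\<^sup>2) = density lborel (\<lambda>s. ennreal pi * indicator {0..} s)"
proof (rule measure_eqI_generator_eq[where E = "range atMost" and \<Omega> = UNIV and A = "\<lambda>i. {..real i}"])
  show "Int_stable (range (atMost :: real \<Rightarrow> _))"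
    by (auto simp: Int_stable_def Int_atMost)
  fix X :: "real set" assume "X \<in> range atMost"
  then obtain a where X: "X = {..a}" by auto
  have vim: "(\<lambda>w::real^2. (norm w)\<^sup>2) -` {..a} = (if a \<ge> 0 then cball 0 (sqrt a) else {})"
  proof -
    have "((norm w)\<^sup>2 \<le> a) = (norm w \<le> sqrt a)" if "a \<ge> 0" for w :: "real^2"
      using real_le_rsqrt[of "norm w" a] that
      by (metis norm_ge_zero power_mono real_sqrt_pow2)
    moreover have "\<not> (norm w)\<^sup>2 \<le> a" if "a < 0" for w :: "real^2"
      using that zero_le_power2[of "norm w"] by linarith
    ultimately show ?thesis
      by (cases "a \<ge> 0") auto
  qed
  have "emeasure (distr lborel borel (\<lambda>w::real^2. (norm w)\<^sup>2)) X = ennreal pi * ennreal (max 0 a)"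
    unfolding X by (subst emeasure_distr) (auto simp: vim emeasure_cball unit_ball_vol_2 ennreal_mult max_def)
  moreover have "emeasure (density lborel (\<lambda>s. ennreal pi * indicator {0..} s)) X = ennreal pi * ennreal (max 0 a)"
  proof -
    have "(\<lambda>s. ennreal pi * indicator {0..} s * indicator {..a} s) = (\<lambda>s. ennreal pi * indicator {0..a} s)"
      by (auto simp: indicator_def)
    then show ?thesis unfolding X
      by (subst emeasure_density) (auto simp: nn_integral_cmult max_def)
  qed
  ultimately show "emeasure (distr lborel borel (\<lambda>w::real^2. (norm w)\<^sup>2)) X =
      emeasure (density lborel (\<lambda>s. ennreal pi * indicator {0..} s)) X" by simp
next
  show "(\<Union>i. {..real i}) = UNIV" using real_arch_simple by auto
  fix i
  have "(\<lambda>w::real^2. (norm w)\<^sup>2) -` {..real i} \<subseteq> cball 0 (sqrt (real i))"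
    using real_le_rsqrt by auto
  then have "emeasure lborel ((\<lambda>w::real^2. (norm w)\<^sup>2) -` {..real i}) \<le> emeasure lborel (cball 0 (sqrt (real i)) :: (real^2) set)"
    by (intro emeasure_mono) auto
  also have "\<dots> < \<infinity>" using emeasure_cball[of "sqrt (real i)" "0::real^2"] by simp
  finally show "emeasure (distr lborel borel (\<lambda>w::real^2. (norm w)\<^sup>2)) {..real i} \<noteq> \<infinity>"
    by (subst emeasure_distr) auto
qed (auto simp: borel_eq_atMost)

lemma nn_integral_radial:
  assumes [measurable]: "f \<in> borel_measurable borel"
  shows "(\<integral>\<^sup>+w. f ((norm (w - a :: real^2))\<^sup>2) \<partial>lborel) = ennreal pi * (\<integral>\<^sup>+s. f s * indicator {0..} s \<partial>lborel)"
proof -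
  have "(\<integral>\<^sup>+w. f ((norm (w - a :: real^2))\<^sup>2) \<partial>lborel) = (\<integral>\<^sup>+w. f ((norm (w - a :: real^2))\<^sup>2) \<partial>distr lborel borel ((+) a))"
    by (simp add: lborel_distr_plus)
  also have "\<dots> = (\<integral>\<^sup>+w. f ((norm (w :: real^2))\<^sup>2) \<partial>lborel)"
    by (subst nn_integral_distr) (auto simp: add.commute)
  also have "\<dots> = (\<integral>\<^sup>+s. f s \<partial>distr lborel borel (\<lambda>w::real^2. (norm w)\<^sup>2))"
    by (subst nn_integral_distr) auto
  also have "\<dots> = (\<integral>\<^sup>+s. ennreal pi * indicator {0..} s * f s \<partial>lborel)"
    unfolding distr_norm2 by (subst nn_integral_density) auto
  also have "\<dots> = ennreal pi * (\<integral>\<^sup>+s. f s * indicator {0..} s \<partial>lborel)"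
    by (subst nn_integral_cmult[symmetric]) (auto simp: mult_ac)
  finally show ?thesis .
qed

lemma norm_sq_powr: "((norm x)\<^sup>2) powr q = norm x powr (2 * q)" for x :: "'a :: real_normed_vector"
proof (cases "x = 0")
  case False
  then have "((norm x)\<^sup>2) powr q = (norm x powr 2) powr q" by simp
  then show ?thesis by (simp only: powr_powr)
qed simp

text \<open>The factor \<open>1 / (2 - p)\<close> is kept because \<open>p\<close> will be chosen
  close to the critical exponent: with \<open>p = 2 - e\<close> it is the \<open>1 / e\<close> that
  \<open>osg_powr\<close> balances.\<close>

lemma nn_integral_norm_powr_cball:
  assumes "p < 2" "B \<ge> 0"
  shows "(\<integral>\<^sup>+w. ennreal (norm (w - a) powr (-p)) * indicator (cball a B) w \<partial>(lborel :: (real^2) measure))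
    = ennreal (2 * pi * B powr (2 - p) / (2 - p))"
proof -
  have "(\<integral>\<^sup>+w. ennreal (norm (w - a) powr (-p)) * indicator (cball a B) w \<partial>(lborel :: (real^2) measure))
    = (\<integral>\<^sup>+w. ennreal (((norm (w - a))\<^sup>2) powr (-p/2)) * indicator {..B\<^sup>2} ((norm (w - a))\<^sup>2) \<partial>(lborel :: (real^2) measure))"
  proof (intro nn_integral_cong)
    fix w :: "real^2"
    have "((norm (w - a))\<^sup>2) powr (-p/2) = norm (w - a) powr (-p)"
      by (simp add: norm_sq_powr)
    moreover have "w \<in> cball a B \<longleftrightarrow> (norm (w - a))\<^sup>2 \<in> {..B\<^sup>2}"
      using assms abs_le_square_iff[of "norm (w - a)" B] by (simp add: dist_norm norm_minus_commute)
    ultimately show "ennreal (norm (w - a) powr (-p)) * indicator (cball a B) w =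
      ennreal (((norm (w - a))\<^sup>2) powr (-p/2)) * indicator {..B\<^sup>2} ((norm (w - a))\<^sup>2)"
      by (simp add: indicator_def)
  qed
  also have "\<dots> = ennreal pi * (\<integral>\<^sup>+s. ennreal (s powr (-p/2)) * indicator {..B\<^sup>2} s * indicator {0..} s \<partial>lborel)"
    by (rule nn_integral_radial) auto
  also have "(\<integral>\<^sup>+s. ennreal (s powr (-p/2)) * indicator {..B\<^sup>2} s * indicator {0..} s \<partial>lborel)
     = (\<integral>\<^sup>+s. ennreal (s powr (-p/2)) * indicator {0..B\<^sup>2} s \<partial>lborel)"
    by (intro nn_integral_cong) (auto simp: indicator_def)
  also have "\<dots> = ennreal ((B\<^sup>2) powr (-p/2 + 1) / (-p/2 + 1))"
    by (rule nn_integral_has_integral_lebesgue') (use assms has_integral_powr_from_0[of "-p/2" "B\<^sup>2"] in auto)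
  also have "(B\<^sup>2) powr (-p/2 + 1) = B powr (2 - p)"
  proof (cases "B = 0")
    case False
    then have "(B\<^sup>2) powr (-p/2 + 1) = (B powr 2) powr (-p/2 + 1)" using assms by simp
    also have "\<dots> = B powr (2 * (-p/2 + 1))" by (rule powr_powr)
    also have "2 * (-p/2 + 1) = 2 - p" by simp
    finally show ?thesis .
  qed simp
  also have "ennreal pi * ennreal (B powr (2 - p) / (-p/2 + 1)) = ennreal (2 * pi * B powr (2 - p) / (2 - p))"
  proof -
    have "pi * (B powr (2 - p) / (-p/2 + 1)) = 2 * pi * B powr (2 - p) / (2 - p)"
      using assms by (simp add: field_simps)
    then show ?thesis using assms by (subst ennreal_mult[symmetric]) auto
  qed
  finally show ?thesis .
qed

lemma nn_integral_norm_powr3_outside: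
  assumes "A > 0"
  shows "(\<integral>\<^sup>+w. ennreal (1 / norm (w - a) ^ 3) * indicator {w. A \<le> norm (w - a)} w \<partial>(lborel :: (real^2) measure))
    = ennreal (2 * pi / A)"
proof -
  have "(\<integral>\<^sup>+w. ennreal (1 / norm (w - a) ^ 3) * indicator {w. A \<le> norm (w - a)} w \<partial>(lborel :: (real^2) measure))
    = (\<integral>\<^sup>+w. ennreal (((norm (w - a))\<^sup>2) powr (-3/2)) * indicator {A\<^sup>2..} ((norm (w - a))\<^sup>2) \<partial>(lborel :: (real^2) measure))"
  proof (intro nn_integral_cong)
    fix w :: "real^2"
    have "((norm (w - a))\<^sup>2) powr (-3/2) = 1 / norm (w - a) ^ 3"
    proof (cases "w = a")
      case False
      have "((norm (w - a))\<^sup>2) powr (-3/2) = norm (w - a) powr (-3)"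
        by (simp add: norm_sq_powr)
      also have "\<dots> = 1 / norm (w - a) ^ 3"
        unfolding powr_minus_divide[of "norm (w - a)" 3] using False by simp
      finally show ?thesis .
    qed auto
    moreover have "w \<in> {w. A \<le> norm (w - a)} \<longleftrightarrow> (norm (w - a))\<^sup>2 \<in> {A\<^sup>2..}"
      using assms abs_le_square_iff[of A "norm (w - a)"] by simp
    ultimately show "ennreal (1 / norm (w - a) ^ 3) * indicator {w. A \<le> norm (w - a)} w =
       ennreal (((norm (w - a))\<^sup>2) powr (-3/2)) * indicator {A\<^sup>2..} ((norm (w - a))\<^sup>2)"
      by (simp add: indicator_def)
  qed
  also have "\<dots> = ennreal pi * (\<integral>\<^sup>+s. ennreal (s powr (-3/2)) * indicator {A\<^sup>2..} s * indicator {0..} s \<partial>lborel)"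
    by (rule nn_integral_radial) auto
  also have "(\<integral>\<^sup>+s. ennreal (s powr (-3/2)) * indicator {A\<^sup>2..} s * indicator {0..} s \<partial>lborel)
     = (\<integral>\<^sup>+s. ennreal (s powr (-3/2)) * indicator {A\<^sup>2..} s \<partial>lborel)"
  proof (intro nn_integral_cong)
    fix s
    have "A\<^sup>2 \<le> s \<Longrightarrow> 0 \<le> s" by (rule order_trans[OF zero_le_power2])
    then show "ennreal (s powr (-3/2)) * indicator {A\<^sup>2..} s * indicator {0..} s = ennreal (s powr (-3/2)) * indicator {A\<^sup>2..} s"
      by (auto simp: indicator_def)
  qed
  also have "\<dots> = ennreal (- ((A\<^sup>2) powr (-3/2 + 1)) / (-3/2 + 1))"
    by (rule nn_integral_has_integral_lebesgue') (use assms has_integral_powr_to_inf[of "-3/2" "A\<^sup>2"] in auto)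
  also have "(A\<^sup>2) powr (-3/2 + 1) = 1 / A"
  proof -
    have "(A\<^sup>2) powr (-3/2 + 1) = A powr (-1)" using norm_sq_powr[of A "-3/2 + 1"] by simp
    also have "\<dots> = 1 / A" unfolding powr_minus_divide using assms by simp
    finally show ?thesis .
  qed
  also have "ennreal pi * ennreal (- (1 / A) / (-3/2 + 1)) = ennreal (2 * pi / A)"
  proof -
    have "pi * (- (1 / A) / (-3/2 + 1)) = 2 * pi / A" by simp
    then show ?thesis using assms by (subst ennreal_mult[symmetric]) auto
  qed
  finally show ?thesis .
qed

section \<open>Differences of kernels\<close>

lemma nn_bound_imp_integral_bound:
  fixes f :: "'a \<Rightarrow> 'b::{banach, second_countable_topology}"
  assumes "f \<in> borel_measurable M" "(\<integral>\<^sup>+x. ennreal (norm (f x)) \<partial>M) \<le> ennreal B" "B \<ge> 0"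
  shows "integrable M f" "norm (integral\<^sup>L M f) \<le> B"
proof -
  show i: "integrable M f"
    using assms by (auto simp: integrable_iff_bounded intro: le_less_trans)
  have "ennreal (norm (integral\<^sup>L M f)) \<le> ennreal B"
    using integral_norm_bound_ennreal[OF i] assms(2) by (rule order_trans)
  then show "norm (integral\<^sup>L M f) \<le> B" using assms by (simp add: ennreal_le_iff)
qed

text \<open>With \<open>s\<close> the larger of the two reciprocal moduli, the difference is at most
  \<open>2 * s\<close> and at most \<open>D * s\<^sup>2\<close>. The geometric mean of the two
  bounds with weights \<open>e\<close> and \<open>1 - e\<close> has the singularity
  \<open>s powr (2 - e)\<close>, which is locally integrable in the plane, unlike
  \<open>s\<^sup>2\<close>.\<close>

lemma inverse_diff_bound:
  fixes a b :: complex
  assumes "0 < e" "e \<le> 1" "norm (a - b) \<le> D"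
  shows "norm (1 / a - 1 / b) \<le> 2 * D powr (1 - e) * (norm a powr (-(2 - e)) + norm b powr (-(2 - e)))"
proof -
  have key: "norm (1 / a - 1 / b) \<le> 2 * D powr (1 - e) * (norm a powr (-(2 - e)))"
    if "norm a \<le> norm b" "a \<noteq> 0" "norm (a - b) \<le> D" for a b :: complex
  proof -
    define s where "s = 1 / norm a"
    have b: "b \<noteq> 0" using that by auto
    have s: "s > 0" "1 / norm b \<le> s" using that b by (auto simp: s_def frac_le)
    have D: "D \<ge> 0" using that(3) norm_ge_zero order_trans by blast
    have 1: "norm (1 / a - 1 / b) \<le> 2 * s"
      using norm_triangle_ineq4[of "1/a" "1/b"] s by (simp add: norm_divide s_def)
    have "norm (1 / a - 1 / b) = norm (a - b) * (1 / norm a) * (1 / norm b)"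
    proof -
      have "1 / a - 1 / b = - (a - b) * (1 / a) * (1 / b)" using that b by (simp add: field_simps)
      then show ?thesis by (simp only: norm_mult norm_minus_cancel norm_divide norm_one)
    qed
    also have "\<dots> \<le> D * s * s"
      using that s D by (intro mult_mono) (auto simp: s_def)
    finally have 2: "norm (1 / a - 1 / b) \<le> D * s * s" .
    let ?n = "norm (1 / a - 1 / b)"
    have "?n = ?n powr (1 - e) * ?n powr e"
      by (cases "?n = 0") (auto simp: powr_add[symmetric])
    also have "\<dots> \<le> (D * s * s) powr (1 - e) * (2 * s) powr e"
      using 1 2 assms by (intro mult_mono powr_mono2) auto
    also have "\<dots> = (D powr (1 - e) * s powr (1 - e) * s powr (1 - e)) * (2 powr e * s powr e)"
      using D s by (simp add: powr_mult)
    also have "\<dots> = 2 powr e * D powr (1 - e) * (s powr (1 - e) * s powr (1 - e) * s powr e)"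
      by simp
    also have "s powr (1 - e) * s powr (1 - e) * s powr e = s powr (2 - e)"
      by (simp add: powr_add[symmetric])
    also have "2 powr e * D powr (1 - e) * s powr (2 - e) \<le> 2 powr 1 * D powr (1 - e) * s powr (2 - e)"
      using assms by (intro mult_right_mono powr_mono) auto
    also have "s powr (2 - e) = norm a powr (-(2 - e))"
      unfolding s_def powr_minus_divide using that by (simp add: powr_divide)
    finally show ?thesis by simp
  qed
  \<comment> \<open>If exactly one argument is \<open>0\<close>, then \<open>1 / 0 = 0\<close>
    leaves a single reciprocal, and the other argument has modulus at most \<open>D\<close>.\<close>
  have one: "norm (1 / b) \<le> 2 * D powr (1 - e) * norm b powr (-(2 - e))" if "norm b \<le> D" "b \<noteq> 0" for b :: complex
  proof -
    have "norm (1 / b) = norm b powr (1 - e) * norm b powr (-(2 - e))"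
      using that by (simp add: powr_add[symmetric] norm_divide powr_minus_divide)
    also have "\<dots> \<le> D powr (1 - e) * norm b powr (-(2 - e))"
      using that assms by (intro mult_right_mono powr_mono2) auto
    also have "\<dots> \<le> 2 * (D powr (1 - e) * norm b powr (-(2 - e)))" by simp
    finally show ?thesis by (simp only: mult.assoc)
  qed
  have nn: "0 \<le> 2 * D powr (1 - e) * x powr y" for x y :: real by simp
  consider "a = 0" "b = 0" | "a = 0" "b \<noteq> 0" | "a \<noteq> 0" "b = 0" | "a \<noteq> 0" "b \<noteq> 0" by blast
  then show ?thesis
  proof cases
    case 2 then show ?thesis using one[of b] assms by (auto simp: norm_divide)
  next
    case 3 then show ?thesis using one[of a] assms by (auto simp: norm_divide)
  next
    case 4
    show ?thesis
    proof (cases "norm a \<le> norm b")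
      case True
      show ?thesis using key[OF True 4(1) assms(3)] nn[of "norm b" "-(2 - e)"] unfolding distrib_left by linarith
    next
      case False
      then have "norm b \<le> norm a" "norm (b - a) \<le> D" using assms(3) by (auto simp: norm_minus_commute)
      from key[OF this(1) 4(2) this(2)] show ?thesis
        using nn[of "norm a" "-(2 - e)"] norm_minus_commute[of "1/a" "1/b"] unfolding distrib_left by linarith
    qed
  qed auto
qed

text \<open>The Osgood modulus; note that \<open>osg 0 = 0\<close>.\<close>

definition osg :: "real \<Rightarrow> real" where "osg d = d * (1 - ln d)"

lemma osg_nonneg: "0 < d \<Longrightarrow> d \<le> 1 \<Longrightarrow> 0 \<le> osg d"
  using ln_le_zero_iff[of d] unfolding osg_def by (intro mult_nonneg_nonneg) linarith+

text \<open>Optimising the exponent of a Hoelder estimate yields the logarithm.\<close>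

lemma osg_powr:
  assumes "0 < d" "d \<le> 1"
  shows "\<exists>e. 0 < e \<and> e \<le> 1 \<and> d powr (1 - e) / e \<le> 3 * osg d"
proof -
  \<comment> \<open>The exponent will be \<open>e = 1 / L\<close>. It keeps
    \<open>d powr (- e) = exp (- ln d / L)\<close> below \<open>exp 1\<close>, while
    \<open>1 / e\<close> is the logarithmic factor itself.\<close>
  define L where "L = 1 - ln d"
  have L: "L \<ge> 1" using assms by (simp add: L_def)
  have "d powr (1 - 1 / L) = d * d powr (- (1 / L))"
    using assms by (simp add: powr_add[symmetric] powr_diff powr_minus divide_inverse)
  also have "d powr (- (1 / L)) = exp (- ln d / L)"
    using assms by (simp add: powr_def)
  also have "\<dots> \<le> exp 1"
    using L by (simp add: L_def field_simps)
  also have "exp 1 \<le> (3::real)" by (rule exp_le)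
  finally have "d powr (1 - 1 / L) \<le> d * 3" using assms by simp
  then have "d powr (1 - 1 / L) / (1 / L) \<le> 3 * osg d"
    using L by (simp add: osg_def L_def[symmetric] mult_right_mono)
  then show ?thesis using L by (intro exI[of _ "1 / L"]) auto
qed

text \<open>This is \<open>1 / (a - b) + 1 / b + a / b\<^sup>2\<close>.\<close>

definition far_ker :: "complex \<Rightarrow> complex \<Rightarrow> complex" where
  "far_ker a b = a\<^sup>2 / (b\<^sup>2 * (a - b))"

text \<open>Two of the three powers of \<beta> are explicit in the kernel; the third comes from
  \<open>norm (a - b) \<ge> \<beta> / 2\<close>.\<close>

lemma far_ker_bound:
  assumes "norm a \<le> \<alpha>" "\<beta> \<le> norm b" "2 * \<alpha> \<le> \<beta>" "0 < \<beta>"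
  shows "norm (far_ker a b) \<le> 2 * \<alpha>\<^sup>2 / \<beta> ^ 3"
proof -
  have "\<beta> / 2 \<le> norm (a - b)"
    using assms norm_triangle_ineq2[of b a] by (simp add: norm_minus_commute)
  then have "\<beta>\<^sup>2 * (\<beta> / 2) \<le> (norm b)\<^sup>2 * norm (a - b)"
    using assms by (intro mult_mono power_mono) auto
  moreover have "(norm a)\<^sup>2 \<le> \<alpha>\<^sup>2" using assms by (intro power_mono) auto
  ultimately have "(norm a)\<^sup>2 / ((norm b)\<^sup>2 * norm (a - b)) \<le> \<alpha>\<^sup>2 / (\<beta>\<^sup>2 * (\<beta> / 2))"
    using assms by (intro frac_le) auto
  moreover have "norm (far_ker a b) = (norm a)\<^sup>2 / ((norm b)\<^sup>2 * norm (a - b))"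
    by (simp add: far_ker_def norm_divide norm_mult norm_power)
  moreover have "\<alpha>\<^sup>2 / (\<beta>\<^sup>2 * (\<beta> / 2)) = 2 * \<alpha>\<^sup>2 / \<beta> ^ 3"
    by (simp add: power2_eq_square power3_eq_cube)
  ultimately show ?thesis by simp
qed

text \<open>Every factor of the kernel changes by a relative amount of order \<delta>, so the cubic
  decay survives in the difference. The factor \<open>K\<close> allows for a displacement of
  \<open>b\<close> that is small relative to its label rather than relative to the lower bound
  \<beta> of its modulus.\<close>

lemma far_ker_diff:
  assumes a: "norm a \<le> \<alpha>" "norm a' \<le> \<alpha>" and b: "\<beta> \<le> norm b" "\<beta> \<le> norm b'"
    and ab: "2 * \<alpha> \<le> \<beta>" "0 < \<beta>"
    and d: "norm (a - a') \<le> \<delta> * \<alpha>" "norm (b - b') \<le> \<delta> * K * \<beta>" "1 \<le> K" "0 \<le> \<delta>"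
  shows "norm (far_ker a b - far_ker a' b') \<le> 14 * K * \<delta> * \<alpha>\<^sup>2 / \<beta> ^ 3"
proof -
  have al: "0 \<le> \<alpha>" using a norm_ge_zero order_trans by blast
  have nz: "b \<noteq> 0" "b' \<noteq> 0" using b ab by auto
  have w: "\<beta> / 2 \<le> norm (a - b)" "\<beta> / 2 \<le> norm (a' - b')"
    using assms norm_triangle_ineq2[of b a] norm_triangle_ineq2[of b' a'] by (auto simp: norm_minus_commute)
  then have wnz: "a - b \<noteq> 0" "a' - b' \<noteq> 0" using ab by auto
  have nb: "norm (1 / b) \<le> 1 / \<beta>" "norm (1 / b') \<le> 1 / \<beta>"
    using b ab by (auto simp: norm_divide intro!: divide_left_mono mult_pos_pos)
  have nw: "norm (1 / (a - b)) \<le> 2 / \<beta>" "norm (1 / (a' - b')) \<le> 2 / \<beta>"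
    using w ab wnz by (auto simp: norm_divide field_simps)
  \<comment> \<open>Telescoping over the three factors \<open>a\<^sup>2\<close>,
    \<open>1 / b\<^sup>2\<close> and \<open>1 / (a - b)\<close>, with a small difference factored
    out of each summand.\<close>
  have eq: "far_ker a b - far_ker a' b' =
      (a - a') * (a + a') * ((1 / b) * (1 / b)) * (1 / (a - b))
    + a' * a' * ((b' - b) * (1 / b) * (1 / b') * (1 / b + 1 / b')) * (1 / (a - b))
    + a' * a' * ((1 / b') * (1 / b')) * (((a' - a) + (b - b')) * (1 / (a - b)) * (1 / (a' - b')))"
    (is "_ = ?A + ?B + ?C")
  proof -
    have 1: "(b' - b) * (1 / b) * (1 / b') * (1 / b + 1 / b') = (1/b)\<^sup>2 - (1/b')\<^sup>2"
      using nz by (simp add: field_simps power2_eq_square)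
    have 2: "((a' - a) + (b - b')) * (1 / (a - b)) * (1 / (a' - b')) = 1 / (a - b) - 1 / (a' - b')"
      using wnz by (simp add: field_simps)
    have f: "far_ker x y = x * x * (1/y)\<^sup>2 * (1 / (x - y))" for x y
      by (simp add: far_ker_def power2_eq_square)
    show ?thesis unfolding 1 2 f by algebra
  qed
  have "norm ?A \<le> (\<delta> * \<alpha>) * (\<alpha> + \<alpha>) * ((1 / \<beta>) * (1 / \<beta>)) * (2 / \<beta>)"
    unfolding norm_mult using a d nb nw al ab
    by (intro mult_mono norm_triangle_mono mult_nonneg_nonneg) auto
  moreover have "norm ?B \<le> \<alpha> * \<alpha> * (\<delta> * K * \<beta> * (1 / \<beta>) * (1 / \<beta>) * (1 / \<beta> + 1 / \<beta>)) * (2 / \<beta>)"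
    unfolding norm_mult using a d nb nw al ab
    by (intro mult_mono norm_triangle_mono mult_nonneg_nonneg) (auto simp: norm_minus_commute)
  moreover have "norm ?C \<le> \<alpha> * \<alpha> * ((1 / \<beta>) * (1 / \<beta>)) * ((\<delta> * \<alpha> + \<delta> * K * \<beta>) * (2 / \<beta>) * (2 / \<beta>))"
    unfolding norm_mult using a d nb nw al ab
    by (intro mult_mono norm_triangle_mono mult_nonneg_nonneg) (auto simp: norm_minus_commute)
  ultimately have "norm (far_ker a b - far_ker a' b') \<le>
     (\<delta> * \<alpha>) * (\<alpha> + \<alpha>) * ((1 / \<beta>) * (1 / \<beta>)) * (2 / \<beta>)
     + \<alpha> * \<alpha> * (\<delta> * K * \<beta> * (1 / \<beta>) * (1 / \<beta>) * (1 / \<beta> + 1 / \<beta>)) * (2 / \<beta>)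
     + \<alpha> * \<alpha> * ((1 / \<beta>) * (1 / \<beta>)) * ((\<delta> * \<alpha> + \<delta> * K * \<beta>) * (2 / \<beta>) * (2 / \<beta>))"
    unfolding eq using norm_triangle_ineq[of "?A + ?B" ?C] norm_triangle_ineq[of ?A ?B] by linarith
  also have "\<dots> = \<delta> * \<alpha>\<^sup>2 / \<beta> ^ 3 * (4 + 8 * K + 4 * (\<alpha> / \<beta>))"
    using ab by (simp add: field_simps power2_eq_square power3_eq_cube)
  also have "\<dots> \<le> \<delta> * \<alpha>\<^sup>2 / \<beta> ^ 3 * (14 * K)"
  proof (intro mult_left_mono)
    have "\<alpha> / \<beta> \<le> 1 / 2" using ab by (simp add: field_simps)
    then show "4 + 8 * K + 4 * (\<alpha> / \<beta>) \<le> 14 * K" using d by linarith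
  qed (use d ab in auto)
  finally show ?thesis by (simp add: algebra_simps)
qed

text \<open>The maps are not assumed to be Lipschitz, so the singularity of
  \<open>1 / (cx a - cx (X y))\<close> in \<open>y\<close> cannot be estimated pointwise. Since
  \<open>X\<close> preserves the Lebesgue measure, the integral is transported to the image, where
  \<open>1 / norm (v - a) powr (2 - e)\<close> is integrated over a disc. Choosing \<open>e\<close>
  by \<open>osg_powr\<close> yields the Osgood modulus.\<close>

lemma near_ker_diff:
  fixes X X' :: "real^2 \<Rightarrow> real^2"
  assumes [measurable]: "X \<in> borel_measurable borel" "X' \<in> borel_measurable borel" "A \<in> sets borel"
    and mp: "distr lborel borel X = lborel" "distr lborel borel X' = lborel"
    and bd: "\<And>y. y \<in> A \<Longrightarrow> norm (X y) \<le> B" "\<And>y. y \<in> A \<Longrightarrow> norm (X' y) \<le> B" "norm a \<le> B" "norm a' \<le> B"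
    and cl: "\<And>y. y \<in> A \<Longrightarrow> norm ((cx a - cx (X y)) - (cx a' - cx (X' y))) \<le> 4 * B * d"
    and d: "0 < d" "d \<le> 1" "0 < B"
  shows "(\<integral>\<^sup>+y. ennreal (norm (1 / (cx a - cx (X y)) - 1 / (cx a' - cx (X' y)))) * indicator A y \<partial>lborel)
      \<le> ennreal (400 * B * osg d)"
proof -
  obtain e where e: "0 < e" "e \<le> 1" "d powr (1 - e) / e \<le> 3 * osg d"
    using osg_powr[OF d(1,2)] by blast
  define D where "D = 4 * B * d"
  have D: "D > 0" using d by (simp add: D_def)
  have ball: "(\<integral>\<^sup>+y. ennreal (norm (b - Y y) powr (-(2 - e))) * indicator A y \<partial>lborel) \<le> ennreal (2 * pi * (2 * B) powr e / e)"
    if [measurable]: "Y \<in> borel_measurable borel" and Y: "distr lborel borel Y = lborel"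
      "\<And>y. y \<in> A \<Longrightarrow> norm (Y y) \<le> B" "norm b \<le> B" for Y and b :: "real^2"
  proof -
    have "(\<integral>\<^sup>+y. ennreal (norm (b - Y y) powr (-(2 - e))) * indicator A y \<partial>lborel)
        \<le> (\<integral>\<^sup>+y. ennreal (norm (Y y - b) powr (-(2 - e))) * indicator (cball b (2 * B)) (Y y) \<partial>lborel)"
    proof (intro nn_integral_mono)
      fix y
      show "ennreal (norm (b - Y y) powr (-(2 - e))) * indicator A y
        \<le> ennreal (norm (Y y - b) powr (-(2 - e))) * indicator (cball b (2 * B)) (Y y)"
      proof (cases "y \<in> A")
        case True
        then have "Y y \<in> cball b (2 * B)"
          using Y(2)[OF True] Y(3) norm_triangle_ineq4[of b "Y y"] by (simp add: dist_norm)
        then show ?thesis using True by (simp add: norm_minus_commute)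
      qed simp
    qed
    also have "\<dots> = (\<integral>\<^sup>+y. ennreal (norm (y - b) powr (-(2 - e))) * indicator (cball b (2 * B)) y \<partial>distr lborel borel Y)"
      by (intro nn_integral_distr[symmetric] borel_measurable_times_ennreal borel_measurable_indicator) auto
    also have "\<dots> = ennreal (2 * pi * (2 * B) powr e / e)"
      unfolding Y(1) using nn_integral_norm_powr_cball[of "2 - e" "2 * B" b] e d by simp
    finally show ?thesis .
  qed
  have "(\<integral>\<^sup>+y. ennreal (norm (1 / (cx a - cx (X y)) - 1 / (cx a' - cx (X' y)))) * indicator A y \<partial>lborel)
     \<le> (\<integral>\<^sup>+y. ennreal (2 * D powr (1 - e)) * (ennreal (norm (a - X y) powr (-(2 - e))) * indicator A y
           + ennreal (norm (a' - X' y) powr (-(2 - e))) * indicator A y) \<partial>lborel)"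
  proof (intro nn_integral_mono)
    fix y
    show "ennreal (norm (1 / (cx a - cx (X y)) - 1 / (cx a' - cx (X' y)))) * indicator A y
      \<le> ennreal (2 * D powr (1 - e)) * (ennreal (norm (a - X y) powr (-(2 - e))) * indicator A y
           + ennreal (norm (a' - X' y) powr (-(2 - e))) * indicator A y)"
    proof (cases "y \<in> A")
      case True
      have "norm (1 / (cx a - cx (X y)) - 1 / (cx a' - cx (X' y)))
        \<le> 2 * D powr (1 - e) * (norm (cx a - cx (X y)) powr (-(2 - e)) + norm (cx a' - cx (X' y)) powr (-(2 - e)))"
        by (rule inverse_diff_bound[OF e(1,2)]) (use cl[OF True] in \<open>simp add: D_def\<close>)
      then have "norm (1 / (cx a - cx (X y)) - 1 / (cx a' - cx (X' y)))
        \<le> 2 * D powr (1 - e) * (norm (a - X y) powr (-(2 - e)) + norm (a' - X' y) powr (-(2 - e)))"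
        by (simp only: cx_diff[symmetric] norm_cx)
      moreover have "ennreal (2 * D powr (1 - e)) * (ennreal (norm (a - X y) powr (-(2 - e))) * indicator A y
           + ennreal (norm (a' - X' y) powr (-(2 - e))) * indicator A y)
         = ennreal (2 * D powr (1 - e) * (norm (a - X y) powr (-(2 - e)) + norm (a' - X' y) powr (-(2 - e))))"
        using True by (simp add: ennreal_mult ennreal_plus)
      ultimately show ?thesis using True by (simp add: ennreal_leI)
    qed simp
  qed
  also have "\<dots> = ennreal (2 * D powr (1 - e)) * ((\<integral>\<^sup>+y. ennreal (norm (a - X y) powr (-(2 - e))) * indicator A y \<partial>lborel)
           + (\<integral>\<^sup>+y. ennreal (norm (a' - X' y) powr (-(2 - e))) * indicator A y \<partial>lborel))"
    by (simp add: nn_integral_cmult nn_integral_add)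
  also have "\<dots> \<le> ennreal (2 * D powr (1 - e)) * (ennreal (2 * pi * (2 * B) powr e / e) + ennreal (2 * pi * (2 * B) powr e / e))"
    using ball[OF _ mp(1) bd(1) bd(3)] ball[OF _ mp(2) bd(2) bd(4)] by (intro mult_left_mono add_mono) auto
  also have "\<dots> = ennreal (8 * pi * D powr (1 - e) * (2 * B) powr e / e)"
  proof -
    have eq: "8 * pi * D powr (1 - e) * (2 * B) powr e / e =
        2 * D powr (1 - e) * (2 * pi * (2 * B) powr e / e + 2 * pi * (2 * B) powr e / e)" by simp
    have m: "ennreal u * (ennreal v + ennreal v) = ennreal (u * (v + v))" if "u \<ge> 0" "v \<ge> 0" for u v
      unfolding ennreal_plus[OF that(2) that(2), symmetric]
      by (rule ennreal_mult[symmetric]) (use that in auto)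
    have "0 \<le> 2 * D powr (1 - e)" "0 \<le> 2 * pi * (2 * B) powr e / e" using e by auto
    from m[OF this] show ?thesis by (simp only: eq)
  qed
  also have "\<dots> \<le> ennreal (400 * B * osg d)"
  proof (rule ennreal_leI)
    \<comment> \<open>The radius \<open>2 * B\<close> is enlarged to \<open>4 * B\<close>, the
      factor in \<open>D = 4 * B * d\<close>, so that the powers with exponents \<open>1 - e\<close>
      and \<open>e\<close> combine.\<close>
    have "D powr (1 - e) * (2 * B) powr e \<le> D powr (1 - e) * (4 * B) powr e"
      using d e by (intro mult_left_mono powr_mono2) auto
    also have "\<dots> = (4 * B) powr (1 - e) * d powr (1 - e) * (4 * B) powr e"
      using d by (simp add: D_def powr_mult)
    also have "\<dots> = 4 * B * d powr (1 - e)"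
      using d by (simp add: powr_diff)
    finally have "D powr (1 - e) * (2 * B) powr e / e \<le> 4 * B * d powr (1 - e) / e"
      using e by (intro divide_right_mono) auto
    also have "\<dots> = 4 * B * (d powr (1 - e) / e)" by simp
    also have "\<dots> \<le> 4 * B * (3 * osg d)" using d e by (intro mult_left_mono) auto
    finally have "8 * pi * (D powr (1 - e) * (2 * B) powr e / e) \<le> 8 * pi * (12 * B * osg d)"
      by (intro mult_left_mono) auto
    also have "\<dots> = 96 * pi * (B * osg d)" by simp
    also have "\<dots> \<le> 400 * (B * osg d)"
    proof (intro mult_right_mono)
      show "0 \<le> B * osg d" using d osg_nonneg by simp
      show "96 * pi \<le> 400" using pi_less_4 by linarith
    qed
    finally show "8 * pi * D powr (1 - e) * (2 * B) powr e / e \<le> 400 * B * osg d" by (simp add: mult.assoc)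
  qed
  finally show ?thesis .
qed

section \<open>Measure preserving maps and rotations\<close>

lemma borel_imp_lebesgue: "f \<in> borel_measurable borel \<Longrightarrow> f \<in> borel_measurable lebesgue"
  by (simp add: measurable_completion)

definition mpres :: "(real^2 \<Rightarrow> real^2) \<Rightarrow> bool" where
  "mpres X \<longleftrightarrow> X \<in> borel_measurable borel \<and> distr lborel borel X = lborel"

text \<open>For the completed measures preimages of null sets have to be null sets as well, and this
  is what the preservation of the measure provides.\<close>

lemma mpres_lebesgue:
  assumes "mpres X"
  shows "X \<in> lebesgue \<rightarrow>\<^sub>M lebesgue" "distr lebesgue lebesgue X = lebesgue"
proof -
  have X: "X \<in> lebesgue \<rightarrow>\<^sub>M lborel" using assms by (simp add: mpres_def measurable_completion)
  have d: "distr lebesgue lborel X = lborel"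
  proof -
    have "distr lebesgue lborel X = distr lborel lborel X"
      using assms by (intro distr_completion) (simp add: mpres_def)
    also have "\<dots> = distr lborel borel X" by (intro distr_cong) auto
    finally show ?thesis using assms by (simp add: mpres_def)
  qed
  show "X \<in> lebesgue \<rightarrow>\<^sub>M lebesgue"
    by (rule completion.measurable_completion2[OF X]) (simp add: d)
  show "distr lebesgue lebesgue X = lebesgue"
    using completion.completion_distr_eq[OF X] by (simp add: d)
qed

lemma mpres_integral:
  fixes h :: "real^2 \<Rightarrow> 'b::{banach, second_countable_topology}"
  assumes "mpres X" "h \<in> borel_measurable lebesgue"
  shows "integral\<^sup>L lebesgue (\<lambda>y. h (X y)) = integral\<^sup>L lebesgue h"
    and "(\<lambda>y. h (X y)) \<in> borel_measurable lebesgue"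
proof -
  note X = mpres_lebesgue[OF assms(1)]
  show "(\<lambda>y. h (X y)) \<in> borel_measurable lebesgue"
    using measurable_compose[OF X(1) assms(2)] by simp
  have "integral\<^sup>L lebesgue h = integral\<^sup>L (distr lebesgue lebesgue X) h" by (simp add: X)
  also have "\<dots> = integral\<^sup>L lebesgue (\<lambda>y. h (X y))"
    by (rule integral_distr[OF X(1) assms(2)])
  finally show "integral\<^sup>L lebesgue (\<lambda>y. h (X y)) = integral\<^sup>L lebesgue h" by simp
qed

lemma mpres_integrable:
  fixes h :: "real^2 \<Rightarrow> 'b::{banach, second_countable_topology}"
  assumes "mpres X" "h \<in> borel_measurable lebesgue"
  shows "integrable lebesgue (\<lambda>y. h (X y)) \<longleftrightarrow> integrable lebesgue h"
  using integrable_distr_eq[OF mpres_lebesgue(1)[OF assms(1)] assms(2)] mpres_lebesgue(2)[OF assms(1)] by simp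

lemma rot_rot_neg [simp]: "rot (-\<theta>) (rot \<theta> x) = x" "rot \<theta> (rot (-\<theta>) x) = x"
proof -
  have "cx (rot (-\<theta>) (rot \<theta> x)) = cx x" "cx (rot \<theta> (rot (-\<theta>) x)) = cx x"
    by (simp_all add: cx_rot mult.assoc[symmetric] cis_mult)
  then show "rot (-\<theta>) (rot \<theta> x) = x" "rot \<theta> (rot (-\<theta>) x) = x" by simp_all
qed

lemma orthogonal_rot: "orthogonal_transformation (rot \<theta>)"
proof -
  have "linear (rot \<theta>)"
  proof (rule linearI)
    show "rot \<theta> (x + y) = rot \<theta> x + rot \<theta> y" for x y
      by (subst cx_eq_iff[symmetric]) (simp add: cx_rot cx_add distrib_left)
    show "rot \<theta> (c *\<^sub>R x) = c *\<^sub>R rot \<theta> x" for c x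
      by (subst cx_eq_iff[symmetric]) (simp add: cx_rot cx_scaleR)
  qed
  then show ?thesis by (simp add: orthogonal_transformation)
qed

lemma continuous_rot: "continuous_on UNIV (rot \<theta>)"
  using orthogonal_transformation_linear[OF orthogonal_rot] linear_continuous_on linear_conv_bounded_linear by blast

lemma mpres_rot: "mpres (rot \<theta>)"
proof -
  have [measurable]: "rot \<theta> \<in> borel_measurable borel"
    by (intro borel_measurable_continuous_onI continuous_rot)
  have "lborel = distr lborel borel (rot \<theta>)"
  proof (rule lborel_eqI)
    fix l u :: "real^2" assume lu: "\<And>b. b \<in> Basis \<Longrightarrow> l \<bullet> b \<le> u \<bullet> b"
    have vim: "rot \<theta> -` box l u = rot (-\<theta>) ` box l u"
      by (auto simp: image_iff intro!: bexI[of _ "rot \<theta> _"])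
    have m: "rot (-\<theta>) ` box l u \<in> lmeasurable" "measure lebesgue (rot (-\<theta>) ` box l u) = measure lebesgue (box l u)"
      using measurable_orthogonal_image[OF orthogonal_rot lmeasurable_box]
        measure_orthogonal_image[OF orthogonal_rot lmeasurable_box] by auto
    have "emeasure (distr lborel borel (rot \<theta>)) (box l u) = emeasure lebesgue (rot (-\<theta>) ` box l u)"
    proof -
      have "rot \<theta> -` box l u \<inter> space borel \<in> sets borel"
        by (rule measurable_sets[of "rot \<theta>" borel borel]) auto
      then show ?thesis by (subst emeasure_distr) (auto simp: vim[symmetric])
    qed
    also have "\<dots> = ennreal (measure lebesgue (box l u))"
      using m by (simp add: emeasure_eq_measure2)
    also have "\<dots> = emeasure lborel (box l u)"
      using lmeasurable_box[of l u] by (simp add: emeasure_eq_measure2[symmetric])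
    finally show "emeasure (distr lborel borel (rot \<theta>)) (box l u) = (\<Prod>b\<in>Basis. (u - l) \<bullet> b)"
      using lu by (simp add: emeasure_lborel_box)
  qed simp
  then show ?thesis by (simp add: mpres_def)
qed

text \<open>For \<open>m \<ge> 3\<close> this removes the terms \<open>1 / x\<close> and \<open>z / x\<^sup>2\<close> in the expansion of the kernel
  at infinity, after which it decays like \<open>1 / \<bar>x\<bar>\<^sup>3\<close> and is integrable.\<close>

lemma integral_rot_zero:
  fixes h :: "real^2 \<Rightarrow> complex"
  assumes "h \<in> borel_measurable lebesgue" "\<And>x. h (rot \<theta> x) = c * h x" "c \<noteq> 1"
  shows "integral\<^sup>L lebesgue h = 0"
proof -
  have "integral\<^sup>L lebesgue h = integral\<^sup>L lebesgue (\<lambda>x. h (rot \<theta> x))"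
    using mpres_integral(1)[OF mpres_rot assms(1)] by simp
  also have "\<dots> = c * integral\<^sup>L lebesgue h" by (simp add: assms(2))
  finally show ?thesis using assms(3) by simp
qed

text \<open>The factor by which \<open>1 / x\<close> or \<open>1 / x\<^sup>2\<close> changes under
  the rotation could be \<open>1\<close> only if \<open>m\<close> divided \<open>1\<close> or
  \<open>2\<close>. This is how \<open>m \<ge> 3\<close> enters the proof.\<close>

lemma cis_pow_ne_1:
  assumes "(m::nat) \<ge> 3" "0 < j" "j < (3::nat)"
  shows "inverse (cis (2 * pi / real m)) ^ j \<noteq> 1"
proof
  assume "inverse (cis (2 * pi / real m)) ^ j = 1"
  then have "cis (2 * pi / real m) ^ j = 1" by (simp only: power_inverse inverse_eq_1_iff)
  then have "cis (real j * (2 * pi / real m)) = 1" unfolding Complex.DeMoivre .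
  then have "cos (real j * (2 * pi / real m)) = 1" by (metis cis.simps(1) one_complex.simps(1))
  then obtain n :: int where n: "real j * (2 * pi / real m) = of_int n * 2 * pi"
    using cos_one_2pi_int by blast
  then have "real j = of_int n * real m" using assms by (simp add: field_simps)
  then have *: "int j = n * int m" by (metis of_int_eq_iff of_int_mult of_int_of_nat_eq)
  then have "int m dvd int j" by simp
  then show False using assms by (auto dest!: dvd_imp_le)
qed

lemma integrable_continuous_cball:
  fixes f :: "real^2 \<Rightarrow> 'b::{banach, second_countable_topology}"
  assumes "continuous_on UNIV f" "\<And>x. norm x > R \<Longrightarrow> f x = 0"
  shows "integrable lebesgue f"
proof -
  have "integrable lborel (\<lambda>x. indicator (cball 0 R) x *\<^sub>R f x)"
    by (rule borel_integrable_compact) (use assms in \<open>auto intro: continuous_on_subset\<close>)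
  also have "(\<lambda>x. indicator (cball 0 R) x *\<^sub>R f x) = f"
    using assms(2) by (auto simp: indicator_def fun_eq_iff not_le)
  finally show ?thesis
    using assms(1) by (subst integrable_completion) (auto intro: borel_measurable_continuous_onI)
qed

section \<open>Radial cutoffs\<close>

definition cut :: "real \<Rightarrow> real^2 \<Rightarrow> real" where
  "cut R x = bump (1 - (norm x)\<^sup>2 / R\<^sup>2)"

text \<open>The gradient of \<open>cut R\<close>, with its two components as real and imaginary
  part; equivalently, twice the derivative in \<open>cnj x\<close>.\<close>

definition Dcut :: "real \<Rightarrow> real^2 \<Rightarrow> complex" where
  "Dcut R x = - of_real (2 * bump' (1 - (norm x)\<^sup>2 / R\<^sup>2) / R\<^sup>2) * cx x"

lemma continuous_cut [continuous_intros]: "continuous_on S (cut R)"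
  unfolding cut_def divide_inverse by (intro continuous_intros)

lemma continuous_Dcut [continuous_intros]: "continuous_on S (Dcut R)"
  unfolding Dcut_def divide_inverse by (intro continuous_intros)

lemma cut_outside: "R > 0 \<Longrightarrow> norm x > R \<Longrightarrow> cut R x = 0" 
  and Dcut_outside: "R > 0 \<Longrightarrow> norm x > R \<Longrightarrow> Dcut R x = 0"
proof -
  assume R: "R > 0" "norm x > R"
  then have "R\<^sup>2 < (norm x)\<^sup>2" by (intro power_strict_mono) auto
  then have "1 - (norm x)\<^sup>2 / R\<^sup>2 \<le> 0" using R by (simp add: field_simps)
  then show "cut R x = 0" "Dcut R x = 0"
    by (auto simp: cut_def Dcut_def bump_zero bump'_zero)
qed

text \<open>The factor \<open>norm x\<close> absorbs the linear growth of the velocity. The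
  right-hand side is bounded uniformly in \<open>R\<close> and tends to \<open>0\<close> pointwise
  as \<open>R\<close> grows, which is what dominated convergence needs.\<close>

lemma Dcut_bound:
  assumes "R > 0" shows "norm (Dcut R x) * norm x \<le> 4 * min 1 ((norm x)\<^sup>2 / R\<^sup>2)"
proof (cases "norm x > R")
  case False
  have "norm (Dcut R x) * norm x = 2 * bump' (1 - (norm x)\<^sup>2 / R\<^sup>2) * ((norm x)\<^sup>2 / R\<^sup>2)"
  proof -
    have "norm (Dcut R x) = \<bar>2 * bump' (1 - (norm x)\<^sup>2 / R\<^sup>2) / R\<^sup>2\<bar> * norm x"
      unfolding Dcut_def norm_mult norm_minus_cancel norm_of_real by simp
    then show ?thesis by (simp add: bump'_nonneg power2_eq_square)
  qed
  also have "\<dots> \<le> 2 * 2 * ((norm x)\<^sup>2 / R\<^sup>2)"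
    using bump'_le bump'_nonneg by (intro mult_mono) auto
  also have "(norm x)\<^sup>2 / R\<^sup>2 = min 1 ((norm x)\<^sup>2 / R\<^sup>2)"
    using False assms by (auto simp: min_def field_simps intro: power_mono)
  finally show ?thesis by simp
qed (use assms Dcut_outside in auto)

section \<open>The velocity as a singular integral\<close>

locale symmetric_velocity =
  fixes m :: nat and w :: "real^2 \<Rightarrow> real" and u :: "real^2 \<Rightarrow> real^2" and M :: real
  assumes vel: "velocity_of m w u" and m3: "m \<ge> 3"
    and w_meas [measurable]: "w \<in> borel_measurable lebesgue"
    and w_bd: "AE x in lebesgue. \<bar>w x\<bar> \<le> M" and M0: "0 \<le> M"
    and w_sym: "sym_scalar m w"
begin

text \<open>With the conjugate, divergence and curl combine into one equation for \<open>U = u\<^sub>1 - \<i> u\<^sub>2\<close>, of the form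
  \<open>\<partial>U / \<partial>(cnj x) = - \<i> w / 2\<close>.\<close>

definition U :: "real^2 \<Rightarrow> complex" where "U x = cnj (cx (u x))"

lemma U_cont [continuous_intros]: "continuous_on S U"
proof -
  have "continuous_on UNIV u" using vel by (simp add: velocity_of_def)
  then have "continuous_on UNIV U" unfolding U_def by (intro continuous_intros)
  then show ?thesis using continuous_on_subset by blast
qed

lemma U_growth: obtains C where "C \<ge> 0" "\<And>x. norm (U x) \<le> C * norm x"
proof -
  obtain C where C: "\<And>x. norm (u x) \<le> C * norm x" using vel by (auto simp: velocity_of_def)
  show ?thesis
  proof (rule that[of "\<bar>C\<bar>"])
    show "norm (U x) \<le> \<bar>C\<bar> * norm x" for x
      using C[of x] by (simp add: U_def) (meson abs_ge_self mult_right_mono norm_ge_zero order_trans)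
  qed simp
qed

abbreviation "\<theta> \<equiv> 2 * pi / real m"

lemma U_rot: "U (rot \<theta> x) = inverse (cis \<theta>) * U x"
  using vel by (simp add: U_def velocity_of_def sym_field_def cx_rot cis_cnj)

lemma w_rot: "w (rot \<theta> x) = w x"
  using w_sym by (simp add: sym_scalar_def)

lemma integrable_w_mult:
  fixes h :: "real^2 \<Rightarrow> complex"
  assumes "integrable lebesgue h"
  shows "integrable lebesgue (\<lambda>x. of_real (w x) * h x)"
proof (rule Bochner_Integration.integrable_bound)
  show "integrable lebesgue (\<lambda>x. M * norm (h x))" using assms by simp
  show "(\<lambda>x. of_real (w x) * h x) \<in> borel_measurable lebesgue"
    using borel_measurable_integrable[OF assms] by measurable
  show "AE x in lebesgue. norm (of_real (w x) * h x) \<le> norm (M * norm (h x))"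
    using w_bd by eventually_elim (use M0 in \<open>auto simp: norm_mult intro!: mult_right_mono\<close>)
qed

text \<open>The real part of \<open>U * (p1 + \<i> p2)\<close> is the integrand of the divergence
  equation and its imaginary part that of the curl equation; the first integrates to
  \<open>0\<close>, the second to the integral of \<open>w * p\<close>.\<close>

lemma weak_real:
  assumes p: "test_fun p"
    and hd: "\<And>x. (p has_derivative (\<lambda>h. p1 x * h$1 + p2 x * h$2)) (at x)"
    and c [continuous_intros]: "continuous_on UNIV p1" "continuous_on UNIV p2"
    and van: "\<And>x. norm x > R \<Longrightarrow> p1 x = 0" "\<And>x. norm x > R \<Longrightarrow> p2 x = 0"
  shows "integrable lebesgue (\<lambda>x. U x * Complex (p1 x) (p2 x))"
    and "(LINT x|lebesgue. U x * Complex (p1 x) (p2 x)) = \<i> * of_real (LINT x|lebesgue. w x * p x)"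
proof -
  have [continuous_intros]: "continuous_on UNIV u" using vel by (simp add: velocity_of_def)
  define A B where "A = (\<lambda>x. u x $ 1 * p1 x + u x $ 2 * p2 x)" and "B = (\<lambda>x. u x $ 1 * p2 x - u x $ 2 * p1 x)"
  have iA: "integrable lebesgue A" and iB: "integrable lebesgue B"
    unfolding A_def B_def by (rule integrable_continuous_cball[where R = R]; auto intro!: continuous_intros simp: van)+
  have part: "partial 1 p x = p1 x" "partial 2 p x = p2 x" for x
    using partial_eqI[OF hd] by auto
  have "(LINT x|lebesgue. - (u x $ 1 * partial 1 p x + u x $ 2 * partial 2 p x)) = 0"
    using vel p by (simp add: velocity_of_def weak_div_zero_def)
  then have A0: "integral\<^sup>L lebesgue A = 0" by (simp only: part A_def[symmetric] integral_minus) (simp add: A_def)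
  have "(LINT x|lebesgue. - (u x $ 2 * partial 1 p x - u x $ 1 * partial 2 p x)) = (LINT x|lebesgue. w x * p x)"
    using vel p unfolding velocity_of_def weak_curl_def by blast
  then have B0: "integral\<^sup>L lebesgue B = (LINT x|lebesgue. w x * p x)" by (simp add: part B_def)
  have eq: "U x * Complex (p1 x) (p2 x) = of_real (A x) + \<i> * of_real (B x)" for x
    by (simp add: U_def cx_def A_def B_def complex_eq_iff)
  show "integrable lebesgue (\<lambda>x. U x * Complex (p1 x) (p2 x))"
    unfolding eq using iA iB by (intro Bochner_Integration.integrable_add integrable_mult_right) auto
  show "(LINT x|lebesgue. U x * Complex (p1 x) (p2 x)) = \<i> * of_real (LINT x|lebesgue. w x * p x)"
    unfolding eq using iA iB
    by (subst Bochner_Integration.integral_add) (auto simp: A0 B0)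
qed

text \<open>The test function is \<open>cut R * f\<close>, so that \<open>f\<close> may be any
  smooth function; by the product rule the cutoff leaves the error term with \<open>Dcut R\<close>,
  which has to vanish as \<open>R\<close> grows.\<close>

lemma weak_cutoff:
  assumes f: "\<And>k. Ck k f" and R: "R > 0"
    and hd: "\<And>x. (f has_derivative (\<lambda>h. f1 x * h$1 + f2 x * h$2)) (at x)"
    and c [continuous_intros]: "continuous_on UNIV f1" "continuous_on UNIV f2"
  shows "integrable lebesgue (\<lambda>x. U x * (cut R x * Complex (f1 x) (f2 x) + f x * Dcut R x))"
    and "(LINT x|lebesgue. U x * (cut R x * Complex (f1 x) (f2 x) + f x * Dcut R x))
      = \<i> * of_real (LINT x|lebesgue. w x * (cut R x * f x))"
proof -
  define b where "b = (\<lambda>x::real^2. - bump' (1 - (norm x)\<^sup>2 / R\<^sup>2) * 2 / R\<^sup>2)"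
  define p where "p = (\<lambda>x. cut R x * f x)"
  define p1 where "p1 = (\<lambda>x. cut R x * f1 x + f x * (b x * x$1))"
  define p2 where "p2 = (\<lambda>x. cut R x * f2 x + f x * (b x * x$2))"
  have [continuous_intros]: "continuous_on UNIV f" using f Ck_continuous by blast
  have [continuous_intros]: "continuous_on UNIV b"
    unfolding b_def divide_inverse by (intro continuous_intros)
  have b0: "b x = 0" if "norm x > R" for x
  proof -
    have "R\<^sup>2 < (norm x)\<^sup>2" using that R by (intro power_strict_mono) auto
    then have "1 - (norm x)\<^sup>2 / R\<^sup>2 \<le> 0" using R that by (simp add: field_simps)
    then show ?thesis by (simp add: b_def bump'_zero)
  qed
  have hb: "(cut R has_derivative (\<lambda>h. (b x * x$1) * h$1 + (b x * x$2) * h$2)) (at x)" for x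
  proof -
    have "((\<lambda>x. bump (1 - (norm x)\<^sup>2 / R\<^sup>2)) has_derivative
      (\<lambda>h. - bump' (1 - (norm x)\<^sup>2 / R\<^sup>2) * (2 * (x $ 1) / R\<^sup>2) * h$1 +
         - bump' (1 - (norm x)\<^sup>2 / R\<^sup>2) * (2 * (x $ 2) / R\<^sup>2) * h$2)) (at x)"
      using radial_bump_deriv[of 0 R x] by simp
    then show ?thesis unfolding cut_def[abs_def]
      by (rule has_derivative_eq_rhs) (auto simp: b_def)
  qed
  have 1: "test_fun p"
    using test_fun_cutoff[OF f R, of 0] by (simp add: p_def cut_def)
  have 2: "(p has_derivative (\<lambda>h. p1 x * h$1 + p2 x * h$2)) (at x)" for x
    unfolding p_def
    by (rule has_derivative_eq_rhs[OF has_derivative_mult[OF hb hd]]) (auto simp: p1_def p2_def algebra_simps)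
  have 3: "continuous_on UNIV p1" "continuous_on UNIV p2"
    unfolding p1_def p2_def by (intro continuous_intros)+
  have 4: "p1 x = 0" "p2 x = 0" if "norm x > R" for x
    using that R by (auto simp: p1_def p2_def b0 cut_outside)
  have eq: "Complex (p1 x) (p2 x) = cut R x * Complex (f1 x) (f2 x) + f x * Dcut R x" for x
    by (simp add: p1_def p2_def Dcut_def b_def cx_def complex_eq_iff field_simps)
  show "integrable lebesgue (\<lambda>x. U x * (cut R x * Complex (f1 x) (f2 x) + f x * Dcut R x))"
    "(LINT x|lebesgue. U x * (cut R x * Complex (f1 x) (f2 x) + f x * Dcut R x))
      = \<i> * of_real (LINT x|lebesgue. w x * (cut R x * f x))"
    using weak_real[OF 1 2 3 4] by (simp_all add: eq p_def)
qed

text \<open>For \<open>e = 0\<close> this is the Cauchy kernel \<open>1 / (z - x)\<close>, and \<open>dkr\<close> is its derivative in \<open>cnj x\<close> up to sign,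
  an approximation of \<open>pi\<close> times the Dirac measure at \<open>z\<close>.\<close>

definition kr :: "real \<Rightarrow> real^2 \<Rightarrow> real^2 \<Rightarrow> complex" where
  "kr e z x = cnj (cx z - cx x) * of_real (inverse ((norm (x - z))\<^sup>2 + e\<^sup>2))"

definition dkr :: "real \<Rightarrow> real^2 \<Rightarrow> real^2 \<Rightarrow> real" where
  "dkr e z x = e\<^sup>2 * (inverse ((norm (x - z))\<^sup>2 + e\<^sup>2))\<^sup>2"

lemma norm2_deriv:
  "((\<lambda>x. (norm (x - z))\<^sup>2 + e) has_derivative (\<lambda>h. 2 * (x$1 - z$1) * h$1 + 2 * (x$2 - z$2) * h$2)) (at (x::real^2))"
  unfolding norm2_eq
  by (auto intro!: derivative_eq_intros bounded_linear_imp_has_derivative bounded_linear_vec_nth simp: fun_eq_iff algebra_simps)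

text \<open>The kernel is complex valued while test functions are real, so real and imaginary part
  are tested separately and recombined by linearity.\<close>

lemma weak_kernel:
  assumes R: "R > 0" and e: "e > 0"
  shows "integrable lebesgue (\<lambda>x. U x * (cut R x * complex_of_real (- 2 * dkr e z x) + kr e z x * Dcut R x))"
    and "(LINT x|lebesgue. U x * (cut R x * complex_of_real (- 2 * dkr e z x) + kr e z x * Dcut R x))
      = \<i> * (LINT x|lebesgue. of_real (w x) * (cut R x * kr e z x))"
proof -
  define q where "q = (\<lambda>x. (norm (x - z))\<^sup>2 + e\<^sup>2)"
  have q0: "q x > 0" for x using e by (simp add: q_def add_nonneg_pos)
  have qn: "q x \<noteq> 0" for x using q0[of x] by simp
  define iq where "iq = (\<lambda>x. inverse (q x))"
  define f g where "f = (\<lambda>x. (z$1 - x$1) * iq x)" and "g = (\<lambda>x. (x$2 - z$2) * iq x)"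
  define f1 f2 g1 g2 where "f1 = (\<lambda>x. - iq x + 2 * (z$1 - x$1)\<^sup>2 * (iq x)\<^sup>2)"
    and "f2 = (\<lambda>x. 2 * (z$1 - x$1) * (z$2 - x$2) * (iq x)\<^sup>2)"
    and "g1 = (\<lambda>x. - 2 * (z$1 - x$1) * (z$2 - x$2) * (iq x)\<^sup>2)"
    and "g2 = (\<lambda>x. iq x - 2 * (z$2 - x$2)\<^sup>2 * (iq x)\<^sup>2)"
  have Cq: "Ck k q" for k unfolding q_def by (intro Ck_add Ck_norm2 Ck_const)
  have Ciq: "Ck k iq" for k unfolding iq_def by (intro Ck_inverse Cq q0)
  have Cf: "Ck k f" and Cg: "Ck k g" for k
    unfolding f_def g_def by (intro Ck_mult Ck_diff Ck_component Ck_const Ciq)+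
  have [continuous_intros]: "continuous_on UNIV iq" using Ciq Ck_continuous by blast
  have fc: "continuous_on UNIV f1" "continuous_on UNIV f2" and gc: "continuous_on UNIV g1" "continuous_on UNIV g2"
    unfolding f1_def f2_def g1_def g2_def by (intro continuous_intros)+
  have hq: "(iq has_derivative (\<lambda>h. - (iq x * (2 * (x$1 - z$1) * h$1 + 2 * (x$2 - z$2) * h$2) * iq x))) (at x)" for x
    unfolding iq_def q_def using Deriv.has_derivative_inverse[OF qn[unfolded q_def] norm2_deriv] by simp
  have hc: "((\<lambda>x::real^2. x $ i - z $ i) has_derivative (\<lambda>h. h $ i)) (at x)" for i x
    by (auto intro!: derivative_eq_intros bounded_linear_imp_has_derivative bounded_linear_vec_nth)
  have hc': "((\<lambda>x::real^2. z $ i - x $ i) has_derivative (\<lambda>h. - h $ i)) (at x)" for i x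
    by (auto intro!: derivative_eq_intros bounded_linear_imp_has_derivative bounded_linear_vec_nth)
  have hf: "(f has_derivative (\<lambda>h. f1 x * h$1 + f2 x * h$2)) (at x)" for x
    unfolding f_def
    by (rule has_derivative_eq_rhs[OF has_derivative_mult[OF hc' hq]])
      (auto simp: f1_def f2_def power2_eq_square algebra_simps)
  have hg: "(g has_derivative (\<lambda>h. g1 x * h$1 + g2 x * h$2)) (at x)" for x
    unfolding g_def
    by (rule has_derivative_eq_rhs[OF has_derivative_mult[OF hc hq]])
      (auto simp: g1_def g2_def power2_eq_square algebra_simps)
  note F = weak_cutoff[OF Cf R hf fc] and G = weak_cutoff[OF Cg R hg gc]
  have kr: "kr e z x = of_real (f x) + \<i> * of_real (g x)" for x
    by (simp add: kr_def f_def g_def iq_def q_def cx_def complex_eq_iff)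
  \<comment> \<open>The operator \<open>\<partial>\<^sub>1 + \<i> \<partial>\<^sub>2\<close> applied
    to \<open>f + \<i> g\<close>. For \<open>e = 0\<close> the result would vanish away from
    \<open>z\<close>, the Cauchy kernel being holomorphic; the regularisation leaves the approximate
    Dirac measure.\<close>
  have D: "Complex (f1 x) (f2 x) + \<i> * Complex (g1 x) (g2 x) = complex_of_real (- 2 * dkr e z x)" for x
  proof -
    have "q x * iq x = 1" using qn[of x] by (simp add: iq_def)
    moreover have "q x = (x$1 - z$1)\<^sup>2 + (x$2 - z$2)\<^sup>2 + e\<^sup>2" by (simp add: q_def norm2_eq)
    ultimately have "f1 x - g2 x = - 2 * (e\<^sup>2 * (iq x)\<^sup>2)"
      unfolding f1_def g2_def by algebra
    moreover have "f2 x + g1 x = 0" unfolding f2_def g1_def by algebra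
    moreover have "dkr e z x = e\<^sup>2 * (iq x)\<^sup>2" by (simp add: dkr_def iq_def q_def)
    ultimately show ?thesis by (simp add: complex_eq_iff)
  qed
  have eq: "U x * (cut R x * complex_of_real (- 2 * dkr e z x) + kr e z x * Dcut R x)
    = U x * (cut R x * Complex (f1 x) (f2 x) + f x * Dcut R x) + \<i> * (U x * (cut R x * Complex (g1 x) (g2 x) + g x * Dcut R x))" for x
    unfolding D[symmetric] kr by (simp add: algebra_simps)
  show "integrable lebesgue (\<lambda>x. U x * (cut R x * complex_of_real (- 2 * dkr e z x) + kr e z x * Dcut R x))"
    unfolding eq using F(1) G(1) by (intro Bochner_Integration.integrable_add integrable_mult_right) auto
  have iw: "integrable lebesgue (\<lambda>x. of_real (w x) * complex_of_real (cut R x * f x))"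
    "integrable lebesgue (\<lambda>x. of_real (w x) * complex_of_real (cut R x * g x))"
    by (rule integrable_w_mult, rule integrable_continuous_cball[where R = R];
        use R in \<open>auto intro!: continuous_intros simp: cut_outside intro: Ck_continuous[OF Cf] Ck_continuous[OF Cg]\<close>)+
  have "(LINT x|lebesgue. U x * (cut R x * complex_of_real (- 2 * dkr e z x) + kr e z x * Dcut R x))
      = \<i> * of_real (LINT x|lebesgue. w x * (cut R x * f x)) + \<i> * (\<i> * of_real (LINT x|lebesgue. w x * (cut R x * g x)))"
    unfolding eq by (subst Bochner_Integration.integral_add) (use F G in auto)
  also have "\<dots> = \<i> * ((LINT x|lebesgue. of_real (w x) * complex_of_real (cut R x * f x)) + \<i> * (LINT x|lebesgue. of_real (w x) * complex_of_real (cut R x * g x)))"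
    by (simp only: of_real_mult[symmetric] integral_complex_of_real distrib_left)
  also have "\<dots> = \<i> * (LINT x|lebesgue. of_real (w x) * complex_of_real (cut R x * f x) + \<i> * (of_real (w x) * complex_of_real (cut R x * g x)))"
    by (subst Bochner_Integration.integral_add) (use iw in \<open>auto simp del: of_real_mult\<close>)
  also have "(\<lambda>x. of_real (w x) * complex_of_real (cut R x * f x) + \<i> * (of_real (w x) * complex_of_real (cut R x * g x)))
     = (\<lambda>x. of_real (w x) * (cut R x * kr e z x))"
    by (simp add: kr algebra_simps)
  finally show "(LINT x|lebesgue. U x * (cut R x * complex_of_real (- 2 * dkr e z x) + kr e z x * Dcut R x))
      = \<i> * (LINT x|lebesgue. of_real (w x) * (cut R x * kr e z x))" .
qed

lemma dkr_nonneg: "0 \<le> dkr e z x"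
  by (simp add: dkr_def)

lemma dkr_meas [measurable]: "dkr e z \<in> borel_measurable borel"
  unfolding dkr_def[abs_def] by measurable

text \<open>The mass does not depend on \<open>e\<close>: with \<open>s\<close> the squared
  distance, \<open>e\<^sup>2 / (s + e\<^sup>2)\<^sup>2\<close> has the antiderivative
  \<open>- e\<^sup>2 / (s + e\<^sup>2)\<close>, which runs from \<open>- 1\<close> to
  \<open>0\<close>.\<close>

lemma dkr_integral:
  assumes "e > 0"
  shows "integrable lborel (dkr e z)" "integral\<^sup>L lborel (dkr e z) = pi"
proof -
  have "(\<integral>\<^sup>+x. ennreal (dkr e z x) \<partial>lborel) = ennreal pi * (\<integral>\<^sup>+s. ennreal (e\<^sup>2 * (inverse (s + e\<^sup>2))\<^sup>2) * indicator {0..} s \<partial>lborel)"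
    unfolding dkr_def by (rule nn_integral_radial[where f = "\<lambda>s. ennreal (e\<^sup>2 * (inverse (s + e\<^sup>2))\<^sup>2)"]) measurable
  also have "(\<integral>\<^sup>+s. ennreal (e\<^sup>2 * (inverse (s + e\<^sup>2))\<^sup>2) * indicator {0..} s \<partial>lborel)
      = ennreal (0 - (- (e\<^sup>2 * inverse (0 + e\<^sup>2))))"
  proof (rule nn_integral_FTC_atLeast)
    show "((\<lambda>s. - (e\<^sup>2 * inverse (s + e\<^sup>2))) has_real_derivative e\<^sup>2 * (inverse (s + e\<^sup>2))\<^sup>2) (at s)" if "0 \<le> s" for s
    proof -
      have "s + e\<^sup>2 \<noteq> 0" using that assms by (metis add_nonneg_eq_0_iff less_numeral_extra(3) zero_le_power2 zero_less_power)
      then show ?thesis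
        by (auto intro!: derivative_eq_intros simp: power2_eq_square)
    qed
    have "((\<lambda>s. - (e\<^sup>2 * inverse (e\<^sup>2 + s))) \<longlongrightarrow> - (e\<^sup>2 * 0)) at_top"
      by (intro tendsto_intros tendsto_inverse_0_at_top filterlim_tendsto_add_at_top[OF tendsto_const filterlim_ident])
    then have "((\<lambda>s. - (e\<^sup>2 * inverse (s + e\<^sup>2))) \<longlongrightarrow> - (e\<^sup>2 * 0)) at_top"
      by (simp only: add.commute)
    then show "((\<lambda>s. - (e\<^sup>2 * inverse (s + e\<^sup>2))) \<longlongrightarrow> 0) at_top" by simp
  qed auto
  also have "ennreal pi * ennreal (0 - (- (e\<^sup>2 * inverse (0 + e\<^sup>2)))) = ennreal pi"
    using assms by simp
  finally have "(\<integral>\<^sup>+x. ennreal (dkr e z x) \<partial>lborel) = ennreal pi" .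
  then have "has_bochner_integral lborel (dkr e z) pi"
    by (intro has_bochner_integral_nn_integral) (auto simp: dkr_nonneg)
  then show "integrable lborel (dkr e z)" "integral\<^sup>L lborel (dkr e z) = pi"
    by (auto simp: has_bochner_integral_iff)
qed

text \<open>The velocity may be unbounded, so the standard argument for approximate identities needs
  a tail estimate. Away from \<open>z\<close> the kernel is at most \<open>e\<^sup>2\<close> times
  the inverse fourth power of the distance, and the linear growth of \<open>U\<close> leaves an
  integrable cubic tail with the factor \<open>e\<^sup>2\<close>.\<close>

lemma dkr_limit:
  shows "e > 0 \<Longrightarrow> integrable lborel (\<lambda>x. U x * of_real (dkr e z x))"
    and "(\<lambda>n. integral\<^sup>L lborel (\<lambda>x. U x * of_real (dkr (1 / real (Suc n)) z x))) \<longlonglongrightarrow> of_real pi * U z"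
proof -
  have [measurable]: "U \<in> borel_measurable borel"
    by (intro borel_measurable_continuous_onI U_cont)
  obtain C where C: "C \<ge> 0" "\<And>x. norm (U x) \<le> C * norm x" using U_growth by blast
  define h where "h = (\<lambda>r x. (1 / norm (x - z) ^ 3) * indicator {x. r \<le> norm (x - z)} x :: real)"
  have [measurable]: "h r \<in> borel_measurable borel" for r
    unfolding h_def by measurable
  have h: "integrable lborel (h r)" "integral\<^sup>L lborel (h r) = 2 * pi / r" if "r > 0" for r
  proof -
    have "has_bochner_integral lborel (h r) (2 * pi / r)"
    proof (rule has_bochner_integral_nn_integral)
      show "integral\<^sup>N lborel (h r) = ennreal (2 * pi / r)"
        unfolding nn_integral_norm_powr3_outside[OF that, of z, symmetric] h_def
        by (intro nn_integral_cong) (auto simp: indicator_def)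
    qed (use that in \<open>auto simp: h_def\<close>)
    then show "integrable lborel (h r)" "integral\<^sup>L lborel (h r) = 2 * pi / r"
      by (auto simp: has_bochner_integral_iff)
  qed
  have key: "norm ((U x - U z) * of_real (dkr e z x)) \<le> k * dkr e z x + C * (1 + 2 * norm z / r) * e\<^sup>2 * h r x"
    if r: "r > 0" "\<And>x. norm (x - z) < r \<Longrightarrow> norm (U x - U z) < k" and e: "e > 0" and k: "k > 0" for r k e x
  proof (cases "norm (x - z) < r")
    case True
    have "norm ((U x - U z) * of_real (dkr e z x)) \<le> k * dkr e z x"
      using r(2)[OF True] dkr_nonneg[of e z x] by (simp add: norm_mult mult_right_mono)
    moreover have "0 \<le> C * (1 + 2 * norm z / r) * e\<^sup>2 * h r x"
      using C r by (simp add: h_def)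
    ultimately show ?thesis by linarith
  next
    case False
    define d where "d = norm (x - z)"
    have d: "d \<ge> r" "d > 0" using False r by (auto simp: d_def)
    have "norm (U x - U z) \<le> C * norm x + C * norm z"
      using C norm_triangle_ineq4[of "U x" "U z"] by (meson add_mono order_trans)
    also have "\<dots> \<le> C * (d + 2 * norm z)"
      using C norm_triangle_ineq[of "x - z" z] by (simp add: d_def distrib_left[symmetric] mult_left_mono)
    also have "\<dots> \<le> C * (1 + 2 * norm z / r) * d"
    proof -
      have "2 * norm z \<le> 2 * norm z / r * d"
        using d r mult_left_mono[of 1 "d / r" "2 * norm z"] by simp
      then have "d + 2 * norm z \<le> (1 + 2 * norm z / r) * d" by (simp add: distrib_right)
      then show ?thesis using C by (simp add: mult.assoc mult_left_mono)
    qed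
    finally have 1: "norm (U x - U z) \<le> C * (1 + 2 * norm z / r) * d" .
    have "dkr e z x \<le> e\<^sup>2 * (inverse (d\<^sup>2))\<^sup>2"
      unfolding dkr_def d_def[symmetric] using d e
      by (intro mult_left_mono power_mono le_imp_inverse_le) auto
    also have "\<dots> = e\<^sup>2 * (1 / d ^ 4)" by (simp add: inverse_eq_divide power_divide flip: power_mult)
    finally have 2: "dkr e z x \<le> e\<^sup>2 * (1 / d ^ 4)" .
    have "norm ((U x - U z) * of_real (dkr e z x)) \<le> (C * (1 + 2 * norm z / r) * d) * (e\<^sup>2 * (1 / d ^ 4))"
      using 1 2 dkr_nonneg[of e z x] C r d by (simp only: norm_mult norm_of_real abs_of_nonneg) (intro mult_mono, auto)
    also have "\<dots> = C * (1 + 2 * norm z / r) * e\<^sup>2 * h r x"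
      using d by (simp add: h_def d_def[symmetric] power3_eq_cube power4_eq_xxxx)
    finally show ?thesis using k dkr_nonneg[of e z x] by (simp add: add_increasing)
  qed
  have ex_r: "\<exists>r>0. \<forall>x. norm (x - z) < r \<longrightarrow> norm (U x - U z) < k" if "k > 0" for k
    using U_cont[of UNIV] that by (auto simp: continuous_on_iff dist_norm)
  have int: "integrable lborel (\<lambda>x. (U x - U z) * of_real (dkr e z x))" if e: "e > 0" for e
  proof -
    obtain r where r: "r > 0" "\<And>x. norm (x - z) < r \<Longrightarrow> norm (U x - U z) < 1" using ex_r[of 1] by auto
    show ?thesis
    proof (rule Bochner_Integration.integrable_bound)
      show "integrable lborel (\<lambda>x. 1 * dkr e z x + C * (1 + 2 * norm z / r) * e\<^sup>2 * h r x)"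
        by (intro Bochner_Integration.integrable_add integrable_mult_right dkr_integral h e r)
      show "AE x in lborel. norm ((U x - U z) * of_real (dkr e z x)) \<le> norm (1 * dkr e z x + C * (1 + 2 * norm z / r) * e\<^sup>2 * h r x)"
      proof (rule AE_I2)
        fix x show "norm ((U x - U z) * of_real (dkr e z x)) \<le> norm (1 * dkr e z x + C * (1 + 2 * norm z / r) * e\<^sup>2 * h r x)"
          using key[OF r(1) _ e, of 1 x] r(2) unfolding real_norm_def by fastforce
      qed
    qed measurable
  qed
  have split: "U x * of_real (dkr e z x) = (U x - U z) * of_real (dkr e z x) + U z * of_real (dkr e z x)" for e x
    by (simp add: algebra_simps)
  have intz: "integrable lborel (\<lambda>x. U z * of_real (dkr e z x))" if "e > 0" for e
    using dkr_integral[OF that] by (intro integrable_mult_right integrable_of_real) auto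
  show "integrable lborel (\<lambda>x. U x * of_real (dkr e z x))" if "e > 0"
    unfolding split using int[OF that] intz[OF that] by (rule Bochner_Integration.integrable_add)
  have val: "integral\<^sup>L lborel (\<lambda>x. U x * of_real (dkr e z x)) - of_real pi * U z
     = integral\<^sup>L lborel (\<lambda>x. (U x - U z) * of_real (dkr e z x))" if "e > 0" for e
    unfolding split[of _ e] using int[OF that] intz[OF that]
    by (subst Bochner_Integration.integral_add) (auto simp: dkr_integral[OF that])
  have "(\<lambda>n. integral\<^sup>L lborel (\<lambda>x. U x * of_real (dkr (1 / real (Suc n)) z x)) - of_real pi * U z) \<longlonglongrightarrow> 0"
  proof (rule LIMSEQ_I)
    fix k :: real assume k: "k > 0"
    \<comment> \<open>The mass \<open>pi\<close> is less than \<open>4\<close>, so a deviation of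
      \<open>k / 8\<close> near \<open>z\<close> costs at most \<open>k / 2\<close>; the other half
      is left for the tail.\<close>
    obtain r where r: "r > 0" "\<And>x. norm (x - z) < r \<Longrightarrow> norm (U x - U z) < k / 8" using ex_r[of "k / 8"] k by auto
    define D where "D = C * (1 + 2 * norm z / r) * (2 * pi / r)"
    have "(\<lambda>n. D * (1 / real (Suc n))\<^sup>2) \<longlonglongrightarrow> D * 0\<^sup>2"
      by (intro tendsto_intros LIMSEQ_Suc[OF lim_1_over_n])
    then have "\<forall>\<^sub>F n in sequentially. D * (1 / real (Suc n))\<^sup>2 < k / 2"
      using k by (intro order_tendstoD(2)) auto
    then obtain N where N: "\<And>n. n \<ge> N \<Longrightarrow> D * (1 / real (Suc n))\<^sup>2 < k / 2"
      by (auto simp: eventually_sequentially)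
    have "norm (integral\<^sup>L lborel (\<lambda>x. U x * of_real (dkr (1 / real (Suc n)) z x)) - of_real pi * U z - 0) < k" if "n \<ge> N" for n
    proof -
      define e where "e = 1 / real (Suc n)"
      have e: "e > 0" by (simp add: e_def)
      have k8: "k / 8 > 0" using k by simp
      have "norm (integral\<^sup>L lborel (\<lambda>x. U x * of_real (dkr e z x)) - of_real pi * U z)
         = norm (integral\<^sup>L lborel (\<lambda>x. (U x - U z) * of_real (dkr e z x)))" using val[OF e] by simp
      also have "\<dots> \<le> integral\<^sup>L lborel (\<lambda>x. k / 8 * dkr e z x + C * (1 + 2 * norm z / r) * e\<^sup>2 * h r x)"
      proof (rule Bochner_Integration.integral_norm_bound_integral)
        show "integrable lborel (\<lambda>x. k / 8 * dkr e z x + C * (1 + 2 * norm z / r) * e\<^sup>2 * h r x)"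
          by (intro Bochner_Integration.integrable_add integrable_mult_right dkr_integral h e r(1))
        show "norm ((U x - U z) * of_real (dkr e z x)) \<le> k / 8 * dkr e z x + C * (1 + 2 * norm z / r) * e\<^sup>2 * h r x" for x
          by (rule key[OF r(1) _ e k8]) (rule r(2))
      qed (rule int[OF e])
      also have "\<dots> = k / 8 * pi + C * (1 + 2 * norm z / r) * e\<^sup>2 * (2 * pi / r)"
        using dkr_integral[OF e] h[OF r(1)]
        by (subst Bochner_Integration.integral_add) auto
      also have "\<dots> = k / 8 * pi + D * e\<^sup>2" by (simp add: D_def)
      also have "\<dots> < k"
      proof -
        have "k / 8 * pi \<le> k / 8 * 4" using k pi_less_4 by (intro mult_left_mono) auto
        moreover have "D * e\<^sup>2 < k / 2" using N[OF that] unfolding e_def .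
        ultimately show ?thesis by linarith
      qed
      finally show ?thesis by (simp add: e_def)
    qed
    then show "\<exists>no. \<forall>n\<ge>no. norm (integral\<^sup>L lborel (\<lambda>x. U x * of_real (dkr (1 / real (Suc n)) z x)) - of_real pi * U z - 0) < k" by blast
  qed
  then show "(\<lambda>n. integral\<^sup>L lborel (\<lambda>x. U x * of_real (dkr (1 / real (Suc n)) z x))) \<longlonglongrightarrow> of_real pi * U z"
    by (simp add: LIM_zero_iff)
qed

end

text \<open>The Cauchy kernel on \<open>S\<close> and, elsewhere, the same kernel without the first
  two terms of its expansion at infinity. \<open>S\<close> is left general because in Lagrangian
  variables it is the image of a disc.\<close>

definition kerS :: "(real^2) set \<Rightarrow> real^2 \<Rightarrow> real^2 \<Rightarrow> complex" where
  "kerS S z x = (if x \<in> S then 1 / (cx z - cx x) else far_ker (cx z) (cx x))"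

text \<open>\<open>S\<close> is invariant under the rotation, which makes the corrections integrate
  to zero; it is bounded, which makes the Cauchy kernel integrable on it; and it contains a disc
  that keeps its complement away from the origin and from \<open>z\<close>.\<close>

locale kernel_region = symmetric_velocity +
  fixes S :: "(real^2) set" and z :: "real^2" and A B :: real
  assumes S [measurable]: "S \<in> sets borel"
    and S_rot: "\<And>x. rot (2 * pi / real m) x \<in> S \<longleftrightarrow> x \<in> S"
    and S_in: "\<And>x. x \<in> S \<Longrightarrow> norm x \<le> B"
    and S_out: "\<And>x. x \<notin> S \<Longrightarrow> A \<le> norm x"
    and A: "0 < A" "2 * norm z \<le> A"
begin

text \<open>An integrable majorant of the corrected kernels that is uniform for \<open>e\<close>
  between \<open>0\<close> and \<open>1\<close>; the \<open>8\<close> accounts for the effect of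
  \<open>e\<close> outside \<open>S\<close>.\<close>

definition G :: "real^2 \<Rightarrow> real" where
  "G x = (if x \<in> S then norm (x - z) powr - 1 else (2 * (norm z)\<^sup>2 + 8) / norm x ^ 3)"

text \<open>At infinity \<open>1 / (z - x) = - 1 / x - z / x\<^sup>2 - ...\<close>, and adding
  \<open>ex1\<close> and \<open>ex2\<close> cancels these two terms.\<close>

definition ex1 :: "real^2 \<Rightarrow> complex" where "ex1 x = (if x \<in> S then 0 else 1 / cx x)"
definition ex2 :: "real^2 \<Rightarrow> complex" where "ex2 x = (if x \<in> S then 0 else cx z / (cx x)\<^sup>2)"

lemma G_meas [measurable]: "G \<in> borel_measurable borel" unfolding G_def[abs_def] by measurable
lemma ex_meas [measurable]: "ex1 \<in> borel_measurable borel" "ex2 \<in> borel_measurable borel"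
  unfolding ex1_def[abs_def] ex2_def[abs_def] by measurable

lemma kr_meas [measurable]: "kr e z \<in> borel_measurable borel"
proof -
  have [measurable]: "cnj \<in> borel_measurable borel"
    by (intro borel_measurable_continuous_onI continuous_intros)
  show ?thesis unfolding kr_def[abs_def] by measurable
qed

lemma G_nonneg: "0 \<le> G x" by (simp add: G_def)

lemma G_int: "integrable lebesgue G"
proof -
  have "(\<integral>\<^sup>+x. ennreal (norm (G x)) \<partial>lborel) \<le> (\<integral>\<^sup>+x. ennreal (norm (x - z) powr (-1)) * indicator (cball z (\<bar>B\<bar> + norm z)) x
      + ennreal (2 * (norm z)\<^sup>2 + 8) * (ennreal (1 / norm (x - 0) ^ 3) * indicator {x. A \<le> norm (x - 0)} x) \<partial>lborel)"
  proof (intro nn_integral_mono)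
    fix x
    show "ennreal (norm (G x)) \<le> ennreal (norm (x - z) powr (-1)) * indicator (cball z (\<bar>B\<bar> + norm z)) x
      + ennreal (2 * (norm z)\<^sup>2 + 8) * (ennreal (1 / norm (x - 0) ^ 3) * indicator {x. A \<le> norm (x - 0)} x)"
    proof (cases "x \<in> S")
      case True
      then have "x \<in> cball z (\<bar>B\<bar> + norm z)" using S_in[OF True] norm_triangle_ineq4[of z x] by (simp add: dist_norm)
      then show ?thesis using True by (simp add: G_def)
    next
      case False
      have "ennreal (2 * (norm z)\<^sup>2 + 8) * ennreal (1 / norm (x - 0) ^ 3) = ennreal (norm (G x))"
        using False by (subst ennreal_mult[symmetric]) (auto simp: G_def)
      then show ?thesis using S_out[OF False] by (simp add: add_increasing del: ennreal_plus)
    qed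
  qed
  also have "\<dots> = (\<integral>\<^sup>+x. ennreal (norm (x - z) powr (-1)) * indicator (cball z (\<bar>B\<bar> + norm z)) x \<partial>lborel)
      + ennreal (2 * (norm z)\<^sup>2 + 8) * (\<integral>\<^sup>+x. (ennreal (1 / norm (x - 0) ^ 3) * indicator {x. A \<le> norm (x - 0)} x) \<partial>(lborel :: (real^2) measure))"
  proof -
    have m1: "(\<lambda>x. ennreal (norm (x - z) powr (-1)) * indicator (cball z (\<bar>B\<bar> + norm z)) x) \<in> borel_measurable lborel"
      by (intro borel_measurable_times_ennreal borel_measurable_indicator) auto
    have m2: "(\<lambda>x::real^2. ennreal (1 / norm (x - 0) ^ 3) * indicator {x. A \<le> norm (x - 0)} x) \<in> borel_measurable lborel"
      by measurable
    show ?thesis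
      unfolding nn_integral_cmult[OF m2, of "ennreal (2 * (norm z)\<^sup>2 + 8)", symmetric]
      by (rule nn_integral_add[OF m1 borel_measurable_times_ennreal[OF borel_measurable_const m2]])
  qed
  also have "\<dots> < \<infinity>"
    using A by (subst nn_integral_norm_powr_cball, simp, simp, subst nn_integral_norm_powr3_outside)
      (auto simp: ennreal_mult_less_top)
  finally have "integrable lborel G" by (intro integrableI_bounded) auto
  then show ?thesis by (subst integrable_completion) auto
qed

lemma kr_near: "norm (kr e z x) \<le> norm (x - z) powr - 1"
proof (cases "x = z")
  case False
  then have p: "norm (x - z) > 0" by simp
  have "norm (kr e z x) = norm (x - z) * inverse ((norm (x - z))\<^sup>2 + e\<^sup>2)"
    unfolding kr_def norm_mult norm_of_real cx_diff[symmetric]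
    by (simp add: norm_minus_commute)
  also have "\<dots> \<le> norm (x - z) * inverse ((norm (x - z))\<^sup>2)"
    using p by (intro mult_left_mono le_imp_inverse_le) auto
  also have "\<dots> = norm (x - z) powr - 1"
    using p by (simp add: powr_minus power2_eq_square)
  finally show ?thesis .
qed (simp add: kr_def)

text \<open>This includes \<open>x = z\<close>, where both sides are \<open>0\<close>.\<close>

lemma kr_0: "kr 0 z x = 1 / (cx z - cx x)"
proof (cases "x = z")
  case False
  define v where "v = cx z - cx x"
  have v: "v \<noteq> 0" using False by (simp add: v_def)
  have "norm (x - z) = norm v" by (simp add: v_def cx_diff[symmetric] norm_minus_commute)
  then have "kr 0 z x = cnj v / (of_real (norm v))\<^sup>2"
    by (simp add: kr_def v_def[symmetric] divide_inverse)
  also have "(complex_of_real (norm v))\<^sup>2 = v * cnj v" using complex_norm_square[of v] by simp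
  also have "cnj v / (v * cnj v) = 1 / v" using v by simp
  finally show ?thesis by (simp add: v_def)
qed (simp add: kr_def)

lemma ker_eq: "kr 0 z x + (ex1 x + ex2 x) = kerS S z x"
proof (cases "x \<in> S")
  case True then show ?thesis by (simp add: ex1_def ex2_def kerS_def kr_0)
next
  case False
  have "cx x \<noteq> 0" using S_out[OF False] A by auto
  moreover have "norm x \<noteq> norm z" using S_out[OF False] A by auto
  then have "cx z - cx x \<noteq> 0" by auto
  ultimately show ?thesis using False
    by (simp add: ex1_def ex2_def kerS_def kr_0 far_ker_def) (simp add: field_simps power2_eq_square)
qed

text \<open>Outside \<open>S\<close> the kernel is compared with its value at \<open>e = 0\<close>,
  which after the correction is \<open>far_ker\<close>. With \<open>v = z - x\<close> the two differ
  by \<open>e\<^sup>2 / (\<bar>v\<bar>\<^sup>2 + e\<^sup>2)\<close> times \<open>1 / v\<close>, and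
  \<open>\<bar>v\<bar> \<ge> \<bar>x\<bar> / 2\<close>.\<close>

lemma kr_ex_bound:
  assumes e: "0 \<le> e" "e \<le> 1"
  shows "norm (kr e z x + (ex1 x + ex2 x)) \<le> G x"
proof (cases "x \<in> S")
  case True then show ?thesis using kr_near[of e x] by (simp add: ex1_def ex2_def G_def)
next
  case False
  have x: "A \<le> norm x" by (rule S_out[OF False])
  define v where "v = cx z - cx x"
  have nv: "norm x / 2 \<le> norm v"
    using norm_triangle_ineq2[of x z] x A by (simp add: v_def cx_diff[symmetric] norm_minus_commute)
  have x0: "norm x > 0" using x A by linarith
  have v: "v \<noteq> 0" using nv x0 by auto
  have xz: "norm (x - z) = norm v" by (simp add: v_def cx_diff[symmetric] norm_minus_commute)
  define q where "q = (norm v)\<^sup>2 + e\<^sup>2"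
  have q: "q > 0" using v by (simp add: q_def add_pos_nonneg)
  have "kr e z x - kr 0 z x = - of_real (e\<^sup>2 / q) * (1 / v)"
  proof -
    have "kr e z x = cnj v / of_real q" by (simp add: kr_def v_def[symmetric] xz q_def divide_inverse)
    moreover have "kr 0 z x = 1 / v" by (simp add: kr_0 v_def)
    moreover have "cnj v * v = of_real (q - e\<^sup>2)"
      unfolding q_def by (simp add: complex_norm_square mult.commute flip: of_real_power)
    ultimately show ?thesis using v q by (simp add: field_simps)
  qed
  then have "norm (kr e z x - kr 0 z x) = e\<^sup>2 / q * (1 / norm v)"
    using q by (simp only: norm_mult norm_minus_cancel norm_of_real norm_divide norm_one) simp
  also have "\<dots> \<le> 1 / (norm v)\<^sup>2 * (1 / norm v)"
  proof (intro mult_right_mono frac_le)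
    show "e\<^sup>2 \<le> 1" using e by (simp add: power_le_one)
    show "(norm v)\<^sup>2 \<le> q" by (simp add: q_def)
  qed (use v in auto)
  also have "\<dots> = 1 / norm v ^ 3" by (simp add: power3_eq_cube power2_eq_square)
  also have "\<dots> \<le> 1 / (norm x / 2) ^ 3"
    using nv x0 by (intro divide_left_mono power_mono mult_pos_pos) auto
  also have "\<dots> = 8 / norm x ^ 3" by (simp add: power_divide)
  finally have 1: "norm (kr e z x - kr 0 z x) \<le> 8 / norm x ^ 3" .
  have 2: "norm (kerS S z x) \<le> 2 * (norm z)\<^sup>2 / norm x ^ 3"
    using False far_ker_bound[of "cx z" "norm z" "norm x" "cx x"] x A x0 by (simp add: kerS_def)
  have "kr e z x + (ex1 x + ex2 x) = kerS S z x + (kr e z x - kr 0 z x)"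
    unfolding ker_eq[symmetric] by simp
  then have "norm (kr e z x + (ex1 x + ex2 x)) = norm (kerS S z x + (kr e z x - kr 0 z x))" by (rule arg_cong)
  then have "norm (kr e z x + (ex1 x + ex2 x)) \<le> 2 * (norm z)\<^sup>2 / norm x ^ 3 + 8 / norm x ^ 3"
    using 1 2 norm_triangle_ineq[of "kerS S z x" "kr e z x - kr 0 z x"] by linarith
  then show ?thesis using False by (simp add: G_def add_divide_distrib)
qed

lemma kerS_bound: "norm (kerS S z x) \<le> G x"
  using kr_ex_bound[of 0 x] by (simp add: ker_eq)

lemma kerS_meas [measurable]: "kerS S z \<in> borel_measurable borel"
proof -
  have "kerS S z = (\<lambda>x. kr 0 z x + (ex1 x + ex2 x))" by (simp add: ker_eq)
  then show ?thesis by simp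
qed


lemma ex_norm: "norm (ex1 x) \<le> 1 / A" "norm (ex2 x) \<le> norm z / A\<^sup>2"
proof -
  show "norm (ex1 x) \<le> 1 / A"
    using S_out[of x] A by (auto simp: ex1_def norm_divide intro!: divide_left_mono mult_pos_pos)
  show "norm (ex2 x) \<le> norm z / A\<^sup>2"
    using S_out[of x] A
    by (auto simp: ex2_def norm_divide norm_power intro!: divide_left_mono mult_pos_pos power_mono zero_less_power)
qed

lemma ex_rot: "ex1 (rot \<theta> x) = inverse (cis \<theta>) * ex1 x" "ex2 (rot \<theta> x) = inverse (cis \<theta>) ^ 2 * ex2 x"
proof -
  have "1 / (c * X) = inverse c * (1 / X)" "Z / (c * X)\<^sup>2 = inverse c ^ 2 * (Z / X\<^sup>2)" for c X Z :: complex
    by (simp_all add: divide_inverse power_mult_distrib power_inverse)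
  then show "ex1 (rot \<theta> x) = inverse (cis \<theta>) * ex1 x" "ex2 (rot \<theta> x) = inverse (cis \<theta>) ^ 2 * ex2 x"
    unfolding ex1_def ex2_def S_rot cx_rot by (cases "x \<in> S"; simp only: if_True if_False mult_zero_right)+
qed

lemma integrable_mult_ex:
  fixes h :: "real^2 \<Rightarrow> complex"
  assumes "integrable lebesgue h"
  shows "integrable lebesgue (\<lambda>x. h x * ex1 x)" "integrable lebesgue (\<lambda>x. h x * ex2 x)"
proof -
  have [measurable]: "h \<in> borel_measurable lebesgue" using assms by auto
  have [measurable]: "ex1 \<in> borel_measurable lebesgue" "ex2 \<in> borel_measurable lebesgue"
    by (intro borel_imp_lebesgue ex_meas)+
  show "integrable lebesgue (\<lambda>x. h x * ex1 x)"
  proof (rule Bochner_Integration.integrable_bound)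
    show "integrable lebesgue (\<lambda>x. (1 / A) * norm (h x))" using assms by (intro integrable_mult_right) auto
    show "AE x in lebesgue. norm (h x * ex1 x) \<le> norm ((1 / A) * norm (h x))"
    proof (rule AE_I2)
      fix x
      have "norm (h x * ex1 x) \<le> norm (h x) * (1 / A)"
        unfolding norm_mult by (intro mult_left_mono ex_norm) auto
      then show "norm (h x * ex1 x) \<le> norm ((1 / A) * norm (h x))"
        using abs_ge_self[of "(1 / A) * norm (h x)"] unfolding real_norm_def by (simp only: mult.commute)
    qed
  qed measurable
  show "integrable lebesgue (\<lambda>x. h x * ex2 x)"
  proof (rule Bochner_Integration.integrable_bound)
    show "integrable lebesgue (\<lambda>x. (norm z / A\<^sup>2) * norm (h x))" using assms by (intro integrable_mult_right) auto
    show "AE x in lebesgue. norm (h x * ex2 x) \<le> norm ((norm z / A\<^sup>2) * norm (h x))"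
    proof (rule AE_I2)
      fix x
      have "norm (h x * ex2 x) \<le> norm (h x) * (norm z / A\<^sup>2)"
        unfolding norm_mult by (intro mult_left_mono ex_norm) auto
      then show "norm (h x * ex2 x) \<le> norm ((norm z / A\<^sup>2) * norm (h x))"
        using abs_ge_self[of "(norm z / A\<^sup>2) * norm (h x)"] unfolding real_norm_def by (simp only: mult.commute)
    qed
  qed measurable
qed

lemma norm_rot_cut: "cut R (rot t x) = cut R x" "Dcut R (rot t x) = cis t * Dcut R x"
  by (auto simp: cut_def Dcut_def cx_rot)

text \<open>Under the rotation \<open>ex1\<close> and \<open>ex2\<close> pick up the inverse of
  \<open>cis \<theta>\<close> and its square, both different from \<open>1\<close>, while
  \<open>h\<close> is invariant.\<close>

lemma ex_integral_zero:
  assumes h: "integrable lebesgue h" and rot: "\<And>x. h (rot \<theta> x) = h x"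
  shows "integral\<^sup>L lebesgue (\<lambda>x. h x * (ex1 x + ex2 x)) = 0"
proof -
  note i = integrable_mult_ex[OF h]
  have "integral\<^sup>L lebesgue (\<lambda>x. h x * ex1 x) = 0"
  proof (rule integral_rot_zero)
    show "inverse (cis \<theta>) \<noteq> 1" using cis_pow_ne_1[OF m3, of 1] by simp
    show "h (rot \<theta> x) * ex1 (rot \<theta> x) = inverse (cis \<theta>) * (h x * ex1 x)" for x
      unfolding rot ex_rot by (rule mult.left_commute)
  qed (use i in auto)
  moreover have "integral\<^sup>L lebesgue (\<lambda>x. h x * ex2 x) = 0"
  proof (rule integral_rot_zero)
    show "inverse (cis \<theta>) ^ 2 \<noteq> 1" by (rule cis_pow_ne_1[OF m3]) auto
    show "h (rot \<theta> x) * ex2 (rot \<theta> x) = inverse (cis \<theta>) ^ 2 * (h x * ex2 x)" for x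
      unfolding rot ex_rot by (rule mult.left_commute)
  qed (use i in auto)
  ultimately show ?thesis
    unfolding distrib_left by (subst Bochner_Integration.integral_add[OF i]) auto
qed

text \<open>The corrections may be added on both sides of \<open>weak_kernel\<close> because they
  integrate to zero there: \<open>w * cut R\<close> is invariant under the rotation, and so is
  \<open>U * Dcut R\<close>, whose two factors rotate in opposite directions.\<close>

lemma cutoff_identity:
  assumes R: "R > 0" and e: "e > 0"
  shows "(LINT x|lebesgue. U x * (cut R x * complex_of_real (- 2 * dkr e z x) + (kr e z x + (ex1 x + ex2 x)) * Dcut R x))
      = \<i> * (LINT x|lebesgue. of_real (w x) * (cut R x * (kr e z x + (ex1 x + ex2 x))))"
proof -
  define hU where "hU = (\<lambda>x. U x * Dcut R x)"
  define hw where "hw = (\<lambda>x. of_real (w x) * complex_of_real (cut R x))"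
  have iU: "integrable lebesgue hU" unfolding hU_def
    by (rule integrable_continuous_cball[where R = R]) (use R in \<open>auto intro!: continuous_intros simp: Dcut_outside\<close>)
  have iw: "integrable lebesgue hw" unfolding hw_def
    by (rule integrable_w_mult, rule integrable_continuous_cball[where R = R])
      (use R in \<open>auto intro!: continuous_intros simp: cut_outside\<close>)
  have zU: "integral\<^sup>L lebesgue (\<lambda>x. hU x * (ex1 x + ex2 x)) = 0"
    by (rule ex_integral_zero[OF iU]) (simp add: hU_def U_rot norm_rot_cut cis_mult)
  have zw: "integral\<^sup>L lebesgue (\<lambda>x. hw x * (ex1 x + ex2 x)) = 0"
    by (rule ex_integral_zero[OF iw]) (simp add: hw_def w_rot norm_rot_cut)
  have iU': "integrable lebesgue (\<lambda>x. hU x * (ex1 x + ex2 x))"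
    unfolding distrib_left by (intro Bochner_Integration.integrable_add integrable_mult_ex iU)
  have iw': "integrable lebesgue (\<lambda>x. hw x * (ex1 x + ex2 x))"
    unfolding distrib_left by (intro Bochner_Integration.integrable_add integrable_mult_ex iw)
  note wk = weak_kernel[OF R e, of z]
  have iwk: "integrable lebesgue (\<lambda>x. of_real (w x) * (cut R x * kr e z x))"
  proof (rule integrable_w_mult, rule integrable_continuous_cball[where R = R])
    have "(norm (x - z))\<^sup>2 + e\<^sup>2 \<noteq> 0" for x
      using e by (simp add: add_nonneg_eq_0_iff)
    then have "continuous_on UNIV (kr e z)" unfolding kr_def[abs_def] by (intro continuous_intros) auto
    then show "continuous_on UNIV (\<lambda>x. complex_of_real (cut R x) * kr e z x)" by (intro continuous_intros)
  qed (use R cut_outside in auto)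
  have "(LINT x|lebesgue. U x * (cut R x * complex_of_real (- 2 * dkr e z x) + (kr e z x + (ex1 x + ex2 x)) * Dcut R x))
    = (LINT x|lebesgue. U x * (cut R x * complex_of_real (- 2 * dkr e z x) + kr e z x * Dcut R x) + hU x * (ex1 x + ex2 x))"
    by (intro Bochner_Integration.integral_cong) (auto simp: hU_def algebra_simps)
  also have "\<dots> = \<i> * (LINT x|lebesgue. of_real (w x) * (cut R x * kr e z x))"
    by (subst Bochner_Integration.integral_add[OF wk(1) iU']) (simp only: zU wk(2) add_0_right)
  also have "(LINT x|lebesgue. of_real (w x) * (cut R x * kr e z x)) = (LINT x|lebesgue. of_real (w x) * (cut R x * kr e z x) + hw x * (ex1 x + ex2 x))"
    by (subst Bochner_Integration.integral_add[OF iwk iw']) (simp add: zw)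
  also have "(\<lambda>x. of_real (w x) * (cut R x * kr e z x) + hw x * (ex1 x + ex2 x))
     = (\<lambda>x. of_real (w x) * (cut R x * (kr e z x + (ex1 x + ex2 x))))"
    by (auto simp: hw_def algebra_simps)
  finally show ?thesis .
qed

lemma cut_le_1: "cut R x \<le> 1" and cut_nonneg: "0 \<le> cut R x"
  by (auto simp: cut_def bump_nonneg bump_le_1)

lemma R_limit: "(\<lambda>n. (norm x)\<^sup>2 / (real (Suc n))\<^sup>2) \<longlonglongrightarrow> (0::real)"
proof -
  have "(\<lambda>n. (norm x)\<^sup>2 * (1 / real (Suc n))\<^sup>2) \<longlonglongrightarrow> (norm x)\<^sup>2 * 0\<^sup>2"
    by (intro tendsto_intros LIMSEQ_Suc[OF lim_1_over_n])
  then show ?thesis by (simp add: power_divide)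
qed

text \<open>The limit is the constant \<open>bump 1\<close> rather than \<open>1\<close>; in the
  proof of \<open>eps_identity\<close> it appears on both sides and cancels.\<close>

lemma cut_limit: "(\<lambda>n. cut (real (Suc n)) x) \<longlonglongrightarrow> bump 1"
proof -
  have "(\<lambda>n. bump (1 - (norm x)\<^sup>2 / (real (Suc n))\<^sup>2)) \<longlonglongrightarrow> bump (1 - 0)"
    by (rule isCont_tendsto_compose[OF DERIV_isCont[OF bump_deriv]]) (intro tendsto_intros R_limit)
  then show ?thesis by (simp add: cut_def)
qed

text \<open>The limit \<open>R \<rightarrow> \<infinity>\<close> of \<open>cutoff_identity\<close>.
  Here the corrections are essential: the bare kernel decays only like
  \<open>1 / \<bar>x\<bar>\<close>, which is not integrable, and \<open>Dcut R\<close> merely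
  compensates the growth of \<open>U\<close>. With the corrections \<open>G\<close> dominates
  both.\<close>

lemma eps_identity:
  assumes e: "0 < e" "e \<le> 1"
  shows "(LINT x|lebesgue. U x * of_real (dkr e z x)) =
    - (\<i> / 2) * (LINT x|lebesgue. of_real (w x) * (kr e z x + (ex1 x + ex2 x)))"
proof -
  define K where "K = (\<lambda>x. kr e z x + (ex1 x + ex2 x))"
  have K: "norm (K x) \<le> G x" for x using kr_ex_bound[of e x] e by (simp add: K_def)
  have Km [measurable]: "K \<in> borel_measurable borel"
    unfolding K_def[abs_def] by (intro borel_measurable_add kr_meas ex_meas)
  have [measurable]: "U \<in> borel_measurable borel"
    by (intro borel_measurable_continuous_onI continuous_intros)
  have [measurable]: "cut R \<in> borel_measurable borel" "Dcut R \<in> borel_measurable borel" for R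
    by (intro borel_measurable_continuous_onI continuous_intros)+
  obtain C where C: "C \<ge> 0" "\<And>x. norm (U x) \<le> C * norm x" using U_growth by blast
  have iUd: "integrable lebesgue (\<lambda>x. U x * of_real (dkr e z x))"
    using dkr_limit(1)[OF e(1), of z] by (subst integrable_completion) auto
  \<comment> \<open>Linear growth of \<open>U\<close> against the decay of \<open>Dcut\<close>; the
    minimum serves both the pointwise limit and the domination.\<close>
  have Dk: "norm (U x * (K x * Dcut (real (Suc n)) x)) \<le> 4 * C * G x * min 1 ((norm x)\<^sup>2 / (real (Suc n))\<^sup>2)" for n x
  proof -
    have "norm (U x * (K x * Dcut (real (Suc n)) x)) = norm (U x) * norm (K x) * norm (Dcut (real (Suc n)) x)"
      by (simp add: norm_mult)
    also have "\<dots> \<le> (C * norm x) * G x * norm (Dcut (real (Suc n)) x)"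
      using C K G_nonneg by (intro mult_mono) auto
    also have "\<dots> = C * G x * (norm (Dcut (real (Suc n)) x) * norm x)" by simp
    also have "\<dots> \<le> C * G x * (4 * min 1 ((norm x)\<^sup>2 / (real (Suc n))\<^sup>2))"
      using C G_nonneg by (intro mult_left_mono Dcut_bound) auto
    finally show ?thesis by (simp add: mult_ac)
  qed
  let ?F = "\<lambda>n x. U x * (cut (real (Suc n)) x * complex_of_real (- 2 * dkr e z x) + K x * Dcut (real (Suc n)) x)"
  let ?H = "\<lambda>n x. of_real (w x) * (cut (real (Suc n)) x * K x)"
  have l1: "(\<lambda>n. integral\<^sup>L lebesgue (?F n)) \<longlonglongrightarrow> integral\<^sup>L lebesgue (\<lambda>x. U x * (bump 1 * complex_of_real (- 2 * dkr e z x) + 0))"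
  proof (rule integral_dominated_convergence)
    show "(\<lambda>x. U x * (bump 1 * complex_of_real (- 2 * dkr e z x) + 0)) \<in> borel_measurable lebesgue"
      by (intro borel_imp_lebesgue) measurable
    show "?F n \<in> borel_measurable lebesgue" for n
      by (intro borel_imp_lebesgue) measurable
    show "integrable lebesgue (\<lambda>x. 2 * norm (U x * of_real (dkr e z x)) + 4 * C * G x)"
      using iUd by (intro Bochner_Integration.integrable_add integrable_mult_right G_int integrable_norm)
    show "AE x in lebesgue. (\<lambda>n. ?F n x) \<longlonglongrightarrow> U x * (bump 1 * complex_of_real (- 2 * dkr e z x) + 0)"
    proof (rule AE_I2)
      fix x
      have "(\<lambda>n. U x * (K x * Dcut (real (Suc n)) x)) \<longlonglongrightarrow> 0"
      proof (rule Lim_null_comparison)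
        show "\<forall>\<^sub>F n in sequentially. norm (U x * (K x * Dcut (real (Suc n)) x)) \<le> 4 * C * G x * ((norm x)\<^sup>2 / (real (Suc n))\<^sup>2)"
          using Dk C G_nonneg by (intro always_eventually allI) (meson min.cobounded2 mult_left_mono mult_nonneg_nonneg order_trans zero_le_numeral)
        have "(\<lambda>n. 4 * C * G x * ((norm x)\<^sup>2 / (real (Suc n))\<^sup>2)) \<longlonglongrightarrow> 4 * C * G x * 0"
          by (intro tendsto_intros R_limit)
        then show "(\<lambda>n. 4 * C * G x * ((norm x)\<^sup>2 / (real (Suc n))\<^sup>2)) \<longlonglongrightarrow> 0" by simp
      qed
      then have "(\<lambda>n. U x * (cut (real (Suc n)) x * complex_of_real (- 2 * dkr e z x)) + U x * (K x * Dcut (real (Suc n)) x))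
          \<longlonglongrightarrow> U x * (bump 1 * complex_of_real (- 2 * dkr e z x)) + 0"
        by (intro tendsto_add tendsto_mult tendsto_const tendsto_of_real cut_limit)
      then show "(\<lambda>n. ?F n x) \<longlonglongrightarrow> U x * (bump 1 * complex_of_real (- 2 * dkr e z x) + 0)"
        by (simp only: distrib_left add_0_right)
    qed
    show "AE x in lebesgue. norm (?F n x) \<le> 2 * norm (U x * of_real (dkr e z x)) + 4 * C * G x" for n
    proof (rule AE_I2)
      fix x
      have "norm (U x * (cut (real (Suc n)) x * complex_of_real (- 2 * dkr e z x))) = cut (real (Suc n)) x * (2 * norm (U x * of_real (dkr e z x)))"
        by (simp add: norm_mult cut_nonneg)
      also have "\<dots> \<le> 1 * (2 * norm (U x * of_real (dkr e z x)))"
        using cut_le_1 by (intro mult_right_mono) auto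
      finally have 1: "norm (U x * (cut (real (Suc n)) x * complex_of_real (- 2 * dkr e z x))) \<le> 2 * norm (U x * of_real (dkr e z x))" by simp
      have "4 * C * G x * min 1 ((norm x)\<^sup>2 / (real (Suc n))\<^sup>2) \<le> 4 * C * G x * 1"
        using C G_nonneg by (intro mult_left_mono) auto
      then have 2: "norm (U x * (K x * Dcut (real (Suc n)) x)) \<le> 4 * C * G x" using Dk[of x n] by linarith
      show "norm (?F n x) \<le> 2 * norm (U x * of_real (dkr e z x)) + 4 * C * G x"
        unfolding distrib_left using 1 2 norm_triangle_mono by blast
    qed
  qed
  have mKw: "(\<lambda>x. of_real (w x) * (c x * K x)) \<in> borel_measurable lebesgue" if "c \<in> borel_measurable borel" for c :: "real^2 \<Rightarrow> complex"
  proof -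
    have [measurable]: "(\<lambda>x. c x * K x) \<in> borel_measurable lebesgue"
      by (intro borel_imp_lebesgue borel_measurable_times that Km)
    show ?thesis by measurable
  qed
  have l2: "(\<lambda>n. integral\<^sup>L lebesgue (?H n)) \<longlonglongrightarrow> integral\<^sup>L lebesgue (\<lambda>x. of_real (w x) * (complex_of_real (bump 1) * K x))"
  proof (rule integral_dominated_convergence)
    show "(\<lambda>x. of_real (w x) * (complex_of_real (bump 1) * K x)) \<in> borel_measurable lebesgue"
      by (rule mKw) simp
    show "?H n \<in> borel_measurable lebesgue" for n
      by (rule mKw) measurable
    show "integrable lebesgue (\<lambda>x. M * G x)" by (intro integrable_mult_right G_int)
    show "AE x in lebesgue. (\<lambda>n. ?H n x) \<longlonglongrightarrow> of_real (w x) * (complex_of_real (bump 1) * K x)"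
      by (intro AE_I2 tendsto_intros cut_limit)
    show "AE x in lebesgue. norm (?H n x) \<le> M * G x" for n
      using w_bd
    proof eventually_elim
      case (elim x)
      have "norm (?H n x) = \<bar>w x\<bar> * (cut (real (Suc n)) x * norm (K x))" by (simp add: norm_mult cut_nonneg)
      also have "\<dots> \<le> M * (1 * G x)"
        using elim cut_le_1 cut_nonneg K G_nonneg M0 by (intro mult_mono) auto
      finally show ?case by simp
    qed
  qed
  have "(\<lambda>n. integral\<^sup>L lebesgue (?F n)) = (\<lambda>n. \<i> * integral\<^sup>L lebesgue (?H n))"
    unfolding K_def using cutoff_identity[OF _ e(1)] by simp
  then have "(\<lambda>n. integral\<^sup>L lebesgue (?F n)) \<longlonglongrightarrow> \<i> * integral\<^sup>L lebesgue (\<lambda>x. of_real (w x) * (complex_of_real (bump 1) * K x))"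
    using tendsto_mult[OF tendsto_const[of \<i>] l2] by simp
  from LIMSEQ_unique[OF l1 this]
  have "integral\<^sup>L lebesgue (\<lambda>x. U x * (bump 1 * complex_of_real (- 2 * dkr e z x) + 0))
    = \<i> * integral\<^sup>L lebesgue (\<lambda>x. of_real (w x) * (complex_of_real (bump 1) * K x))" .
  also have "(\<lambda>x. U x * (bump 1 * complex_of_real (- 2 * dkr e z x) + 0)) = (\<lambda>x. (- 2 * bump 1) * (U x * of_real (dkr e z x)))"
    by (auto simp: algebra_simps)
  also have "(\<lambda>x. of_real (w x) * (complex_of_real (bump 1) * K x)) = (\<lambda>x. complex_of_real (bump 1) * (of_real (w x) * K x))"
    by (auto simp: algebra_simps)
  finally have "complex_of_real (- 2 * bump 1) * (LINT x|lebesgue. U x * of_real (dkr e z x)) = \<i> * (complex_of_real (bump 1) * (LINT x|lebesgue. of_real (w x) * K x))"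
    by (simp only: integral_mult_right_zero)
  moreover have "X = - (\<i> / 2) * Y"
    if "complex_of_real (- 2 * b) * X = \<i> * (complex_of_real b * Y)" "b \<noteq> 0" for X Y b
  proof -
    have "of_real b * (2 * X + \<i> * Y) = 0" using that(1) by (simp add: algebra_simps add_eq_0_iff2)
    then have "2 * X + \<i> * Y = 0" using that(2) by simp
    moreover have "X = (2 * X + \<i> * Y) / 2 - (\<i> / 2) * Y" by (simp add: field_simps)
    ultimately show ?thesis by (metis div_0 diff_0 mult_minus_left)
  qed
  moreover have "bump 1 \<noteq> 0" by (simp add: bump_eq)
  ultimately have "(LINT x|lebesgue. U x * of_real (dkr e z x)) = - (\<i> / 2) * (LINT x|lebesgue. of_real (w x) * K x)"
    by blast
  then show ?thesis by (simp only: K_def)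
qed

text \<open>The Biot-Savart law with the corrected kernel, from \<open>eps_identity\<close> as
  \<open>e\<close> tends to \<open>0\<close>: the left-hand side concentrates at \<open>z\<close>,
  and the right-hand side is dominated by \<open>M * G\<close>.\<close>

theorem velocity_kernel:
  shows "integrable lebesgue (\<lambda>x. of_real (w x) * kerS S z x)"
    and "U z = - (\<i> / (2 * pi)) * (LINT x|lebesgue. of_real (w x) * kerS S z x)"
proof -
  have mw: "(\<lambda>x. of_real (w x) * c x) \<in> borel_measurable lebesgue" if "c \<in> borel_measurable borel" for c :: "real^2 \<Rightarrow> complex"
  proof -
    have [measurable]: "c \<in> borel_measurable lebesgue" using that by (intro borel_imp_lebesgue)
    show ?thesis by measurable
  qed
  have bd: "AE x in lebesgue. norm (of_real (w x) * c x) \<le> M * G x" if "\<And>x. norm (c x) \<le> G x" for c :: "real^2 \<Rightarrow> complex"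
    using w_bd
  proof eventually_elim
    case (elim x)
    then show ?case unfolding norm_mult using that M0 by (intro mult_mono) auto
  qed
  show "integrable lebesgue (\<lambda>x. of_real (w x) * kerS S z x)"
    by (intro integrable_w_mult Bochner_Integration.integrable_bound[OF G_int])
      (use kerS_bound G_nonneg in \<open>auto intro!: borel_imp_lebesgue kerS_meas\<close>)
  let ?e = "\<lambda>n. 1 / real (Suc n)"
  have "(\<lambda>n. LINT x|lebesgue. of_real (w x) * (kr (?e n) z x + (ex1 x + ex2 x))) \<longlonglongrightarrow> (LINT x|lebesgue. of_real (w x) * (kr 0 z x + (ex1 x + ex2 x)))"
  proof (rule integral_dominated_convergence)
    show "integrable lebesgue (\<lambda>x. M * G x)" by (intro integrable_mult_right G_int)
    show "AE x in lebesgue. norm (of_real (w x) * (kr (?e n) z x + (ex1 x + ex2 x))) \<le> M * G x" for n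
      by (rule bd, rule kr_ex_bound) auto
    show "AE x in lebesgue. (\<lambda>n. of_real (w x) * (kr (?e n) z x + (ex1 x + ex2 x))) \<longlonglongrightarrow> of_real (w x) * (kr 0 z x + (ex1 x + ex2 x))"
    proof (intro AE_I2 tendsto_intros)
      fix x
      show "(\<lambda>n. kr (?e n) z x) \<longlonglongrightarrow> kr 0 z x"
      proof (cases "x = z")
        case False
        then show ?thesis unfolding kr_def
          by (intro tendsto_intros LIMSEQ_Suc[OF lim_1_over_n]) simp
      qed (simp add: kr_def)
    qed
  qed (auto intro!: mw borel_measurable_add)
  then have "(\<lambda>n. - (\<i> / 2) * (LINT x|lebesgue. of_real (w x) * (kr (?e n) z x + (ex1 x + ex2 x)))) \<longlonglongrightarrow> - (\<i> / 2) * (LINT x|lebesgue. of_real (w x) * kerS S z x)"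
    unfolding ker_eq by (intro tendsto_mult tendsto_const)
  moreover have "- (\<i> / 2) * (LINT x|lebesgue. of_real (w x) * (kr (?e n) z x + (ex1 x + ex2 x)))
     = integral\<^sup>L lborel (\<lambda>x. U x * of_real (dkr (?e n) z x))" for n
  proof -
    have [measurable]: "U \<in> borel_measurable borel"
      by (intro borel_measurable_continuous_onI continuous_intros)
    have "(LINT x|lebesgue. U x * of_real (dkr (?e n) z x)) = integral\<^sup>L lborel (\<lambda>x. U x * of_real (dkr (?e n) z x))"
      by (rule integral_completion) measurable
    then show ?thesis using eps_identity[of "?e n"] by simp
  qed
  ultimately have "(\<lambda>n. integral\<^sup>L lborel (\<lambda>x. U x * of_real (dkr (?e n) z x))) \<longlonglongrightarrow> - (\<i> / 2) * (LINT x|lebesgue. of_real (w x) * kerS S z x)"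
    by simp
  from LIMSEQ_unique[OF dkr_limit(2) this]
  have "of_real pi * U z = - (\<i> / 2) * (LINT x|lebesgue. of_real (w x) * kerS S z x)" .
  then show "U z = - (\<i> / (2 * pi)) * (LINT x|lebesgue. of_real (w x) * kerS S z x)"
    by (simp add: field_simps)
qed

end

section \<open>Growth and modulus of continuity of the velocity\<close>

text \<open>The kernel pulled back along \<open>X\<close>. The case distinction refers to the label
  \<open>y\<close> and not to its image, so that for two flows the same labels are near and the same
  labels are far.\<close>

definition kmap :: "real \<Rightarrow> (real^2 \<Rightarrow> real^2) \<Rightarrow> real^2 \<Rightarrow> real^2 \<Rightarrow> complex" where
  "kmap \<rho> X a y = (if norm y \<le> \<rho> then 1 / (cx a - cx (X y)) else far_ker (cx a) (cx (X y)))"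

lemma far_ker_measurable [measurable]:
  assumes [measurable]: "f \<in> borel_measurable M"
  shows "(\<lambda>y. far_ker a (f y)) \<in> borel_measurable M"
  unfolding far_ker_def by measurable

lemma kmap_measurable [measurable]:
  assumes "mpres X"
  shows "kmap \<rho> X a \<in> borel_measurable borel"
proof -
  have [measurable]: "X \<in> borel_measurable borel" using assms by (simp add: mpres_def)
  show ?thesis unfolding kmap_def[abs_def] by measurable
qed

text \<open>The labels fall into three regions. Up to \<rho> the singular kernels are compared by
  \<open>near_ker_diff\<close>; between \<rho> and \<open>N\<close> the decaying kernels are
  compared by \<open>far_ker_diff\<close>; beyond \<open>N\<close>, where nothing is known about the
  distance of the maps, both kernels are bounded separately, at the cost of a tail of order
  \<open>1 / N\<close>.\<close>

lemma kmap_diff_bound: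
  fixes X X' :: "real^2 \<Rightarrow> real^2"
  assumes X: "mpres X" "mpres X'"
    and r: "0 < \<rho>" "0 < b" "2 * \<alpha> \<le> b * \<rho>" "\<alpha> \<le> B" "0 < B" "0 < N"
    and a: "norm a \<le> \<alpha>" "norm a' \<le> \<alpha>"
    and near: "\<And>y. norm y \<le> \<rho> \<Longrightarrow> norm (X y) \<le> B \<and> norm (X' y) \<le> B"
    and far: "\<And>y. norm y > \<rho> \<Longrightarrow> b * norm y \<le> norm (X y) \<and> b * norm y \<le> norm (X' y)"
    and cl: "\<And>y. norm y \<le> \<rho> \<Longrightarrow> norm (a - a' - (X y - X' y)) \<le> 4 * B * d" "0 < d" "d \<le> 1"
    and clf: "norm (a - a') \<le> \<delta> * \<alpha>" "\<And>y. \<rho> < norm y \<Longrightarrow> norm y \<le> N \<Longrightarrow> norm (X y - X' y) \<le> \<delta> * K * (b * norm y)"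
    and dK: "1 \<le> K" "0 \<le> \<delta>"
  shows "(\<integral>\<^sup>+y. ennreal (norm (kmap \<rho> X a y - kmap \<rho> X' a' y)) \<partial>lborel)
    \<le> ennreal (400 * B * osg d + 14 * K * \<delta> * \<alpha>\<^sup>2 / b ^ 3 * (2 * pi / \<rho>) + 4 * \<alpha>\<^sup>2 / b ^ 3 * (2 * pi / N))"
proof -
  have [measurable]: "X \<in> borel_measurable borel" "X' \<in> borel_measurable borel" using X by (auto simp: mpres_def)
  let ?n = "\<lambda>y. ennreal (norm (1 / (cx a - cx (X y)) - 1 / (cx a' - cx (X' y)))) * indicator (cball 0 \<rho>) y"
  let ?h = "\<lambda>r y. ennreal (1 / norm (y - 0) ^ 3) * indicator {y::real^2. r \<le> norm (y - 0)} y"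
  define c1 where "c1 = 14 * K * \<delta> * \<alpha>\<^sup>2 / b ^ 3"
  define c2 where "c2 = 4 * \<alpha>\<^sup>2 / b ^ 3"
  have c: "0 \<le> c1" "0 \<le> c2" using r dK by (auto simp: c1_def c2_def)
  have pt: "ennreal (norm (kmap \<rho> X a y - kmap \<rho> X' a' y)) \<le> ?n y + (ennreal c1 * ?h \<rho> y + ennreal c2 * ?h N y)" for y
  proof (cases "norm y \<le> \<rho>")
    case True then show ?thesis by (simp add: kmap_def add_increasing2)
  next
    case False
    then have y: "\<rho> < norm y" by simp
    then have y0: "0 < norm y" using r by linarith
    have by2: "2 * \<alpha> \<le> b * norm y" using r y mult_left_mono[of \<rho> "norm y" b] by linarith
    have eq: "kmap \<rho> X a y - kmap \<rho> X' a' y = far_ker (cx a) (cx (X y)) - far_ker (cx a') (cx (X' y))"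
      using False by (simp add: kmap_def)
    show ?thesis
    proof (cases "norm y \<le> N")
      case True
      have "norm (far_ker (cx a) (cx (X y)) - far_ker (cx a') (cx (X' y))) \<le> 14 * K * \<delta> * \<alpha>\<^sup>2 / (b * norm y) ^ 3"
      proof (rule far_ker_diff)
        show "norm (cx a - cx a') \<le> \<delta> * \<alpha>" "norm (cx (X y) - cx (X' y)) \<le> \<delta> * K * (b * norm y)"
          using clf(1) clf(2)[OF y True] by (simp_all add: cx_diff[symmetric])
      qed (use a far[OF y] by2 r y0 dK in auto)
      also have "\<dots> = c1 * (1 / norm (y - 0) ^ 3)" by (simp add: c1_def power_mult_distrib)
      finally have "ennreal (norm (kmap \<rho> X a y - kmap \<rho> X' a' y)) \<le> ennreal c1 * ennreal (1 / norm (y - 0) ^ 3)"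
        unfolding eq using c by (subst ennreal_mult[symmetric]) (auto intro: ennreal_leI)
      then have "ennreal (norm (kmap \<rho> X a y - kmap \<rho> X' a' y)) \<le> ennreal c1 * ?h \<rho> y" using y by simp
      then show ?thesis by (meson add_increasing add_increasing2 order_trans zero_le)
    next
      case False
      have 1: "norm (far_ker (cx a) (cx (X y))) \<le> 2 * \<alpha>\<^sup>2 / (b * norm y) ^ 3"
        "norm (far_ker (cx a') (cx (X' y))) \<le> 2 * \<alpha>\<^sup>2 / (b * norm y) ^ 3"
        by (rule far_ker_bound; use a far[OF y] by2 r y0 in auto)+
      have "norm (far_ker (cx a) (cx (X y)) - far_ker (cx a') (cx (X' y))) \<le> 2 * \<alpha>\<^sup>2 / (b * norm y) ^ 3 + 2 * \<alpha>\<^sup>2 / (b * norm y) ^ 3"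
        using 1 norm_triangle_ineq4 add_mono order_trans by meson
      also have "\<dots> = c2 * (1 / norm (y - 0) ^ 3)" by (simp add: c2_def power_mult_distrib)
      finally have "ennreal (norm (kmap \<rho> X a y - kmap \<rho> X' a' y)) \<le> ennreal c2 * ennreal (1 / norm (y - 0) ^ 3)"
        unfolding eq using c by (subst ennreal_mult[symmetric]) (auto intro: ennreal_leI)
      then have "ennreal (norm (kmap \<rho> X a y - kmap \<rho> X' a' y)) \<le> ennreal c2 * ?h N y" using False by simp
      then show ?thesis by (meson add_increasing add_increasing2 order_trans zero_le)
    qed
  qed
  have mh: "?h r \<in> borel_measurable lborel" for r by measurable
  have mn: "?n \<in> borel_measurable lborel"
    by (intro borel_measurable_times_ennreal borel_measurable_indicator) auto
  have ih: "(\<integral>\<^sup>+y. ennreal c * ?h r y \<partial>lborel) = ennreal (c * (2 * pi / r))" if "r > 0" "c \<ge> 0" for r c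
    unfolding nn_integral_cmult[OF mh] using nn_integral_norm_powr3_outside[OF that(1), of "0::real^2"] that
    by (simp only:) (rule ennreal_mult[symmetric], auto)
  have "(\<integral>\<^sup>+y. ennreal (norm (kmap \<rho> X a y - kmap \<rho> X' a' y)) \<partial>lborel)
      \<le> (\<integral>\<^sup>+y. ?n y + (ennreal c1 * ?h \<rho> y + ennreal c2 * ?h N y) \<partial>lborel)"
    by (intro nn_integral_mono pt)
  also have "\<dots> = integral\<^sup>N lborel ?n + (\<integral>\<^sup>+y. ennreal c1 * ?h \<rho> y + ennreal c2 * ?h N y \<partial>lborel)"
    by (intro nn_integral_add mn borel_measurable_add borel_measurable_times_ennreal borel_measurable_const mh)
  also have "(\<integral>\<^sup>+y. ennreal c1 * ?h \<rho> y + ennreal c2 * ?h N y \<partial>lborel) = (\<integral>\<^sup>+y. ennreal c1 * ?h \<rho> y \<partial>lborel) + (\<integral>\<^sup>+y. ennreal c2 * ?h N y \<partial>lborel)"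
    by (intro nn_integral_add borel_measurable_times_ennreal borel_measurable_const mh)
  also have "\<dots> = ennreal (c1 * (2 * pi / \<rho>)) + ennreal (c2 * (2 * pi / N))"
    by (simp only: ih[OF r(1) c(1)] ih[OF r(6) c(2)])
  also have "integral\<^sup>N lborel ?n + (ennreal (c1 * (2 * pi / \<rho>)) + ennreal (c2 * (2 * pi / N)))
     \<le> ennreal (400 * B * osg d) + (ennreal (c1 * (2 * pi / \<rho>)) + ennreal (c2 * (2 * pi / N)))"
  proof (intro add_mono order_refl near_ker_diff)
    show "norm ((cx a - cx (X y)) - (cx a' - cx (X' y))) \<le> 4 * B * d" if "y \<in> cball 0 \<rho>" for y
    proof -
      have "(cx a - cx (X y)) - (cx a' - cx (X' y)) = cx (a - a' - (X y - X' y))"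
        by (simp add: cx_diff)
      then show ?thesis using cl(1)[of y] that by simp
    qed
  qed (use X near a r cl in \<open>auto simp: mpres_def\<close>)
  also have "\<dots> = ennreal (400 * B * osg d + c1 * (2 * pi / \<rho>) + c2 * (2 * pi / N))"
    using c r osg_nonneg[OF cl(2,3)] by (simp add: ennreal_plus[symmetric] add.assoc del: ennreal_plus)
  finally show ?thesis by (simp only: c1_def c2_def)
qed

lemma weighted_integral_bound:
  fixes c :: "real^2 \<Rightarrow> complex"
  assumes w: "w \<in> borel_measurable lebesgue" "AE x in lebesgue. \<bar>w x\<bar> \<le> M" "0 \<le> M"
    and c: "c \<in> borel_measurable borel" "(\<integral>\<^sup>+y. ennreal (norm (c y)) \<partial>lborel) \<le> ennreal L" "0 \<le> L"
  shows "integrable lebesgue (\<lambda>y. of_real (w y) * c y)" "norm (LINT y|lebesgue. of_real (w y) * c y) \<le> M * L"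
proof -
  have mc [measurable]: "c \<in> borel_measurable lebesgue" using c by (intro borel_imp_lebesgue)
  note [measurable] = w(1)
  have "(\<integral>\<^sup>+y. ennreal (norm (of_real (w y) * c y)) \<partial>lebesgue) \<le> (\<integral>\<^sup>+y. ennreal M * ennreal (norm (c y)) \<partial>lebesgue)"
  proof (rule nn_integral_mono_AE)
    show "AE y in lebesgue. ennreal (norm (of_real (w y) * c y)) \<le> ennreal M * ennreal (norm (c y))"
      using w(2)
    proof eventually_elim
      case (elim y)
      then show ?case using w(3)
        by (subst ennreal_mult[symmetric]) (auto simp: norm_mult intro!: ennreal_leI mult_right_mono)
    qed
  qed
  also have "\<dots> = ennreal M * (\<integral>\<^sup>+y. ennreal (norm (c y)) \<partial>lebesgue)" by (rule nn_integral_cmult) measurable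
  also have "(\<integral>\<^sup>+y. ennreal (norm (c y)) \<partial>lebesgue) = (\<integral>\<^sup>+y. ennreal (norm (c y)) \<partial>lborel)" by (rule nn_integral_completion)
  also have "ennreal M * \<dots> \<le> ennreal M * ennreal L" by (intro mult_left_mono c) simp
  also have "\<dots> = ennreal (M * L)" using w c by (simp add: ennreal_mult)
  finally have b: "(\<integral>\<^sup>+y. ennreal (norm (of_real (w y) * c y)) \<partial>lebesgue) \<le> ennreal (M * L)" .
  have m: "(\<lambda>y. of_real (w y) * c y) \<in> borel_measurable lebesgue" by measurable
  show "integrable lebesgue (\<lambda>y. of_real (w y) * c y)" "norm (LINT y|lebesgue. of_real (w y) * c y) \<le> M * L"
    using nn_bound_imp_integral_bound[OF m b] w c by auto
qed

lemma osg_ge: "0 < d \<Longrightarrow> d \<le> 1 \<Longrightarrow> d \<le> osg d"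
  using ln_le_zero_iff[of d] mult_left_mono[of 1 "1 - ln d" d] by (simp add: osg_def)

lemma mpres_id: "mpres (\<lambda>x. x)"
  by (simp add: mpres_def distr_id2)

context symmetric_velocity
begin

lemma region_cball:
  assumes "0 < r" "2 * norm z \<le> r"
  shows "kernel_region m w u M (cball 0 r) z r r"
  by unfold_locales (use assms in \<open>auto simp: dist_norm\<close>)

lemma U_zero: "U 0 = 0"
proof -
  obtain C where C: "C \<ge> 0" "\<And>x. norm (U x) \<le> C * norm x" using U_growth by blast
  show ?thesis using C(2)[of 0] by simp
qed

lemma norm_U: "norm (U x) = norm (u x)" "norm (U x - U y) = norm (u x - u y)"
proof -
  show "norm (U x) = norm (u x)" by (simp add: U_def)
  have "U x - U y = cnj (cx (u x - u y))" by (simp add: U_def cx_diff)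
  then show "norm (U x - U y) = norm (u x - u y)" by simp
qed

text \<open>The cut is at \<open>r = 2 * norm z\<close>. The near part lies in the disc of radius
  \<open>3 * norm z\<close> about \<open>z\<close> and gives \<open>6 * pi * norm z\<close>, the far
  part gives \<open>2 * pi * norm z\<close>; division by \<open>2 * pi\<close> leaves the factor
  \<open>4\<close>.\<close>

lemma velocity_growth: "norm (u z) \<le> 4 * M * norm z"
proof (cases "z = 0")
  case True then show ?thesis using U_zero norm_U(1)[of z] by simp
next
  case False
  define r where "r = 2 * norm z"
  have r: "r > 0" using False by (simp add: r_def)
  interpret kernel_region m w u M "cball 0 r" z r r
    by (rule region_cball) (use r in \<open>auto simp: r_def\<close>)
  let ?k = "kerS (cball 0 r) z"
  have "(\<integral>\<^sup>+x. ennreal (norm (?k x)) \<partial>lborel) \<le> (\<integral>\<^sup>+x. ennreal (norm (x - z) powr (-1)) * indicator (cball z (3 * norm z)) x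
      + ennreal (2 * (norm z)\<^sup>2) * (ennreal (1 / norm (x - 0) ^ 3) * indicator {x. r \<le> norm (x - 0)} x) \<partial>lborel)"
  proof (intro nn_integral_mono)
    fix x
    show "ennreal (norm (?k x)) \<le> ennreal (norm (x - z) powr (-1)) * indicator (cball z (3 * norm z)) x
      + ennreal (2 * (norm z)\<^sup>2) * (ennreal (1 / norm (x - 0) ^ 3) * indicator {x. r \<le> norm (x - 0)} x)"
    proof (cases "x \<in> cball 0 r")
      case True
      have "x \<in> cball z (3 * norm z)" using True norm_triangle_ineq4[of z x] by (simp add: dist_norm r_def)
      moreover have "norm (?k x) \<le> norm (x - z) powr - 1"
        using True kr_near[of 0 x] ker_eq[of x] by (simp add: ex1_def ex2_def)
      ultimately show ?thesis by (simp add: add_increasing2 ennreal_leI)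
    next
      case False
      then have x: "r < norm x" by simp
      then have "x \<noteq> 0" using r by auto
      have "norm (?k x) \<le> 2 * (norm z)\<^sup>2 / norm x ^ 3"
        using False far_ker_bound[of "cx z" "norm z" "norm x" "cx x"] x \<open>x \<noteq> 0\<close> by (simp add: kerS_def r_def)
      then have "ennreal (norm (?k x)) \<le> ennreal (2 * (norm z)\<^sup>2) * ennreal (1 / norm (x - 0) ^ 3)"
        by (subst ennreal_mult[symmetric]) (auto intro: ennreal_leI)
      then show ?thesis using x by (simp add: add_increasing)
    qed
  qed
  also have "\<dots> = (\<integral>\<^sup>+x. ennreal (norm (x - z) powr (-1)) * indicator (cball z (3 * norm z)) x \<partial>lborel)
      + ennreal (2 * (norm z)\<^sup>2) * (\<integral>\<^sup>+x. (ennreal (1 / norm (x - 0) ^ 3) * indicator {x. r \<le> norm (x - 0)} x) \<partial>(lborel :: (real^2) measure))"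
  proof -
    have m1: "(\<lambda>x. ennreal (norm (x - z) powr (-1)) * indicator (cball z (3 * norm z)) x) \<in> borel_measurable lborel"
      by (intro borel_measurable_times_ennreal borel_measurable_indicator) auto
    have m2: "(\<lambda>x::real^2. ennreal (1 / norm (x - 0) ^ 3) * indicator {x. r \<le> norm (x - 0)} x) \<in> borel_measurable lborel"
      by measurable
    show ?thesis
      unfolding nn_integral_cmult[OF m2, of "ennreal (2 * (norm z)\<^sup>2)", symmetric]
      by (rule nn_integral_add[OF m1 borel_measurable_times_ennreal[OF borel_measurable_const m2]])
  qed
  also have "(\<integral>\<^sup>+x. ennreal (norm (x - z) powr (-1)) * indicator (cball z (3 * norm z)) x \<partial>lborel) = ennreal (2 * pi * (3 * norm z) powr (2 - 1) / (2 - 1))"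
    by (rule nn_integral_norm_powr_cball) auto
  also have "(\<integral>\<^sup>+x. (ennreal (1 / norm (x - 0) ^ 3) * indicator {x. r \<le> norm (x - 0)} x) \<partial>(lborel :: (real^2) measure)) = ennreal (2 * pi / r)"
    by (rule nn_integral_norm_powr3_outside[OF r])
  also have "ennreal (2 * pi * (3 * norm z) powr (2 - 1) / (2 - 1)) + ennreal (2 * (norm z)\<^sup>2) * ennreal (2 * pi / r)
    = ennreal (8 * pi * norm z)"
  proof -
    have "ennreal (2 * (norm z)\<^sup>2) * ennreal (2 * pi / r) = ennreal (2 * pi * norm z)"
      using False r by (subst ennreal_mult[symmetric]) (auto simp: r_def power2_eq_square)
    moreover have "2 * pi * (3 * norm z) powr (2 - 1) / (2 - 1) = 6 * pi * norm z" by simp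
    moreover have "ennreal (6 * pi * norm z) + ennreal (2 * pi * norm z) = ennreal (6 * pi * norm z + 2 * pi * norm z)"
      by (rule ennreal_plus[symmetric]) auto
    ultimately show ?thesis by (simp add: algebra_simps)
  qed
  finally have b: "(\<integral>\<^sup>+x. ennreal (norm (?k x)) \<partial>lborel) \<le> ennreal (8 * pi * norm z)" .
  have "norm (LINT x|lebesgue. of_real (w x) * ?k x) \<le> M * (8 * pi * norm z)"
    by (rule weighted_integral_bound(2)[OF w_meas w_bd M0 kerS_meas b]) simp
  moreover have "norm (U z) = 1 / (2 * pi) * norm (LINT x|lebesgue. of_real (w x) * ?k x)"
    unfolding velocity_kernel(2) by (simp add: norm_mult norm_divide)
  ultimately have "norm (U z) \<le> 1 / (2 * pi) * (M * (8 * pi * norm z))"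
    by (simp only:) (intro mult_left_mono, auto)
  then show ?thesis by (simp add: norm_U)
qed

text \<open>The estimate for two maps is applied with both maps equal to the identity and only the
  points \<open>x\<close> and \<open>y\<close> different.\<close>

lemma velocity_log_lipschitz:
  assumes R: "0 < R" "norm x \<le> R" "norm y \<le> R"
  shows "norm (u x - u y) \<le> 320 * M * R * osg (norm (x - y) / (4 * R))"
proof (cases "x = y")
  case False
  define d where "d = norm (x - y) / (4 * R)"
  have d: "0 < d" using False R by (simp add: d_def)
  have "norm (x - y) \<le> 2 * R" using norm_triangle_ineq4[of x y] R by linarith
  then have d1: "d \<le> 1/2" using R by (simp add: d_def field_simps)
  have od: "0 < osg d" using osg_ge[of d] d d1 by linarith
  define \<rho> where "\<rho> = 2 * R"
  have rho: "0 < \<rho>" using R by (simp add: \<rho>_def)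
  interpret X: kernel_region m w u M "cball 0 \<rho>" x \<rho> \<rho>
    by (rule region_cball) (use R in \<open>auto simp: \<rho>_def\<close>)
  interpret Y: kernel_region m w u M "cball 0 \<rho>" y \<rho> \<rho>
    by (rule region_cball) (use R in \<open>auto simp: \<rho>_def\<close>)
  \<comment> \<open>Any \<open>N\<close> is admissible since both maps are the identity; this one
    makes the tail equal to \<open>R * osg d\<close>.\<close>
  define N where "N = 8 * pi * R / osg d"
  have N: "N > 0" using od R by (simp add: N_def)
  have km: "kmap \<rho> (\<lambda>x. x) a = kerS (cball 0 \<rho>) a" for a
    by (auto simp: kmap_def kerS_def fun_eq_iff)
  have nd: "norm (x - y) = 4 * R * d" using R by (simp add: d_def)
  have "(\<integral>\<^sup>+v. ennreal (norm (kmap \<rho> (\<lambda>x. x) x v - kmap \<rho> (\<lambda>x. x) y v)) \<partial>lborel)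
    \<le> ennreal (400 * (2 * R) * osg d + 14 * 1 * (4 * d) * R\<^sup>2 / 1 ^ 3 * (2 * pi / \<rho>) + 4 * R\<^sup>2 / 1 ^ 3 * (2 * pi / N))"
    by (rule kmap_diff_bound[OF mpres_id mpres_id]) (use R d d1 N rho nd in \<open>auto simp: \<rho>_def\<close>)
  also have "\<dots> \<le> ennreal (1100 * R * osg d)"
  proof (rule ennreal_leI)
    have "14 * 1 * (4 * d) * R\<^sup>2 / 1 ^ 3 * (2 * pi / \<rho>) = 56 * pi * R * d"
      using R by (simp add: \<rho>_def power2_eq_square)
    also have "\<dots> \<le> 56 * 4 * R * osg d"
      using R pi_less_4 d osg_ge[of d] d1 by (intro mult_mono) auto
    finally have 1: "14 * 1 * (4 * d) * R\<^sup>2 / 1 ^ 3 * (2 * pi / \<rho>) \<le> 224 * (R * osg d)" by simp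
    have 2: "4 * R\<^sup>2 / 1 ^ 3 * (2 * pi / N) = R * osg d"
      using R od by (simp add: N_def power2_eq_square)
    have "0 \<le> R * osg d" using R od by simp
    then show "400 * (2 * R) * osg d + 14 * 1 * (4 * d) * R\<^sup>2 / 1 ^ 3 * (2 * pi / \<rho>) + 4 * R\<^sup>2 / 1 ^ 3 * (2 * pi / N) \<le> 1100 * R * osg d"
      using 1 unfolding 2 by linarith
  qed
  finally have b: "(\<integral>\<^sup>+v. ennreal (norm (kerS (cball 0 \<rho>) x v - kerS (cball 0 \<rho>) y v)) \<partial>lborel) \<le> ennreal (1100 * R * osg d)"
    unfolding km .
  have nn: "0 \<le> 1100 * R * osg d" using R od by simp
  have "norm (LINT v|lebesgue. of_real (w v) * (kerS (cball 0 \<rho>) x v - kerS (cball 0 \<rho>) y v)) \<le> M * (1100 * R * osg d)"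
    by (rule weighted_integral_bound(2)[OF w_meas w_bd M0 _ b nn]) (intro borel_measurable_diff X.kerS_meas Y.kerS_meas)
  moreover have "U x - U y = - (\<i> / (2 * pi)) * (LINT v|lebesgue. of_real (w v) * (kerS (cball 0 \<rho>) x v - kerS (cball 0 \<rho>) y v))"
    unfolding X.velocity_kernel(2) Y.velocity_kernel(2) right_diff_distrib
    by (subst Bochner_Integration.integral_diff[OF X.velocity_kernel(1) Y.velocity_kernel(1)]) (simp add: algebra_simps)
  then have "norm (U x - U y) = 1 / (2 * pi) * norm (LINT v|lebesgue. of_real (w v) * (kerS (cball 0 \<rho>) x v - kerS (cball 0 \<rho>) y v))"
    by (simp add: norm_mult norm_divide)
  ultimately have "norm (U x - U y) \<le> 1 / (2 * pi) * (M * (1100 * R * osg d))"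
    by (simp only:) (intro mult_left_mono, auto)
  also have "\<dots> \<le> 1 / 6 * (M * (1100 * R * osg d))"
    using pi_gt3 M0 nn by (intro mult_right_mono frac_le) auto
  also have "\<dots> \<le> 320 * (M * R * osg d)"
  proof -
    have "0 \<le> M * R * osg d" using M0 R od by simp
    then show ?thesis by simp
  qed
  finally show ?thesis by (simp add: norm_U d_def)
qed (simp add: osg_def)

end

section \<open>The flow\<close>

text \<open>The derivative \<open>- ln x\<close> is nonnegative up to \<open>1\<close>; the endpoint
  \<open>a = 0\<close>, where \<open>osg\<close> is not differentiable, is treated apart.\<close>

lemma osg_mono: assumes "0 \<le> a" "a \<le> b" "b \<le> 1" shows "osg a \<le> osg b"
proof (cases "a = 0")
  case True
  then show ?thesis using assms osg_nonneg[of b] by (cases "b = 0") (auto simp: osg_def)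
next
  case False
  show ?thesis
  proof (rule DERIV_nonneg_imp_nondecreasing[OF assms(2)])
    fix x assume x: "a \<le> x" "x \<le> b"
    then have "(osg has_real_derivative - ln x) (at x)"
      unfolding osg_def[abs_def] using False assms
      by (auto intro!: derivative_eq_intros)
    moreover have "0 \<le> - ln x" using x False assms ln_le_zero_iff[of x] by simp
    ultimately show "\<exists>y. (osg has_real_derivative y) (at x) \<and> 0 \<le> y" by blast
  qed
qed

section \<open>Differential inequalities forward and backward in time\<close>

lemma gronwall_two_sided:
  assumes f: "\<And>t. t \<in> {a..b} \<Longrightarrow> (f has_real_derivative f' t) (at t within {a..b})"
    and pos: "\<And>t. t \<in> {a..b} \<Longrightarrow> 0 < f t" and bd: "\<And>t. t \<in> {a..b} \<Longrightarrow> \<bar>f' t\<bar> \<le> C * f t"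
    and st: "s \<in> {a..b}" "t \<in> {a..b}"
  shows "f t \<le> exp (C * \<bar>t - s\<bar>) * f s"
proof -
  have "norm (ln (f t) - ln (f s)) \<le> C * norm (t - s)"
  proof (rule field_differentiable_bound[OF convex_real_interval(5)[of a b]])
    show "((\<lambda>t. ln (f t)) has_real_derivative f' t / f t) (at t within {a..b})" if "t \<in> {a..b}" for t
      using f[OF that] pos[OF that] by (auto intro!: derivative_eq_intros)
    show "norm (f' t / f t) \<le> C" if "t \<in> {a..b}" for t
      using bd[OF that] pos[OF that] by (simp add: field_simps)
  qed (use st in auto)
  then have "ln (f t) \<le> C * \<bar>t - s\<bar> + ln (f s)" by simp
  then have "exp (ln (f t)) \<le> exp (C * \<bar>t - s\<bar> + ln (f s))" by simp
  then show ?thesis using pos st by (simp add: exp_add)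
qed

text \<open>The function \<open>1 - ln f\<close> satisfies a linear differential inequality, to
  which Gronwall's lemma applies. Exponentiating turns the Gronwall factor into an exponent of
  \<open>f s\<close>; the \<open>3\<close> bounds \<open>exp 1\<close>.\<close>

lemma osgood_two_sided:
  assumes f: "\<And>t. t \<in> {a..b} \<Longrightarrow> (f has_real_derivative f' t) (at t within {a..b})"
    and pos: "\<And>t. t \<in> {a..b} \<Longrightarrow> 0 < f t \<and> f t \<le> 1" and bd: "\<And>t. t \<in> {a..b} \<Longrightarrow> \<bar>f' t\<bar> \<le> C * osg (f t)"
    and st: "s \<in> {a..b}" "t \<in> {a..b}"
  shows "f t \<le> 3 * f s powr exp (- C * \<bar>t - s\<bar>)"
proof -
  define q where "q = exp (- C * \<bar>t - s\<bar>)"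
  have ln: "ln (f t) \<le> 0" if "t \<in> {a..b}" for t using pos[OF that] by simp
  have "1 - ln (f s) \<le> exp (C * \<bar>s - t\<bar>) * (1 - ln (f t))"
  proof (rule gronwall_two_sided[where f = "\<lambda>t. 1 - ln (f t)" and f' = "\<lambda>t. - (f' t / f t)" and a = a and b = b])
    show "((\<lambda>t. 1 - ln (f t)) has_real_derivative - (f' t / f t)) (at t within {a..b})" if "t \<in> {a..b}" for t
      using f[OF that] pos[OF that] by (auto intro!: derivative_eq_intros)
    show "0 < 1 - ln (f t)" if "t \<in> {a..b}" for t using ln[OF that] by linarith
    show "\<bar>- (f' t / f t)\<bar> \<le> C * (1 - ln (f t))" if "t \<in> {a..b}" for t
      using bd[OF that] pos[OF that] by (simp add: osg_def field_simps)
  qed (use st in auto)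
  then have "q * (1 - ln (f s)) \<le> 1 - ln (f t)"
    by (simp add: q_def exp_minus field_simps abs_minus_commute)
  then have "ln (f t) \<le> 1 + q * ln (f s)"
  proof -
    have "0 \<le> q" by (simp add: q_def)
    then show ?thesis using \<open>q * (1 - ln (f s)) \<le> 1 - ln (f t)\<close> by (simp add: right_diff_distrib)
  qed
  then have "exp (ln (f t)) \<le> exp (1 + q * ln (f s))" by simp
  also have "\<dots> = exp 1 * f s powr q"
    using pos[OF st(1)] by (simp add: exp_add powr_def)
  also have "\<dots> \<le> 3 * f s powr q" using exp_le by (intro mult_right_mono) auto
  finally show ?thesis using pos[OF st(2)] by (simp add: q_def)
qed

text \<open>Replacing a distance by a positive smooth majorant lets the scalar differential inequality
  be applied without excluding zeros of the distance.\<close>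

lemma norm_reg_deriv:
  fixes x :: "real \<Rightarrow> real^2"
  assumes x: "(x has_vector_derivative v) (at t within S)" and k: "k > 0"
  shows "((\<lambda>t. sqrt ((norm (x t))\<^sup>2 + k\<^sup>2)) has_real_derivative (x t \<bullet> v) / sqrt ((norm (x t))\<^sup>2 + k\<^sup>2)) (at t within S)"
    and "\<bar>(x t \<bullet> v) / sqrt ((norm (x t))\<^sup>2 + k\<^sup>2)\<bar> \<le> norm v"
    and "\<bar>(x t \<bullet> v) / sqrt ((norm (x t))\<^sup>2 + k\<^sup>2)\<bar> * sqrt ((norm (x t))\<^sup>2 + k\<^sup>2) \<le> norm (x t) * norm v"
proof -
  let ?r = "sqrt ((norm (x t))\<^sup>2 + k\<^sup>2)"
  have p: "(norm (x t))\<^sup>2 + k\<^sup>2 > 0" using k by (simp add: add_nonneg_pos)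
  then have r: "?r > 0" by simp
  have "((\<lambda>t. x t \<bullet> x t) has_derivative (\<lambda>h. x t \<bullet> (h *\<^sub>R v) + (h *\<^sub>R v) \<bullet> x t)) (at t within S)"
    using has_derivative_inner[OF x[unfolded has_vector_derivative_def] x[unfolded has_vector_derivative_def]] .
  then have "((\<lambda>t. x t \<bullet> x t) has_real_derivative 2 * (x t \<bullet> v)) (at t within S)"
    unfolding has_field_derivative_def
    by (rule has_derivative_eq_rhs) (auto simp: inner_commute)
  then have "((\<lambda>t. (norm (x t))\<^sup>2) has_real_derivative 2 * (x t \<bullet> v)) (at t within S)"
    unfolding power2_norm_eq_inner .
  from DERIV_add[OF this DERIV_const[of "k\<^sup>2"]]
  have "((\<lambda>t. (norm (x t))\<^sup>2 + k\<^sup>2) has_real_derivative 2 * (x t \<bullet> v)) (at t within S)"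
    by (simp only: add_0_right)
  from DERIV_chain2[OF DERIV_real_sqrt[OF p] this]
  show "((\<lambda>t. sqrt ((norm (x t))\<^sup>2 + k\<^sup>2)) has_real_derivative (x t \<bullet> v) / ?r) (at t within S)"
    by (rule DERIV_cong) (simp add: field_simps)
  have cs: "\<bar>x t \<bullet> v\<bar> \<le> norm (x t) * norm v" by (rule Cauchy_Schwarz_ineq2)
  have xr: "norm (x t) \<le> ?r" by (rule real_le_rsqrt) simp
  show 3: "\<bar>(x t \<bullet> v) / ?r\<bar> * ?r \<le> norm (x t) * norm v" using cs r by (simp add: abs_divide)
  also have "\<dots> \<le> norm v * ?r" using mult_left_mono[OF xr norm_ge_zero[of v]] by (simp only: mult.commute)
  finally show "\<bar>(x t \<bullet> v) / ?r\<bar> \<le> norm v" using r by (rule mult_right_le_imp_le)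
qed

lemma norm_gronwall:
  fixes x v :: "real \<Rightarrow> real^2"
  assumes x: "\<And>t. t \<in> {a..b} \<Longrightarrow> (x has_vector_derivative v t) (at t within {a..b})"
    and v: "\<And>t. t \<in> {a..b} \<Longrightarrow> norm (v t) \<le> C * norm (x t)" and C: "0 \<le> C"
    and st: "s \<in> {a..b}" "t \<in> {a..b}"
  shows "norm (x t) \<le> exp (C * \<bar>t - s\<bar>) * norm (x s)"
proof -
  let ?f = "\<lambda>k t. sqrt ((norm (x t))\<^sup>2 + k\<^sup>2)"
  have "norm (x t) \<le> exp (C * \<bar>t - s\<bar>) * (norm (x s) + k)" if k: "k > 0" for k
  proof -
    have fp: "0 < ?f k t" for t using k by (simp add: add_nonneg_pos)
    have "?f k t \<le> exp (C * \<bar>t - s\<bar>) * ?f k s"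
    proof (rule gronwall_two_sided[where f = "?f k" and f' = "\<lambda>t. (x t \<bullet> v t) / ?f k t" and a = a and b = b])
      fix t assume t: "t \<in> {a..b}"
      show "(?f k has_real_derivative (x t \<bullet> v t) / ?f k t) (at t within {a..b})"
        by (rule norm_reg_deriv(1)[OF x[OF t] k])
      show "0 < ?f k t" by (rule fp)
      define F where "F = ?f k t"
      have F: "0 < F" "F * F = (norm (x t))\<^sup>2 + k\<^sup>2" using fp[of t] by (auto simp: F_def)
      have "\<bar>(x t \<bullet> v t) / F\<bar> * F \<le> norm (x t) * norm (v t)"
        unfolding F_def by (rule norm_reg_deriv(3)[OF x[OF t] k])
      also have "\<dots> \<le> norm (x t) * (C * norm (x t))" by (intro mult_left_mono v t) simp
      also have "\<dots> = C * (norm (x t))\<^sup>2" by (simp add: power2_eq_square)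
      also have "\<dots> \<le> C * (F * F)" unfolding F using C by (intro mult_left_mono) auto
      also have "\<dots> = (C * F) * F" by simp
      finally have "\<bar>(x t \<bullet> v t) / F\<bar> \<le> C * F" using F(1) by (rule mult_right_le_imp_le)
      then show "\<bar>(x t \<bullet> v t) / ?f k t\<bar> \<le> C * ?f k t" by (simp only: F_def)
    qed (use st in auto)
    moreover have "norm (x t) \<le> ?f k t" by (rule real_le_rsqrt) simp
    moreover have "?f k s \<le> norm (x s) + k" using k by (intro real_le_lsqrt) (auto simp: power2_sum)
    then have "exp (C * \<bar>t - s\<bar>) * ?f k s \<le> exp (C * \<bar>t - s\<bar>) * (norm (x s) + k)"
      by (rule mult_left_mono) simp
    ultimately show ?thesis by linarith
  qed
  note * = this
  have "((\<lambda>k. exp (C * \<bar>t - s\<bar>) * (norm (x s) + k)) \<longlongrightarrow> exp (C * \<bar>t - s\<bar>) * (norm (x s) + 0)) (at_right 0)"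
    by (intro tendsto_intros)
  then have "norm (x t) \<le> exp (C * \<bar>t - s\<bar>) * (norm (x s) + 0)"
  proof (rule tendsto_lowerbound)
    show "\<forall>\<^sub>F k in at_right 0. norm (x t) \<le> exp (C * \<bar>t - s\<bar>) * (norm (x s) + k)"
    proof (rule eventually_at_rightI[of 0 1])
      fix k :: real assume "k \<in> {0<..<1}"
      then show "norm (x t) \<le> exp (C * \<bar>t - s\<bar>) * (norm (x s) + k)" by (intro *) auto
    qed auto
  qed simp
  then show ?thesis by simp
qed

text \<open>Distances are divided by \<open>4 * R\<close> in order to stay in the range where
  \<open>osg\<close> is increasing: the smooth majorant is at most \<open>2 * R + k\<close> with
  \<open>k \<le> R\<close>. The case \<open>norm (x s) = 0\<close> is included and yields uniqueness
  for the flow.\<close>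

lemma norm_osgood:
  fixes x v :: "real \<Rightarrow> real^2"
  assumes x: "\<And>t. t \<in> {a..b} \<Longrightarrow> (x has_vector_derivative v t) (at t within {a..b})"
    and v: "\<And>t. t \<in> {a..b} \<Longrightarrow> norm (v t) \<le> 4 * R * C * osg (norm (x t) / (4 * R))" and C: "0 \<le> C" "0 < R"
    and bd: "\<And>t. t \<in> {a..b} \<Longrightarrow> norm (x t) \<le> 2 * R"
    and st: "s \<in> {a..b}" "t \<in> {a..b}"
  shows "norm (x t) / (4 * R) \<le> 3 * (norm (x s) / (4 * R)) powr exp (- C * \<bar>t - s\<bar>)"
proof -
  let ?q = "exp (- C * \<bar>t - s\<bar>)"
  let ?f = "\<lambda>k t. sqrt ((norm (x t))\<^sup>2 + k\<^sup>2) / (4 * R)"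
  have "norm (x t) / (4 * R) \<le> 3 * ((norm (x s) + k) / (4 * R)) powr ?q" if k: "k > 0" "k \<le> R" for k
  proof -
    have sp: "0 < sqrt ((norm (x t))\<^sup>2 + k\<^sup>2)" for t using k by (simp add: add_nonneg_pos)
    have sl: "sqrt ((norm (x t))\<^sup>2 + k\<^sup>2) \<le> norm (x t) + k" for t
      using k by (intro real_le_lsqrt) (auto simp: power2_sum)
    have sg: "norm (x t) \<le> sqrt ((norm (x t))\<^sup>2 + k\<^sup>2)" for t by (rule real_le_rsqrt) simp
    have f1: "?f k t \<le> 1" if "t \<in> {a..b}" for t
    proof -
      have "sqrt ((norm (x t))\<^sup>2 + k\<^sup>2) \<le> 4 * R" using sl[of t] bd[OF that] k C by linarith
      then show ?thesis using C by (subst divide_le_eq_1_pos) auto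
    qed
    have "?f k t \<le> 3 * ?f k s powr ?q"
    proof (rule osgood_two_sided[where f = "?f k" and f' = "\<lambda>t. (x t \<bullet> v t) / sqrt ((norm (x t))\<^sup>2 + k\<^sup>2) / (4 * R)" and a = a and b = b])
      fix t assume t: "t \<in> {a..b}"
      show "(?f k has_real_derivative (x t \<bullet> v t) / sqrt ((norm (x t))\<^sup>2 + k\<^sup>2) / (4 * R)) (at t within {a..b})"
        by (rule DERIV_cdivide[OF norm_reg_deriv(1)[OF x[OF t] k(1)]])
      show "0 < ?f k t \<and> ?f k t \<le> 1" using sp[of t] f1[OF t] C by simp
      define X where "X = (x t \<bullet> v t) / sqrt ((norm (x t))\<^sup>2 + k\<^sup>2)"
      have "\<bar>X\<bar> \<le> 4 * R * C * osg (norm (x t) / (4 * R))"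
        unfolding X_def using norm_reg_deriv(2)[OF x[OF t] k(1)] v[OF t] by (rule order_trans)
      also have "\<dots> \<le> 4 * R * C * osg (?f k t)"
        using C sg[of t] f1[OF t] by (intro mult_left_mono osg_mono divide_right_mono) auto
      finally have "\<bar>X\<bar> \<le> C * osg (?f k t) * (4 * R)" by (simp only: mult_ac)
      then have "\<bar>X\<bar> / (4 * R) \<le> C * osg (?f k t)"
        using C by (subst pos_divide_le_eq) auto
      moreover have "\<bar>X / (4 * R)\<bar> = \<bar>X\<bar> / (4 * R)" using C by (simp add: abs_divide)
      ultimately show "\<bar>(x t \<bullet> v t) / sqrt ((norm (x t))\<^sup>2 + k\<^sup>2) / (4 * R)\<bar> \<le> C * osg (?f k t)"
        by (simp only: X_def)
    qed (use st in auto)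
    moreover have "norm (x t) / (4 * R) \<le> ?f k t" using sg[of t] C by (intro divide_right_mono) auto
    moreover have "?f k s powr ?q \<le> ((norm (x s) + k) / (4 * R)) powr ?q"
      using sl[of s] sp[of s] C by (intro powr_mono2 divide_right_mono) auto
    ultimately show ?thesis by linarith
  qed
  note * = this
  have "((\<lambda>k. 3 * ((norm (x s) + k) / (4 * R)) powr ?q) \<longlongrightarrow> 3 * ((norm (x s) + 0) / (4 * R)) powr ?q) (at_right 0)"
  proof (rule tendsto_mult[OF tendsto_const], rule tendsto_powr2[OF _ tendsto_const])
    show "((\<lambda>k. (norm (x s) + k) / (4 * R)) \<longlongrightarrow> (norm (x s) + 0) / (4 * R)) (at_right 0)"
      by (rule tendsto_divide[OF tendsto_add[OF tendsto_const tendsto_ident_at] tendsto_const]) (use C in simp)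
    show "\<forall>\<^sub>F k in at_right 0. 0 \<le> (norm (x s) + k) / (4 * R)"
      by (rule eventually_at_rightI[of 0 1]) (use C in auto)
  qed simp
  then have "norm (x t) / (4 * R) \<le> 3 * ((norm (x s) + 0) / (4 * R)) powr ?q"
  proof (rule tendsto_lowerbound)
    show "\<forall>\<^sub>F k in at_right 0. norm (x t) / (4 * R) \<le> 3 * ((norm (x s) + k) / (4 * R)) powr ?q"
    proof (rule eventually_at_rightI[of 0 R])
      fix k assume "k \<in> {0<..<R}"
      then show "norm (x t) / (4 * R) \<le> 3 * ((norm (x s) + k) / (4 * R)) powr ?q" by (intro *) auto
    qed (use C in auto)
  qed simp
  then show ?thesis by simp
qed

section \<open>Growth, Hoelder continuity and symmetry of the flow\<close>

locale flow_solution =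
  fixes m :: nat and w0 :: "real^2 \<Rightarrow> real" and w :: "real \<Rightarrow> real^2 \<Rightarrow> real"
    and u :: "real \<Rightarrow> real^2 \<Rightarrow> real^2" and \<Phi> :: "real \<Rightarrow> real^2 \<Rightarrow> real^2" and M :: real
  assumes m3: "m \<ge> 3" and M0: "0 \<le> M"
    and w_meas: "\<And>t. 0 \<le> t \<Longrightarrow> w t \<in> borel_measurable lebesgue"
    and w_bd: "\<And>t. 0 \<le> t \<Longrightarrow> AE x in lebesgue. \<bar>w t x\<bar> \<le> M"
    and w_sym: "\<And>t. 0 \<le> t \<Longrightarrow> sym_scalar m (w t)"
    and vel: "\<And>t. 0 \<le> t \<Longrightarrow> velocity_of m (w t) (u t)"
    and \<Phi>_0: "\<Phi> 0 x = x"
    and ode: "\<And>t x. 0 \<le> t \<Longrightarrow> ((\<lambda>s. \<Phi> s x) has_vector_derivative u t (\<Phi> t x)) (at t within {0..})"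
    and \<Phi>_bij: "\<And>t. 0 \<le> t \<Longrightarrow> bij (\<Phi> t)"
    and transport: "\<And>t x. 0 \<le> t \<Longrightarrow> x \<noteq> 0 \<Longrightarrow> w t x = w0 (inv (\<Phi> t) x)"
begin

lemma symmetric_velocity_at: "0 \<le> t \<Longrightarrow> symmetric_velocity m (w t) (u t) M"
  by unfold_locales (use m3 M0 w_meas w_bd w_sym vel in auto)

lemma u_growth: "0 \<le> t \<Longrightarrow> norm (u t x) \<le> 4 * M * norm x"
  by (rule symmetric_velocity.velocity_growth[OF symmetric_velocity_at])

lemma u_loglip:
  "0 \<le> t \<Longrightarrow> 0 < R \<Longrightarrow> norm x \<le> R \<Longrightarrow> norm y \<le> R \<Longrightarrow> norm (u t x - u t y) \<le> 320 * M * R * osg (norm (x - y) / (4 * R))"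
  by (rule symmetric_velocity.velocity_log_lipschitz[OF symmetric_velocity_at])

lemma ode_on: "0 \<le> a \<Longrightarrow> t \<in> {a..b} \<Longrightarrow> ((\<lambda>s. \<Phi> s x) has_vector_derivative u t (\<Phi> t x)) (at t within {a..b})"
  by (rule has_vector_derivative_within_subset[OF ode]) auto

lemma \<Phi>_growth:
  assumes "0 \<le> s" "0 \<le> t"
  shows "norm (\<Phi> t x) \<le> exp (4 * M * \<bar>t - s\<bar>) * norm (\<Phi> s x)"
proof (rule norm_gronwall[where x = "\<lambda>r. \<Phi> r x" and a = 0 and b = "max s t" and v = "\<lambda>t. u t (\<Phi> t x)"])
  show "((\<lambda>s. \<Phi> s x) has_vector_derivative u r (\<Phi> r x)) (at r within {0..max s t})" if "r \<in> {0..max s t}" for r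
    using that by (intro ode_on) auto
  show "norm (u r (\<Phi> r x)) \<le> 4 * M * norm (\<Phi> r x)" if "r \<in> {0..max s t}" for r
    using that by (intro u_growth) auto
qed (use M0 assms in auto)

text \<open>The log-Lipschitz constant \<open>320 * M * R\<close> is
  \<open>4 * R * (80 * M)\<close>, hence the \<open>80\<close>. The exponent decreases with the
  elapsed time, the usual loss under an Osgood condition. Since \<open>s\<close> and
  \<open>t\<close> may come in either order, the inverse flow is covered too.\<close>

lemma \<Phi>_holder:
  assumes st: "0 \<le> s" "0 \<le> t" and R: "0 < R"
    and bd: "\<And>r. min s t \<le> r \<Longrightarrow> r \<le> max s t \<Longrightarrow> norm (\<Phi> r x) \<le> R \<and> norm (\<Phi> r y) \<le> R"
  shows "norm (\<Phi> t x - \<Phi> t y) / (4 * R) \<le> 3 * (norm (\<Phi> s x - \<Phi> s y) / (4 * R)) powr exp (- (80 * M) * \<bar>t - s\<bar>)"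
proof  (rule norm_osgood[where x = "\<lambda>r. \<Phi> r x - \<Phi> r y" and a = "min s t" and b = "max s t" and v = "\<lambda>t. u t (\<Phi> t x) - u t (\<Phi> t y)"])
  fix r assume r: "r \<in> {min s t..max s t}"
  show "((\<lambda>r. \<Phi> r x - \<Phi> r y) has_vector_derivative u r (\<Phi> r x) - u r (\<Phi> r y)) (at r within {min s t..max s t})"
    using r st by (intro has_vector_derivative_diff ode_on) auto
  have b: "norm (\<Phi> r x) \<le> R" "norm (\<Phi> r y) \<le> R" using bd[of r] r by auto
  show "norm (u r (\<Phi> r x) - u r (\<Phi> r y)) \<le> 4 * R * (80 * M) * osg (norm (\<Phi> r x - \<Phi> r y) / (4 * R))"
  proof -
    have "0 \<le> r" using r st by (auto simp: min_def split: if_splits)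
    then show ?thesis using u_loglip[OF _ R b, of r] by (simp add: mult_ac)
  qed
  show "norm (\<Phi> r x - \<Phi> r y) \<le> 2 * R"
    using b norm_triangle_ineq4[of "\<Phi> r x" "\<Phi> r y"] by linarith
qed (use R M0 in auto)

lemma \<Phi>_zero: "0 \<le> t \<Longrightarrow> \<Phi> t 0 = 0"
  using \<Phi>_growth[of 0 t 0] by (simp add: \<Phi>_0)

lemma inv_\<Phi> [simp]: "0 \<le> t \<Longrightarrow> \<Phi> t (inv (\<Phi> t) x) = x" "0 \<le> t \<Longrightarrow> inv (\<Phi> t) (\<Phi> t x) = x"
  using \<Phi>_bij[of t] by (auto simp: bij_def surj_f_inv_f inv_f_f)

text \<open>The transition from time \<open>s\<close> to time \<open>t\<close>. As
  \<open>t < s\<close> is allowed, its estimates apply to the flow and to the inverse flow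
  alike.\<close>

definition T :: "real \<Rightarrow> real \<Rightarrow> real^2 \<Rightarrow> real^2" where "T s t x = \<Phi> t (inv (\<Phi> s) x)"

lemma T_growth: "0 \<le> s \<Longrightarrow> 0 \<le> t \<Longrightarrow> norm (T s t x) \<le> exp (4 * M * \<bar>t - s\<bar>) * norm x"
  using \<Phi>_growth[of s t "inv (\<Phi> s) x"] by (simp add: T_def)

lemma T_T: "0 \<le> r \<Longrightarrow> T r t (T s r x) = T s t x"
  by (simp add: T_def)

lemma T_same: "0 \<le> s \<Longrightarrow> T s s x = x"
  by (simp add: T_def)

lemma T_ode: "0 \<le> t \<Longrightarrow> ((\<lambda>t. T s t x) has_vector_derivative u t (T s t x)) (at t within {0..})"
  unfolding T_def by (rule ode)

text \<open>Trajectories that start in the disc of radius \<open>R\<close> stay in the disc whose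
  radius is enlarged by the growth factor; there the Hoelder estimate is applied.\<close>

lemma T_holder:
  assumes st: "0 \<le> s" "0 \<le> t" and R: "0 < R" "norm x \<le> R" "norm y \<le> R"
  shows "norm (T s t x - T s t y) / (4 * (exp (4 * M * \<bar>t - s\<bar>) * R))
    \<le> 3 * (norm (x - y) / (4 * (exp (4 * M * \<bar>t - s\<bar>) * R))) powr exp (- (80 * M) * \<bar>t - s\<bar>)"
proof -
  have b: "norm (\<Phi> r (inv (\<Phi> s) x)) \<le> exp (4 * M * \<bar>t - s\<bar>) * R" if r: "min s t \<le> r" "r \<le> max s t" and x: "norm x \<le> R" for r x
  proof -
    have "norm (\<Phi> r (inv (\<Phi> s) x)) \<le> exp (4 * M * \<bar>r - s\<bar>) * norm x"
      using \<Phi>_growth[of s r "inv (\<Phi> s) x"] st r by simp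
    also have "\<dots> \<le> exp (4 * M * \<bar>t - s\<bar>) * R"
      using M0 r x by (intro mult_mono) (auto intro!: mult_left_mono)
    finally show ?thesis .
  qed
  show ?thesis
    using \<Phi>_holder[OF st, of "exp (4 * M * \<bar>t - s\<bar>) * R" "inv (\<Phi> s) x" "inv (\<Phi> s) y"] b R st
    by (simp add: T_def)
qed

lemma T_continuous:
  assumes "0 \<le> s" "0 \<le> t"
  shows "continuous_on UNIV (T s t)"
  unfolding continuous_on_eq_continuous_at[OF open_UNIV] 
proof (intro ballI)
  fix x :: "real^2"
  define R where "R = norm x + 1"
  define E where "E = exp (4 * M * \<bar>t - s\<bar>) * R"
  define q where "q = exp (- (80 * M) * \<bar>t - s\<bar>)"
  have R: "R > 0" "norm x \<le> R" by (auto simp: R_def add_nonneg_pos)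
  have E: "E > 0" using R by (simp add: E_def)
  have "((\<lambda>y. norm (x - y) / (4 * E)) \<longlongrightarrow> norm (x - x) / (4 * E)) (at x)"
    using E by (intro tendsto_intros) auto
  then have "((\<lambda>y. (norm (x - y) / (4 * E)) powr q) \<longlongrightarrow> (norm (x - x) / (4 * E)) powr q) (at x)"
    by (rule tendsto_powr2[OF _ tendsto_const]) (use E in \<open>auto simp: q_def\<close>)
  from tendsto_mult[OF tendsto_mult[OF tendsto_const[of 3] this] tendsto_const[of "4 * E"]]
  have "((\<lambda>y. 3 * (norm (x - y) / (4 * E)) powr q * (4 * E)) \<longlongrightarrow> 3 * 0 powr q * (4 * E)) (at x)"
    by simp
  then have l: "((\<lambda>y. 3 * (norm (x - y) / (4 * E)) powr q * (4 * E)) \<longlongrightarrow> 0) (at x)" by (simp add: q_def)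
  have "((\<lambda>y. T s t y - T s t x) \<longlongrightarrow> 0) (at x)"
  proof (rule Lim_null_comparison[OF _ l])
    have "\<forall>\<^sub>F y in at x. dist y x < 1" unfolding eventually_at by (intro exI[of _ 1]) auto
    then show "\<forall>\<^sub>F y in at x. norm (T s t y - T s t x) \<le> 3 * (norm (x - y) / (4 * E)) powr q * (4 * E)"
    proof eventually_elim
      case (elim y)
      then have "norm y \<le> R" using norm_triangle_ineq[of x "y - x"] by (simp add: R_def dist_norm)
      from T_holder[OF assms R this]
      have "norm (T s t x - T s t y) / (4 * E) \<le> 3 * (norm (x - y) / (4 * E)) powr q"
        by (simp only: E_def q_def)
      then have "norm (T s t x - T s t y) \<le> 3 * (norm (x - y) / (4 * E)) powr q * (4 * E)"
        using E by (subst (asm) pos_divide_le_eq) auto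
      then show ?case by (simp only: norm_minus_commute[of "T s t y" "T s t x"])
    qed
  qed
  then show "isCont (T s t) x" unfolding isCont_def by (rule LIM_zero_cancel)
qed

lemma \<Phi>_eq_T: "0 \<le> t \<Longrightarrow> \<Phi> t = T 0 t"
  by (rule ext) (use inv_\<Phi>(2)[of 0] in \<open>simp add: T_def \<Phi>_0\<close>)

lemma inv_\<Phi>_eq_T: "0 \<le> t \<Longrightarrow> inv (\<Phi> t) = T t 0"
  by (rule ext) (simp add: T_def \<Phi>_0)

lemma \<Phi>_continuous: "0 \<le> t \<Longrightarrow> continuous_on UNIV (\<Phi> t)"
  using T_continuous[of 0 t] by (simp add: \<Phi>_eq_T)

lemma inv_\<Phi>_continuous: "0 \<le> t \<Longrightarrow> continuous_on UNIV (inv (\<Phi> t))"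
  using T_continuous[of t 0] by (simp add: inv_\<Phi>_eq_T)

text \<open>Both sides solve the same differential equation with the same initial value, since the
  velocity is symmetric; Osgood's estimate with initial distance \<open>0\<close> makes them
  equal.\<close>

lemma \<Phi>_rot:
  assumes t: "0 \<le> t"
  shows "\<Phi> t (rot (2 * pi / real m) x) = rot (2 * pi / real m) (\<Phi> t x)"
proof -
  let ?\<theta> = "2 * pi / real m"
  define R where "R = exp (4 * M * t) * (norm x + 1)"
  have R: "R > 0" by (simp add: R_def add_nonneg_pos)
  have lin: "bounded_linear (rot ?\<theta>)"
    using orthogonal_transformation_linear[OF orthogonal_rot] by (rule linear_conv_bounded_linear[THEN iffD1])
  have b: "norm (\<Phi> r y) \<le> R" if "r \<in> {0..t}" "norm y = norm x" for r y
  proof -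
    have "norm (\<Phi> r y) \<le> exp (4 * M * \<bar>r - 0\<bar>) * norm (\<Phi> 0 y)" by (rule \<Phi>_growth) (use that in auto)
    also have "\<dots> \<le> exp (4 * M * t) * (norm x + 1)"
      using that M0 by (intro mult_mono) (auto simp: \<Phi>_0 intro!: mult_left_mono)
    finally show ?thesis by (simp add: R_def)
  qed
  have "norm (\<Phi> t (rot ?\<theta> x) - rot ?\<theta> (\<Phi> t x)) / (4 * R) \<le> 3 * (norm (\<Phi> 0 (rot ?\<theta> x) - rot ?\<theta> (\<Phi> 0 x)) / (4 * R)) powr exp (- (80 * M) * \<bar>t - 0\<bar>)"
  proof (rule norm_osgood[where x = "\<lambda>r. \<Phi> r (rot ?\<theta> x) - rot ?\<theta> (\<Phi> r x)" and a = 0 and b = t and v = "\<lambda>t. u t (\<Phi> t (rot ?\<theta> x)) - u t (rot ?\<theta> (\<Phi> t x))"])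
    fix r assume r: "r \<in> {0..t}"
    have "u r (rot ?\<theta> (\<Phi> r x)) = rot ?\<theta> (u r (\<Phi> r x))"
      using vel[of r] r by (simp add: velocity_of_def sym_field_def)
    then show "((\<lambda>r. \<Phi> r (rot ?\<theta> x) - rot ?\<theta> (\<Phi> r x)) has_vector_derivative u r (\<Phi> r (rot ?\<theta> x)) - u r (rot ?\<theta> (\<Phi> r x))) (at r within {0..t})"
      using r bounded_linear.has_vector_derivative[OF lin ode_on[of 0 r t x]]
      by (auto intro!: has_vector_derivative_diff ode_on)
    have bb: "norm (\<Phi> r (rot ?\<theta> x)) \<le> R" "norm (rot ?\<theta> (\<Phi> r x)) \<le> R" using b[OF r] by auto
    show "norm (u r (\<Phi> r (rot ?\<theta> x)) - u r (rot ?\<theta> (\<Phi> r x))) \<le> 4 * R * (80 * M) * osg (norm (\<Phi> r (rot ?\<theta> x) - rot ?\<theta> (\<Phi> r x)) / (4 * R))"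
      using u_loglip[OF _ R bb, of r] r by (simp add: mult_ac)
    show "norm (\<Phi> r (rot ?\<theta> x) - rot ?\<theta> (\<Phi> r x)) \<le> 2 * R"
      using bb norm_triangle_ineq4[of "\<Phi> r (rot ?\<theta> x)" "rot ?\<theta> (\<Phi> r x)"] by linarith
  qed (use t R M0 in auto)
  then show ?thesis using R by (simp add: \<Phi>_0 divide_le_0_iff)
qed

end

section \<open>Mollification and volume\<close>

text \<open>Dominated convergence of the difference quotients, with majorant \<open>2 * g\<close>.
  Working within a set \<open>S\<close> covers both uses: points in a ball, for mollifications, and
  times in a closed interval, for integrals along the flow.\<close>

lemma has_derivative_integral:
  fixes f :: "'x::euclidean_space \<Rightarrow> 'z \<Rightarrow> 'b::{banach, second_countable_topology}"
  assumes x: "x \<in> S"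
    and d: "\<And>z. z \<in> space M \<Longrightarrow> ((\<lambda>y. f y z) has_derivative f' z) (at x within S)"
    and i: "\<And>y. y \<in> S \<Longrightarrow> integrable M (f y)" and i': "\<And>k. integrable M (\<lambda>z. f' z k)"
    and lip: "\<And>y z. y \<in> S \<Longrightarrow> z \<in> space M \<Longrightarrow> norm (f y z - f x z) \<le> norm (y - x) * g z"
    and lip': "\<And>k z. z \<in> space M \<Longrightarrow> norm (f' z k) \<le> norm k * g z"
    and g: "integrable M g"
  shows "((\<lambda>y. \<integral>z. f y z \<partial>M) has_derivative (\<lambda>k. \<integral>z. f' z k \<partial>M)) (at x within S)"
  unfolding has_derivative_iff_norm
proof
  have bl: "bounded_linear (f' z)" if "z \<in> space M" for z using d[OF that] by (rule has_derivative_bounded_linear)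
  show "bounded_linear (\<lambda>k. \<integral>z. f' z k \<partial>M)"
  proof (rule bounded_linear_intro[where K = "\<integral>z. g z \<partial>M"])
    show "(\<integral>z. f' z (k + l) \<partial>M) = (\<integral>z. f' z k \<partial>M) + (\<integral>z. f' z l \<partial>M)" for k l
      unfolding Bochner_Integration.integral_add[OF i' i', symmetric]
      by (intro Bochner_Integration.integral_cong refl linear_add bounded_linear.linear bl)
    show "(\<integral>z. f' z (r *\<^sub>R k) \<partial>M) = r *\<^sub>R (\<integral>z. f' z k \<partial>M)" for r k
      unfolding integral_scaleR_right[symmetric]
      by (intro Bochner_Integration.integral_cong refl linear_scale bounded_linear.linear bl)
    show "norm (\<integral>z. f' z k \<partial>M) \<le> norm k * (\<integral>z. g z \<partial>M)" for k
    proof -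
      have "norm (\<integral>z. f' z k \<partial>M) \<le> (\<integral>z. norm (f' z k) \<partial>M)" by (rule integral_norm_bound)
      also have "\<dots> \<le> (\<integral>z. norm k * g z \<partial>M)"
        by (intro integral_mono integrable_norm i' integrable_mult_right g lip')
      finally show ?thesis by simp
    qed
  qed
  show "((\<lambda>y. norm ((\<integral>z. f y z \<partial>M) - (\<integral>z. f x z \<partial>M) - (\<integral>z. f' z (y - x) \<partial>M)) / norm (y - x)) \<longlongrightarrow> 0) (at x within S)"
    unfolding tendsto_at_iff_sequentially
  proof (intro allI impI)
    fix X :: "nat \<Rightarrow> 'x" assume X: "\<forall>n. X n \<in> S - {x}" "X \<longlonglongrightarrow> x"
    define E where "E = (\<lambda>n z. (f (X n) z - f x z - f' z (X n - x)) /\<^sub>R norm (X n - x))"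
    have p: "norm (X n - x) > 0" for n using X(1) by auto
    have iE: "integrable M (E n)" for n
      unfolding E_def using X(1) x
      by (intro integrable_scaleR_right Bochner_Integration.integrable_diff i i') auto
    have "(\<lambda>n. \<integral>z. E n z \<partial>M) \<longlonglongrightarrow> (\<integral>z. 0 \<partial>M)"
    proof (rule integral_dominated_convergence)
      show "integrable M (\<lambda>z. 2 * g z)" by (intro integrable_mult_right g)
      show "E n \<in> borel_measurable M" for n using iE by auto
      show "AE z in M. (\<lambda>n. E n z) \<longlonglongrightarrow> 0"
      proof (rule AE_I2)
        fix z assume z: "z \<in> space M"
        have "((\<lambda>y. norm ((f y z - f x z) - f' z (y - x)) / norm (y - x)) \<longlongrightarrow> 0) (at x within S)"
          using d[OF z] unfolding has_derivative_iff_norm by blast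
        then have "(\<lambda>n. norm ((f (X n) z - f x z) - f' z (X n - x)) / norm (X n - x)) \<longlonglongrightarrow> 0"
          using X unfolding tendsto_at_iff_sequentially by (auto simp: comp_def)
        moreover have "norm (E n z) = norm ((f (X n) z - f x z) - f' z (X n - x)) / norm (X n - x)" for n
          by (simp add: E_def divide_inverse mult.commute)
        ultimately show "(\<lambda>n. E n z) \<longlonglongrightarrow> 0" by (intro tendsto_norm_zero_cancel[of "\<lambda>n. E n z"]) simp
      qed
      show "AE z in M. norm (E n z) \<le> 2 * g z" for n
      proof (rule AE_I2)
        fix z assume z: "z \<in> space M"
        have "norm (f (X n) z - f x z - f' z (X n - x)) \<le> norm (X n - x) * g z + norm (X n - x) * g z"
        proof -
          have "norm (f (X n) z - f x z) \<le> norm (X n - x) * g z" by (rule lip) (use X(1) z in auto)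
          moreover have "norm (f' z (X n - x)) \<le> norm (X n - x) * g z" by (rule lip'[OF z])
          ultimately show ?thesis using norm_triangle_ineq4[of "f (X n) z - f x z" "f' z (X n - x)"] by linarith
        qed
        then have "norm (f (X n) z - f x z - f' z (X n - x)) / norm (X n - x) \<le> 2 * g z"
          using p[of n] by (subst pos_divide_le_eq) (auto simp: mult_ac)
        moreover have "norm (E n z) = norm (f (X n) z - f x z - f' z (X n - x)) / norm (X n - x)"
          by (simp add: E_def divide_inverse mult.commute)
        ultimately show "norm (E n z) \<le> 2 * g z" by simp
      qed
    qed simp
    then have "(\<lambda>n. norm (\<integral>z. E n z \<partial>M)) \<longlonglongrightarrow> 0" by (simp add: tendsto_norm_zero)
    moreover have "norm (\<integral>z. E n z \<partial>M) = norm ((\<integral>z. f (X n) z \<partial>M) - (\<integral>z. f x z \<partial>M) - (\<integral>z. f' z (X n - x) \<partial>M)) / norm (X n - x)" for n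
    proof -
      have iX: "integrable M (f (X n))" "integrable M (f x)" using i X(1) x by auto
      have "(\<integral>z. E n z \<partial>M) = ((\<integral>z. f (X n) z \<partial>M) - (\<integral>z. f x z \<partial>M) - (\<integral>z. f' z (X n - x) \<partial>M)) /\<^sub>R norm (X n - x)"
        unfolding E_def using iX i'
        by (subst integral_scaleR_right) (simp add: Bochner_Integration.integral_diff)
      then show ?thesis by (simp add: divide_inverse mult.commute)
    qed
    ultimately show "((\<lambda>y. norm ((\<integral>z. f y z \<partial>M) - (\<integral>z. f x z \<partial>M) - (\<integral>z. f' z (y - x) \<partial>M)) / norm (y - x)) \<circ> X) \<longlonglongrightarrow> 0"
      by (simp add: comp_def)
  qed
qed

section \<open>The mollifier\<close>

definition rho :: "real \<Rightarrow> real^2 \<Rightarrow> real^2 \<Rightarrow> real" where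
  "rho e z x = bump (1 - (norm (x - z))\<^sup>2 / e\<^sup>2)"

definition drho :: "real \<Rightarrow> real^2 \<Rightarrow> real^2 \<Rightarrow> 2 \<Rightarrow> real" where
  "drho e z x i = - bump' (1 - (norm (x - z))\<^sup>2 / e\<^sup>2) * (2 * ((x - z) $ i) / e\<^sup>2)"

lemma rho_deriv: "(rho e z has_derivative (\<lambda>h. drho e z x 1 * h$1 + drho e z x 2 * h$2)) (at x)"
  unfolding rho_def[abs_def] drho_def by (rule radial_bump_deriv)

text \<open>The kernel depends on \<open>x - z\<close> only. Hence the derivative of a mollification
  in \<open>x\<close> is, up to sign, the derivative of a test function in \<open>z\<close>, and the
  weak form of incompressibility applies to it.\<close>

lemma drho_commute: "drho e z x i = - drho e x z i"
proof -
  have "(x - z) $ i = - ((z - x) $ i)" by simp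
  then show ?thesis unfolding drho_def norm_minus_commute[of x z]
    by (simp del: vector_minus_component)
qed

lemma rho_nonneg: "0 \<le> rho e z x" by (simp add: rho_def bump_nonneg)

lemma outside_arg: assumes "e > 0" "e \<le> norm (x - z)" shows "1 - (norm (x - z))\<^sup>2 / e\<^sup>2 \<le> (0::real)"
proof -
  have "e\<^sup>2 \<le> (norm (x - z))\<^sup>2" using assms by (intro power_mono) auto
  then show ?thesis using assms by simp
qed

lemma rho_outside: "e > 0 \<Longrightarrow> e \<le> norm (x - z) \<Longrightarrow> rho e z x = 0"
  unfolding rho_def by (rule bump_zero[OF outside_arg])

lemma drho_outside: "e > 0 \<Longrightarrow> e \<le> norm (x - z) \<Longrightarrow> drho e z x i = 0"
  unfolding drho_def using bump'_zero[OF outside_arg[of e x z]] by simp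

lemma drho_bound:
  fixes h :: "real^2"
  assumes e: "e > 0"
  shows "norm (drho e z x 1 * h$1 + drho e z x 2 * h$2) \<le> 4 / e * norm h"
proof (cases "norm (x - z) < e")
  case True
  let ?b = "bump' (1 - (norm (x - z))\<^sup>2 / e\<^sup>2)"
  have "drho e z x 1 * h$1 + drho e z x 2 * h$2 = - (?b * (2 / e\<^sup>2)) * ((x - z) \<bullet> h)"
    by (simp add: drho_def inner_vec_def sum_2 divide_inverse algebra_simps)
  then have "norm (drho e z x 1 * h$1 + drho e z x 2 * h$2) = ?b * (2 / e\<^sup>2) * \<bar>(x - z) \<bullet> h\<bar>"
    by (simp add: abs_mult bump'_nonneg)
  also have "\<dots> \<le> 2 * (2 / e\<^sup>2) * (e * norm h)"
  proof (intro mult_mono)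
    have "\<bar>(x - z) \<bullet> h\<bar> \<le> norm (x - z) * norm h" by (rule Cauchy_Schwarz_ineq2)
    also have "\<dots> \<le> e * norm h" using True by (intro mult_right_mono) auto
    finally show "\<bar>(x - z) \<bullet> h\<bar> \<le> e * norm h" .
  qed (use bump'_le bump'_nonneg e in auto)
  also have "\<dots> = 4 / e * norm h" using e by (simp add: power2_eq_square)
  finally show ?thesis .
next
  case False
  then show ?thesis using drho_outside[OF e, of x z] e by simp
qed

lemma rho_lipschitz: assumes e: "e > 0" shows "norm (rho e z y - rho e z x) \<le> 4 / e * norm (y - x)"
proof (rule differentiable_bound[where S = UNIV and f' = "\<lambda>x (h::real^2). drho e z x 1 * h$1 + drho e z x 2 * h$2"])
  show "(rho e z has_derivative (\<lambda>h. drho e z x 1 * h$1 + drho e z x 2 * h$2)) (at x within UNIV)" for x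
    using rho_deriv by simp
  show "onorm (\<lambda>h::real^2. drho e z x 1 * h$1 + drho e z x 2 * h$2) \<le> 4 / e" for x
    by (rule onorm_le) (rule drho_bound[OF e])
qed auto

lemma continuous_rho [continuous_intros]: "continuous_on S f \<Longrightarrow> continuous_on S g \<Longrightarrow> continuous_on S (\<lambda>x. rho e (f x) (g x))"
  unfolding rho_def divide_inverse by (intro continuous_intros)

lemma continuous_drho [continuous_intros]: "continuous_on S f \<Longrightarrow> continuous_on S g \<Longrightarrow> continuous_on S (\<lambda>x. drho e (f x) (g x) i)"
  unfolding drho_def divide_inverse by (intro continuous_intros)

lemma integrable_cball_support:
  fixes f :: "real^2 \<Rightarrow> 'b::{banach, second_countable_topology}"
  assumes "continuous_on UNIV f" "\<And>x. norm (x - a) \<ge> R \<Longrightarrow> f x = 0"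
  shows "integrable lborel f"
proof -
  have "integrable lborel (\<lambda>x. indicator (cball a R) x *\<^sub>R f x)"
    by (rule borel_integrable_compact) (use assms in \<open>auto intro: continuous_on_subset\<close>)
  also have "(\<lambda>x. indicator (cball a R) x *\<^sub>R f x) = f"
    using assms(2) by (auto simp: indicator_def fun_eq_iff dist_norm norm_minus_commute)
  finally show ?thesis .
qed

definition rhoN :: "real \<Rightarrow> real" where "rhoN e = (\<integral>z. rho e z 0 \<partial>lborel)"

lemma lborel_reflect_shift:
  fixes f :: "real^2 \<Rightarrow> real"
  assumes [measurable]: "f \<in> borel_measurable borel"
  shows "(\<integral>z. f (x + z) \<partial>lborel) = (\<integral>z. f z \<partial>lborel)"
proof -
  have "(\<integral>z. f z \<partial>lborel) = (\<integral>z. f z \<partial>distr lborel borel ((+) x))" by (simp add: lborel_distr_plus)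
  also have "\<dots> = (\<integral>z. f (x + z) \<partial>lborel)" by (subst integral_distr) auto
  finally show ?thesis by simp
qed

text \<open>For the lower bound, the bump is at least \<open>exp (- 2) \<ge> 1 / 9\<close> on the
  disc of radius \<open>e / 2\<close>. The mass has no closed form, but it is at least of order
  \<open>e\<^sup>2\<close>.\<close>

lemma rho_integral:
  assumes e: "e > 0"
  shows "integrable lborel (\<lambda>z. rho e z x)" "(\<integral>z. rho e z x \<partial>lborel) = rhoN e" "e\<^sup>2 / 24 \<le> rhoN e"
proof -
  show i: "integrable lborel (\<lambda>z. rho e z x)" for x
    by (rule integrable_cball_support[where a = x and R = e])
      (use e rho_outside[OF e] in \<open>auto intro!: continuous_intros simp: norm_minus_commute\<close>)
  have "(\<integral>z. rho e z x \<partial>lborel) = (\<integral>z. rho e (x + z) x \<partial>lborel)"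
    using lborel_reflect_shift[of "\<lambda>z. rho e z x" x] borel_measurable_integrable[OF i[of x]] by simp
  also have "\<dots> = rhoN e" by (simp add: rhoN_def rho_def)
  finally show "(\<integral>z. rho e z x \<partial>lborel) = rhoN e" .
  have "(\<integral>z. (1/9) * indicator (cball 0 (e / 2)) z \<partial>(lborel :: (real^2) measure)) \<le> rhoN e"
    unfolding rhoN_def
  proof (intro integral_mono integrable_mult_right i)
    show "integrable lborel (indicator (cball 0 (e/2)) :: real^2 \<Rightarrow> real)"
      by (subst integrable_indicator_iff) (use e emeasure_lborel_cball_finite in auto)
    fix z :: "real^2"
    show "1 / 9 * indicator (cball 0 (e/2)) z \<le> rho e z 0"
    proof (cases "z \<in> cball 0 (e/2)")
      case True
      then have "(norm z)\<^sup>2 \<le> (e/2)\<^sup>2" by (intro power_mono) auto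
      then have "(norm z)\<^sup>2 / e\<^sup>2 \<le> 1/4" using e by (simp add: power_divide field_simps)
      then have a: "1 - (norm z)\<^sup>2 / e\<^sup>2 \<ge> 1/2" by linarith
      then have "inverse (1 - (norm z)\<^sup>2 / e\<^sup>2) \<le> inverse (1/2)" by (intro le_imp_inverse_le) auto
      then have "exp (-2) \<le> exp (- inverse (1 - (norm z)\<^sup>2 / e\<^sup>2))" by simp
      moreover have "(1/9::real) \<le> exp (-2)"
      proof -
        have "exp 2 = exp (1::real) * exp 1" by (simp flip: exp_add)
        also have "\<dots> \<le> 3 * 3" by (intro mult_mono exp_le) auto
        finally show ?thesis by (simp add: exp_minus field_simps)
      qed
      moreover have "rho e z 0 = exp (- inverse (1 - (norm z)\<^sup>2 / e\<^sup>2))"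
        using bump_eq[of "1 - (norm z)\<^sup>2 / e\<^sup>2"] a unfolding rho_def by simp
      ultimately have "1/9 \<le> rho e z 0" by linarith
      then show ?thesis using True by simp
    qed (simp add: rho_nonneg)
  qed
  moreover have "(\<integral>z. (1/9) * indicator (cball 0 (e / 2)) z \<partial>(lborel :: (real^2) measure)) = 1/9 * (pi * (e/2)\<^sup>2)"
    using e content_cball[of "e/2" "0::real^2"] by (simp add: unit_ball_vol_2)
  moreover have "e\<^sup>2 / 24 \<le> 1/9 * (pi * (e/2)\<^sup>2)"
  proof -
    have "e\<^sup>2 / 24 \<le> 1/9 * (3 * (e/2)\<^sup>2)" by (simp add: power_divide)
    also have "\<dots> \<le> 1/9 * (pi * (e/2)\<^sup>2)" using pi_gt3 by (intro mult_left_mono mult_right_mono) auto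
    finally show ?thesis .
  qed
  ultimately show "e\<^sup>2 / 24 \<le> rhoN e" by linarith
qed

definition moll :: "real \<Rightarrow> (real^2 \<Rightarrow> real^2) \<Rightarrow> real^2 \<Rightarrow> real^2" where
  "moll e V x = (1 / rhoN e) *\<^sub>R (\<integral>z. rho e z x *\<^sub>R V z \<partial>lborel)"

text \<open>The derivative of \<open>moll e V\<close> at \<open>x\<close> in direction
  \<open>h\<close>; it falls on the kernel, \<open>V\<close> being merely continuous.\<close>

definition dmoll :: "real \<Rightarrow> (real^2 \<Rightarrow> real^2) \<Rightarrow> real^2 \<Rightarrow> real^2 \<Rightarrow> real^2" where
  "dmoll e V x h = (1 / rhoN e) *\<^sub>R (\<integral>z. (drho e z x 1 * h$1 + drho e z x 2 * h$2) *\<^sub>R V z \<partial>lborel)"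

locale mollifier =
  fixes V :: "real^2 \<Rightarrow> real^2" and e :: real
  assumes V [continuous_intros]: "continuous_on UNIV V" and e: "0 < e"
begin

lemma N: "0 < rhoN e" using rho_integral(3)[OF e] e by (meson divide_pos_pos less_le_trans zero_less_numeral zero_less_power)

lemma int_rhoV: "integrable lborel (\<lambda>z. rho e z x *\<^sub>R V z)"
  by (rule integrable_cball_support[where a = x and R = e])
    (use e rho_outside[OF e] in \<open>auto intro!: continuous_intros simp: norm_minus_commute\<close>)

lemma int_drhoV: "integrable lborel (\<lambda>z. (drho e z x 1 * h$1 + drho e z x 2 * h$2) *\<^sub>R V z)"
  by (rule integrable_cball_support[where a = x and R = e])
    (use e drho_outside[OF e] in \<open>auto intro!: continuous_intros simp: norm_minus_commute\<close>)

lemma moll_deriv: "(moll e V has_derivative dmoll e V x) (at x)"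
proof -
  define g where "g = (\<lambda>z. 4 / e * (indicator (cball x (1 + e)) z * norm (V z)))"
  have ig: "integrable lborel g"
  proof -
    have "integrable lborel (\<lambda>z. indicator (cball x (1 + e)) z *\<^sub>R norm (V z))"
      by (intro borel_integrable_compact continuous_intros continuous_on_subset[OF V]) auto
    then show ?thesis by (simp add: g_def)
  qed
  have g0: "0 \<le> g z" for z using e by (simp add: g_def)
  have "((\<lambda>y. \<integral>z. rho e z y *\<^sub>R V z \<partial>lborel) has_derivative (\<lambda>h. \<integral>z. (drho e z x 1 * h$1 + drho e z x 2 * h$2) *\<^sub>R V z \<partial>lborel)) (at x within ball x 1)"
  proof (rule has_derivative_integral[where g = g])
    show "((\<lambda>y. rho e z y *\<^sub>R V z) has_derivative (\<lambda>h. (drho e z x 1 * h$1 + drho e z x 2 * h$2) *\<^sub>R V z)) (at x within ball x 1)" for z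
      by (rule has_derivative_scaleR_left[OF has_derivative_at_withinI[OF rho_deriv]])
    show "norm (rho e z y *\<^sub>R V z - rho e z x *\<^sub>R V z) \<le> norm (y - x) * g z" if "y \<in> ball x 1" for y z
    proof (cases "z \<in> cball x (1 + e)")
      case True
      have "norm (rho e z y *\<^sub>R V z - rho e z x *\<^sub>R V z) = norm (rho e z y - rho e z x) * norm (V z)"
        by (simp add: scaleR_diff_left[symmetric])
      also have "\<dots> \<le> (4 / e * norm (y - x)) * norm (V z)"
        by (intro mult_right_mono rho_lipschitz e) auto
      finally show ?thesis using True by (simp add: g_def mult_ac)
    next
      case False
      then have "norm (x - z) > 1 + e" by (simp add: dist_norm)
      moreover have "norm (x - y) < 1" using that by (simp add: dist_norm)
      moreover have "norm (x - z) \<le> norm (x - y) + norm (y - z)" using norm_triangle_ineq[of "x - y" "y - z"] by simp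
      ultimately have "e \<le> norm (y - z)" "e \<le> norm (x - z)" using e by linarith+
      then show ?thesis using g0[of z] by (simp add: rho_outside[OF e])
    qed
    show "norm ((drho e z x 1 * h$1 + drho e z x 2 * h$2) *\<^sub>R V z) \<le> norm h * g z" for h :: "real^2" and z
    proof (cases "z \<in> cball x (1 + e)")
      case True
      have "norm ((drho e z x 1 * h$1 + drho e z x 2 * h$2) *\<^sub>R V z) \<le> (4 / e * norm h) * norm (V z)"
        unfolding norm_scaleR real_norm_def[symmetric] by (intro mult_right_mono drho_bound e) auto
      then show ?thesis using True by (simp add: g_def mult_ac)
    next
      case False
      then have "e \<le> norm (x - z)" by (simp add: dist_norm)
      then show ?thesis using g0[of z] by (simp add: drho_outside[OF e])
    qed
  qed (auto intro: int_rhoV int_drhoV ig)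
  then have "((\<lambda>y. \<integral>z. rho e z y *\<^sub>R V z \<partial>lborel) has_derivative (\<lambda>h. \<integral>z. (drho e z x 1 * h$1 + drho e z x 2 * h$2) *\<^sub>R V z \<partial>lborel)) (at x)"
    by (simp add: at_within_open[of x "ball x 1"])
  then show ?thesis unfolding moll_def[abs_def] dmoll_def[abs_def] by (rule has_derivative_scaleR_right)
qed

lemma moll_close:
  assumes "\<And>z. norm (x - z) \<le> e \<Longrightarrow> norm (V z - V x) \<le> k" "0 \<le> k"
  shows "norm (moll e V x - V x) \<le> k"
proof -
  note r = rho_integral[OF e]
  have "moll e V x - V x = (1 / rhoN e) *\<^sub>R ((\<integral>z. rho e z x *\<^sub>R V z \<partial>lborel) - (\<integral>z. rho e z x *\<^sub>R V x \<partial>lborel))"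
    using N r(1,2)[of x] by (simp add: moll_def scaleR_diff_right)
  also have "(\<integral>z. rho e z x *\<^sub>R V z \<partial>lborel) - (\<integral>z. rho e z x *\<^sub>R V x \<partial>lborel) = (\<integral>z. rho e z x *\<^sub>R (V z - V x) \<partial>lborel)"
    using r(1)[of x] int_rhoV[of x] by (simp add: scaleR_diff_right Bochner_Integration.integral_diff)
  finally have eq: "moll e V x - V x = (1 / rhoN e) *\<^sub>R (\<integral>z. rho e z x *\<^sub>R (V z - V x) \<partial>lborel)" .
  have "norm (\<integral>z. rho e z x *\<^sub>R (V z - V x) \<partial>lborel) \<le> (\<integral>z. rho e z x * k \<partial>lborel)"
  proof (rule Bochner_Integration.integral_norm_bound_integral)
    show "integrable lborel (\<lambda>z. rho e z x *\<^sub>R (V z - V x))"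
      using r(1)[of x] int_rhoV[of x] by (simp add: scaleR_diff_right)
    show "integrable lborel (\<lambda>z. rho e z x * k)" using r(1) by simp
    show "norm (rho e z x *\<^sub>R (V z - V x)) \<le> rho e z x * k" for z
    proof (cases "norm (x - z) \<le> e")
      case True then show ?thesis using assms(1) by (simp add: rho_nonneg mult_left_mono)
    next
      case False then show ?thesis using rho_outside[OF e, of x z] by simp
    qed
  qed
  also have "\<dots> = rhoN e * k" using r(2)[of x] by simp
  finally show ?thesis unfolding eq using N by (simp add: field_simps)
qed

text \<open>The gradient of the kernel is at most \<open>4 / e\<close> on a disc of area
  \<open>pi * e\<^sup>2\<close>, and the mass is at least \<open>e\<^sup>2 / 24\<close>; the product
  \<open>24 * 16 = 384\<close> is rounded up.\<close>

lemma dmoll_bound: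
  assumes "\<And>z. norm (x - z) \<le> e \<Longrightarrow> norm (V z) \<le> v" "0 \<le> v"
  shows "norm (dmoll e V x h) \<le> 400 * v / e * norm h"
proof -
  have "norm (\<integral>z. (drho e z x 1 * h$1 + drho e z x 2 * h$2) *\<^sub>R V z \<partial>lborel) \<le> (\<integral>z. (4 / e * norm h * v) * indicator (cball x e) z \<partial>lborel)"
  proof (rule Bochner_Integration.integral_norm_bound_integral)
    show "integrable lborel (\<lambda>z. (4 / e * norm h * v) * indicator (cball x e) z)"
      by (intro integrable_mult_right, subst integrable_indicator_iff) (use emeasure_lborel_cball_finite in auto)
    show "norm ((drho e z x 1 * h$1 + drho e z x 2 * h$2) *\<^sub>R V z) \<le> (4 / e * norm h * v) * indicator (cball x e) z" for z
    proof (cases "z \<in> cball x e")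
      case True
      have "norm ((drho e z x 1 * h$1 + drho e z x 2 * h$2) *\<^sub>R V z) \<le> (4 / e * norm h) * v"
        unfolding norm_scaleR real_norm_def[symmetric]
        using assms True e by (intro mult_mono drho_bound e) (auto simp: dist_norm)
      then show ?thesis using True by simp
    next
      case False then show ?thesis using drho_outside[OF e, of x z] by (simp add: dist_norm)
    qed
  qed (rule int_drhoV)
  also have "\<dots> = 4 / e * norm h * v * (pi * e\<^sup>2)"
    using e content_cball[of e x] by (simp add: unit_ball_vol_2)
  finally have 1: "norm (\<integral>z. (drho e z x 1 * h$1 + drho e z x 2 * h$2) *\<^sub>R V z \<partial>lborel) \<le> 4 * pi * (v * e * norm h)"
    using e by (simp add: power2_eq_square mult_ac)
  have "norm (dmoll e V x h) = 1 / rhoN e * norm (\<integral>z. (drho e z x 1 * h$1 + drho e z x 2 * h$2) *\<^sub>R V z \<partial>lborel)"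
    using N by (simp add: dmoll_def)
  also have "\<dots> \<le> 24 / e\<^sup>2 * (16 * (v * e * norm h))"
  proof (intro mult_mono)
    show "1 / rhoN e \<le> 24 / e\<^sup>2" using rho_integral(3)[OF e] N e by (simp add: field_simps)
    have "4 * pi * (v * e * norm h) \<le> 16 * (v * e * norm h)"
      using pi_less_4 assms e by (intro mult_right_mono) auto
    with 1 show "norm (\<integral>z. (drho e z x 1 * h$1 + drho e z x 2 * h$2) *\<^sub>R V z \<partial>lborel) \<le> 16 * (v * e * norm h)" by linarith
  qed auto
  also have "\<dots> = 384 * (v / e * norm h)" using e by (simp add: power2_eq_square field_simps)
  also have "\<dots> \<le> 400 * (v / e * norm h)" using assms e by (intro mult_right_mono) auto
  finally show ?thesis by simp
qed


lemma dmoll_component: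
  "dmoll e V x h $ i = 1 / rhoN e * (\<integral>z. (drho e z x 1 * h$1 + drho e z x 2 * h$2) * V z $ i \<partial>lborel)"
proof -
  have "(\<integral>z. ((drho e z x 1 * h$1 + drho e z x 2 * h$2) *\<^sub>R V z) $ i \<partial>lborel) = (\<integral>z. (drho e z x 1 * h$1 + drho e z x 2 * h$2) *\<^sub>R V z \<partial>lborel) $ i"
    by (rule integral_bounded_linear[OF bounded_linear_vec_nth int_drhoV])
  then show ?thesis by (simp add: dmoll_def)
qed

text \<open>The divergence of the mollified field is an integral of \<open>V\<close> against the
  gradient of the kernel, the form in which incompressibility can enter.\<close>

lemma dmoll_trace:
  "dmoll e V x (axis 1 1) $ 1 + dmoll e V x (axis 2 1) $ 2
    = 1 / rhoN e * (\<integral>z. drho e z x 1 * V z $ 1 + drho e z x 2 * V z $ 2 \<partial>lborel)"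
proof -
  have i: "integrable lborel (\<lambda>z. drho e z x i * V z $ j)" for i j
    by (rule integrable_cball_support[where a = x and R = e])
      (use e drho_outside[OF e] in \<open>auto intro!: continuous_intros simp: norm_minus_commute\<close>)
  show ?thesis
    unfolding dmoll_component Bochner_Integration.integral_add[OF i i] distrib_left
    by (simp add: axis_def)
qed

end

text \<open>The flow need not be differentiable, so the Jacobian is that of \<open>x + moll e V x\<close> where \<open>V\<close> is the displacement.
  Its trace is controlled by \<open>s\<close> and its determinant by \<open>400 * v / e\<close>; passing from \<open>T\<close> to the mollified map
  costs \<open>k\<close>.\<close>

lemma near_identity_volume:
  fixes T :: "real^2 \<Rightarrow> real^2" and \<psi> :: "real^2 \<Rightarrow> real"
  assumes T [continuous_intros]: "continuous_on UNIV T" and R: "0 < R" and ee: "0 < e" "e \<le> R"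
    and v: "\<And>z. norm z \<le> 3 * R \<Longrightarrow> norm (T z - z) \<le> v" "400 * v / e \<le> 1 / 4" "v + k \<le> R" "0 \<le> k"
    and k: "\<And>x z. norm x \<le> 2 * R \<Longrightarrow> norm (x - z) \<le> e \<Longrightarrow> norm ((T z - z) - (T x - x)) \<le> k"
    and s: "\<And>x. norm x \<le> 2 * R \<Longrightarrow> \<bar>\<integral>z. drho e z x 1 * (T z - z) $ 1 + drho e z x 2 * (T z - z) $ 2 \<partial>lborel\<bar> \<le> s" 
    and bk: "\<And>x. norm (T x) \<le> R \<Longrightarrow> norm x \<le> 2 * R"
    and psi [continuous_intros]: "continuous_on UNIV \<psi>" and supp: "\<And>x. norm x > R \<Longrightarrow> \<psi> x = 0"
    and hol: "\<And>x y. norm x \<le> 3 * R \<Longrightarrow> norm y \<le> 3 * R \<Longrightarrow> \<bar>\<psi> x - \<psi> y\<bar> \<le> H * norm (x - y) powr g" "0 < g" "0 \<le> H"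
    and B: "\<And>x. \<bar>\<psi> x\<bar> \<le> B"
  shows "\<bar>(\<integral>x. \<psi> (T x) \<partial>lborel) - (\<integral>x. \<psi> x \<partial>lborel)\<bar> \<le> 16 * R\<^sup>2 * (H * k powr g + B * (24 * s / e\<^sup>2 + 2 * (400 * v / e)\<^sup>2))"
proof -
  define V where "V = (\<lambda>z. T z - z)"
  have Vc: "continuous_on UNIV V" unfolding V_def by (intro continuous_on_diff T continuous_on_id)
  interpret mollifier V e by (rule mollifier.intro[OF Vc ee(1)])
  define m where "m = moll e V"
  define Q where "Q = (\<lambda>x. x + m x)"
  define dQ where "dQ = (\<lambda>x h. h + dmoll e V x h)"
  \<comment> \<open>By \<open>bk\<close> no point outside this disc is mapped by \<open>T\<close>
    into the support of \<psi>, and the image of the disc under \<open>Q\<close> covers that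
    support.\<close>
  define D where "D = cball (0::real^2) (2 * R)"
  define r where "r = 400 * v / e"
  have "norm (T 0 - 0) \<le> v" by (rule v(1)) (use R in simp)
  then have v0: "0 \<le> v" using norm_ge_zero[of "T 0 - 0"] by linarith
  have r0: "0 \<le> r" "r \<le> 1/4" using v0 ee v by (auto simp: r_def)
  have B0: "0 \<le> B" using B[of 0] by linarith
  have near: "norm z \<le> 3 * R" if "x \<in> D" "norm (x - z) \<le> e" for x z
    using that ee norm_triangle_ineq4[of x "x - z"] by (simp add: D_def)
  have dm: "norm (dmoll e V x h) \<le> r * norm h" if "x \<in> D" for x h
    unfolding r_def by (rule dmoll_bound[OF _ v0]) (use v(1) near[OF that] in \<open>auto simp: V_def\<close>)
  have mc: "norm (m x - V x) \<le> k" if "x \<in> D" for x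
    unfolding m_def by (rule moll_close[OF _ v(4)]) (use k that in \<open>auto simp: V_def D_def\<close>)
  have mb: "norm (m x) \<le> R" if "x \<in> D" for x
  proof -
    have "norm x \<le> 3 * R" using that R by (simp add: D_def)
    then have "norm (V x) \<le> v" unfolding V_def by (rule v(1))
    then show ?thesis using mc[OF that] norm_triangle_ineq[of "m x - V x" "V x"] v(3) by simp
  qed
  have ml: "norm (m x - m y) \<le> (1/4) * norm (x - y)" if "x \<in> D" "y \<in> D" for x y
  proof (rule differentiable_bound[where S = D and f' = "dmoll e V"])
    show "convex D" by (simp add: D_def)
    show "(m has_derivative dmoll e V x) (at x within D)" for x
      unfolding m_def by (rule has_derivative_at_withinI[OF moll_deriv])
    show "onorm (dmoll e V x) \<le> 1/4" if "x \<in> D" for x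
      by (rule onorm_le) (use dm[OF that] r0 in \<open>meson mult_right_mono norm_ge_zero order_trans\<close>)
  qed (use that in auto)
  have inj: "inj_on Q D"
  proof (rule inj_onI)
    fix x y assume xy: "x \<in> D" "y \<in> D" "Q x = Q y"
    then have "x - y = - (m x - m y)" by (simp add: Q_def algebra_simps)
    then have "norm (x - y) = norm (m x - m y)" by (metis norm_minus_cancel)
    then have "norm (x - y) \<le> (1/4) * norm (x - y)" using ml[OF xy(1,2)] by simp
    then have "norm (x - y) \<le> 0" by linarith
    then show "x = y" by simp
  qed
  \<comment> \<open>Solving \<open>x + m x = y\<close> is a fixed point problem for
    \<open>x \<mapsto> y - m x\<close>, a contraction of \<open>D\<close> into itself.\<close>
  have surj: "y \<in> Q ` D" if y: "norm y \<le> R" for y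
  proof -
    have "\<exists>!x\<in>D. y - m x = x"
    proof (rule Banach_fix[where f = "\<lambda>x. y - m x" and c = "1/4"])
      show "complete D" unfolding D_def by (simp add: compact_imp_complete)
      show "D \<noteq> {}" using R by (simp add: D_def)
      show "(\<lambda>x. y - m x) ` D \<subseteq> D"
      proof (rule image_subsetI)
        fix x assume "x \<in> D"
        then show "y - m x \<in> D" using mb[of x] y norm_triangle_ineq4[of y "m x"] by (simp add: D_def)
      qed
      show "dist (y - m x) (y - m x') \<le> 1 / 4 * dist x x'" if "x \<in> D" "x' \<in> D" for x x'
        using ml[of x' x] that by (simp add: dist_norm norm_minus_commute)
    qed auto
    then obtain x where "x \<in> D" "y - m x = x" by blast
    then show ?thesis unfolding Q_def by (intro image_eqI[of _ _ x]) (auto simp: algebra_simps)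
  qed
  have dQ: "(Q has_derivative dQ x) (at x within D)" for x
    unfolding Q_def dQ_def m_def
    by (intro has_derivative_add has_derivative_ident has_derivative_at_withinI[OF moll_deriv])
  have Qc: "continuous_on D Q" using dQ has_derivative_continuous_on by blast
  have cD: "compact D" by (simp add: D_def)
  \<comment> \<open>Determinant of the identity plus a small matrix: the linear term is the trace,
    which is the mollified divergence, and the other terms are products of two entries of size at
    most \<open>r\<close>.\<close>
  have det: "\<bar>\<bar>det (matrix (dQ x))\<bar> - 1\<bar> \<le> 24 * s / e\<^sup>2 + 2 * r\<^sup>2" if x: "x \<in> D" for x
  proof -
    define a where "a = (\<lambda>i j. dmoll e V x (axis j 1) $ i)"
    have a: "\<bar>a i j\<bar> \<le> r" for i j
      using dm[OF x, of "axis j 1"] component_le_norm_cart[of "dmoll e V x (axis j 1)" i]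
      by (simp add: a_def)
    have aa: "\<bar>a i j * a k l\<bar> \<le> r * r" for i j k l
      unfolding abs_mult by (intro mult_mono a) (use r0 in auto)
    have "matrix (dQ x) $ i $ j = (if i = j then 1 else 0) + a i j" for i j
      by (simp add: matrix_def dQ_def a_def axis_def)
    then have "det (matrix (dQ x)) = 1 + (a 1 1 + a 2 2) + (a 1 1 * a 2 2 - a 1 2 * a 2 1)"
      by (simp add: det_2 algebra_simps)
    moreover have "\<bar>a 1 1 + a 2 2\<bar> \<le> 24 * s / e\<^sup>2"
    proof -
      have "\<bar>a 1 1 + a 2 2\<bar> = 1 / rhoN e * \<bar>\<integral>z. drho e z x 1 * V z $ 1 + drho e z x 2 * V z $ 2 \<partial>lborel\<bar>"
        unfolding a_def dmoll_trace abs_mult using N by simp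
      also have "\<dots> \<le> 24 / e\<^sup>2 * s"
      proof (intro mult_mono)
        show "1 / rhoN e \<le> 24 / e\<^sup>2" using rho_integral(3)[OF ee(1)] N ee by (simp add: field_simps)
        show "\<bar>\<integral>z. drho e z x 1 * V z $ 1 + drho e z x 2 * V z $ 2 \<partial>lborel\<bar> \<le> s"
          using s[of x] x by (simp add: V_def D_def)
      qed auto
      finally show ?thesis by simp
    qed
    ultimately show ?thesis using aa[of 1 1 2 2] aa[of 1 2 2 1] by (simp add: power2_eq_square abs_if split: if_splits)
  qed
  define dv where "dv = 24 * s / e\<^sup>2 + 2 * r\<^sup>2"
  \<comment> \<open>The change of variables formula is applied to a vector-valued function, hence
    the embedding into \<open>real^1\<close>.\<close>
  define F where "F = (\<lambda>x. vec (\<psi> x) :: real^1)"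
  have Fc: "continuous_on S F" for S
  proof -
    have "continuous_on UNIV F" unfolding F_def vec_def by (intro continuous_on_vec_lambda psi)
    then show ?thesis using continuous_on_subset by blast
  qed
  have cQD: "compact (Q ` D)" using Qc cD by (rule compact_continuous_image)
  have absint: "G absolutely_integrable_on S" if "compact S" "continuous_on S G" for S and G :: "real^2 \<Rightarrow> real^1"
  proof -
    have "integrable lborel (\<lambda>x. indicator S x *\<^sub>R G x)" by (rule borel_integrable_compact[OF that])
    then show ?thesis unfolding set_integrable_def
      using borel_measurable_integrable by (subst integrable_completion) auto
  qed
  have iF: "F absolutely_integrable_on Q ` D" by (rule absint[OF cQD Fc])
  have cv: "(\<lambda>x. \<bar>det (matrix (dQ x))\<bar> *\<^sub>R F (Q x)) absolutely_integrable_on D \<and>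
      integral D (\<lambda>x. \<bar>det (matrix (dQ x))\<bar> *\<^sub>R F (Q x)) = integral (Q ` D) F"
    by (rule has_absolute_integral_change_of_variables[THEN iffD2]) (use dQ inj iF in \<open>auto simp: D_def\<close>)
  have toL: "(LINT x|lebesgue. indicator S x * (G x $ 1)) = integral S G $ 1" "integrable lebesgue (\<lambda>x. indicator S x * (G x $ 1))"
    if "G absolutely_integrable_on S" for S and G :: "real^2 \<Rightarrow> real^1"
  proof -
    have i: "integrable lebesgue (\<lambda>x. indicator S x *\<^sub>R G x)" using that by (simp add: set_integrable_def)
    have "(LINT x|lebesgue. (indicator S x *\<^sub>R G x) $ 1) = (LINT x|lebesgue. indicator S x *\<^sub>R G x) $ 1"
      by (rule integral_bounded_linear[OF bounded_linear_vec_nth i])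
    also have "(LINT x|lebesgue. indicator S x *\<^sub>R G x) = integral S G"
      using set_lebesgue_integral_eq_integral(2)[OF that] by (simp add: set_lebesgue_integral_def)
    finally show "(LINT x|lebesgue. indicator S x * (G x $ 1)) = integral S G $ 1" by simp
    show "integrable lebesgue (\<lambda>x. indicator S x * (G x $ 1))"
      using integrable_bounded_linear[OF bounded_linear_vec_nth i, of 1] by simp
  qed
  let ?A = "\<lambda>x. indicator D x * (\<bar>det (matrix (dQ x))\<bar> * \<psi> (Q x))"
  let ?C = "\<lambda>x. indicator D x * \<psi> (T x)"
  have iA: "integrable lebesgue ?A" using toL(2)[OF cv[THEN conjunct1]] by (simp add: F_def)
  have "(LINT x|lebesgue. ?A x) = (LINT x|lebesgue. indicator (Q ` D) x * \<psi> x)"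
    using toL(1)[OF cv[THEN conjunct1]] toL(1)[OF iF] cv by (simp add: F_def)
  also have "(\<lambda>x. indicator (Q ` D) x * \<psi> x) = \<psi>"
    using surj supp by (force simp: indicator_def fun_eq_iff)
  also have "(LINT x|lebesgue. \<psi> x) = (\<integral>x. \<psi> x \<partial>lborel)"
    by (rule integral_completion) (auto intro!: borel_measurable_continuous_onI psi)
  finally have 1: "(LINT x|lebesgue. ?A x) = (\<integral>x. \<psi> x \<partial>lborel)" .
  have psiT: "continuous_on UNIV (\<lambda>x. \<psi> (T x))" by (rule continuous_on_compose2[OF psi T]) auto
  have psiT_b: "(\<lambda>x. \<psi> (T x)) \<in> borel_measurable borel" by (rule borel_measurable_continuous_onI[OF psiT])
  have "?C = (\<lambda>x. \<psi> (T x))"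
  proof
    fix x show "?C x = \<psi> (T x)"
      using bk[of x] supp[of "T x"] by (cases "norm (T x) \<le> R") (auto simp: D_def indicator_def)
  qed
  moreover have "(LINT x|lebesgue. \<psi> (T x)) = (\<integral>x. \<psi> (T x) \<partial>lborel)"
    by (rule integral_completion) (use psiT_b in simp)
  ultimately have 2: "(LINT x|lebesgue. ?C x) = (\<integral>x. \<psi> (T x) \<partial>lborel)" by (simp only:)
  have iC: "integrable lebesgue ?C"
  proof -
    have "integrable lborel (\<lambda>x. indicator D x *\<^sub>R \<psi> (T x))"
      by (rule borel_integrable_compact[OF cD continuous_on_subset[OF psiT]]) simp
    then show ?thesis using borel_measurable_integrable by (subst integrable_completion) auto
  qed
  \<comment> \<open>\<open>T\<close> and \<open>Q\<close> differ by at most \<open>k\<close>, which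
    enters through the Hoelder bound on \<psi>; the Jacobian differs from \<open>1\<close> by at
    most \<open>dv\<close>, which enters through the bound \<open>B\<close> on \<psi>.\<close>
  have pw: "norm (?C x - ?A x) \<le> (H * k powr g + B * dv) * indicator D x" for x
  proof (cases "x \<in> D")
    case True
    have x3: "norm x \<le> 2 * R" using True by (simp add: D_def)
    have Tx: "norm (T x) \<le> 3 * R"
    proof -
      have "norm (T x - x) \<le> v" by (rule v(1)) (use x3 R in auto)
      then show ?thesis using norm_triangle_ineq[of "T x - x" x] v(3,4) x3 by simp
    qed
    have Qx: "norm (Q x) \<le> 3 * R" unfolding Q_def using mb[OF True] norm_triangle_ineq[of x "m x"] x3 by linarith
    have TQ: "norm (T x - Q x) \<le> k" using mc[OF True] by (simp add: Q_def V_def norm_minus_commute algebra_simps)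
    have "\<bar>\<psi> (T x) - \<psi> (Q x)\<bar> \<le> H * norm (T x - Q x) powr g" by (rule hol(1)[OF Tx Qx])
    also have "\<dots> \<le> H * k powr g" using TQ hol by (intro mult_left_mono powr_mono2) auto
    finally have 3: "\<bar>\<psi> (T x) - \<psi> (Q x)\<bar> \<le> H * k powr g" .
    have 4: "\<bar>(1 - \<bar>det (matrix (dQ x))\<bar>) * \<psi> (Q x)\<bar> \<le> dv * B"
      unfolding abs_mult using det[OF True] B[of "Q x"] by (intro mult_mono) (auto simp: dv_def abs_minus_commute)
    have "\<psi> (T x) - \<bar>det (matrix (dQ x))\<bar> * \<psi> (Q x) = (\<psi> (T x) - \<psi> (Q x)) + (1 - \<bar>det (matrix (dQ x))\<bar>) * \<psi> (Q x)"
      by (simp add: algebra_simps)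
    then have "\<bar>\<psi> (T x) - \<bar>det (matrix (dQ x))\<bar> * \<psi> (Q x)\<bar> \<le> H * k powr g + dv * B"
      using 3 4 by linarith
    then show ?thesis using True by (simp add: mult.commute)
  qed simp
  have iD: "integrable lebesgue (\<lambda>x. (H * k powr g + B * dv) * indicator D x)"
  proof -
    have "integrable lborel (indicator D :: real^2 \<Rightarrow> real)"
      unfolding D_def by (subst integrable_indicator_iff) (use emeasure_lborel_cball_finite in auto)
    then have "integrable lebesgue (indicator D :: real^2 \<Rightarrow> real)"
      using borel_measurable_integrable by (subst integrable_completion) auto
    then show ?thesis by (rule integrable_mult_right)
  qed
  have "\<bar>(\<integral>x. \<psi> (T x) \<partial>lborel) - (\<integral>x. \<psi> x \<partial>lborel)\<bar> = norm (LINT x|lebesgue. ?C x - ?A x)"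
    using iA iC by (simp add: 1[symmetric] 2[symmetric] del: Bochner_Integration.integral_mult_right_zero)
  also have "\<dots> \<le> (LINT x|lebesgue. (H * k powr g + B * dv) * indicator D x)"
    by (intro Bochner_Integration.integral_norm_bound_integral Bochner_Integration.integrable_diff iA iC iD pw)
  also have "\<dots> = (H * k powr g + B * dv) * (pi * (2 * R)\<^sup>2)"
    using R content_cball[of "2 * R" "0::real^2"] by (simp add: D_def unit_ball_vol_2)
  also have "\<dots> \<le> (H * k powr g + B * dv) * (16 * R\<^sup>2)"
  proof (intro mult_left_mono)
    have "pi * (2 * R)\<^sup>2 = 4 * pi * R\<^sup>2" by (simp add: power_mult_distrib)
    also have "\<dots> \<le> 4 * 4 * R\<^sup>2" using pi_less_4 by (intro mult_right_mono) auto
    finally show "pi * (2 * R)\<^sup>2 \<le> 16 * R\<^sup>2" by simp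
    have "0 \<le> dv" using det[of 0] R abs_ge_zero[of "\<bar>det (matrix (dQ 0))\<bar> - 1"] unfolding dv_def D_def by simp
    then show "0 \<le> H * k powr g + B * dv" using B0 hol(3) by simp
  qed
  finally show ?thesis by (simp add: dv_def r_def mult_ac)
qed

section \<open>The flow preserves the Lebesgue measure\<close>

lemma vector_mean_value:
  fixes f :: "real \<Rightarrow> 'b::real_normed_vector"
  assumes "\<And>t. t \<in> {a..b} \<Longrightarrow> (f has_vector_derivative f' t) (at t within {a..b})"
    and "\<And>t. t \<in> {a..b} \<Longrightarrow> norm (f' t) \<le> B" and "s \<in> {a..b}" "t \<in> {a..b}"
  shows "norm (f t - f s) \<le> B * \<bar>t - s\<bar>"
proof -
  have "norm (f t - f s) \<le> B * norm (t - s)"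
  proof (rule differentiable_bound[where S = "{a..b}" and f' = "\<lambda>t h. h *\<^sub>R f' t"])
    show "(f has_derivative (\<lambda>h. h *\<^sub>R f' t)) (at t within {a..b})" if "t \<in> {a..b}" for t
      using assms(1)[OF that] by (simp add: has_vector_derivative_def)
    show "onorm (\<lambda>h. h *\<^sub>R f' t) \<le> B" if "t \<in> {a..b}" for t
    proof (rule onorm_le)
      fix h :: real
      show "norm (h *\<^sub>R f' t) \<le> B * norm h"
        using mult_right_mono[OF assms(2)[OF that] abs_ge_zero[of h]] by (simp add: mult.commute)
    qed
  qed (use assms in auto)
  then show ?thesis by simp
qed

text \<open>This is \<open>ln y \<le> y - 1\<close> at \<open>y = d powr (- 1 / 10)\<close>. The
  exponent \<open>9 / 10\<close> is close enough to \<open>1\<close>: although it is iterated three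
  times below, the errors remain superlinear in the time step.\<close>

lemma osg_le_powr: assumes "0 \<le> d" "d \<le> 1" shows "osg d \<le> 10 * d powr (9/10)"
proof (cases "d = 0")
  case False
  then have d: "0 < d" using assms by simp
  have "ln (d powr (-1/10)) \<le> d powr (-1/10) - 1" using d by (intro ln_le_minus_one) simp
  then have "- ln d \<le> 10 * d powr (-1/10) - 10" using d by (simp add: ln_powr)
  then have "1 - ln d \<le> 10 * d powr (-1/10)" by linarith
  then have "d * (1 - ln d) \<le> d * (10 * d powr (-1/10))" using d by (intro mult_left_mono) auto
  also have "\<dots> = 10 * (d powr 1 * d powr (-1/10))" using d by simp
  also have "\<dots> = 10 * d powr (9/10)" by (simp only: powr_add[symmetric]) simp
  finally show ?thesis by (simp add: osg_def)
qed (simp add: osg_def)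

lemma powr_tendsto_0: "0 < p \<Longrightarrow> ((\<lambda>h. c * h powr p) \<longlongrightarrow> (0::real)) (at_right 0)"
proof -
  assume p: "0 < p"
  have "((\<lambda>h::real. h powr p) \<longlongrightarrow> 0 powr p) (at_right 0)"
    by (rule tendsto_powr2[OF tendsto_ident_at tendsto_const]) (use p in \<open>auto intro!: eventually_at_rightI[of 0 1]\<close>)
  from tendsto_mult[OF tendsto_const[of c] this] show ?thesis by simp
qed

text \<open>Since \<open>p > 1\<close>, all difference quotients tend to \<open>0\<close>, so
  \<open>J\<close> has derivative zero on the interval.\<close>

lemma superlinear_constant:
  fixes J :: "real \<Rightarrow> real"
  assumes J: "\<And>s t. a \<le> s \<Longrightarrow> s < t \<Longrightarrow> t \<le> b \<Longrightarrow> t - s \<le> h \<Longrightarrow> \<bar>J s - J t\<bar> \<le> K * (t - s) powr p"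
    and p: "1 < p" and h: "0 < h" and ab: "a \<le> b"
  shows "J a = J b"
proof -
  have K: "\<bar>J s - J t\<bar> \<le> K * \<bar>t - s\<bar> powr p" if "s \<in> {a..b}" "t \<in> {a..b}" "\<bar>t - s\<bar> \<le> h" for s t
  proof (cases s t rule: linorder_cases)
    case less then show ?thesis using J[of s t] that by auto
  next
    case greater then show ?thesis using J[of t s] that by (auto simp: abs_minus_commute)
  qed auto
  have "\<exists>c. \<forall>x\<in>{a..b}. J x = c"
  proof (rule has_field_derivative_zero_constant)
    show "convex {a..b}" by simp
    fix x assume x: "x \<in> {a..b}"
    have "((\<lambda>y. (J y - J x) / (y - x)) \<longlongrightarrow> 0) (at x within {a..b})"
    proof (rule Lim_null_comparison)
      have "((\<lambda>y. \<bar>y - x\<bar>) \<longlongrightarrow> \<bar>x - x\<bar>) (at x within {a..b})" by (intro tendsto_intros)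
      then have "((\<lambda>y. \<bar>y - x\<bar> powr (p - 1)) \<longlongrightarrow> \<bar>x - x\<bar> powr (p - 1)) (at x within {a..b})"
        by (rule tendsto_powr2[OF _ tendsto_const]) (use p in auto)
      from tendsto_mult[OF tendsto_const[of K] this]
      show "((\<lambda>y. K * \<bar>y - x\<bar> powr (p - 1)) \<longlongrightarrow> 0) (at x within {a..b})" by simp
      have "\<forall>\<^sub>F y in at x within {a..b}. y \<in> {a..b} \<and> y \<noteq> x \<and> dist y x < h"
        unfolding eventually_at using h by (intro exI[of _ h]) auto
      then show "\<forall>\<^sub>F y in at x within {a..b}. norm ((J y - J x) / (y - x)) \<le> K * \<bar>y - x\<bar> powr (p - 1)"
      proof eventually_elim
        case (elim y)
        then have y: "\<bar>y - x\<bar> > 0" by auto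
        have "\<bar>J y - J x\<bar> \<le> K * \<bar>x - y\<bar> powr p" using K[of y x] x elim by (auto simp: dist_real_def)
        also have "\<dots> = K * \<bar>y - x\<bar> powr (p - 1) * \<bar>y - x\<bar>"
          using y by (simp add: powr_diff abs_minus_commute)
        finally show ?case using y by (simp add: abs_divide pos_divide_le_eq)
      qed
    qed
    then show "(J has_real_derivative 0) (at x within {a..b})"
      by (simp add: has_field_derivative_iff)
  qed
  then show ?thesis using ab by fastforce
qed

text \<open>The gradient of the kernel is at most \<open>4 / e\<close> on an area of at most
  \<open>4 * e\<^sup>2\<close>.\<close>

lemma integral_drho_dot:
  fixes F :: "real^2 \<Rightarrow> real^2"
  assumes F: "continuous_on UNIV F" and e: "0 < e" and b: "\<And>z. norm (x - z) \<le> e \<Longrightarrow> norm (F z) \<le> c" "0 \<le> c"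
  shows "\<bar>\<integral>z. drho e z x 1 * F z $ 1 + drho e z x 2 * F z $ 2 \<partial>lborel\<bar> \<le> 16 * e * c"
    and "integrable lborel (\<lambda>z. drho e z x 1 * F z $ 1 + drho e z x 2 * F z $ 2)"
proof -
  note [continuous_intros] = F
  show i: "integrable lborel (\<lambda>z. drho e z x 1 * F z $ 1 + drho e z x 2 * F z $ 2)"
    by (rule integrable_cball_support[where a = x and R = e])
      (use e drho_outside[OF e] in \<open>auto intro!: continuous_intros simp: norm_minus_commute\<close>)
  have "norm (\<integral>z. drho e z x 1 * F z $ 1 + drho e z x 2 * F z $ 2 \<partial>lborel) \<le> (\<integral>z. (4 / e * c) * indicator (cball x e) z \<partial>lborel)"
  proof (rule Bochner_Integration.integral_norm_bound_integral[OF i])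
    show "integrable lborel (\<lambda>z. (4 / e * c) * indicator (cball x e) z)"
      by (intro integrable_mult_right, subst integrable_indicator_iff) (use emeasure_lborel_cball_finite in auto)
    show "norm (drho e z x 1 * F z $ 1 + drho e z x 2 * F z $ 2) \<le> (4 / e * c) * indicator (cball x e) z" for z
    proof (cases "z \<in> cball x e")
      case True
      have "norm (drho e z x 1 * F z $ 1 + drho e z x 2 * F z $ 2) \<le> 4 / e * norm (F z)" by (rule drho_bound[OF e])
      also have "\<dots> \<le> 4 / e * c" using b True e by (intro mult_left_mono) (auto simp: dist_norm)
      finally show ?thesis using True by simp
    next
      case False then show ?thesis using drho_outside[OF e, of x z] by (simp add: dist_norm)
    qed
  qed
  also have "\<dots> = 4 / e * c * (pi * e\<^sup>2)" using e content_cball[of e x] by (simp add: unit_ball_vol_2)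
  also have "\<dots> = 4 * (e * c) * pi" using e by (simp add: power2_eq_square)
  also have "\<dots> \<le> 4 * (e * c) * 4" using e b pi_less_4 by (intro mult_left_mono) auto
  finally show "\<bar>\<integral>z. drho e z x 1 * F z $ 1 + drho e z x 2 * F z $ 2 \<partial>lborel\<bar> \<le> 16 * e * c" by simp
qed

text \<open>The kernel as a function of the integration variable is a test function;
  \<open>drho_commute\<close> moves the derivative to that variable.\<close>

lemma weak_div_zero_rho:
  assumes u: "weak_div_zero u" "continuous_on UNIV u" and e: "0 < e"
  shows "(\<integral>z. drho e z x 1 * u z $ 1 + drho e z x 2 * u z $ 2 \<partial>lborel) = 0"
proof -
  note [continuous_intros] = u(2)
  have "test_fun (\<lambda>z. bump (1 - (norm (z - x))\<^sup>2 / e\<^sup>2) * 1)"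
    by (rule test_fun_cutoff[OF Ck_const e])
  then have t: "test_fun (rho e x)" by (simp add: rho_def[abs_def])
  have p: "partial 1 (rho e x) z = - drho e z x 1" "partial 2 (rho e x) z = - drho e z x 2" for z
    using partial_eqI[OF rho_deriv[of e x z]] drho_commute[of e x z] by auto
  have "(LINT z|lebesgue. - (u z $ 1 * partial 1 (rho e x) z + u z $ 2 * partial 2 (rho e x) z)) = 0"
    using u(1) t unfolding weak_div_zero_def by blast
  then have "(LINT z|lebesgue. drho e z x 1 * u z $ 1 + drho e z x 2 * u z $ 2) = 0"
    unfolding p by (simp add: mult.commute add.commute)
  moreover have "(LINT z|lebesgue. drho e z x 1 * u z $ 1 + drho e z x 2 * u z $ 2) = (\<integral>z. drho e z x 1 * u z $ 1 + drho e z x 2 * u z $ 2 \<partial>lborel)"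
    by (rule integral_completion) (simp, intro borel_measurable_continuous_onI continuous_intros)
  ultimately show ?thesis by simp
qed

section \<open>Displacement during one short time step\<close>

context flow_solution
begin

text \<open>A time span on which the Hoelder exponent
  \<open>exp (- (80 * M) * \<bar>h\<bar>)\<close> stays at or above \<open>9 / 10\<close> and the
  growth factor at or below \<open>2\<close>. It depends on \<open>M\<close> only and is therefore
  the same for every starting time.\<close>

definition T0 :: real where "T0 = 1 / (10 * (80 * M + 1))"

lemma T0: "0 < T0" "\<bar>h\<bar> \<le> T0 \<Longrightarrow> 9/10 \<le> exp (- (80 * M) * \<bar>h\<bar>)" "\<bar>h\<bar> \<le> T0 \<Longrightarrow> exp (4 * M * \<bar>h\<bar>) \<le> 2" "T0 \<le> 1"
proof -
  show p: "0 < T0" using M0 by (simp add: T0_def)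
  show "T0 \<le> 1" using M0 by (simp add: T0_def)
  assume h: "\<bar>h\<bar> \<le> T0"
  have "80 * M * \<bar>h\<bar> \<le> 80 * M * T0" using h M0 by (intro mult_left_mono) auto
  also have "\<dots> \<le> 1/10" using M0 by (simp add: T0_def field_simps)
  finally have b: "80 * M * \<bar>h\<bar> \<le> 1/10" .
  show "9/10 \<le> exp (- (80 * M) * \<bar>h\<bar>)" using b exp_ge_add_one_self[of "- (80 * M) * \<bar>h\<bar>"] by linarith
  have "exp (4 * M * \<bar>h\<bar>) \<le> exp 0 + 1"
  proof -
    have "19/20 \<le> exp (- (4 * M * \<bar>h\<bar>))" using b exp_ge_add_one_self[of "- (4 * M * \<bar>h\<bar>)"] M0 by linarith
    then have "inverse (exp (- (4 * M * \<bar>h\<bar>))) \<le> inverse (19/20)" by (intro le_imp_inverse_le) auto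
    then show ?thesis by (simp add: exp_minus)
  qed
  then show "exp (4 * M * \<bar>h\<bar>) \<le> 2" by simp
qed

lemma T_bound: "0 \<le> s \<Longrightarrow> 0 \<le> t \<Longrightarrow> \<bar>t - s\<bar> \<le> T0 \<Longrightarrow> norm (T s t x) \<le> 2 * norm x"
  using T_growth[of s t x] mult_right_mono[OF T0(3)[of "t - s"] norm_ge_zero[of x]] by linarith

text \<open>The enlarged radius is at most \<open>2 * R\<close>, and the normalised distance is at
  most \<open>1\<close>, so the time-dependent exponent may be lowered to the fixed
  \<open>9 / 10\<close>.\<close>

lemma T_holder9:
  assumes st: "0 \<le> s" "0 \<le> t" "\<bar>t - s\<bar> \<le> T0" and R: "0 < R" "norm x \<le> R" "norm y \<le> R"
  shows "norm (T s t x - T s t y) \<le> 24 * R * (norm (x - y) / (4 * R)) powr (9/10)"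
proof -
  define E where "E = exp (4 * M * \<bar>t - s\<bar>) * R"
  define q where "q = exp (- (80 * M) * \<bar>t - s\<bar>)"
  define d where "d = norm (x - y) / (4 * R)"
  have "1 \<le> exp (4 * M * \<bar>t - s\<bar>)" using M0 by simp
  then have E: "R \<le> E" "E \<le> 2 * R" using T0(3)[OF st(3)] R by (auto simp: E_def)
  have d: "0 \<le> d" "d \<le> 1" using R norm_triangle_ineq4[of x y] by (auto simp: d_def field_simps)
  have dE: "norm (x - y) / (4 * E) \<le> d" unfolding d_def using E R by (intro divide_left_mono) auto
  have "norm (T s t x - T s t y) / (4 * E) \<le> 3 * (norm (x - y) / (4 * E)) powr q"
    unfolding E_def q_def by (rule T_holder[OF st(1,2) R])
  also have "\<dots> \<le> 3 * d powr q" using dE E R by (intro mult_left_mono powr_mono2) (auto simp: q_def)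
  also have "\<dots> \<le> 3 * d powr (9/10)" using d T0(2)[OF st(3)] by (intro mult_left_mono powr_mono') (auto simp: q_def)
  finally have "norm (T s t x - T s t y) \<le> 3 * d powr (9/10) * (4 * E)"
    using E R by (subst (asm) pos_divide_le_eq) auto
  also have "\<dots> \<le> 3 * d powr (9/10) * (4 * (2 * R))" using E by (intro mult_left_mono) auto
  finally show ?thesis by (simp add: d_def mult_ac)
qed

lemma u_holder9:
  assumes t: "0 \<le> t" and R: "0 < R" "norm x \<le> R" "norm y \<le> R"
  shows "norm (u t x - u t y) \<le> 3200 * M * R * (norm (x - y) / (4 * R)) powr (9/10)"
proof -
  define d where "d = norm (x - y) / (4 * R)"
  have d: "0 \<le> d" "d \<le> 1" using R norm_triangle_ineq4[of x y] by (auto simp: d_def field_simps)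
  have "norm (u t x - u t y) \<le> 320 * M * R * osg d" unfolding d_def by (rule u_loglip[OF t R])
  also have "\<dots> \<le> 320 * M * R * (10 * d powr (9/10))" using d M0 R by (intro mult_left_mono osg_le_powr) auto
  finally show ?thesis by (simp add: d_def)
qed

lemma u_cont: "0 \<le> t \<Longrightarrow> continuous_on UNIV (u t)"
  using vel[of t] by (simp add: velocity_of_def)

lemma T_ode_on: "0 \<le> a \<Longrightarrow> t \<in> {a..b} \<Longrightarrow> ((\<lambda>t. T s t x) has_vector_derivative u t (T s t x)) (at t within {a..b})"
  by (rule has_vector_derivative_within_subset[OF T_ode]) auto

context
  fixes R s h :: real
  assumes R: "0 < R" and s: "0 \<le> s" and h: "0 < h" "h \<le> T0"
begin

lemma T_bound_on: "r \<in> {s..s+h} \<Longrightarrow> norm (T s r x) \<le> 2 * norm x"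
  using s h by (intro T_bound) auto

lemma u_T_bound: "r \<in> {s..s+h} \<Longrightarrow> norm x \<le> 3 * R \<Longrightarrow> norm (u r (T s r x)) \<le> 24 * M * R"
proof -
  assume r: "r \<in> {s..s+h}" and x: "norm x \<le> 3 * R"
  have "norm (u r (T s r x)) \<le> 4 * M * norm (T s r x)" using r s by (intro u_growth) auto
  also have "\<dots> \<le> 4 * M * (6 * R)" using T_bound_on[OF r, of x] x M0 by (intro mult_left_mono) auto
  finally show ?thesis by simp
qed

lemma T_speed:
  assumes "r \<in> {s..s+h}" "r' \<in> {s..s+h}" "norm x \<le> 3 * R"
  shows "norm (T s r x - T s r' x) \<le> 24 * M * R * \<bar>r - r'\<bar>"
  by (rule vector_mean_value[where f' = "\<lambda>r. u r (T s r x)" and a = s and b = "s + h"])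
    (use assms s T_ode_on u_T_bound in auto)

lemma displacement_bound: "norm x \<le> 3 * R \<Longrightarrow> r \<in> {s..s+h} \<Longrightarrow> norm (T s r x - x) \<le> 24 * M * R * h"
proof -
  assume x: "norm x \<le> 3 * R" and r: "r \<in> {s..s+h}"
  have "norm (T s r x - T s s x) \<le> 24 * M * R * \<bar>r - s\<bar>" by (rule T_speed[OF r _ x]) (use h in auto)
  also have "\<dots> \<le> 24 * M * R * h" using r M0 R by (intro mult_left_mono) auto
  finally show ?thesis using s by (simp add: T_same)
qed

text \<open>Hoelder constants for the exponent \<open>9 / 10\<close>: \<open>Ku\<close> for the
  velocity on the disc of radius \<open>6 * R\<close>, \<open>KT\<close> for the transition maps on
  the disc of radius \<open>3 * R\<close>, which they send into the larger disc.\<close>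

definition Ku :: real where "Ku = 3200 * M * (6 * R) * (1 / (4 * (6 * R))) powr (9/10)"
definition KT :: real where "KT = 24 * (3 * R) * (1 / (4 * (3 * R))) powr (9/10)"

lemma K_nonneg: "0 \<le> Ku" "0 \<le> KT" using M0 R by (auto simp: Ku_def KT_def)

lemma u_hol: "0 \<le> r \<Longrightarrow> norm x \<le> 6 * R \<Longrightarrow> norm y \<le> 6 * R \<Longrightarrow> norm (u r x - u r y) \<le> Ku * norm (x - y) powr (9/10)"
proof -
  assume a: "0 \<le> r" "norm x \<le> 6 * R" "norm y \<le> 6 * R"
  have "norm (x - y) / (4 * (6 * R)) = 1 / (4 * (6 * R)) * norm (x - y)" by simp
  then have "(norm (x - y) / (4 * (6 * R))) powr (9/10) = (1 / (4 * (6 * R))) powr (9/10) * norm (x - y) powr (9/10)"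
    using R by (simp only:) (rule powr_mult)
  then show ?thesis using u_holder9[OF a(1) _ a(2,3)] R by (simp add: Ku_def mult.assoc)
qed

lemma T_hol: "0 \<le> a \<Longrightarrow> 0 \<le> b \<Longrightarrow> \<bar>b - a\<bar> \<le> T0 \<Longrightarrow> norm x \<le> 3 * R \<Longrightarrow> norm y \<le> 3 * R \<Longrightarrow> norm (T a b x - T a b y) \<le> KT * norm (x - y) powr (9/10)"
proof -
  assume a: "0 \<le> a" "0 \<le> b" "\<bar>b - a\<bar> \<le> T0" "norm x \<le> 3 * R" "norm y \<le> 3 * R"
  have "norm (x - y) / (4 * (3 * R)) = 1 / (4 * (3 * R)) * norm (x - y)" by simp
  then have "(norm (x - y) / (4 * (3 * R))) powr (9/10) = (1 / (4 * (3 * R))) powr (9/10) * norm (x - y) powr (9/10)"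
    using R by (simp only:) (rule powr_mult)
  then show ?thesis using T_holder9[OF a(1,2,3) _ a(4,5)] R by (simp add: KT_def mult.assoc)
qed

text \<open>Points at distance \<open>e\<close> move apart at the speed of the velocity difference
  along their trajectories. The Hoelder bound of the flow is inserted into that of the velocity, and
  the factor \<open>h\<close> comes from integrating in time.\<close>

lemma displacement_diff:
  assumes x: "norm x \<le> 3 * R" "norm z \<le> 3 * R" and e: "norm (x - z) \<le> e"
  shows "norm ((T s (s+h) z - z) - (T s (s+h) x - x)) \<le> Ku * (KT * e powr (9/10)) powr (9/10) * h"
proof -
  let ?f = "\<lambda>r. T s r z - T s r x"
  have "norm (?f (s+h) - ?f s) \<le> Ku * (KT * e powr (9/10)) powr (9/10) * \<bar>(s+h) - s\<bar>"
  proof (rule vector_mean_value[where f' = "\<lambda>r. u r (T s r z) - u r (T s r x)" and a = s and b = "s + h"])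
    fix r assume r: "r \<in> {s..s+h}"
    show "(?f has_vector_derivative u r (T s r z) - u r (T s r x)) (at r within {s..s+h})"
      using r s by (intro has_vector_derivative_diff T_ode_on) auto
    have b: "norm (T s r z) \<le> 6 * R" "norm (T s r x) \<le> 6 * R"
      using T_bound_on[OF r, of z] T_bound_on[OF r, of x] x by auto
    have "norm (T s r z - T s r x) \<le> KT * norm (z - x) powr (9/10)"
      by (rule T_hol) (use r s h x in auto)
    also have "\<dots> \<le> KT * e powr (9/10)"
      using e K_nonneg by (intro mult_left_mono powr_mono2) (auto simp: norm_minus_commute)
    finally have c: "norm (T s r z - T s r x) \<le> KT * e powr (9/10)" .
    have "norm (u r (T s r z) - u r (T s r x)) \<le> Ku * norm (T s r z - T s r x) powr (9/10)"
      by (rule u_hol[OF _ b]) (use r s in auto)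
    also have "\<dots> \<le> Ku * (KT * e powr (9/10)) powr (9/10)"
      using c K_nonneg by (intro mult_left_mono powr_mono2) auto
    finally show "norm (u r (T s r z) - u r (T s r x)) \<le> Ku * (KT * e powr (9/10)) powr (9/10)" .
  qed (use h in auto)
  moreover have "?f (s+h) - ?f s = (T s (s+h) z - z) - (T s (s+h) x - x)" using s by (simp add: T_same)
  ultimately show ?thesis using h by simp
qed

text \<open>The trivial bound is of order \<open>e * h\<close>. For a further power of
  \<open>h\<close>, the time derivative of the integral, in which \<open>u\<close> is evaluated at
  the moved point \<open>T s r z\<close>, is compared with the same integral at \<open>z\<close>,
  which is \<open>0\<close> by incompressibility.\<close>

lemma displacement_div:
  assumes x: "norm x \<le> 2 * R" and e: "0 < e" "e \<le> R"
  shows "\<bar>\<integral>z. drho e z x 1 * (T s (s+h) z - z) $ 1 + drho e z x 2 * (T s (s+h) z - z) $ 2 \<partial>lborel\<bar>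
    \<le> 16 * e * (Ku * (24 * M * R * h) powr (9/10)) * h"
proof -
  define D where "D = (\<lambda>z (y::real^2). drho e z x 1 * y $ 1 + drho e z x 2 * y $ 2)"
  have Dn: "norm (D z y) \<le> 4 / e * norm y" for z y unfolding D_def by (rule drho_bound[OF e(1)])
  have Dz: "D z y = 0" if "norm (x - z) \<ge> e" for z y using drho_outside[OF e(1) that] by (simp add: D_def)
  have Dl: "bounded_linear (D z)" for z
    unfolding D_def by (intro bounded_linear_add bounded_linear_const_mult bounded_linear_vec_nth)
  have z3: "norm z \<le> 3 * R" if "norm (x - z) \<le> e" for z
    using that x e norm_triangle_ineq4[of x "x - z"] by simp
  define G where "G = (\<lambda>r. \<integral>z. D z (T s r z - z) \<partial>lborel)"
  define G' where "G' = (\<lambda>r. \<integral>z. D z (u r (T s r z)) \<partial>lborel)"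
  have T_c: "continuous_on UNIV (T s r)" if "r \<in> {s..s+h}" for r using that s by (intro T_continuous) auto
  have uT_c: "continuous_on UNIV (\<lambda>z. u r (T s r z))" if "r \<in> {s..s+h}" for r
    by (rule continuous_on_compose2[OF u_cont T_c[OF that]]) (use that s in auto)
  have uT_b: "norm (u r (T s r z)) \<le> 24 * M * R" if "r \<in> {s..s+h}" "norm (x - z) \<le> e" for r z
    by (rule u_T_bound[OF that(1) z3[OF that(2)]])
  have c0: "0 \<le> 24 * M * R" using M0 R by simp
  have G'_bound: "\<bar>G' r\<bar> \<le> 16 * e * (Ku * (24 * M * R * h) powr (9/10))" if r: "r \<in> {s..s+h}" for r
  proof -
    have r0: "0 \<le> r" using r s by auto
    have i1: "integrable lborel (\<lambda>z. drho e z x 1 * u r (T s r z) $ 1 + drho e z x 2 * u r (T s r z) $ 2)"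
      by (rule integral_drho_dot(2)[OF uT_c[OF r] e(1) _ c0]) (rule uT_b[OF r])
    have ub: "norm (u r z) \<le> 12 * M * R" if "norm (x - z) \<le> e" for z
    proof -
      have "norm (u r z) \<le> 4 * M * norm z" by (rule u_growth[OF r0])
      also have "\<dots> \<le> 4 * M * (3 * R)" using z3[OF that] M0 by (intro mult_left_mono) auto
      finally show ?thesis by simp
    qed
    have i2': "integrable lborel (\<lambda>z. drho e z x 1 * u r z $ 1 + drho e z x 2 * u r z $ 2)"
      by (rule integral_drho_dot(2)[OF u_cont[OF r0] e(1), of _ "12 * M * R"]) (use ub M0 R in auto)
    have w0: "(\<integral>z. drho e z x 1 * u r z $ 1 + drho e z x 2 * u r z $ 2 \<partial>lborel) = 0"
      by (rule weak_div_zero_rho[OF _ u_cont[OF r0] e(1)]) (use vel[OF r0] in \<open>simp add: velocity_of_def\<close>)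
    have "G' r = (\<integral>z. drho e z x 1 * u r (T s r z) $ 1 + drho e z x 2 * u r (T s r z) $ 2 \<partial>lborel)
       - (\<integral>z. drho e z x 1 * u r z $ 1 + drho e z x 2 * u r z $ 2 \<partial>lborel)"
      unfolding w0 by (simp add: G'_def D_def)
    also have "\<dots> = (\<integral>z. drho e z x 1 * (u r (T s r z) - u r z) $ 1 + drho e z x 2 * (u r (T s r z) - u r z) $ 2 \<partial>lborel)"
      unfolding Bochner_Integration.integral_diff[OF i1 i2', symmetric]
      by (intro Bochner_Integration.integral_cong refl) (simp add: algebra_simps)
    finally have "G' r = (\<integral>z. drho e z x 1 * (u r (T s r z) - u r z) $ 1 + drho e z x 2 * (u r (T s r z) - u r z) $ 2 \<partial>lborel)" .
    moreover have "\<bar>\<integral>z. drho e z x 1 * (u r (T s r z) - u r z) $ 1 + drho e z x 2 * (u r (T s r z) - u r z) $ 2 \<partial>lborel\<bar> \<le> 16 * e * (Ku * (24 * M * R * h) powr (9/10))"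
    proof (rule integral_drho_dot(1)[OF _ e(1)])
      show "continuous_on UNIV (\<lambda>z. u r (T s r z) - u r z)" by (intro continuous_on_diff uT_c r u_cont r0)
      fix z assume z: "norm (x - z) \<le> e"
      have "norm (u r (T s r z) - u r z) \<le> Ku * norm (T s r z - z) powr (9/10)"
        by (rule u_hol[OF r0]) (use T_bound_on[OF r, of z] z3[OF z] R in auto)
      also have "\<dots> \<le> Ku * (24 * M * R * h) powr (9/10)"
        using displacement_bound[OF z3[OF z] r] K_nonneg by (intro mult_left_mono powr_mono2) auto
      finally show "norm (u r (T s r z) - u r z) \<le> Ku * (24 * M * R * h) powr (9/10)" .
    qed (use K_nonneg in auto)
    ultimately show ?thesis by simp
  qed
  have G_deriv: "(G has_vector_derivative G' r) (at r within {s..s+h})" if r: "r \<in> {s..s+h}" for r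
  proof -
    define g where "g = (\<lambda>z. 4 / e * (24 * M * R) * indicator (cball x e) z)"
    have g0: "0 \<le> g z" for z using e c0 by (simp add: g_def)
    have "(G has_derivative (\<lambda>k. \<integral>z. k * D z (u r (T s r z)) \<partial>lborel)) (at r within {s..s+h})"
      unfolding G_def
    proof (rule has_derivative_integral[where g = g, OF r])
      show "((\<lambda>y. D z (T s y z - z)) has_derivative (\<lambda>k. k * D z (u r (T s r z)))) (at r within {s..s+h})" for z
      proof -
        have "((\<lambda>y. T s y z - z) has_vector_derivative u r (T s r z)) (at r within {s..s+h})"
          using has_vector_derivative_diff[OF T_ode_on[OF s r] has_vector_derivative_const] by simp
        from bounded_linear.has_vector_derivative[OF Dl this]
        show ?thesis by (simp add: has_vector_derivative_def)
      qed
      show "integrable lborel (\<lambda>z. D z (T s y z - z))" if y: "y \<in> {s..s+h}" for y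
        unfolding D_def
      proof (rule integral_drho_dot(2)[OF _ e(1)])
        show "continuous_on UNIV (\<lambda>z. T s y z - z)" by (intro continuous_on_diff T_c y continuous_on_id)
        show "norm (T s y z - z) \<le> 24 * M * R * h" if "norm (x - z) \<le> e" for z
          by (rule displacement_bound[OF z3[OF that] y])
      qed (use c0 h in auto)
      show "integrable lborel (\<lambda>z. k * D z (u r (T s r z)))" for k
      proof -
        have "integrable lborel (\<lambda>z. D z (u r (T s r z)))" unfolding D_def
          by (rule integral_drho_dot(2)[OF uT_c[OF r] e(1) _ c0]) (rule uT_b[OF r])
        then show ?thesis by (rule integrable_mult_right)
      qed
      show "norm (D z (T s y z - z) - D z (T s r z - z)) \<le> norm (y - r) * g z" if y: "y \<in> {s..s+h}" for y z
      proof (cases "z \<in> cball x e")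
        case True
        then have zz: "norm z \<le> 3 * R" by (intro z3) (simp add: dist_norm)
        have "D z (T s y z - z) - D z (T s r z - z) = D z (T s y z - T s r z)"
          using linear_diff[OF bounded_linear.linear[OF Dl], symmetric, of z "T s y z - z" "T s r z - z"] by simp
        then have "norm (D z (T s y z - z) - D z (T s r z - z)) \<le> 4 / e * norm (T s y z - T s r z)" using Dn by simp
        also have "\<dots> \<le> 4 / e * (24 * M * R * \<bar>y - r\<bar>)"
          using T_speed[OF y r zz] e by (intro mult_left_mono) auto
        finally show ?thesis using True by (simp add: g_def mult_ac)
      next
        case False
        then show ?thesis using Dz[of z] g0[of z] by (simp add: dist_norm)
      qed
      show "norm (k * D z (u r (T s r z))) \<le> norm k * g z" for k z
      proof (cases "z \<in> cball x e")
        case True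
        have "norm (D z (u r (T s r z))) \<le> 4 / e * norm (u r (T s r z))" by (rule Dn)
        also have "\<dots> \<le> 4 / e * (24 * M * R)" using uT_b[OF r, of z] True e by (intro mult_left_mono) (auto simp: dist_norm)
        finally have "norm k * norm (D z (u r (T s r z))) \<le> norm k * (4 / e * (24 * M * R))" by (intro mult_left_mono) auto
        then show ?thesis using True by (simp add: g_def abs_mult)
      next
        case False
        then show ?thesis using Dz[of z] g0[of z] by (simp add: dist_norm)
      qed
      show "integrable lborel g"
        unfolding g_def by (intro integrable_mult_right, subst integrable_indicator_iff) (use emeasure_lborel_cball_finite in auto)
    qed
    then show ?thesis by (simp add: has_vector_derivative_def G'_def)
  qed
  have "norm (G (s+h) - G s) \<le> 16 * e * (Ku * (24 * M * R * h) powr (9/10)) * \<bar>(s+h) - s\<bar>"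
    by (rule vector_mean_value[OF G_deriv]) (use G'_bound h in auto)
  moreover have "G s = 0" using s by (simp add: G_def T_same D_def)
  ultimately show ?thesis using h by (simp add: G_def D_def)
qed

end

end

section \<open>From one time step to measure preservation\<close>

lemma mpres_comp: "mpres X \<Longrightarrow> mpres Y \<Longrightarrow> mpres (\<lambda>x. X (Y x))"
  unfolding mpres_def
proof safe
  assume X: "X \<in> borel_measurable borel" "distr lborel borel X = lborel"
    and Y: "Y \<in> borel_measurable borel" "distr lborel borel Y = lborel"
  show "(\<lambda>x. X (Y x)) \<in> borel_measurable borel" using measurable_compose[OF Y(1) X(1)] by simp
  have "distr lborel borel (\<lambda>x. X (Y x)) = distr (distr lborel borel Y) borel X"
    using distr_distr[of X borel borel Y lborel] X(1) Y(1) by (simp add: comp_def)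
  then show "distr lborel borel (\<lambda>x. X (Y x)) = lborel" using X Y by simp
qed

text \<open>Boxes determine the measure, and the indicator of a box is the pointwise limit of
  truncated multiples of the distance to its complement, which are Lipschitz. By
  \<open>proper\<close> the compositions with \<open>X\<close> have their supports in a fixed disc,
  so dominated convergence applies on both sides.\<close>

lemma mpres_from_lipschitz_tests:
  fixes X :: "real^2 \<Rightarrow> real^2"
  assumes X: "continuous_on UNIV X" and proper: "\<And>x. norm x \<le> 2 * norm (X x)"
    and test: "\<And>\<phi> L R. continuous_on UNIV \<phi> \<Longrightarrow> 0 < R \<Longrightarrow> 0 \<le> L \<Longrightarrow> (\<And>x. norm x > R \<Longrightarrow> \<phi> x = 0) \<Longrightarrow>
      (\<And>x y. \<bar>\<phi> x - \<phi> y\<bar> \<le> L * norm (x - y)) \<Longrightarrow> (\<And>x. \<bar>\<phi> x\<bar> \<le> 1) \<Longrightarrow>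
      (\<integral>x. \<phi> (X x) \<partial>lborel) = (\<integral>x. \<phi> x \<partial>lborel)"
  shows "mpres X"
proof -
  have [measurable]: "X \<in> borel_measurable borel" by (rule borel_measurable_continuous_onI[OF X])
  have "lborel = distr lborel borel X"
  proof (rule lborel_eqI)
    fix l b :: "real^2" assume lb: "\<And>i. i \<in> Basis \<Longrightarrow> l \<bullet> i \<le> b \<bullet> i"
    define Q where "Q = box l b"
    have Q [measurable]: "Q \<in> sets borel" "open Q" by (auto simp: Q_def)
    obtain R where R: "0 < R" "Q \<subseteq> cball 0 R"
      using bounded_box[of l b] unfolding bounded_pos Q_def by (metis mem_cball_0 subsetI)
    have ne: "- Q \<noteq> {}"
    proof
      assume "- Q = {}"
      then have "Q = UNIV" by blast
      then have "box l b = UNIV" by (simp add: Q_def)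
      then have "bounded (UNIV :: (real^2) set)" using bounded_box[of l b] by simp
      then show False using not_bounded_UNIV by blast
    qed
    define p where "p = (\<lambda>n::nat. \<lambda>x. min 1 (real n * infdist x (- Q)))"
    have p_cont: "continuous_on UNIV (p n)" for n
      unfolding p_def by (intro continuous_intros)
    have p01: "0 \<le> p n x" "p n x \<le> 1" for n x by (auto simp: p_def infdist_nonneg)
    have p_out: "p n x = 0" if "x \<notin> Q" for n x
      using that by (simp add: p_def infdist_zero)
    have p_le: "p n x \<le> indicator Q x" for n x using p01 p_out by (auto simp: indicator_def)
    have lim: "(\<lambda>n. p n x) \<longlonglongrightarrow> indicator Q x" for x
    proof (cases "x \<in> Q")
      case True
      have "closed (- Q)" using Q by (simp add: closed_open)
      then have "infdist x (- Q) \<noteq> 0" using in_closed_iff_infdist_zero[OF _ ne, of x] True by simp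
      then have d: "infdist x (- Q) > 0" using infdist_nonneg[of x "- Q"] by linarith
      obtain N :: nat where N: "1 / infdist x (- Q) < real N" using reals_Archimedean2 by blast
      have "p n x = 1" if "n \<ge> N" for n
      proof -
        have "1 / infdist x (- Q) < real n" using N that by linarith
        then show ?thesis using d by (simp add: p_def field_simps)
      qed
      then have "\<forall>\<^sub>F n in sequentially. p n x = 1" by (auto simp: eventually_sequentially)
      then show ?thesis using True by (simp add: tendsto_eventually)
    next
      case False then show ?thesis by (simp add: p_out)
    qed
    have p_lip: "\<bar>p n x - p n y\<bar> \<le> real n * norm (x - y)" for n x y
    proof -
      have "\<bar>infdist x (- Q) - infdist y (- Q)\<bar> \<le> norm (x - y)"
        using infdist_triangle[of x "- Q" y] infdist_triangle[of y "- Q" x] by (simp add: dist_norm norm_minus_commute)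
      then have "real n * \<bar>infdist x (- Q) - infdist y (- Q)\<bar> \<le> real n * norm (x - y)" by (intro mult_left_mono) auto
      then have "\<bar>real n * infdist x (- Q) - real n * infdist y (- Q)\<bar> \<le> real n * norm (x - y)"
        by (simp add: right_diff_distrib[symmetric] abs_mult)
      then show ?thesis unfolding p_def by linarith
    qed
    have eq: "(\<integral>x. p n (X x) \<partial>lborel) = (\<integral>x. p n x \<partial>lborel)" for n
    proof (rule test[OF p_cont R(1) _ _ p_lip])
      show "p n x = 0" if "norm x > R" for x using that R(2) by (intro p_out) auto
      show "\<bar>p n x\<bar> \<le> 1" for x using p01[of n x] by simp
    qed auto
    have fin: "integrable lborel (indicator (cball (0::real^2) r) :: _ \<Rightarrow> real)" for r
      by (subst integrable_indicator_iff) (use emeasure_lborel_cball_finite in auto)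
    have pm [measurable]: "p n \<in> borel_measurable borel" for n
      by (rule borel_measurable_continuous_onI[OF p_cont])
    have l1: "(\<lambda>n. \<integral>x. p n x \<partial>lborel) \<longlonglongrightarrow> (\<integral>x. indicator Q x \<partial>lborel)"
    proof (rule integral_dominated_convergence[OF _ _ fin[of R]])
      show "AE x in lborel. norm (p n x) \<le> indicator (cball 0 R) x" for n
      proof (rule AE_I2)
        fix x
        show "norm (p n x) \<le> indicator (cball 0 R) x"
        proof (cases "x \<in> Q")
          case True
          then have "x \<in> cball 0 R" using R(2) by blast
          then show ?thesis using p01[of n x] by simp
        qed (simp add: p_out)
      qed
    qed (use lim in auto)
    have l2: "(\<lambda>n. \<integral>x. p n (X x) \<partial>lborel) \<longlonglongrightarrow> (\<integral>x. indicator Q (X x) \<partial>lborel)"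
    proof (rule integral_dominated_convergence[OF _ _ fin[of "2 * R"]])
      show "AE x in lborel. norm (p n (X x)) \<le> indicator (cball 0 (2 * R)) x" for n
      proof (rule AE_I2)
        fix x
        show "norm (p n (X x)) \<le> indicator (cball 0 (2 * R)) x"
        proof (cases "X x \<in> Q")
          case True
          then have "norm (X x) \<le> R" using R(2) by auto
          then have "norm x \<le> 2 * R" using proper[of x] by linarith
          then show ?thesis using p01[of n "X x"] by simp
        qed (simp add: p_out)
      qed
    qed (use lim in auto)
    have "(\<integral>x. indicator Q (X x) \<partial>lborel) = (\<integral>x. indicator Q x \<partial>(lborel :: (real^2) measure) :: real)"
      using LIMSEQ_unique[OF l1 l2[unfolded eq]] by simp
    moreover have "(\<lambda>x. indicator Q (X x) :: real) = indicator (X -` Q)" by (auto simp: indicator_def)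
    ultimately have m: "measure lborel (X -` Q) = measure lborel Q" by simp
    have XQ: "X -` Q \<inter> space borel \<in> sets borel" by (rule measurable_sets[of X borel borel]) auto
    have "X -` Q \<subseteq> cball 0 (2 * R)"
    proof
      fix x assume "x \<in> X -` Q"
      then have "norm (X x) \<le> R" using R(2) by auto
      then show "x \<in> cball 0 (2 * R)" using proper[of x] by simp
    qed
    then have "emeasure lborel (X -` Q) \<le> emeasure lborel (cball (0::real^2) (2 * R))" by (intro emeasure_mono) auto
    then have "emeasure lborel (X -` Q) < top"
      using emeasure_lborel_cball_finite[of "0::real^2" "2 * R"] by (metis infinity_ennreal_def le_less_trans)
    then have "emeasure lborel (X -` Q) = ennreal (measure lborel (X -` Q))" by (intro emeasure_eq_ennreal_measure) auto
    moreover have "emeasure lborel Q = ennreal (measure lborel Q)"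
      unfolding Q_def by (intro emeasure_eq_ennreal_measure) (use emeasure_lborel_box_finite[of l b] in auto)
    ultimately have "emeasure lborel (X -` Q) = emeasure lborel Q" using m by simp
    moreover have "emeasure (distr lborel borel X) Q = emeasure lborel (X -` Q)"
      by (subst emeasure_distr) auto
    ultimately show "emeasure (distr lborel borel X) (box l b) = (\<Prod>i\<in>Basis. (b - l) \<bullet> i)"
      using lb by (simp add: Q_def emeasure_lborel_box)
  qed simp
  then show ?thesis by (simp add: mpres_def)
qed

context flow_solution
begin

lemma T_proper: "0 \<le> s \<Longrightarrow> 0 \<le> t \<Longrightarrow> \<bar>t - s\<bar> \<le> T0 \<Longrightarrow> norm x \<le> 2 * norm (T s t x)"
  using T_bound[of t s "T s t x"] T_T[of t s s x] T_same[of s x] by (simp add: abs_minus_commute)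

text \<open>Mollification at scale \<open>h powr (1/4)\<close> makes all errors of a time step \<open>h\<close> superlinear in \<open>h\<close>.\<close>

lemma step_bound:
  assumes R: "0 < R" and H: "0 \<le> H" and B: "0 \<le> B"
  obtains K h0 where "0 < h0"
    and "\<And>s h \<psi>. 0 \<le> s \<Longrightarrow> 0 < h \<Longrightarrow> h \<le> h0 \<Longrightarrow> continuous_on UNIV \<psi> \<Longrightarrow> (\<And>x. norm x > R \<Longrightarrow> \<psi> x = 0) \<Longrightarrow>
      (\<And>x y. norm x \<le> 3 * R \<Longrightarrow> norm y \<le> 3 * R \<Longrightarrow> \<bar>\<psi> x - \<psi> y\<bar> \<le> H * norm (x - y) powr (9/10)) \<Longrightarrow>
      (\<And>x. \<bar>\<psi> x\<bar> \<le> B) \<Longrightarrow> \<bar>(\<integral>x. \<psi> (T s (s + h) x) \<partial>lborel) - (\<integral>x. \<psi> x \<partial>lborel)\<bar> \<le> K * h powr (27/25)"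
proof -
  define c where "c = 24 * M * R"
  define ku kt where "ku = Ku R" and "kt = KT R"
  have c0: "0 \<le> c" using M0 R by (simp add: c_def)
  have k0: "0 \<le> ku" "0 \<le> kt" unfolding ku_def kt_def using K_nonneg[OF R _ T0(1), of 0] by auto
  define k3 where "k3 = ku * kt powr (9/10)"
  have k3: "0 \<le> k3" using k0 by (simp add: k3_def)
  define K where "K = 16 * R\<^sup>2 * (H * k3 powr (9/10) + B * (384 * ku * c powr (9/10) + 320000 * c\<^sup>2))"
  \<comment> \<open>The conditions under which \<open>near_identity_volume\<close> will apply with
    \<open>e = h powr (1/4)\<close>, \<open>v = c * h\<close> and
    \<open>k = k3 * h powr (481/400)\<close>; they hold for small \<open>h\<close>, all exponents
    being positive.\<close>
  have "\<forall>\<^sub>F h in at_right 0. h \<in> {0<..<T0}" by (rule eventually_at_right_real[OF T0(1)])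
  moreover have "\<forall>\<^sub>F h in at_right 0. 1 * h powr (1/4) < R"
    by (rule order_tendstoD(2)[OF powr_tendsto_0]) (use R in auto)
  moreover have "\<forall>\<^sub>F h in at_right 0. (400 * c) * h powr (3/4) < 1/4"
    by (rule order_tendstoD(2)[OF powr_tendsto_0]) auto
  moreover have "\<forall>\<^sub>F h in at_right 0. c * h powr 1 < R / 2"
    by (rule order_tendstoD(2)[OF powr_tendsto_0]) (use R in auto)
  moreover have "\<forall>\<^sub>F h in at_right 0. k3 * h powr (481/400) < R / 2"
    by (rule order_tendstoD(2)[OF powr_tendsto_0]) (use R in auto)
  ultimately have "\<forall>\<^sub>F h in at_right 0. h < T0 \<and> h powr (1/4) < R \<and> 400 * c * h powr (3/4) < 1/4 \<and> c * h powr 1 < R / 2 \<and> k3 * h powr (481/400) < R / 2"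
    by eventually_elim auto
  then obtain b where b: "0 < b" "\<And>h. 0 < h \<Longrightarrow> h < b \<Longrightarrow> h < T0 \<and> h powr (1/4) < R \<and> 400 * c * h powr (3/4) < 1/4 \<and> c * h powr 1 < R / 2 \<and> k3 * h powr (481/400) < R / 2"
    unfolding eventually_at_right_field by blast
  show ?thesis
  proof (rule that[of "b / 2" K])
    show "0 < b / 2" using b by simp
    fix s h :: real and \<psi> :: "real^2 \<Rightarrow> real"
    assume s: "0 \<le> s" and h: "0 < h" "h \<le> b / 2"
      and psi: "continuous_on UNIV \<psi>" "\<And>x. norm x > R \<Longrightarrow> \<psi> x = 0"
      "\<And>x y. norm x \<le> 3 * R \<Longrightarrow> norm y \<le> 3 * R \<Longrightarrow> \<bar>\<psi> x - \<psi> y\<bar> \<le> H * norm (x - y) powr (9/10)" "\<And>x. \<bar>\<psi> x\<bar> \<le> B"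
    have hb: "h < T0" "h powr (1/4) < R" "400 * c * h powr (3/4) < 1/4" "c * h powr 1 < R / 2" "k3 * h powr (481/400) < R / 2"
      using b(2)[of h] h b(1) by auto
    have hT: "h \<le> T0" "h \<le> 1" using hb T0(4) by auto
    define e where "e = h powr (1/4)"
    have e: "0 < e" "e \<le> R" using h hb by (auto simp: e_def)
    define k where "k = ku * (kt * e powr (9/10)) powr (9/10) * h"
    define sg where "sg = 16 * e * (ku * (c * h) powr (9/10)) * h"
    \<comment> \<open>The exponent is \<open>1/4 * 9/10 * 9/10 + 1\<close>: the scale
      \<open>e\<close> passes through the Hoelder bounds of the flow and of the velocity, and the
      last summand is the length of the step.\<close>
    have k_eq: "k = k3 * h powr (481/400)"
    proof -
      have "(kt * e powr (9/10)) powr (9/10) * h = kt powr (9/10) * (h powr (81/400) * h powr 1)"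
        using k0 h by (simp add: e_def powr_mult powr_powr)
      also have "\<dots> = kt powr (9/10) * h powr (481/400)" by (simp only: powr_add[symmetric]) simp
      finally show ?thesis by (simp add: k_def k3_def mult.assoc)
    qed
    have ve: "400 * (c * h) / e = 400 * c * h powr (3/4)"
    proof -
      have "h / e = h powr 1 / h powr (1/4)" using h by (simp add: e_def)
      also have "\<dots> = h powr (3/4)" by (simp only: powr_diff[symmetric]) simp
      finally have "h / e = h powr (3/4)" .
      moreover have "400 * (c * h) / e = 400 * c * (h / e)" by simp
      ultimately show ?thesis by (simp only:)
    qed
    have main: "\<bar>(\<integral>x. \<psi> (T s (s + h) x) \<partial>lborel) - (\<integral>x. \<psi> x \<partial>lborel)\<bar>
      \<le> 16 * R\<^sup>2 * (H * k powr (9/10) + B * (24 * sg / e\<^sup>2 + 2 * (400 * (c * h) / e)\<^sup>2))"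
    proof (rule near_identity_volume[OF _ R e])
      show "continuous_on UNIV (T s (s + h))" using s h by (intro T_continuous) auto
      show "norm (T s (s + h) z - z) \<le> c * h" if "norm z \<le> 3 * R" for z
        unfolding c_def by (rule displacement_bound[OF R s h(1) hT(1) that]) (use h in auto)
      show "400 * (c * h) / e \<le> 1 / 4" unfolding ve using hb(3) by simp
      show "c * h + k \<le> R" using hb(4,5) h by (simp add: k_eq)
      show "0 \<le> k" using k0 h by (simp add: k_def)
      show "norm ((T s (s + h) z - z) - (T s (s + h) x - x)) \<le> k" if "norm x \<le> 2 * R" "norm (x - z) \<le> e" for x z
        unfolding k_def ku_def kt_def
      proof (rule displacement_diff[OF R s h(1) hT(1)])
        show "norm z \<le> 3 * R" using that e norm_triangle_ineq4[of x "x - z"] by simp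
      qed (use that R in auto)
      show "\<bar>\<integral>z. drho e z x 1 * (T s (s + h) z - z) $ 1 + drho e z x 2 * (T s (s + h) z - z) $ 2 \<partial>lborel\<bar> \<le> sg"
        if "norm x \<le> 2 * R" for x
        unfolding sg_def c_def ku_def by (rule displacement_div[OF R s h(1) hT(1) that e])
      show "norm x \<le> 2 * R" if "norm (T s (s + h) x) \<le> R" for x
        using T_proper[of s "s + h" x] that s h hT by simp
    qed (use psi H in auto)
    \<comment> \<open>The three errors carry the exponents \<open>4329/4000\<close>,
      \<open>33/20\<close> and \<open>3/2\<close>; \<open>27/25\<close> is a common lower bound that
      still exceeds \<open>1\<close>.\<close>
    have mono: "h powr p \<le> h powr (27/25)" if "27/25 \<le> p" for p
      using h hT that by (intro powr_mono') auto
    have t1: "H * k powr (9/10) \<le> H * k3 powr (9/10) * h powr (27/25)"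
    proof -
      have "k powr (9/10) = k3 powr (9/10) * h powr (4329/4000)"
        unfolding k_eq using k3 h by (simp add: powr_mult powr_powr)
      also have "\<dots> \<le> k3 powr (9/10) * h powr (27/25)" by (intro mult_left_mono mono) auto
      finally show ?thesis using H by (simp add: mult.assoc mult_left_mono)
    qed
    have t2: "24 * sg / e\<^sup>2 \<le> 384 * ku * c powr (9/10) * h powr (27/25)"
    proof -
      have "24 * sg / e\<^sup>2 = 384 * ku * c powr (9/10) * (h powr (9/10) * h powr 1 / e)"
        using e c0 h by (simp add: sg_def power2_eq_square powr_mult field_simps)
      also have "h powr (9/10) * h powr 1 / e = h powr (33/20)"
        unfolding e_def by (simp only: powr_add[symmetric] powr_diff[symmetric]) simp
      also have "384 * ku * c powr (9/10) * h powr (33/20) \<le> 384 * ku * c powr (9/10) * h powr (27/25)"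
        using k0 by (intro mult_left_mono mono) auto
      finally show ?thesis .
    qed
    have t3: "2 * (400 * (c * h) / e)\<^sup>2 \<le> 320000 * c\<^sup>2 * h powr (27/25)"
    proof -
      have "(h powr (3/4))\<^sup>2 = h powr (3/2)" by (simp add: power2_eq_square powr_add[symmetric])
      then have "2 * (400 * (c * h) / e)\<^sup>2 = 320000 * c\<^sup>2 * h powr (3/2)"
        unfolding ve by (simp add: power_mult_distrib)
      also have "\<dots> \<le> 320000 * c\<^sup>2 * h powr (27/25)" by (intro mult_left_mono mono) auto
      finally show ?thesis .
    qed
    have "H * k powr (9/10) + B * (24 * sg / e\<^sup>2 + 2 * (400 * (c * h) / e)\<^sup>2)
      \<le> H * k3 powr (9/10) * h powr (27/25) + B * (384 * ku * c powr (9/10) * h powr (27/25) + 320000 * c\<^sup>2 * h powr (27/25))"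
      by (intro add_mono mult_left_mono t1 t2 t3 B)
    then have "16 * R\<^sup>2 * (H * k powr (9/10) + B * (24 * sg / e\<^sup>2 + 2 * (400 * (c * h) / e)\<^sup>2))
      \<le> 16 * R\<^sup>2 * (H * k3 powr (9/10) * h powr (27/25) + B * (384 * ku * c powr (9/10) * h powr (27/25) + 320000 * c\<^sup>2 * h powr (27/25)))"
      by (intro mult_left_mono) auto
    also have "\<dots> = K * h powr (27/25)" by (simp add: K_def algebra_simps)
    finally show "\<bar>(\<integral>x. \<psi> (T s (s + h) x) \<partial>lborel) - (\<integral>x. \<psi> x \<partial>lborel)\<bar> \<le> K * h powr (27/25)"
      using main by linarith
  qed
qed

text \<open>The starting time \<open>s\<close> varies while \<open>t\<close> is fixed. Passing from
  \<open>s'\<close> back to \<open>s\<close> composes the function \<open>\<phi> (T s' t x)\<close>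
  with one short step. This function is Hoelder continuous uniformly in \<open>s'\<close> and
  vanishes outside the disc of radius \<open>2 * R\<close>, so \<open>step_bound\<close> makes the
  increments of the integral superlinear and the integral constant.\<close>

lemma flow_test_integral:
  assumes a: "0 \<le> a" "a \<le> t" "t - a \<le> T0"
    and phi: "continuous_on UNIV \<phi>" "0 < R" "0 \<le> L" "\<And>x. norm x > R \<Longrightarrow> \<phi> x = 0"
      "\<And>x y. \<bar>\<phi> x - \<phi> y\<bar> \<le> L * norm (x - y)" "\<And>x. \<bar>\<phi> x\<bar> \<le> (1::real)"
  shows "(\<integral>x. \<phi> (T a t x) \<partial>lborel) = (\<integral>x. \<phi> x \<partial>lborel)"
proof -
  have R2: "0 < 2 * R" using phi by simp
  have kt: "0 \<le> KT (2 * R)" using K_nonneg(2)[OF R2 _ T0(1), of 0] by simp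
  obtain K h0 where h0: "0 < h0"
    and st: "\<And>s h \<psi>. 0 \<le> s \<Longrightarrow> 0 < h \<Longrightarrow> h \<le> h0 \<Longrightarrow> continuous_on UNIV \<psi> \<Longrightarrow> (\<And>x. norm x > 2 * R \<Longrightarrow> \<psi> x = 0) \<Longrightarrow>
      (\<And>x y. norm x \<le> 3 * (2 * R) \<Longrightarrow> norm y \<le> 3 * (2 * R) \<Longrightarrow> \<bar>\<psi> x - \<psi> y\<bar> \<le> (L * KT (2 * R)) * norm (x - y) powr (9/10)) \<Longrightarrow>
      (\<And>x. \<bar>\<psi> x\<bar> \<le> 1) \<Longrightarrow> \<bar>(\<integral>x. \<psi> (T s (s + h) x) \<partial>lborel) - (\<integral>x. \<psi> x \<partial>lborel)\<bar> \<le> K * h powr (27/25)"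
  proof (rule step_bound[OF R2 mult_nonneg_nonneg[OF phi(3) kt] zero_le_one], goal_cases)
    case (1 K h0)
    show ?case by (rule 1(1)[OF 1(2)]) (rule 1(3))
  qed
  define J where "J = (\<lambda>s. \<integral>x. \<phi> (T s t x) \<partial>lborel)"
  have "J a = J t"
  proof (rule superlinear_constant[OF _ _ h0 a(2)])
    fix s s' assume s: "a \<le> s" "s < s'" "s' \<le> t" "s' - s \<le> h0"
    define \<psi> where "\<psi> = (\<lambda>x. \<phi> (T s' t x))"
    have s': "0 \<le> s'" "0 \<le> t" "\<bar>t - s'\<bar> \<le> T0" "0 \<le> s" using s a by auto
    have "\<bar>(\<integral>x. \<psi> (T s (s + (s' - s)) x) \<partial>lborel) - (\<integral>x. \<psi> x \<partial>lborel)\<bar> \<le> K * (s' - s) powr (27/25)"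
    proof (rule st)
      show "continuous_on UNIV \<psi>" unfolding \<psi>_def
        by (rule continuous_on_compose2[OF phi(1) T_continuous]) (use s' in auto)
      show "\<psi> x = 0" if "norm x > 2 * R" for x
        unfolding \<psi>_def using T_proper[OF s'(1,2,3), of x] that by (intro phi) simp
      show "\<bar>\<psi> x - \<psi> y\<bar> \<le> (L * KT (2 * R)) * norm (x - y) powr (9/10)"
        if "norm x \<le> 3 * (2 * R)" "norm y \<le> 3 * (2 * R)" for x y
      proof -
        have "\<bar>\<psi> x - \<psi> y\<bar> \<le> L * norm (T s' t x - T s' t y)" unfolding \<psi>_def by (rule phi)
        also have "\<dots> \<le> L * (KT (2 * R) * norm (x - y) powr (9/10))"
          by (intro mult_left_mono phi T_hol[OF R2 order_refl T0(1) order_refl s'(1,2,3) that])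
        finally show ?thesis by simp
      qed
      show "\<bar>\<psi> x\<bar> \<le> 1" for x unfolding \<psi>_def by (rule phi)
    qed (use s s' in auto)
    moreover have "(\<integral>x. \<psi> (T s (s + (s' - s)) x) \<partial>lborel) = J s"
      using T_T[OF s'(1), of t s] by (simp add: \<psi>_def J_def)
    ultimately show "\<bar>J s - J s'\<bar> \<le> K * (s' - s) powr (27/25)" by (simp add: \<psi>_def J_def)
  qed simp
  then show ?thesis using a by (simp add: J_def T_same)
qed

lemma mpres_T: assumes a: "0 \<le> a" "a \<le> t" "t - a \<le> T0" shows "mpres (T a t)"
proof (rule mpres_from_lipschitz_tests)
  show "continuous_on UNIV (T a t)" using a by (intro T_continuous) auto
  show "norm x \<le> 2 * norm (T a t x)" for x using a by (intro T_proper) auto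
qed (rule flow_test_integral[OF a])

text \<open>The Hoelder exponent is under control on intervals of length \<open>T0\<close> only, so
  longer times are split; measure preservation, unlike the exponent, is not weakened by
  composition.\<close>

lemma mpres_\<Phi>_upto: "0 \<le> t \<Longrightarrow> t \<le> real n * T0 \<Longrightarrow> mpres (\<Phi> t)"
proof (induction n arbitrary: t)
  case 0
  then have "t = 0" by simp
  moreover have "\<Phi> 0 = (\<lambda>x. x)" using \<Phi>_0 by auto
  ultimately show ?case using mpres_id by simp
next
  case (Suc n)
  define a where "a = max 0 (t - T0)"
  have a: "0 \<le> a" "a \<le> t" "t - a \<le> T0" "a \<le> real n * T0"
    using Suc.prems T0(1) by (auto simp: a_def algebra_simps)
  have "\<Phi> t = (\<lambda>x. T a t (\<Phi> a x))" using a by (auto simp: T_def)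
  then show ?case using mpres_comp[OF mpres_T[OF a(1,2,3)] Suc.IH[OF a(1,4)]] by simp
qed

theorem mpres_\<Phi>: assumes "0 \<le> t" shows "mpres (\<Phi> t)"
proof -
  obtain n :: nat where "t / T0 < real n" using reals_Archimedean2 by blast
  then have "t \<le> real n * T0" using T0(1) by (simp add: field_simps)
  then show ?thesis by (rule mpres_\<Phi>_upto[OF assms])
qed

end

section \<open>Two flows with close data at the origin\<close>

text \<open>This measures the effect of different data: the weight \<open>g\<close> is small for
  labels up to \<open>N\<close> and merely bounded beyond, where the decay of the kernel supplies
  \<open>1 / N\<close>. The label \<open>0\<close> is excluded because the values of vorticities are
  arbitrary there.\<close>

lemma kmap_bound:
  assumes X: "mpres X"
    and r: "0 < \<rho>" "0 < b" "2 * \<alpha> \<le> b * \<rho>" "\<alpha> \<le> B" "0 < N" "0 \<le> c" "c \<le> D"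
    and a: "norm a \<le> \<alpha>"
    and near: "\<And>y. norm y \<le> \<rho> \<Longrightarrow> norm (X y) \<le> B"
    and far: "\<And>y. norm y > \<rho> \<Longrightarrow> b * norm y \<le> norm (X y)"
    and g: "\<And>y. y \<noteq> 0 \<Longrightarrow> norm y \<le> N \<Longrightarrow> \<bar>g y\<bar> \<le> c" "AE y in lborel. \<bar>g y\<bar> \<le> D"
    and rN: "\<rho> \<le> N"
  shows "(\<integral>\<^sup>+y. ennreal (norm (of_real (g y) * kmap \<rho> X a y)) \<partial>lborel)
    \<le> ennreal (c * (4 * pi * B + 2 * \<alpha>\<^sup>2 / b ^ 3 * (2 * pi / \<rho>)) + D * (2 * \<alpha>\<^sup>2 / b ^ 3 * (2 * pi / N)))"
proof -
  have [measurable]: "X \<in> borel_measurable borel" using X by (simp add: mpres_def)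
  have B: "0 \<le> B" using a r norm_ge_zero[of a] by linarith
  let ?n = "\<lambda>y. ennreal (norm (X y - a) powr (-1)) * indicator (cball a (2 * B)) (X y)"
  let ?h = "\<lambda>r y. ennreal (1 / norm (y - 0) ^ 3) * indicator {y::real^2. r \<le> norm (y - 0)} y"
  define k where "k = 2 * \<alpha>\<^sup>2 / b ^ 3"
  have k: "0 \<le> k" using r by (simp add: k_def)
  have pt: "ennreal (norm (of_real (g y) * kmap \<rho> X a y)) \<le> ennreal c * ?n y + (ennreal (c * k) * ?h \<rho> y + ennreal (D * k) * ?h N y)"
    if gy: "\<bar>g y\<bar> \<le> D" and y0: "y \<noteq> 0" for y
  proof (cases "norm y \<le> \<rho>")
    case True
    have "\<bar>g y\<bar> \<le> c" using g(1)[OF y0] True rN by linarith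
    moreover have "norm (kmap \<rho> X a y) = norm (X y - a) powr (-1)"
    proof -
      have "kmap \<rho> X a y = 1 / cx (a - X y)" using True by (simp add: kmap_def cx_diff)
      then have "norm (kmap \<rho> X a y) = 1 / norm (X y - a)" by (simp add: norm_divide norm_minus_commute)
      then show ?thesis by (simp add: powr_minus_divide)
    qed
    ultimately have "norm (of_real (g y) * kmap \<rho> X a y) \<le> c * norm (X y - a) powr (-1)"
      by (simp only: norm_mult norm_of_real) (intro mult_right_mono powr_ge_zero; assumption)
    then have "ennreal (norm (of_real (g y) * kmap \<rho> X a y)) \<le> ennreal c * ennreal (norm (X y - a) powr (-1))"
      using r by (subst ennreal_mult[symmetric]) (auto intro: ennreal_leI)
    moreover have "X y \<in> cball a (2 * B)"
      using near[OF True] a r(4) norm_triangle_ineq4[of a "X y"] by (simp add: dist_norm)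
    ultimately show ?thesis by (simp add: add_increasing2)
  next
    case False
    then have y: "\<rho> < norm y" by simp
    have "2 * \<alpha> \<le> b * norm y" using y r(2,3) by (intro order_trans[OF r(3)] mult_left_mono) auto
    then have "norm (kmap \<rho> X a y) \<le> 2 * \<alpha>\<^sup>2 / (b * norm y) ^ 3"
      using False far_ker_bound[of "cx a" \<alpha> "b * norm y" "cx (X y)"] a far[OF y] r y y0
      by (simp add: kmap_def)
    then have kb: "norm (kmap \<rho> X a y) \<le> k * (1 / norm (y - 0) ^ 3)" by (simp add: k_def power_mult_distrib)
    show ?thesis
    proof (cases "norm y \<le> N")
      case True
      have "norm (of_real (g y) * kmap \<rho> X a y) \<le> c * (k * (1 / norm (y - 0) ^ 3))"
        unfolding norm_mult using g(1)[OF y0 True] kb r by (intro mult_mono) auto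
      then have "ennreal (norm (of_real (g y) * kmap \<rho> X a y)) \<le> ennreal (c * k) * ennreal (1 / norm (y - 0) ^ 3)"
        using r k by (subst ennreal_mult[symmetric]) (auto intro: ennreal_leI simp: mult.assoc)
      then have "ennreal (norm (of_real (g y) * kmap \<rho> X a y)) \<le> ennreal (c * k) * ?h \<rho> y" using y by simp
      then show ?thesis by (meson add_increasing add_increasing2 order_trans zero_le)
    next
      case False
      have "norm (of_real (g y) * kmap \<rho> X a y) \<le> D * (k * (1 / norm (y - 0) ^ 3))"
        unfolding norm_mult using gy kb r by (intro mult_mono) auto
      then have "ennreal (norm (of_real (g y) * kmap \<rho> X a y)) \<le> ennreal (D * k) * ennreal (1 / norm (y - 0) ^ 3)"
        using r k by (subst ennreal_mult[symmetric]) (auto intro: ennreal_leI simp: mult.assoc)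
      then have "ennreal (norm (of_real (g y) * kmap \<rho> X a y)) \<le> ennreal (D * k) * ?h N y" using False by simp
      then show ?thesis by (meson add_increasing add_increasing2 order_trans zero_le)
    qed
  qed
  have mh: "?h r \<in> borel_measurable lborel" for r by measurable
  have mn': "(\<lambda>y::real^2. ennreal (norm (y - a) powr (-1)) * indicator (cball a (2 * B)) y) \<in> borel_measurable borel"
    by (intro borel_measurable_times_ennreal borel_measurable_indicator) auto
  have mn: "?n \<in> borel_measurable lborel" using measurable_compose[OF _ mn', of X lborel] by simp
  have ih: "(\<integral>\<^sup>+y. ennreal c * ?h r y \<partial>lborel) = ennreal (c * (2 * pi / r))" if "r > 0" "c \<ge> 0" for r c
    unfolding nn_integral_cmult[OF mh] using nn_integral_norm_powr3_outside[OF that(1), of "0::real^2"] that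
    by (simp only:) (rule ennreal_mult[symmetric], auto)
  have inn: "(\<integral>\<^sup>+y. ennreal c * ?n y \<partial>lborel) = ennreal (c * (4 * pi * B))"
  proof -
    have "integral\<^sup>N lborel ?n = (\<integral>\<^sup>+y. ennreal (norm (y - a) powr (-1)) * indicator (cball a (2 * B)) y \<partial>distr lborel borel X)"
      by (rule nn_integral_distr[symmetric]) (use mn' in auto)
    also have "\<dots> = ennreal (2 * pi * (2 * B) powr (2 - 1) / (2 - 1))"
      using X nn_integral_norm_powr_cball[of 1 "2 * B" a] B by (simp add: mpres_def)
    also have "2 * pi * (2 * B) powr (2 - 1) / (2 - 1) = 4 * pi * B" using B by simp
    finally show ?thesis
      unfolding nn_integral_cmult[OF mn] using r B by (simp only:) (rule ennreal_mult[symmetric], auto)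
  qed
  have "(\<integral>\<^sup>+y. ennreal (norm (of_real (g y) * kmap \<rho> X a y)) \<partial>lborel)
      \<le> (\<integral>\<^sup>+y. ennreal c * ?n y + (ennreal (c * k) * ?h \<rho> y + ennreal (D * k) * ?h N y) \<partial>lborel)"
  proof (rule nn_integral_mono_AE)
    have "AE y in lborel. y \<noteq> (0::real^2)" by (rule AE_lborel_singleton)
    with g(2) show "AE y in lborel. ennreal (norm (of_real (g y) * kmap \<rho> X a y)) \<le> ennreal c * ?n y + (ennreal (c * k) * ?h \<rho> y + ennreal (D * k) * ?h N y)"
      by eventually_elim (rule pt)
  qed
  also have "\<dots> = (\<integral>\<^sup>+y. ennreal c * ?n y \<partial>lborel) + (\<integral>\<^sup>+y. ennreal (c * k) * ?h \<rho> y + ennreal (D * k) * ?h N y \<partial>lborel)"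
    by (intro nn_integral_add borel_measurable_add borel_measurable_times_ennreal borel_measurable_const mh mn)
  also have "(\<integral>\<^sup>+y. ennreal (c * k) * ?h \<rho> y + ennreal (D * k) * ?h N y \<partial>lborel) = (\<integral>\<^sup>+y. ennreal (c * k) * ?h \<rho> y \<partial>lborel) + (\<integral>\<^sup>+y. ennreal (D * k) * ?h N y \<partial>lborel)"
    by (intro nn_integral_add borel_measurable_times_ennreal borel_measurable_const mh)
  also have "\<dots> = ennreal (c * k * (2 * pi / \<rho>)) + ennreal (D * k * (2 * pi / N))"
    using ih[OF r(1) mult_nonneg_nonneg[OF r(6) k]] ih[OF r(5) mult_nonneg_nonneg[OF order_trans[OF r(6,7)] k]] by (simp only:)
  also have "(\<integral>\<^sup>+y. ennreal c * ?n y \<partial>lborel) + (ennreal (c * k * (2 * pi / \<rho>)) + ennreal (D * k * (2 * pi / N)))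
    = ennreal (c * (4 * pi * B) + (c * k * (2 * pi / \<rho>) + D * k * (2 * pi / N)))"
    unfolding inn using k r B by (subst ennreal_plus[symmetric], simp, simp)+ simp
  finally show ?thesis by (simp add: k_def algebra_simps)
qed

context flow_solution
begin

definition vel_cx :: "real \<Rightarrow> real^2 \<Rightarrow> complex" where "vel_cx t x = cnj (cx (u t x))"

lemma w0_measurable [measurable]: "w0 \<in> borel_measurable lebesgue"
proof -
  have [measurable]: "w 0 \<in> borel_measurable lebesgue" by (rule w_meas) simp
  have "w0 x = w 0 x" if "x \<noteq> 0" for x
    using transport[of 0 x] inv_\<Phi>(2)[of 0 x] that by (simp add: \<Phi>_0)
  then have "w0 = (\<lambda>x. if x \<in> {0} then w0 0 else w 0 x)" by auto
  also have "\<dots> \<in> borel_measurable lebesgue"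
    by (rule measurable_If_set) (auto intro: borel_closed)
  finally show ?thesis .
qed

lemma w0_bound: "AE x in lebesgue. \<bar>w0 x\<bar> \<le> M"
proof -
  have "AE x in lebesgue. x \<noteq> (0::real^2)" by (intro AE_completion AE_lborel_singleton)
  with w_bd[of 0, OF order_refl] show ?thesis
  proof eventually_elim
    case (elim x)
    then show ?case using transport[of 0 x] inv_\<Phi>(2)[of 0 x] by (simp add: \<Phi>_0)
  qed
qed

lemma \<Phi>_lower: "0 \<le> t \<Longrightarrow> exp (- (4 * M * t)) * norm x \<le> norm (\<Phi> t x)"
  using \<Phi>_growth[of t 0 x] by (simp add: \<Phi>_0 exp_minus field_simps)

lemma \<Phi>_upper: "0 \<le> t \<Longrightarrow> norm (\<Phi> t x) \<le> exp (4 * M * t) * norm x"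
  using \<Phi>_growth[of 0 t x] by (simp add: \<Phi>_0)

text \<open>The velocity along the flow in Lagrangian variables. The cut between near and far field is the
  image of a disc; it is invariant under the rotation because the flow commutes with it.\<close>

lemma lagrangian_velocity:
  assumes t: "0 \<le> t" and rho: "0 < \<rho>" "2 * norm (\<Phi> t x) \<le> exp (- (4 * M * t)) * \<rho>"
  shows "vel_cx t (\<Phi> t x) = - (\<i> / (2 * pi)) * (LINT y|lebesgue. of_real (w0 y) * kmap \<rho> (\<Phi> t) (\<Phi> t x) y)"
    and "integrable lebesgue (\<lambda>y. of_real (w0 y) * kmap \<rho> (\<Phi> t) (\<Phi> t x) y)"
proof -
  interpret V: symmetric_velocity m "w t" "u t" M by (rule symmetric_velocity_at[OF t])
  define z where "z = \<Phi> t x"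
  define S where "S = \<Phi> t ` cball 0 \<rho>"
  have injP: "\<Phi> t a = \<Phi> t b \<longleftrightarrow> a = b" for a b using \<Phi>_bij[OF t] by (auto simp: bij_def inj_def)
  have inS: "\<Phi> t y \<in> S \<longleftrightarrow> norm y \<le> \<rho>" for y by (auto simp: S_def injP)
  \<comment> \<open>The growth bounds of the flow and of its inverse enclose the boundary of the
    image of the disc between two circles.\<close>
  interpret kernel_region m "w t" "u t" M S z "exp (- (4 * M * t)) * \<rho>" "exp (4 * M * t) * \<rho>"
  proof
    have "compact S" unfolding S_def
      by (intro compact_continuous_image continuous_on_subset[OF \<Phi>_continuous[OF t]]) auto
    then show "S \<in> sets borel" by (intro borel_closed compact_imp_closed)
    show "rot (2 * pi / real m) y \<in> S \<longleftrightarrow> y \<in> S" for y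
    proof -
      obtain v where v: "y = \<Phi> t v" using inv_\<Phi>(1)[OF t, of y] by metis
      show ?thesis unfolding v \<Phi>_rot[OF t, symmetric] inS by simp
    qed
    show "norm y \<le> exp (4 * M * t) * \<rho>" if "y \<in> S" for y
    proof -
      obtain v where v: "y = \<Phi> t v" "norm v \<le> \<rho>" using \<open>y \<in> S\<close> by (auto simp: S_def)
      show ?thesis unfolding v(1) by (rule order_trans[OF \<Phi>_upper[OF t] mult_left_mono[OF v(2)]]) simp
    qed
    show "exp (- (4 * M * t)) * \<rho> \<le> norm y" if "y \<notin> S" for y
    proof -
      obtain v where v: "y = \<Phi> t v" using inv_\<Phi>(1)[OF t, of y] by metis
      then have "\<rho> \<le> norm v" using that inS[of v] by simp
      show ?thesis unfolding v by (rule order_trans[OF mult_left_mono[OF \<open>\<rho> \<le> norm v\<close>] \<Phi>_lower[OF t]]) simp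
    qed
  qed (use rho in \<open>auto simp: z_def\<close>)
  have mpr: "mpres (\<Phi> t)" by (rule mpres_\<Phi>[OF t])
  have [measurable]: "kerS S z \<in> borel_measurable lebesgue" by (rule borel_imp_lebesgue[OF kerS_meas])
  have [measurable]: "w t \<in> borel_measurable lebesgue" by (rule w_meas[OF t])
  let ?h = "\<lambda>x. of_real (w t x) * kerS S z x"
  have mh: "?h \<in> borel_measurable lebesgue" by measurable
  have km: "kmap \<rho> (\<Phi> t) z \<in> borel_measurable lebesgue" by (rule borel_imp_lebesgue[OF kmap_measurable[OF mpr]])
  have mk: "(\<lambda>y. of_real (w0 y) * kmap \<rho> (\<Phi> t) z y) \<in> borel_measurable lebesgue"
    using km by measurable
  have ae: "AE y in lebesgue. ?h (\<Phi> t y) = of_real (w0 y) * kmap \<rho> (\<Phi> t) z y"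
  proof -
    have "AE y in lebesgue. y \<noteq> (0::real^2)" by (intro AE_completion AE_lborel_singleton)
    then show ?thesis
    proof eventually_elim
      case (elim y)
      then have "\<Phi> t y \<noteq> 0" using injP[of y 0] \<Phi>_zero[OF t] by simp
      then have "w t (\<Phi> t y) = w0 y" using transport[OF t, of "\<Phi> t y"] t by simp
      then show ?case using inS[of y] by (simp add: kerS_def kmap_def)
    qed
  qed
  have "integral\<^sup>L lebesgue ?h = (LINT y|lebesgue. ?h (\<Phi> t y))" using mpres_integral(1)[OF mpr mh] by simp
  also have "\<dots> = (LINT y|lebesgue. of_real (w0 y) * kmap \<rho> (\<Phi> t) z y)"
    by (rule integral_cong_AE[OF mpres_integral(2)[OF mpr mh] mk ae])
  finally have eq: "integral\<^sup>L lebesgue ?h = (LINT y|lebesgue. of_real (w0 y) * kmap \<rho> (\<Phi> t) z y)" .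
  have "vel_cx t z = V.U z" by (simp add: vel_cx_def V.U_def)
  then show "vel_cx t (\<Phi> t x) = - (\<i> / (2 * pi)) * (LINT y|lebesgue. of_real (w0 y) * kmap \<rho> (\<Phi> t) (\<Phi> t x) y)"
    using velocity_kernel(2) eq by (simp add: z_def)
  have "integrable lebesgue (\<lambda>y. ?h (\<Phi> t y))" using mpres_integrable[OF mpr mh] velocity_kernel(1) by simp
  then show "integrable lebesgue (\<lambda>y. of_real (w0 y) * kmap \<rho> (\<Phi> t) (\<Phi> t x) y)"
    using integrable_cong_AE[OF mpres_integral(2)[OF mpr mh] mk ae] by (simp add: z_def)
qed

end

text \<open>Both flows share the bound \<open>M\<close> and hence the growth factors.
  \<open>data_close\<close> says that the difference of the data tends to \<open>0\<close> at the
  origin.\<close>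

locale two_flows = \<Phi>: flow_solution m w0 w u \<Phi> M + \<Psi>: flow_solution m v0 v u' \<Psi> M
  for m w0 w u \<Phi> M v0 v u' \<Psi> +
  assumes data_close: "0 < \<gamma> \<Longrightarrow> \<exists>r>0. \<forall>y. y \<noteq> 0 \<longrightarrow> norm y \<le> r \<longrightarrow> \<bar>w0 y - v0 y\<bar> \<le> \<gamma>"
begin

text \<open>\<open>E\<close> bounds the growth factor of the flows up to the time considered;
  \<open>E ^ 5\<close> is the largest power among the error terms of
  \<open>velocity_difference\<close>.\<close>

definition Cv :: "real \<Rightarrow> real" where "Cv E = E ^ 5 * (150 * M + 7)"

text \<open>By \<open>lagrangian_velocity\<close> both velocities are integrals over the same
  labels. Replacing the kernel of one flow by that of the other costs \<open>osg d\<close> for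
  labels near the origin and \<open>1 / n\<close> for those beyond \<open>n * norm x\<close>;
  replacing the datum costs \<gamma>, and again \<open>1 / n\<close> where the data are not
  close.\<close>

lemma velocity_difference:
  assumes t: "0 \<le> t" "exp (4 * M * t) \<le> E" and x: "x \<noteq> 0" and n: "2 * E\<^sup>2 \<le> n" "n * norm x \<le> r"
    and d: "0 < d" "d \<le> 1" and cl: "\<And>y. norm y \<le> r \<Longrightarrow> norm (\<Phi> t y - \<Psi> t y) \<le> d * norm y"
    and g: "0 \<le> \<gamma>" "\<And>y. y \<noteq> 0 \<Longrightarrow> norm y \<le> r \<Longrightarrow> \<bar>w0 y - v0 y\<bar> \<le> \<gamma>"
  shows "norm (u t (\<Phi> t x) - u' t (\<Psi> t x)) \<le> Cv E * norm x * (osg d + 1 / n + \<gamma>)"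
proof -
  have M0: "0 \<le> M" by (rule \<Phi>.M0)
  have E1: "1 \<le> E" using t M0 one_le_exp_iff[of "4 * M * t"] by (intro order_trans[OF _ t(2)]) simp
  have E0: "0 < E" using E1 by simp
  define s where "s = norm x"
  have s: "0 < s" using x by (simp add: s_def)
  have "1 \<le> E\<^sup>2" using E1 by simp
  then have n1: "1 \<le> n" using n(1) by linarith
  define a a' where "a = \<Phi> t x" and "a' = \<Psi> t x"
  \<comment> \<open>Here \<open>\<rho> / E = 2 * E * s\<close> is twice the bound on both images of
    \<open>x\<close>, which separates them from the images of far labels, and
    \<open>B = E * \<rho>\<close> bounds the images of near labels.\<close>
  define \<rho> B N where "\<rho> = 2 * E\<^sup>2 * s" and "B = 2 * E ^ 3 * s" and "N = n * s"
  have pos: "0 < \<rho>" "0 < B" "0 < N" "0 < 1 / E" using s E0 n1 by (auto simp: \<rho>_def B_def N_def)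
  have up: "norm (\<Phi> t y) \<le> E * norm y" "norm (\<Psi> t y) \<le> E * norm y" for y
    by (rule order_trans[OF \<Phi>.\<Phi>_upper[OF t(1)] mult_right_mono[OF t(2)]], simp)
       (rule order_trans[OF \<Psi>.\<Phi>_upper[OF t(1)] mult_right_mono[OF t(2)]], simp)
  have "1 / E \<le> exp (- (4 * M * t))" using t(2) E0 by (simp add: exp_minus field_simps)
  then have lo: "1 / E * norm y \<le> norm (\<Phi> t y)" "1 / E * norm y \<le> norm (\<Psi> t y)" for y
    using order_trans[OF mult_right_mono \<Phi>.\<Phi>_lower[OF t(1)], of "1 / E" y]
      order_trans[OF mult_right_mono \<Psi>.\<Phi>_lower[OF t(1)], of "1 / E" y] by auto
  have b\<rho>: "1 / E * \<rho> = 2 * (E * s)" using E0 by (simp add: \<rho>_def power2_eq_square)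
  have aE: "norm a \<le> E * s" "norm a' \<le> E * s" using up[of x] by (auto simp: a_def a'_def s_def)
  have "s \<le> E * s" using s E1 by simp
  have EB: "E * s \<le> B"
  proof -
    have "E * 1 \<le> E * (2 * E\<^sup>2)" using \<open>1 \<le> E\<^sup>2\<close> E0 by (intro mult_left_mono) auto
    then have "E * 1 * s \<le> E * (2 * E\<^sup>2) * s" using s by (intro mult_right_mono) auto
    then show ?thesis by (simp add: B_def power3_eq_cube power2_eq_square mult_ac)
  qed
  have \<rho>N: "\<rho> \<le> N" unfolding \<rho>_def N_def using n s by (intro mult_right_mono) auto
  have Nr: "N \<le> r" using n(2) by (simp add: N_def s_def)
  have near: "norm (\<Phi> t y) \<le> B" "norm (\<Psi> t y) \<le> B" if "norm y \<le> \<rho>" for y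
  proof -
    have "E * norm y \<le> B" using mult_left_mono[OF that, of E] E0
      by (simp add: \<rho>_def B_def power3_eq_cube power2_eq_square mult_ac)
    then show "norm (\<Phi> t y) \<le> B" "norm (\<Psi> t y) \<le> B" using up[of y] by auto
  qed
  have ad: "norm (a - a') \<le> d * s"
  proof -
    have "1 * s \<le> n * s" using n1 s by (intro mult_right_mono) auto
    then have "norm x \<le> r" using n(2) by (simp add: s_def)
    then show ?thesis using cl[of x] by (simp add: a_def a'_def s_def)
  qed
  have l1: "(\<integral>\<^sup>+y. ennreal (norm (kmap \<rho> (\<Phi> t) a y - kmap \<rho> (\<Psi> t) a' y)) \<partial>lborel)
    \<le> ennreal (400 * B * osg d + 14 * E * d * (E * s)\<^sup>2 / (1 / E) ^ 3 * (2 * pi / \<rho>) + 4 * (E * s)\<^sup>2 / (1 / E) ^ 3 * (2 * pi / N))"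
  proof (rule kmap_diff_bound)
    show "norm (a - a' - (\<Phi> t y - \<Psi> t y)) \<le> 4 * B * d" if "norm y \<le> \<rho>" for y
    proof -
      have "norm (\<Phi> t y - \<Psi> t y) \<le> d * norm y" using that \<rho>N Nr by (intro cl) auto
      also have "\<dots> \<le> d * \<rho>" using that d by (intro mult_left_mono) auto
      finally have "norm (a - a' - (\<Phi> t y - \<Psi> t y)) \<le> d * s + d * \<rho>"
        using norm_triangle_ineq4[of "a - a'" "\<Phi> t y - \<Psi> t y"] ad by linarith
      also have "\<dots> \<le> d * B + d * B"
      proof (intro add_mono mult_left_mono)
        show "s \<le> B" using \<open>s \<le> E * s\<close> EB by linarith
        have "E\<^sup>2 * 1 \<le> E\<^sup>2 * E" using E1 by (intro mult_left_mono) auto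
        then have "E\<^sup>2 \<le> E ^ 3" by (simp add: power3_eq_cube power2_eq_square)
        then show "\<rho> \<le> B" using s by (simp add: \<rho>_def B_def)
      qed (use d in auto)
      finally have "norm (a - a' - (\<Phi> t y - \<Psi> t y)) \<le> 2 * (d * B)" by linarith
      also have "\<dots> \<le> 4 * B * d" using mult_pos_pos[OF d(1) pos(2)] by (simp add: mult_ac)
      finally show ?thesis .
    qed
    have "d * s \<le> d * (E * s)" using \<open>s \<le> E * s\<close> d by (intro mult_left_mono) auto
    then show "norm (a - a') \<le> d * (E * s)" using ad by linarith
    show "norm (\<Phi> t y - \<Psi> t y) \<le> d * E * (1 / E * norm y)" if "norm y \<le> N" for y
      using cl[of y] that Nr E0 by simp
  qed (use pos b\<rho> EB aE near lo d E1 \<Phi>.mpres_\<Phi>[OF t(1)] \<Psi>.mpres_\<Phi>[OF t(1)] in auto)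
  let ?L1 = "400 * B * osg d + 14 * E * d * (E * s)\<^sup>2 / (1 / E) ^ 3 * (2 * pi / \<rho>) + 4 * (E * s)\<^sup>2 / (1 / E) ^ 3 * (2 * pi / N)"
  have ogd: "d \<le> osg d" "0 \<le> osg d" using osg_ge[OF d] osg_nonneg[OF d] by auto
  have L1: "0 \<le> ?L1" using pos ogd d E0 s by (intro add_nonneg_nonneg) auto
  let ?k = "\<lambda>y. kmap \<rho> (\<Phi> t) a y - kmap \<rho> (\<Psi> t) a' y"
  have mk: "?k \<in> borel_measurable borel"
    using kmap_measurable[OF \<Phi>.mpres_\<Phi>[OF t(1)]] kmap_measurable[OF \<Psi>.mpres_\<Phi>[OF t(1)]] by simp
  note W = weighted_integral_bound[OF \<Psi>.w0_measurable \<Psi>.w0_bound M0 mk l1 L1]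
  have aeD: "AE y in lebesgue. \<bar>w0 y - v0 y\<bar> \<le> 2 * M + \<gamma>"
    using \<Phi>.w0_bound \<Psi>.w0_bound by eventually_elim (use g in auto)
  have l2: "(\<integral>\<^sup>+y. ennreal (norm (of_real (w0 y - v0 y) * kmap \<rho> (\<Phi> t) a y)) \<partial>lborel)
    \<le> ennreal (\<gamma> * (4 * pi * B + 2 * (E * s)\<^sup>2 / (1 / E) ^ 3 * (2 * pi / \<rho>)) + (2 * M + \<gamma>) * (2 * (E * s)\<^sup>2 / (1 / E) ^ 3 * (2 * pi / N)))"
    (is "_ \<le> ennreal ?L2")
    by (rule kmap_bound) (use pos b\<rho> EB aE near lo g M0 aeD Nr \<rho>N \<Phi>.mpres_\<Phi>[OF t(1)] in \<open>auto simp: AE_completion_iff\<close>)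
  have L2: "0 \<le> ?L2" using pos g M0 s E0 by (intro add_nonneg_nonneg mult_nonneg_nonneg) auto
  have rho\<Phi>: "2 * norm (\<Phi> t x) \<le> exp (- (4 * M * t)) * \<rho>" "2 * norm (\<Psi> t x) \<le> exp (- (4 * M * t)) * \<rho>"
    using aE b\<rho> mult_right_mono[OF \<open>1 / E \<le> exp (- (4 * M * t))\<close>, of \<rho>] pos by (auto simp: a_def a'_def)
  note U = \<Phi>.lagrangian_velocity[OF t(1) pos(1) rho\<Phi>(1), folded a_def]
  note V = \<Psi>.lagrangian_velocity[OF t(1) pos(1) rho\<Phi>(2), folded a'_def]
  let ?F = "\<lambda>y. of_real (w0 y) * kmap \<rho> (\<Phi> t) a y" and ?G = "\<lambda>y. of_real (v0 y) * kmap \<rho> (\<Psi> t) a' y"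
  let ?H = "\<lambda>y. of_real (w0 y - v0 y) * kmap \<rho> (\<Phi> t) a y" and ?K = "\<lambda>y. of_real (v0 y) * ?k y"
  \<comment> \<open>The difference of the data is weighted with one kernel, the difference of the
    kernels with one datum.\<close>
  have Heq: "?H = (\<lambda>y. ?F y - ?G y - ?K y)" by (rule ext) (simp add: algebra_simps)
  have Hi: "integrable lebesgue ?H" unfolding Heq by (intro Bochner_Integration.integrable_diff U V W)
  have Hl: "norm (integral\<^sup>L lebesgue ?H) \<le> ?L2"
    by (rule nn_bound_imp_integral_bound(2)[OF borel_measurable_integrable[OF Hi] _ L2])
       (use l2 in \<open>simp add: nn_integral_completion\<close>)
  have "integral\<^sup>L lebesgue ?H = integral\<^sup>L lebesgue ?F - integral\<^sup>L lebesgue ?G - integral\<^sup>L lebesgue ?K"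
    unfolding Heq using U V W by (simp add: Bochner_Integration.integral_diff)
  then have FG: "integral\<^sup>L lebesgue ?F - integral\<^sup>L lebesgue ?G = integral\<^sup>L lebesgue ?H + integral\<^sup>L lebesgue ?K" by simp
  have "norm (u t a - u' t a') = norm (\<Phi>.vel_cx t a - \<Psi>.vel_cx t a')"
    by (simp add: \<Phi>.vel_cx_def \<Psi>.vel_cx_def flip: complex_cnj_diff cx_diff)
  also have "\<Phi>.vel_cx t a - \<Psi>.vel_cx t a' = - (\<i> / (2 * pi)) * (integral\<^sup>L lebesgue ?F - integral\<^sup>L lebesgue ?G)"
    unfolding U(1) V(1) by (simp add: algebra_simps)
  also have "norm \<dots> = norm (integral\<^sup>L lebesgue ?H + integral\<^sup>L lebesgue ?K) / (2 * pi)"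
    unfolding FG by (simp add: norm_mult norm_divide)
  also have "\<dots> \<le> (?L2 + M * ?L1) / (2 * pi)"
    using norm_triangle_le[OF add_mono[OF Hl W(2)]] by (intro divide_right_mono) auto
  also have "\<dots> \<le> Cv E * norm x * (osg d + 1 / n + \<gamma>)"
  proof -
    \<comment> \<open>All powers of \<open>E\<close> will be raised to the fifth; since
      \<open>pi > 3\<close>, the factor \<open>800 / (2 * pi)\<close> is at most
      \<open>140\<close>.\<close>
    have E3: "E ^ 3 \<le> E ^ 5" "E ^ 4 \<le> E ^ 5" using E1 by (auto intro: power_increasing)
    have e1: "2 * (E * s)\<^sup>2 / (1 / E) ^ 3 * (2 * pi / \<rho>) = 2 * pi * (E ^ 3 * s)"
      using E0 s by (simp add: \<rho>_def power2_eq_square power3_eq_cube field_simps)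
    have e2: "2 * (E * s)\<^sup>2 / (1 / E) ^ 3 * (2 * pi / N) = 4 * pi * (E ^ 5 * s * (1 / n))"
      using E0 s n1 by (simp add: N_def power2_eq_square power3_eq_cube field_simps eval_nat_numeral)
    have l2: "?L2 = 2 * pi * (\<gamma> * (5 * (E ^ 3 * s)) + (2 * M + \<gamma>) * 2 * (E ^ 5 * s * (1 / n)))"
      unfolding e1 e2 by (simp add: B_def algebra_simps add_divide_distrib)
    have f1: "14 * E * d * (E * s)\<^sup>2 / (1 / E) ^ 3 * (2 * pi / \<rho>) = 2 * pi * (7 * d * (E ^ 4 * s))"
      using E0 s by (simp add: \<rho>_def power2_eq_square power3_eq_cube field_simps eval_nat_numeral)
    have f2: "4 * (E * s)\<^sup>2 / (1 / E) ^ 3 * (2 * pi / N) = 2 * pi * (4 * (E ^ 5 * s * (1 / n)))"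
      using E0 s n1 by (simp add: N_def power2_eq_square power3_eq_cube field_simps eval_nat_numeral)
    have pi3: "800 / (2 * pi) \<le> 800 / (2 * 3)" using pi_gt3 by (intro divide_left_mono) auto
    have "(?L2 + M * ?L1) / (2 * pi) = \<gamma> * (5 * (E ^ 3 * s)) + (2 * M + \<gamma>) * 2 * (E ^ 5 * s * (1 / n))
      + M * (800 / (2 * pi) * (E ^ 3 * s) * osg d + 7 * d * (E ^ 4 * s) + 4 * (E ^ 5 * s * (1 / n)))"
      unfolding l2 f1 f2 by (simp add: B_def add_divide_distrib distrib_left mult_ac)
    also have "\<dots> \<le> \<gamma> * (5 * (E ^ 5 * s)) + (2 * M * (1 / n) + \<gamma> * 1) * 2 * (E ^ 5 * s)
      + M * (140 * (E ^ 5 * s) * osg d + 7 * osg d * (E ^ 5 * s) + 4 * (E ^ 5 * s * (1 / n)))"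
    proof -
      have "(2 * M + \<gamma>) * 2 * (E ^ 5 * s * (1 / n)) = (2 * M * (1 / n) + \<gamma> * (1 / n)) * 2 * (E ^ 5 * s)" by (simp add: algebra_simps)
      moreover have "\<dots> \<le> (2 * M * (1 / n) + \<gamma> * 1) * 2 * (E ^ 5 * s)"
        using g n1 E0 s by (intro mult_right_mono add_mono mult_left_mono) auto
      moreover have "\<gamma> * (5 * (E ^ 3 * s)) \<le> \<gamma> * (5 * (E ^ 5 * s))" using g E3 s by (intro mult_left_mono mult_right_mono) auto
      moreover have "800 / (2 * pi) * (E ^ 3 * s) * osg d \<le> 140 * (E ^ 5 * s) * osg d"
        using pi3 E0 E3 s ogd by (intro mult_mono mult_right_mono) auto
      moreover have "7 * d * (E ^ 4 * s) \<le> 7 * osg d * (E ^ 5 * s)" using d ogd E0 E3 s by (intro mult_mono) auto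
      ultimately show ?thesis using M0 by (smt (verit) mult_left_mono)
    qed
    also have "\<dots> \<le> Cv E * s * (osg d + 1 / n + \<gamma>)"
    proof -
      have "Cv E * s * (osg d + 1 / n + \<gamma>) - (\<gamma> * (5 * (E ^ 5 * s)) + (2 * M * (1 / n) + \<gamma> * 1) * 2 * (E ^ 5 * s)
      + M * (140 * (E ^ 5 * s) * osg d + 7 * osg d * (E ^ 5 * s) + 4 * (E ^ 5 * s * (1 / n))))
       = E ^ 5 * s * ((3 * M + 7) * osg d + (142 * M + 7) * (1 / n) + 150 * M * \<gamma>)"
        by (simp add: Cv_def algebra_simps)
      moreover have "0 \<le> \<dots>" using E0 s M0 ogd n1 g by (intro mult_nonneg_nonneg add_nonneg_nonneg) auto
      ultimately show ?thesis by linarith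
    qed
    finally show ?thesis by (simp add: s_def)
  qed
  finally show ?thesis by (simp add: a_def a'_def)
qed

text \<open>For all \<open>d > 0\<close> this says that the blow-ups of both flows at the origin coincide.\<close>

definition tangent :: "real \<Rightarrow> real \<Rightarrow> bool" where
  "tangent t d \<longleftrightarrow> (\<exists>r>0. \<forall>y. norm y \<le> r \<longrightarrow> norm (\<Phi> t y - \<Psi> t y) \<le> d * norm y)"

text \<open>During the step the growth bound alone keeps the flows within the cruder relative
  distance \<open>D = d + (8 * M * E + 1) * h\<close>. For this \<open>D\<close> the velocity
  estimate holds throughout the step and gives an increment of order \<open>h * osg D\<close>, which
  is better than \<open>D - d\<close> when \<open>D\<close> is small. The price is a smaller
  disc.\<close>

lemma tangent_step:
  assumes t: "0 \<le> t" "t + h \<le> \<tau>" "0 < h" and d: "0 \<le> d" "d + (8 * M * exp (4 * M * \<tau>) + 1) * h \<le> 1"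
    and A: "tangent t d"
  shows "tangent (t + h) (d + 2 * Cv (exp (4 * M * \<tau>)) * h * osg (d + (8 * M * exp (4 * M * \<tau>) + 1) * h))"
proof -
  define E where "E = exp (4 * M * \<tau>)"
  \<comment> \<open>Each of the two trajectories moves by at most \<open>4 * M * E * h\<close>
    relative to its label. The additional \<open>h\<close> keeps \<open>D\<close> positive even if
    \<open>d\<close> and \<open>M\<close> vanish, so that \<open>osg D\<close> can absorb the other
    errors.\<close>
  define D where "D = d + (8 * M * E + 1) * h"
  have M0: "0 \<le> M" by (rule \<Phi>.M0)
  have E1: "1 \<le> E" using t M0 by (simp add: E_def)
  have ME: "0 \<le> M * E" using M0 E1 by simp
  have D: "0 < D" "D \<le> 1"
  proof -
    have "0 < (8 * M * E + 1) * h" using t ME by (intro mult_pos_pos) auto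
    then show "0 < D" using d by (simp add: D_def)
    show "D \<le> 1" using d by (simp add: D_def E_def)
  qed
  have oD: "0 < osg D" using osg_ge[OF D] D by linarith
  \<comment> \<open>This makes \<open>1 / n\<close> at most \<open>osg D / 2\<close>; with \<gamma>
    equal to \<open>osg D / 2\<close>, the errors in \<open>velocity_difference\<close> add up to at
    most \<open>2 * osg D\<close>.\<close>
  define n where "n = max (2 * E\<^sup>2) (2 / osg D)"
  have "1 \<le> E\<^sup>2" using E1 by simp
  then have n: "1 \<le> n" "2 * E\<^sup>2 \<le> n" "2 / osg D \<le> n" by (auto simp: n_def)
  have n': "1 / n \<le> osg D / 2" using n(3) oD n(1) by (simp add: field_simps)
  obtain r1 where r1: "r1 > 0" "\<And>y. norm y \<le> r1 \<Longrightarrow> norm (\<Phi> t y - \<Psi> t y) \<le> d * norm y"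
    using A by (auto simp: tangent_def)
  obtain r2 where r2: "r2 > 0" "\<And>y. y \<noteq> 0 \<Longrightarrow> norm y \<le> r2 \<Longrightarrow> \<bar>w0 y - v0 y\<bar> \<le> osg D / 2"
    using data_close[of "osg D / 2"] oD by auto
  define r where "r = min r1 r2"
  have r: "0 < r" using r1 r2 by (simp add: r_def)
  have Es: "exp (4 * M * s) \<le> E" if "s \<le> \<tau>" for s using that M0 by (auto simp: E_def intro: mult_left_mono)
  have inc: "norm (\<Phi> s y - \<Phi> t y) \<le> 4 * M * E * norm y * (s - t)" "norm (\<Psi> s y - \<Psi> t y) \<le> 4 * M * E * norm y * (s - t)"
    if s: "s \<in> {t..t + h}" for s y
  proof -
    have b: "norm (u p (\<Phi> p y)) \<le> 4 * M * E * norm y" "norm (u' p (\<Psi> p y)) \<le> 4 * M * E * norm y" if "p \<in> {t..t + h}" for p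
    proof -
      have p: "0 \<le> p" "p \<le> \<tau>" using that t by auto
      have "norm (\<Phi> p y) \<le> E * norm y" "norm (\<Psi> p y) \<le> E * norm y"
        by (rule order_trans[OF \<Phi>.\<Phi>_upper[OF p(1)] mult_right_mono[OF Es[OF p(2)]]], simp)
           (rule order_trans[OF \<Psi>.\<Phi>_upper[OF p(1)] mult_right_mono[OF Es[OF p(2)]]], simp)
      then have "4 * M * norm (\<Phi> p y) \<le> 4 * M * (E * norm y)" "4 * M * norm (\<Psi> p y) \<le> 4 * M * (E * norm y)"
        using M0 by (auto intro: mult_left_mono)
      then show "norm (u p (\<Phi> p y)) \<le> 4 * M * E * norm y" "norm (u' p (\<Psi> p y)) \<le> 4 * M * E * norm y"
        using \<Phi>.u_growth[OF p(1), of "\<Phi> p y"] \<Psi>.u_growth[OF p(1), of "\<Psi> p y"] by (simp_all add: mult.assoc)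
    qed
    have "norm (\<Phi> s y - \<Phi> t y) \<le> 4 * M * E * norm y * \<bar>s - t\<bar>"
      by (rule vector_mean_value[where a = t and b = "t + h" and f' = "\<lambda>p. u p (\<Phi> p y)"])
         (use \<Phi>.ode_on[OF t(1)] b(1) s t in auto)
    moreover have "norm (\<Psi> s y - \<Psi> t y) \<le> 4 * M * E * norm y * \<bar>s - t\<bar>"
      by (rule vector_mean_value[where a = t and b = "t + h" and f' = "\<lambda>p. u' p (\<Psi> p y)"])
         (use \<Psi>.ode_on[OF t(1)] b(2) s t in auto)
    ultimately show "norm (\<Phi> s y - \<Phi> t y) \<le> 4 * M * E * norm y * (s - t)" "norm (\<Psi> s y - \<Psi> t y) \<le> 4 * M * E * norm y * (s - t)"
      using s by auto
  qed
  have cl: "norm (\<Phi> s y - \<Psi> s y) \<le> D * norm y" if s: "s \<in> {t..t + h}" and y: "norm y \<le> r" for s y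
  proof -
    have "norm (\<Phi> t y - \<Psi> t y) \<le> d * norm y" using r1(2)[of y] y by (simp add: r_def)
    moreover have "norm (\<Phi> s y - \<Psi> s y) = norm ((\<Phi> t y - \<Psi> t y) + ((\<Phi> s y - \<Phi> t y) - (\<Psi> s y - \<Psi> t y)))" by simp
    ultimately have "norm (\<Phi> s y - \<Psi> s y) \<le> d * norm y + (4 * M * E * norm y * (s - t) + 4 * M * E * norm y * (s - t))"
      using inc[OF s, of y] norm_triangle_ineq[of "\<Phi> t y - \<Psi> t y" "(\<Phi> s y - \<Phi> t y) - (\<Psi> s y - \<Psi> t y)"]
        norm_triangle_ineq4[of "\<Phi> s y - \<Phi> t y" "\<Psi> s y - \<Psi> t y"] by linarith
    also have "4 * M * E * norm y * (s - t) + 4 * M * E * norm y * (s - t) = 8 * (M * E * norm y) * (s - t)" by simp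
    also have "\<dots> \<le> 8 * (M * E * norm y) * h" using s ME by (intro mult_left_mono) auto
    also have "d * norm y + 8 * (M * E * norm y) * h \<le> D * norm y"
    proof -
      have "0 \<le> h * norm y" using t by simp
      moreover have "D * norm y = d * norm y + 8 * (M * E * norm y) * h + h * norm y" by (simp add: D_def algebra_simps)
      ultimately show ?thesis by linarith
    qed
    finally show ?thesis by simp
  qed
  have C0: "0 \<le> Cv E" using M0 E1 by (simp add: Cv_def)
  have "norm (\<Phi> (t + h) x - \<Psi> (t + h) x) \<le> (d + 2 * Cv E * h * osg D) * norm x" if x: "norm x \<le> r / n" for x
  proof (cases "x = 0")
    case True
    then show ?thesis using \<Phi>.\<Phi>_zero[of "t + h"] \<Psi>.\<Phi>_zero[of "t + h"] t by simp
  next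
    case False
    have xr: "n * norm x \<le> r" using x n(1) by (simp add: field_simps)
    have "1 * norm x \<le> n * norm x" using n(1) by (intro mult_right_mono) auto
    then have xr1: "norm x \<le> r1" using xr by (simp add: r_def)
    have v: "norm (u s (\<Phi> s x) - u' s (\<Psi> s x)) \<le> 2 * Cv E * norm x * osg D" if s: "s \<in> {t..t + h}" for s
    proof -
      have "norm (u s (\<Phi> s x) - u' s (\<Psi> s x)) \<le> Cv E * norm x * (osg D + 1 / n + osg D / 2)"
        by (rule velocity_difference[where r = r])
           (use s t Es[of s] False n xr D cl[OF s] oD r2(2) in \<open>auto simp: r_def\<close>)
      also have "\<dots> \<le> Cv E * norm x * (2 * osg D)" using n' C0 by (intro mult_left_mono) auto
      finally show ?thesis by simp
    qed
    have "norm ((\<Phi> (t + h) x - \<Psi> (t + h) x) - (\<Phi> t x - \<Psi> t x)) \<le> 2 * Cv E * norm x * osg D * \<bar>t + h - t\<bar>"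
      by (rule vector_mean_value[where a = t and b = "t + h" and f' = "\<lambda>s. u s (\<Phi> s x) - u' s (\<Psi> s x)"
            and f = "\<lambda>s. \<Phi> s x - \<Psi> s x"])
         (use v t in \<open>auto intro!: has_vector_derivative_diff \<Phi>.ode_on[OF t(1)] \<Psi>.ode_on[OF t(1)]\<close>)
    then have "norm (\<Phi> (t + h) x - \<Psi> (t + h) x) \<le> norm (\<Phi> t x - \<Psi> t x) + 2 * Cv E * norm x * osg D * h"
      using norm_triangle_sub[of "\<Phi> (t + h) x - \<Psi> (t + h) x" "\<Phi> t x - \<Psi> t x"] t by simp
    also have "\<dots> \<le> d * norm x + 2 * Cv E * norm x * osg D * h" using r1(2)[OF xr1] by simp
    finally show ?thesis by (simp add: algebra_simps)
  qed
  then show ?thesis unfolding tangent_def E_def[symmetric] D_def[symmetric] using r n(1)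
    by (intro exI[of _ "r / n"]) auto
qed

text \<open>Osgood's argument in discrete form: for \<open>d = exp (1 - l)\<close> one has \<open>osg d = d * l\<close>, so that a step
  multiplies \<open>l\<close> by \<open>1 - 2 * Cv E * h\<close>. As the step size tends to \<open>0\<close> so does the initial \<open>d\<close>.\<close>

theorem flows_tangent:
  assumes t: "0 \<le> t" and e: "0 < \<epsilon>" "\<epsilon> \<le> 1"
  shows "tangent t \<epsilon>"
proof (cases "t = 0")
  case True
  then show ?thesis using e by (auto simp: tangent_def \<Phi>.\<Phi>_0 \<Psi>.\<Phi>_0 intro!: exI[of _ 1])
next
  case False
  then have t0: "0 < t" using t by simp
  define E where "E = exp (4 * M * t)"
  define C where "C = 2 * Cv E"
  define L where "L = 8 * M * E + 1"
  have M0: "0 \<le> M" by (rule \<Phi>.M0)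
  have E1: "1 \<le> E" using t M0 by (simp add: E_def)
  have C0: "0 < C" using M0 E1 by (simp add: C_def Cv_def zero_less_mult_iff add_nonneg_pos)
  have L0: "0 < L" using M0 E1 by (simp add: L_def add_nonneg_pos)
  \<comment> \<open>If \<open>L * h \<le> \<eta>\<close>, then the initial
    \<open>l = 1 - ln (L * h)\<close> is at least
    \<open>(1 - ln \<epsilon>) * exp (2 * C * t)\<close>, so that after all steps it is still at
    least \<open>1 - ln \<epsilon>\<close>.\<close>
  define \<eta> where "\<eta> = exp (1 - (1 - ln \<epsilon>) * exp (2 * C * t))"
  have le: "ln \<epsilon> \<le> 0" using e by simp
  define h1 where "h1 = min (\<eta> / L) (1 / (2 * C))"
  have h1: "0 < h1" using L0 C0 by (simp add: h1_def \<eta>_def)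
  obtain N :: nat where N: "t / h1 < real N" using reals_Archimedean2 by blast
  have "0 < t / h1" using t0 h1 by simp
  then have N0: "0 < real N" using N by linarith
  define h where "h = t / real N"
  have h: "0 < h" "real N * h = t" using t0 N0 by (auto simp: h_def)
  have "h \<le> h1" using N N0 h1 by (simp add: h_def field_simps)
  then have "h \<le> \<eta> / L" "h \<le> 1 / (2 * C)" by (auto simp: h1_def)
  then have hL: "L * h \<le> \<eta>" and hC: "C * h \<le> 1 / 2" using L0 C0 by (simp_all add: field_simps)
  define q where "q = 1 - C * h"
  have Ch: "0 \<le> C * h" using C0 h by simp
  have q: "0 < q" "q \<le> 1" using Ch hC by (auto simp: q_def)
  \<comment> \<open>From \<open>1 - y \<ge> exp (- 2 * y)\<close> for
    \<open>0 \<le> y \<le> 1 / 2\<close>, which is why \<open>C * h \<le> 1 / 2\<close> was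
    arranged.\<close>
  have qN: "exp (- (2 * C * t)) \<le> q ^ N"
  proof -
    have "(C * h)\<^sup>2 \<le> C * h * (1 / 2)" unfolding power2_eq_square using Ch hC by (intro mult_left_mono) auto
    then have "- 2 * (C * h) \<le> ln q"
      using ln_one_minus_pos_lower_bound[of "C * h"] Ch hC by (simp add: q_def)
    then have "real N * (- 2 * (C * h)) \<le> real N * ln q" by (intro mult_left_mono) auto
    moreover have "real N * (- 2 * (C * h)) = - (2 * C * t)" by (simp flip: h(2))
    moreover have "q ^ N = exp (real N * ln q)" using q by (simp add: exp_of_nat_mult)
    ultimately show ?thesis by (simp only: exp_le_cancel_iff)
  qed
  define l where "l = 1 - ln (L * h)"
  have lN: "1 - ln \<epsilon> \<le> exp (- (2 * C * t)) * l"
  proof -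
    have "ln (L * h) \<le> ln \<eta>" using hL L0 h by (intro ln_mono) (auto simp: \<eta>_def)
    then have "(1 - ln \<epsilon>) * exp (2 * C * t) \<le> l" by (simp add: l_def \<eta>_def)
    then have "exp (- (2 * C * t)) * ((1 - ln \<epsilon>) * exp (2 * C * t)) \<le> exp (- (2 * C * t)) * l" by (intro mult_left_mono) auto
    moreover have "exp (- (2 * C * t)) * ((1 - ln \<epsilon>) * exp (2 * C * t)) = 1 - ln \<epsilon>" by (simp add: exp_minus field_simps)
    ultimately show ?thesis by simp
  qed
  have "0 < exp (- (2 * C * t)) * l" using lN le by linarith
  then have l0: "0 \<le> l" by (simp add: zero_less_mult_iff)
  have lk: "1 - ln \<epsilon> \<le> q ^ k * l" if "k \<le> N" for k
  proof -
    have "q ^ N \<le> q ^ k" using that q by (intro power_decreasing) auto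
    then have "exp (- (2 * C * t)) * l \<le> q ^ k * l" using qN l0 by (intro mult_right_mono) auto
    then show ?thesis using lN by linarith
  qed
  \<comment> \<open>The induction controls \<open>d + L * h\<close>, the argument of
    \<open>osg\<close> in \<open>tangent_step\<close>; initially \<open>d = 0\<close> and
    \<open>L * h = exp (1 - l)\<close>. Each step shrinks the disc in \<open>tangent\<close>, but
    there are only \<open>N\<close> of them.\<close>
  have main: "\<exists>d\<ge>0. tangent (real k * h) d \<and> d + L * h \<le> exp (1 - q ^ k * l)" if "k \<le> N" for k
    using that
  proof (induction k)
    case 0
    have "tangent 0 0" by (auto simp: tangent_def \<Phi>.\<Phi>_0 \<Psi>.\<Phi>_0 intro!: exI[of _ 1])
    moreover have "L * h = exp (1 - l)" using L0 h by (simp add: l_def)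
    ultimately show ?case by (intro exI[of _ 0]) simp
  next
    case (Suc k)
    then obtain d where d: "0 \<le> d" "tangent (real k * h) d" "d + L * h \<le> exp (1 - q ^ k * l)" by auto
    define D where "D = d + L * h"
    define p where "p = q ^ k * l"
    have p: "1 \<le> p" using lk[of k] Suc le by (simp add: p_def)
    have D: "0 < D" "D \<le> exp (1 - p)" using d L0 h by (auto simp: D_def p_def add_nonneg_pos)
    have D1: "D \<le> 1" using D p by (metis diff_le_0_iff_le exp_le_one_iff order_trans)
    have "real k * h + h \<le> t"
    proof -
      have "real (Suc k) * h \<le> real N * h" using Suc.prems h by (intro mult_right_mono) auto
      then show ?thesis using h(2) by (simp add: algebra_simps)
    qed
    then have "tangent (real k * h + h) (d + C * h * osg D)"
      using tangent_step[of "real k * h" h t d] d h D1 by (simp add: C_def D_def L_def E_def)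
    then have "tangent (real (Suc k) * h) (d + C * h * osg D)" by (simp add: algebra_simps)
    moreover have "0 \<le> d + C * h * osg D" using d Ch osg_nonneg[OF D(1) D1] by simp
    moreover have "d + C * h * osg D + L * h \<le> exp (1 - q ^ Suc k * l)"
    proof -
      \<comment> \<open>As \<open>osg (exp (1 - p)) = exp (1 - p) * p\<close>, the step multiplies
        the bound by \<open>1 + C * h * p \<le> exp (C * h * p)\<close>, that is, it lowers
        \<open>p\<close> to \<open>q * p\<close>.\<close>
      have "osg D \<le> osg (exp (1 - p))" using D p by (intro osg_mono) auto
      also have "\<dots> = exp (1 - p) * p" by (simp add: osg_def)
      finally have "C * h * osg D \<le> C * h * (exp (1 - p) * p)" using Ch by (intro mult_left_mono) auto
      then have "D + C * h * osg D \<le> exp (1 - p) * (1 + C * h * p)" using D(2) by (simp add: algebra_simps)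
      also have "\<dots> \<le> exp (1 - p) * exp (C * h * p)" by (intro mult_left_mono exp_ge_add_one_self) auto
      also have "\<dots> = exp (1 - q * p)" by (simp add: q_def algebra_simps flip: exp_add)
      finally show ?thesis by (simp add: D_def p_def mult.assoc algebra_simps)
    qed
    ultimately show ?case by (intro exI[of _ "d + C * h * osg D"]) auto
  qed
  obtain d where d: "0 \<le> d" "tangent (real N * h) d" "d + L * h \<le> exp (1 - q ^ N * l)" using main[of N] by auto
  have "exp (1 - q ^ N * l) \<le> exp (ln \<epsilon>)" using lk[of N] by simp
  then have "d \<le> \<epsilon>" using d(3) e mult_pos_pos[OF L0 h(1)] by simp
  then show ?thesis using d(2) unfolding h(2) tangent_def
    by (meson mult_right_mono norm_ge_zero order_trans)
qed


section \<open>Blow-up at the origin\<close>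

text \<open>Both vorticities at \<open>l *\<^sub>R x\<close> are data at preimages \<open>p\<close>
  and \<open>q\<close> under the two flows. Tangency makes the images of \<open>p\<close> under both
  flows close relative to \<open>l\<close>, and Hoelder continuity of the inverse of \<Psi> makes
  \<open>p\<close> and \<open>q\<close> close relative to \<open>l\<close>. By homogeneity
  \<open>v0\<close> may be evaluated at the points rescaled by \<open>1 / l\<close>, which lie in a
  fixed annulus where it is uniformly continuous.\<close>

lemma blow_up:
  assumes t: "0 \<le> t" and x: "x \<noteq> 0"
    and cont: "continuous_on (- {0}) v0" and hom: "\<And>l y. 0 < l \<Longrightarrow> y \<noteq> 0 \<Longrightarrow> v0 (l *\<^sub>R y) = v0 y"
  shows "(\<lambda>n. w t ((1 / real (Suc n)) *\<^sub>R x) - v t ((1 / real (Suc n)) *\<^sub>R x)) \<longlonglongrightarrow> 0"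
proof (rule LIMSEQ_I)
  fix e :: real assume e: "0 < e"
  define E where "E = exp (4 * M * t)"
  have E1: "1 \<le> E" using t \<Phi>.M0 by (simp add: E_def)
  have E0: "0 < E" using E1 by simp
  define s where "s = norm x"
  have s: "0 < s" using x by (simp add: s_def)
  \<comment> \<open>The annulus of the rescaled preimages: the flows change norms by at most the
    factor \<open>E\<close>.\<close>
  define K where "K = cball (0::real^2) (E * s) - ball 0 (s / E)"
  have "compact K" unfolding K_def by (intro compact_diff) auto
  moreover have "continuous_on K v0"
    by (rule continuous_on_subset[OF cont]) (use s E0 in \<open>auto simp: K_def\<close>)
  ultimately have "uniformly_continuous_on K v0" by (intro compact_uniformly_continuous)
  then obtain \<delta> where \<delta>: "0 < \<delta>" "\<And>a b. a \<in> K \<Longrightarrow> b \<in> K \<Longrightarrow> norm (a - b) < \<delta> \<Longrightarrow> \<bar>v0 a - v0 b\<bar> < e / 2"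
    unfolding uniformly_continuous_on_def dist_norm using e by (metis half_gt_zero norm_minus_commute real_norm_def)
  define k where "k = exp (- (80 * M) * t)"
  have k: "0 < k" by (simp add: k_def)
  \<comment> \<open>Up to the cap \<open>1\<close>, the solution of \<open>12 * E\<^sup>2 * s *
    (\<epsilon> / (4 * E)) powr k = \<delta> / 2\<close>. The Hoelder estimate is invariant under
    dilations, so the choice does not depend on \<open>l\<close>.\<close>
  define \<epsilon> where "\<epsilon> = min 1 (4 * E * (\<delta> / (24 * E\<^sup>2 * s)) powr (1 / k))"
  have \<epsilon>: "0 < \<epsilon>" "\<epsilon> \<le> 1" using E0 s \<delta> by (auto simp: \<epsilon>_def)
  have ek: "12 * E\<^sup>2 * s * (\<epsilon> / (4 * E)) powr k < \<delta>"
  proof -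
    have "\<epsilon> / (4 * E) \<le> (\<delta> / (24 * E\<^sup>2 * s)) powr (1 / k)" using E0 by (simp add: \<epsilon>_def field_simps)
    then have "(\<epsilon> / (4 * E)) powr k \<le> ((\<delta> / (24 * E\<^sup>2 * s)) powr (1 / k)) powr k"
      using k \<epsilon> E0 by (intro powr_mono2) auto
    also have "\<dots> = \<delta> / (24 * E\<^sup>2 * s)" using k \<delta> E0 s by (simp add: powr_powr)
    finally have "12 * E\<^sup>2 * s * (\<epsilon> / (4 * E)) powr k \<le> 12 * E\<^sup>2 * s * (\<delta> / (24 * E\<^sup>2 * s))"
      using E0 s by (intro mult_left_mono) auto
    also have "\<dots> = \<delta> / 2" using E0 s by (simp add: field_simps)
    finally show ?thesis using \<delta> by simp
  qed
  obtain r1 where r1: "r1 > 0" "\<And>y. norm y \<le> r1 \<Longrightarrow> norm (\<Phi> t y - \<Psi> t y) \<le> \<epsilon> * norm y"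
    using flows_tangent[OF t \<epsilon>] by (auto simp: tangent_def)
  obtain r2 where r2: "r2 > 0" "\<And>y. y \<noteq> 0 \<Longrightarrow> norm y \<le> r2 \<Longrightarrow> \<bar>w0 y - v0 y\<bar> \<le> e / 2"
    using data_close[of "e / 2"] e by auto
  have main: "\<bar>w t (l *\<^sub>R x) - v t (l *\<^sub>R x)\<bar> < e" if l: "0 < l" "l * (E * s) \<le> min r1 r2" for l
  proof -
    define p q where "p = inv (\<Phi> t) (l *\<^sub>R x)" and "q = inv (\<Psi> t) (l *\<^sub>R x)"
    have pq: "\<Phi> t p = l *\<^sub>R x" "\<Psi> t q = l *\<^sub>R x" using t by (auto simp: p_def q_def)
    have up: "norm p \<le> l * (E * s)" "norm q \<le> l * (E * s)"
      using \<Phi>.\<Phi>_growth[OF t order_refl, of p] \<Psi>.\<Phi>_growth[OF t order_refl, of q] pq l t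
      by (auto simp: \<Phi>.\<Phi>_0 \<Psi>.\<Phi>_0 E_def s_def mult_ac)
    have lo: "l * s \<le> E * norm p" "l * s \<le> E * norm q"
      using \<Phi>.\<Phi>_upper[OF t, of p] \<Psi>.\<Phi>_upper[OF t, of q] pq l by (auto simp: E_def s_def)
    have nz: "p \<noteq> 0" "q \<noteq> 0" using lo l s by (auto simp: mult_le_0_iff)
    define P Q where "P = (1 / l) *\<^sub>R p" and "Q = (1 / l) *\<^sub>R q"
    have PQK: "P \<in> K" "Q \<in> K" using up lo l E0 by (auto simp: P_def Q_def K_def field_simps)
    define R where "R = E\<^sup>2 * (l * s)"
    have R: "0 < R" using E0 l s by (simp add: R_def)
    have bd: "norm (\<Psi> r y) \<le> R" if "0 \<le> r" "r \<le> t" "norm y \<le> l * (E * s)" for r y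
    proof -
      have "exp (4 * M * r) \<le> E" using that \<Phi>.M0 by (auto simp: E_def intro: mult_left_mono)
      then have "exp (4 * M * r) * norm y \<le> E * (l * (E * s))" using that by (intro mult_mono) (auto simp: E_def)
      then show ?thesis using \<Psi>.\<Phi>_upper[of r y] that by (simp add: R_def power2_eq_square mult_ac)
    qed
    have "norm (\<Psi> 0 p - \<Psi> 0 q) / (4 * R) \<le> 3 * (norm (\<Psi> t p - \<Psi> t q) / (4 * R)) powr exp (- (80 * M) * \<bar>0 - t\<bar>)"
      by (rule \<Psi>.\<Phi>_holder) (use t R bd up in auto)
    then have "norm (p - q) \<le> 4 * R * (3 * (norm (\<Psi> t p - \<Psi> t q) / (4 * R)) powr k)"
      using t R by (simp add: \<Psi>.\<Phi>_0 k_def field_simps)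
    also have "\<dots> \<le> 4 * R * (3 * (\<epsilon> / (4 * E)) powr k)"
    proof -
      have "norm (\<Psi> t p - \<Psi> t q) \<le> \<epsilon> * norm p"
        using r1(2)[of p] up l pq by (simp add: norm_minus_commute)
      also have "\<dots> \<le> \<epsilon> * (l * (E * s))" using up \<epsilon> by (intro mult_left_mono) auto
      finally have "norm (\<Psi> t p - \<Psi> t q) / (4 * R) \<le> \<epsilon> * (l * (E * s)) / (4 * R)"
        using R by (intro divide_right_mono) auto
      also have "\<dots> = \<epsilon> / (4 * E)" using E0 l s by (simp add: R_def power2_eq_square field_simps)
      finally show ?thesis using R k by (intro mult_left_mono powr_mono2) auto
    qed
    also have "\<dots> = l * (12 * E\<^sup>2 * s * (\<epsilon> / (4 * E)) powr k)" by (simp add: R_def)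
    also have "\<dots> < l * \<delta>" using ek l by (intro mult_strict_left_mono) auto
    finally have "norm (p - q) < l * \<delta>" .
    moreover have "norm (P - Q) = norm (p - q) / l" using l by (simp add: P_def Q_def flip: scaleR_diff_right)
    ultimately have "norm (P - Q) < \<delta>" using l by (simp add: pos_divide_less_eq mult.commute)
    then have "\<bar>v0 P - v0 Q\<bar> < e / 2" using \<delta>(2) PQK by blast
    moreover have "v0 P = v0 p" "v0 Q = v0 q" unfolding P_def Q_def using l nz by (auto intro: hom)
    moreover have "\<bar>w0 p - v0 p\<bar> \<le> e / 2" using r2(2)[OF nz(1)] up l by simp
    moreover have "w t (l *\<^sub>R x) = w0 p" "v t (l *\<^sub>R x) = v0 q"
      using \<Phi>.transport[OF t, of "l *\<^sub>R x"] \<Psi>.transport[OF t, of "l *\<^sub>R x"] l x by (auto simp: p_def q_def)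
    ultimately show ?thesis by linarith
  qed
  obtain n0 :: nat where n0: "E * s / min r1 r2 < real n0" using reals_Archimedean2 by blast
  show "\<exists>n0. \<forall>n\<ge>n0. norm (w t ((1 / real (Suc n)) *\<^sub>R x) - v t ((1 / real (Suc n)) *\<^sub>R x) - 0) < e"
  proof (intro exI allI impI)
    fix n assume "n0 \<le> n"
    then have "E * s / min r1 r2 < real (Suc n)" using n0 by simp
    then have "E * s < real (Suc n) * min r1 r2" using r1 r2 by (subst (asm) pos_divide_less_eq) auto
    then have "1 / real (Suc n) * (E * s) \<le> min r1 r2"
      by (simp only: times_divide_eq_left mult_1_left) (subst pos_divide_le_eq; simp add: mult.commute)
    then show "norm (w t ((1 / real (Suc n)) *\<^sub>R x) - v t ((1 / real (Suc n)) *\<^sub>R x) - 0) < e"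
      using main[of "1 / real (Suc n)"] by simp
  qed
qed

end

section \<open>The norm under blow-up\<close>

lemma holder_imp_continuous:
  fixes F :: "real^2 \<Rightarrow> real"
  assumes "\<And>x y. \<bar>F x - F y\<bar> \<le> C * norm (x - y) powr \<alpha>" and \<alpha>: "0 < \<alpha>"
  shows "continuous_on UNIV F"
  unfolding continuous_on_eq_continuous_at[OF open_UNIV]
proof
  fix x :: "real^2"
  have "((\<lambda>y. norm (y - x) powr \<alpha>) \<longlongrightarrow> norm (x - x) powr \<alpha>) (at x)"
    by (rule tendsto_powr2[OF _ tendsto_const]) (use \<alpha> in \<open>auto intro!: tendsto_eq_intros\<close>)
  then have "((\<lambda>y. C * norm (y - x) powr \<alpha>) \<longlongrightarrow> C * 0) (at x)" using \<alpha> by (intro tendsto_intros) simp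
  then have "((\<lambda>y. C * norm (y - x) powr \<alpha>) \<longlongrightarrow> 0) (at x)" by simp
  moreover have "\<forall>\<^sub>F y in at x. norm (F y - F x) \<le> C * norm (y - x) powr \<alpha>"
    using assms(1) by (intro always_eventually allI) simp
  ultimately have "((\<lambda>y. F y - F x) \<longlongrightarrow> 0) (at x)" by (rule Lim_null_comparison[rotated])
  then show "isCont F x" by (simp add: isCont_def LIM_zero_iff)
qed

text \<open>A finite seminorm makes \<open>norm x powr \<alpha> * f x\<close> Hoelder continuous,
  and away from the origin the weight can be divided out.\<close>

lemma ring_space_continuous:
  assumes f: "f \<in> ring_space \<alpha>" and \<alpha>: "0 < \<alpha>"
  shows "continuous_on (- {0}) f"
proof -
  define S where "S = (SUP x. SUP x'\<in>{x'. x \<noteq> x'}.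
        ennreal (\<bar>norm x powr \<alpha> * f x - norm x' powr \<alpha> * f x'\<bar> / norm (x - x') powr \<alpha>))"
  have "S < top"
  proof -
    have "S \<le> ring_norm \<alpha> f" by (simp add: ring_norm_def S_def)
    then show ?thesis using f by (auto simp: ring_space_def intro: le_less_trans)
  qed
  then obtain C where C: "0 \<le> C" "S = ennreal C" by (cases S) auto
  let ?F = "\<lambda>x. norm x powr \<alpha> * f x"
  have "\<bar>?F x - ?F y\<bar> \<le> C * norm (x - y) powr \<alpha>" for x y
  proof (cases "x = y")
    case False
    then have "ennreal (\<bar>?F x - ?F y\<bar> / norm (x - y) powr \<alpha>) \<le> ennreal C"
      unfolding C(2)[symmetric] S_def by (intro SUP_upper2[of x] SUP_upper2[of y]) auto
    then show ?thesis using C False by (simp add: ennreal_le_iff field_simps)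
  qed (use C in simp)
  then have "continuous_on (- {0}) ?F"
    by (intro continuous_on_subset[OF holder_imp_continuous[OF _ \<alpha>]]) auto
  then have "continuous_on (- {0}) (\<lambda>x. ?F x / norm x powr \<alpha>)"
    by (intro continuous_on_divide continuous_on_powr' continuous_on_norm continuous_on_id continuous_on_const) (use \<alpha> in auto)
  then show ?thesis by (rule continuous_on_eq) auto
qed

text \<open>Both parts of the norm are invariant under dilations and lower semicontinuous.\<close>

lemma ring_norm_blow_up_le:
  assumes f: "continuous_on (- {0}) f" and h: "h \<in> borel_measurable lebesgue"
    and lim: "\<And>x. x \<noteq> 0 \<Longrightarrow> (\<lambda>n. f ((1 / real (Suc n)) *\<^sub>R x)) \<longlonglongrightarrow> h x"
    and \<alpha>: "0 < \<alpha>"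
  shows "ring_norm \<alpha> h \<le> ring_norm \<alpha> f"
  unfolding ring_norm_def
proof (rule add_mono)
  show "esssup lebesgue (\<lambda>x. ennreal \<bar>h x\<bar>) \<le> esssup lebesgue (\<lambda>x. ennreal \<bar>f x\<bar>)"
  proof (cases "esssup lebesgue (\<lambda>x. ennreal \<bar>f x\<bar>)")
    case (real D)
    \<comment> \<open>By continuity the set where \<open>\<bar>f\<bar>\<close> exceeds its essential
      supremum is open, hence empty, being null. The bound thus holds at every point other than the
      origin and passes to the limit.\<close>
    have "\<bar>f x\<bar> \<le> D" if x: "x \<noteq> 0" for x
    proof (rule ccontr)
      assume n: "\<not> \<bar>f x\<bar> \<le> D"
      define U where "U = {y \<in> - {0}. D < \<bar>f y\<bar>}"
      have "continuous_on (- {0}) (\<lambda>y. \<bar>f y\<bar>)" by (intro continuous_on_rabs f)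
      then have "open (- {0} \<inter> (\<lambda>y. \<bar>f y\<bar>) -` {D<..})" by (rule continuous_open_preimage) auto
      moreover have "U = - {0} \<inter> (\<lambda>y. \<bar>f y\<bar>) -` {D<..}" by (auto simp: U_def)
      ultimately have "open U" by simp
      have "AE y in lebesgue. \<bar>f y\<bar> \<le> D"
        using esssup_AE[of "\<lambda>x. ennreal \<bar>f x\<bar>" lebesgue] real by (simp add: ennreal_le_iff)
      then have "AE y in lebesgue. y \<notin> U" by eventually_elim (auto simp: U_def)
      then have "negligible U" by (simp add: negligible_iff_null_sets completion.AE_iff_null_sets)
      with \<open>open U\<close> have "U = {}" using open_not_negligible by blast
      then show False using n x by (auto simp: U_def)
    qed
    then have hD: "\<bar>h x\<bar> \<le> D" if "x \<noteq> 0" for x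
      using LIMSEQ_le_const2[OF tendsto_rabs[OF lim[OF that]], of D] that by simp
    have "AE x in lebesgue. x \<noteq> (0::real^2)" by (intro AE_completion AE_lborel_singleton)
    then have "AE x in lebesgue. ennreal \<bar>h x\<bar> \<le> ennreal D" by eventually_elim (rule ennreal_leI, rule hD)
    then show ?thesis unfolding real using h by (intro esssup_I) auto
  qed auto
  show "(SUP x. SUP x'\<in>{x'. x \<noteq> x'}.
        ennreal (\<bar>norm x powr \<alpha> * h x - norm x' powr \<alpha> * h x'\<bar> / norm (x - x') powr \<alpha>))
    \<le> (SUP x. SUP x'\<in>{x'. x \<noteq> x'}.
        ennreal (\<bar>norm x powr \<alpha> * f x - norm x' powr \<alpha> * f x'\<bar> / norm (x - x') powr \<alpha>))" (is "_ \<le> ?S")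
  proof (intro SUP_least)
    fix x x' :: "real^2" assume "x' \<in> {x'. x \<noteq> x'}"
    then have xx: "x \<noteq> x'" by simp
    have l: "(\<lambda>n. norm y powr \<alpha> * f ((1 / real (Suc n)) *\<^sub>R y)) \<longlonglongrightarrow> norm y powr \<alpha> * h y" for y
      by (cases "y = 0") (use lim[of y] in \<open>auto intro: tendsto_mult_left\<close>)
    let ?a = "\<lambda>n. \<bar>norm x powr \<alpha> * f ((1 / real (Suc n)) *\<^sub>R x) - norm x' powr \<alpha> * f ((1 / real (Suc n)) *\<^sub>R x')\<bar> / norm (x - x') powr \<alpha>"
    have a: "?a \<longlonglongrightarrow> \<bar>norm x powr \<alpha> * h x - norm x' powr \<alpha> * h x'\<bar> / norm (x - x') powr \<alpha>"
      by (intro tendsto_divide tendsto_rabs tendsto_diff l tendsto_const) (use xx in auto)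
    show "ennreal (\<bar>norm x powr \<alpha> * h x - norm x' powr \<alpha> * h x'\<bar> / norm (x - x') powr \<alpha>) \<le> ?S"
    proof (rule LIMSEQ_le_const2[OF tendsto_ennrealI[OF a]], intro exI allI impI)
      fix n :: nat
      define c where "c = 1 / real (Suc n)"
      have c: "0 < c" by (simp add: c_def)
      define A B where "A = norm x powr \<alpha> * f (c *\<^sub>R x)" and "B = norm x' powr \<alpha> * f (c *\<^sub>R x')"
      \<comment> \<open>The weight and the denominator are both homogeneous of degree \<alpha>, so
        the quotient for \<open>f\<close> at dilated points equals the one with the weights of the
        original points.\<close>
      have pw: "norm (c *\<^sub>R y) powr \<alpha> = c powr \<alpha> * norm y powr \<alpha>" for y :: "real^2" using c by (simp add: powr_mult)
      have "norm (c *\<^sub>R x) powr \<alpha> * f (c *\<^sub>R x) - norm (c *\<^sub>R x') powr \<alpha> * f (c *\<^sub>R x') = c powr \<alpha> * (A - B)"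
        unfolding pw by (simp add: A_def B_def algebra_simps)
      then have "\<bar>norm (c *\<^sub>R x) powr \<alpha> * f (c *\<^sub>R x) - norm (c *\<^sub>R x') powr \<alpha> * f (c *\<^sub>R x')\<bar> / norm (c *\<^sub>R x - c *\<^sub>R x') powr \<alpha>
          = c powr \<alpha> * \<bar>A - B\<bar> / (c powr \<alpha> * norm (x - x') powr \<alpha>)"
        using pw[of "x - x'"] by (simp add: scaleR_diff_right abs_mult)
      also have "\<dots> = \<bar>A - B\<bar> / norm (x - x') powr \<alpha>" using c by simp
      also have "\<dots> = ?a n" unfolding A_def B_def c_def ..
      finally have "?a n = \<bar>norm (c *\<^sub>R x) powr \<alpha> * f (c *\<^sub>R x) - norm (c *\<^sub>R x') powr \<alpha> * f (c *\<^sub>R x')\<bar> / norm (c *\<^sub>R x - c *\<^sub>R x') powr \<alpha>" ..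
      then show "ennreal (?a n) \<le> ?S"
        using xx c by (intro SUP_upper2[of "c *\<^sub>R x"] SUP_upper2[of "c *\<^sub>R x'"]) auto
    qed
  qed
qed

lemma euler_solution_flow:
  assumes "euler_solution m w0 w" "3 \<le> m"
  shows "\<exists>u \<Phi> M. \<forall>M'\<ge>M. flow_solution m w0 w u \<Phi> M'"
proof -
  from assms(1) obtain C :: real where C: "\<And>t. 0 \<le> t \<Longrightarrow> AE x in lebesgue. \<bar>w t x\<bar> \<le> C"
    unfolding euler_solution_def by blast
  from assms(1) obtain u \<Phi> where uP: "\<forall>t\<ge>0. velocity_of m (w t) (u t)" "\<forall>x. \<Phi> 0 x = x"
      "\<forall>t\<ge>0. \<forall>x. ((\<lambda>s. \<Phi> s x) has_vector_derivative u t (\<Phi> t x)) (at t within {0..})"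
      "\<forall>t\<ge>0. bij (\<Phi> t)" "\<forall>t\<ge>0. \<forall>x. x \<noteq> 0 \<longrightarrow> w t x = w0 (inv (\<Phi> t) x)"
    unfolding euler_solution_def by blast
  have "flow_solution m w0 w u \<Phi> M'" if "\<bar>C\<bar> \<le> M'" for M'
  proof
    show "AE x in lebesgue. \<bar>w t x\<bar> \<le> M'" if "0 \<le> t" for t
      using C[OF that] by eventually_elim (use \<open>\<bar>C\<bar> \<le> M'\<close> in linarith)
  qed (use assms that uP in \<open>auto simp: euler_solution_def\<close>)
  then show ?thesis by blast
qed

theorem theoremD:
  fixes m :: nat and \<alpha> :: real
    and w1D w :: "real \<Rightarrow> real^2 \<Rightarrow> real" and w0 :: "real^2 \<Rightarrow> real"
  assumes "m \<ge> 3" and "0 < \<alpha>" and "\<alpha> \<le> 1"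
    and "Linf_loc_ring \<alpha> w1D"
    and "zero_homogeneous w1D"
    and "euler_solution m (w1D 0) w1D"
    and "sym_scalar m w0" and "w0 \<in> ring_space \<alpha>"
    and "\<exists>g \<in> holder_space \<alpha>. g 0 = 0 \<and> (\<forall>x. x \<noteq> 0 \<longrightarrow> w0 x - w1D 0 x = g x)"
    and "euler_solution m w0 w"
  shows "\<forall>t\<ge>0. ring_norm \<alpha> (w t) \<ge> ring_norm \<alpha> (w1D t)"
proof (intro allI impI)
  fix t :: real assume t: "0 \<le> t"
  obtain g where g: "g \<in> holder_space \<alpha>" "g 0 = 0" "\<And>x. x \<noteq> 0 \<Longrightarrow> w0 x - w1D 0 x = g x"
    using assms(9) by blast
  then obtain C where "\<And>x x'. \<bar>g x - g x'\<bar> \<le> C * norm (x - x') powr \<alpha>"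
    by (auto simp: holder_space_def)
  then have cg: "continuous_on UNIV g" by (rule holder_imp_continuous) (rule assms(2))
  obtain u \<Phi> M1 where f1: "\<forall>M'\<ge>M1. flow_solution m w0 w u \<Phi> M'"
    using euler_solution_flow[OF assms(10,1)] by blast
  obtain u' \<Psi> M2 where f2: "\<forall>M'\<ge>M2. flow_solution m (w1D 0) w1D u' \<Psi> M'"
    using euler_solution_flow[OF assms(6,1)] by blast
  define M where "M = max M1 M2"
  interpret \<Phi>: flow_solution m w0 w u \<Phi> M by (rule f1[rule_format]) (simp add: M_def)
  interpret \<Psi>: flow_solution m "w1D 0" w1D u' \<Psi> M by (rule f2[rule_format]) (simp add: M_def)
  interpret two_flows m w0 w u \<Phi> M "w1D 0" w1D u' \<Psi>
  proof
    fix \<gamma> :: real assume "0 < \<gamma>"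
    then obtain d where d: "d > 0" "\<And>y. dist y 0 < d \<Longrightarrow> dist (g y) (g 0) < \<gamma>"
      using cg unfolding continuous_on_iff by (metis UNIV_I)
    have "\<bar>w0 y - w1D 0 y\<bar> \<le> \<gamma>" if y: "y \<noteq> 0" "norm y \<le> d / 2" for y
    proof -
      have "norm y < d" using y d(1) by simp
      then show ?thesis using g(3)[OF y(1)] g(2) d(2)[of y] by (simp add: dist_norm)
    qed
    then show "\<exists>r>0. \<forall>y. y \<noteq> 0 \<longrightarrow> norm y \<le> r \<longrightarrow> \<bar>w0 y - w1D 0 y\<bar> \<le> \<gamma>"
      using d(1) by (intro exI[of _ "d / 2"]) auto
  qed
  have hom: "w1D s (l *\<^sub>R y) = w1D s y" if "0 \<le> s" "0 < l" "y \<noteq> 0" for s l y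
    using assms(5) that by (auto simp: zero_homogeneous_def)
  have c0: "continuous_on (- {0}) w0" by (rule ring_space_continuous[OF assms(8,2)])
  \<comment> \<open>\<open>Linf_loc_ring\<close> speaks about almost every time only, so the
    continuity of the datum \<open>w1D 0\<close> is taken from \<open>w0\<close> and the Hoelder
    continuous difference \<open>g\<close>.\<close>
  then have "continuous_on (- {0}) (\<lambda>x. w0 x - g x)"
    by (intro continuous_on_diff continuous_on_subset[OF cg]) auto
  then have c1: "continuous_on (- {0}) (w1D 0)" by (rule continuous_on_eq) (use g(3) in force)
  show "ring_norm \<alpha> (w1D t) \<le> ring_norm \<alpha> (w t)"
  proof (rule ring_norm_blow_up_le[OF _ \<Psi>.w_meas[OF t] _ assms(2)])
    have "continuous_on (- {0}) (\<lambda>x. w0 (inv (\<Phi> t) x))"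
    proof (rule continuous_on_compose2[OF c0])
      show "continuous_on (- {0}) (inv (\<Phi> t))" using \<Phi>.inv_\<Phi>_continuous[OF t] by (rule continuous_on_subset) simp
      have "inv (\<Phi> t) y \<noteq> 0" if "y \<noteq> 0" for y
      proof
        assume "inv (\<Phi> t) y = 0"
        then have "\<Phi> t (inv (\<Phi> t) y) = 0" using \<Phi>.\<Phi>_zero[OF t] by (simp only:)
        then show False using \<Phi>.inv_\<Phi>(1)[OF t, of y] that by (simp only:)
      qed
      then show "inv (\<Phi> t) ` (- {0}) \<subseteq> - {0}" by (intro image_subsetI) simp
    qed
    then show "continuous_on (- {0}) (w t)" by (rule continuous_on_eq) (use \<Phi>.transport[OF t] in auto)
    fix x :: "real^2" assume x: "x \<noteq> 0"
    have "(\<lambda>n. w t ((1 / real (Suc n)) *\<^sub>R x) - w1D t ((1 / real (Suc n)) *\<^sub>R x)) \<longlonglongrightarrow> 0"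
      by (rule blow_up[OF t x c1]) (rule hom; simp)
    moreover have "w1D t ((1 / real (Suc n)) *\<^sub>R x) = w1D t x" for n using t x by (intro hom) auto
    ultimately show "(\<lambda>n. w t ((1 / real (Suc n)) *\<^sub>R x)) \<longlonglongrightarrow> w1D t x" by (simp only: LIM_zero_iff)
  qed
qed

end
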